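(* Let $k$ be a field of characteristic zero and $G$ a finite group. (a) The algebra $E_G^c$ is a covering algebra for $E_G$, i.e. $E_G^c$ is a subalgebra of $E_G$ with $E_G=E_G^c+I_G$. (b) The equality $$E_G^c\cap I_G=\bigoplus_{\substack{\{K,P\}_G\in\mathcal G_G/\sim\\ (K,P)\notin\mathcal R_G}}f_{\{K,P\}_G}E_G^c$$ holds. (c) The canonical epimorphism $E_G\to\bar E_G$ maps the subalgebra $\bigoplus_{\{K,P\}_G\in\widetilde{\mathcal R}_G}f_{\{K,P\}_G}E_G^c$ of $E_G^c$ isomorphically onto $\bar E_G$. (d) For each $(K,P)\in\mathcal R_G$, the map $$k\Gamma_{(G,K,P)}\to\bar f_{(K,P)}\bar E_G\bar f_{(K,P)},\qquad a\mapsto\bar f_{(K,P)}\,\bar a\,\bar f_{(K,P)}$$ is a $k$-algebra isomorphism. (e) There is a bijective correspondence between the isomorphism classes of simple $\bar E_G$-modules and the set of triples $(K,P,[V])$, where $(K,P)$ runs over (representatives of) linkage classes of reduced pairs for $G$ and, for each such representative $(K,P)$, $[V]$ runs over (isomorphism classes of) irreducible $k\Gamma_{(G,K,P)}$-modules. The correspondence is given by associating to the triple $(K,P,[V])$ the $\bar E_G$-module $\bar E_G\bar f_{(K,P)}\otimes_{k\Gamma_{(G,K,P)}}V$.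
   Context: A section of a group $X$ is a pair $(T,S)$ of subgroups with $S\unlhd T\le X$; $\Sigma_X$ is the set of sections. For $U\le G\times H$ put $p_1(U)=\{g:(g,h)\in U\text{ for some }h\}$, $p_2(U)=\{h:(g,h)\in U\text{ for some }g\}$, $k_1(U)=\{g:(g,1)\in U\}$, $k_2(U)=\{h:(1,h)\in U\}$. For $(T,S)\in\Sigma_{G\times H}$ put $l(T,S)=(p_1(T),k_1(T),p_1(S),k_1(S))$, $r(T,S)=(p_2(T),k_2(T),p_2(S),k_2(S))$. $\Gamma(G,H)$ is the section Burnside group of $G\times H$: the free abelian group with basis the elements $\left[\frac{G\times H}{S\unlhd T}\right]$ (class of the projection $(G\times H)/S\to(G\times H)/T$), for $(T,S)\in\Sigma_{G\times H}$ up to $G\times H$-conjugacy. There is a bilinear associative composition $$\left[\tfrac{G\times H}{S\unlhd T}\right]\cdot\left[\tfrac{H\times M}{U\unlhd V}\right]=\sum_{t\in p_2(S)\backslash H/p_1(U)}\left[\tfrac{G\times M}{S*{}^{(t,1)}U\,\unlhd\, T*{}^{(t,1)}V}\right],$$ with $S*U=\{(g,m):\exists h,\ (g,h)\in S,\ (h,m)\in U\}$. $E_G=k\otimes\Gamma(G,G)$ is the resulting $k$-algebra. $I_G$ is the ideal of $E_G$ generated by all elements that factor through a group of smaller order, i.e. by the products $x\cdot y$ with $x\in k\Gamma(G,H)$, $y\in k\Gamma(H,G)$, $|H|<|G|$; $\bar E_G=E_G/I_G$ is the essential algebra and bars denote images in $\bar E_G$. A section $(T,S)\in\Sigma_{G\times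 G}$ is covering if $p_1(T)=p_2(T)=G$ and $k_1(S)=k_2(S)=1$. $E_G^c$ is the subalgebra of $E_G$ with $k$-basis the elements $\left[\frac{G\times G}{S\unlhd T}\right]$ with $(T,S)$ covering. $\mathcal G_G$ is the set of pairs $(K,P)$ of normal subgroups of $G$ with $[K,P]=1$, ordered by $(K,P)\preceq(L,Q)$ iff $K\le L$ and $P\ge Q$. Put $\Delta(P)=\{(x,x):x\in P\}$, $\Delta_K(G)=\{(g,h): h^{-1}g\in K\}$, $e_{(K,P)}=\frac1{|G:P|}\left[\frac{G\times G}{\Delta(P)\unlhd\Delta_K(G)}\right]$ and $f_{(K,P)}=\sum_{(K,P)\preceq(L,Q)\in\mathcal G_G}\mu_{(K,P),(L,Q)}\,e_{(L,Q)}$, with $\mu$ the Möbius function of $\mathcal G_G$. Pairs $(K,P),(L,Q)\in\mathcal G_G$ are linked, $(K,P)\sim(L,Q)$, if there is $(T,S)\in\Sigma_{G\times G}$ with $l(T,S)=(G,K,P,1)$ and $r(T,S)=(G,L,Q,1)$. This is an equivalence relation; $\{K,P\}_G$ is the class of $(K,P)$, and $f_{\{K,P\}_G}=\sum_{(K',P')\in\{K,P\}_G}f_{(K',P')}$. A pair $(K,P)\in\mathcal G_G$ is reduced if $e_{(K,P)}\notin I_G$; $\mathcal R_G$ is the set of reduced pairs. Being reduced depends only on the linkage class; $\widetilde{\mathcal R}_G$ is the set of linkage classes of reduced pairs. $\Gamma_{(G,K,P)}=\left\{\frac1{|G:P|}\left[\frac{G\times G}{S\unlhd T}\right] : l(T,S)=(G,K,P,1)=r(T,S)\right\}$,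 a finite group under the multiplication of $E_G$ with identity $e_{(K,P)}$. In (e), $\bar E_G\bar f_{(K,P)}$ is a right $k\Gamma_{(G,K,P)}$-module via the isomorphism in (d). *)

theory Defs
  imports
    "HOL-Algebra.Algebra"
    "HOL-Algebra.Free_Abelian_Groups"
    "HOL-Algebra.Algebraic_Closure_Type"
begin

section \<open>Algebras and modules\<close>

text \<open>
  A k-algebra is a value of the library record type \<^typ>\<open>('k, 'a) module\<close>, which carries ring
  operations as well as a scalar action; here \<^typ>\<open>'k\<close> is a type of class \<^class>\<open>field\<close>.  The library
  locales \<^locale>\<open>algebra\<close> and \<^locale>\<open>module\<close> demand commutativity (of the algebra, respectively of
  the ring of scalars), so the noncommutative versions are stated here.
\<close>

locale k_algebra =
  fixes A :: "('k::field, 'a) module" (structure)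
  assumes is_ring: "ring A"
    and is_module: "module ring_of_type_algebra A"
    and smult_mult_left: "\<lbrakk>x \<in> carrier A; y \<in> carrier A\<rbrakk> \<Longrightarrow> (c \<odot> x) \<otimes> y = c \<odot> (x \<otimes> y)"
    and smult_mult_right: "\<lbrakk>x \<in> carrier A; y \<in> carrier A\<rbrakk> \<Longrightarrow> x \<otimes> (c \<odot> y) = c \<odot> (x \<otimes> y)"

text \<open>
  \<open>B\<close> is a subalgebra of \<open>A\<close> with identity element \<open>e\<close>, which is allowed to differ from that of \<open>A\<close>.
\<close>

definition k_subalgebra :: "('k::field, 'a) module \<Rightarrow> 'a set \<Rightarrow> 'a \<Rightarrow> bool" where
  "k_subalgebra A B e \<longleftrightarrow>
     k_algebra A \<and> B \<subseteq> carrier A \<and> k_algebra (A\<lparr>carrier := B, one := e\<rparr>)"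

definition k_algebra_iso :: "('k, 'a) module \<Rightarrow> ('k, 'b) module \<Rightarrow> ('a \<Rightarrow> 'b) set" where
  "k_algebra_iso A B = {\<phi> \<in> ring_iso A B. \<forall>c. \<forall>x\<in>carrier A. \<phi> (c \<odot>\<^bsub>A\<^esub> x) = c \<odot>\<^bsub>B\<^esub> \<phi> x}"

definition quotient_algebra :: "('k, 'a) module \<Rightarrow> 'a set \<Rightarrow> ('k, 'a set) module" where
  "quotient_algebra A I =
     ring.extend (A Quot I) (module.fields (\<lambda>c Z. \<Union>x\<in>Z. I +>\<^bsub>A\<^esub> (c \<odot>\<^bsub>A\<^esub> x)))"

definition corner_algebra :: "('k, 'a) module \<Rightarrow> 'a \<Rightarrow> ('k, 'a) module" where
  "corner_algebra A e = A\<lparr>carrier := (\<lambda>x. e \<otimes>\<^bsub>A\<^esub> x \<otimes>\<^bsub>A\<^esub> e) ` carrier A, one := e\<rparr>"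

locale left_module = R?: ring R + M?: abelian_group M
  for R :: "('r, 's) ring_scheme" (structure) and M :: "('r, 'v) module" (structure) +
  assumes smult_closed: "\<lbrakk>a \<in> carrier R; x \<in> carrier M\<rbrakk> \<Longrightarrow> a \<odot>\<^bsub>M\<^esub> x \<in> carrier M"
    and smult_l_distr:
      "\<lbrakk>a \<in> carrier R; b \<in> carrier R; x \<in> carrier M\<rbrakk> \<Longrightarrow>
       (a \<oplus> b) \<odot>\<^bsub>M\<^esub> x = a \<odot>\<^bsub>M\<^esub> x \<oplus>\<^bsub>M\<^esub> b \<odot>\<^bsub>M\<^esub> x"
    and smult_r_distr:
      "\<lbrakk>a \<in> carrier R; x \<in> carrier M; y \<in> carrier M\<rbrakk> \<Longrightarrow>
       a \<odot>\<^bsub>M\<^esub> (x \<oplus>\<^bsub>M\<^esub> y) = a \<odot>\<^bsub>M\<^esub> x \<oplus>\<^bsub>M\<^esub> a \<odot>\<^bsub>M\<^esub> y"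
    and smult_assoc:
      "\<lbrakk>a \<in> carrier R; b \<in> carrier R; x \<in> carrier M\<rbrakk> \<Longrightarrow>
       (a \<otimes> b) \<odot>\<^bsub>M\<^esub> x = a \<odot>\<^bsub>M\<^esub> (b \<odot>\<^bsub>M\<^esub> x)"
    and smult_one: "x \<in> carrier M \<Longrightarrow> \<one> \<odot>\<^bsub>M\<^esub> x = x"

definition simple_module :: "('r, 's) ring_scheme \<Rightarrow> ('r, 'v) module \<Rightarrow> bool" where
  "simple_module R M \<longleftrightarrow>
     left_module R M \<and> carrier M \<noteq> {\<zero>\<^bsub>M\<^esub>} \<and>
     (\<forall>N. submodule N R M \<longrightarrow> N = {\<zero>\<^bsub>M\<^esub>} \<or> N = carrier M)"

definition module_isomorphic ::
  "('r, 's) ring_scheme \<Rightarrow> ('r, 'v) module \<Rightarrow> ('r, 'w) module \<Rightarrow> bool" where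
  "module_isomorphic R M N \<longleftrightarrow>
     (\<exists>\<phi> \<in> iso (add_monoid M) (add_monoid N).
        \<forall>a\<in>carrier R. \<forall>x\<in>carrier M. \<phi> (a \<odot>\<^bsub>M\<^esub> x) = a \<odot>\<^bsub>N\<^esub> \<phi> x)"

definition principal_left_module :: "('r, 's) ring_scheme \<Rightarrow> 'r \<Rightarrow> ('r, 'r) module" where
  "principal_left_module A e =
     \<lparr>carrier = carrier A #>\<^bsub>A\<^esub> e, monoid.mult = monoid.mult A, one = one A,
      ring.zero = ring.zero A, ring.add = ring.add A, module.smult = monoid.mult A\<rparr>"

text \<open>
  The tensor product \<open>Z \<otimes>\<^sub>R V\<close> of a left \<open>A\<close>-module \<open>Z\<close> with a commuting right \<open>R\<close>-action \<open>act\<close>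
  and a left \<open>R\<close>-module \<open>V\<close>: the free abelian group on \<open>Z \<times> V\<close> modulo the subgroup generated by the
  biadditivity and balancing relations.  The ring product and unit of the record play no role for a
  module.
\<close>

definition tensor_relations ::
  "('r, 's) ring_scheme \<Rightarrow> ('a, 'x) module \<Rightarrow> ('x \<Rightarrow> 'r \<Rightarrow> 'x) \<Rightarrow> ('r, 'v) module \<Rightarrow> ('x \<times> 'v \<Rightarrow>\<^sub>0 int) set"
where
  "tensor_relations R Z act V =
     {frag_of (x \<oplus>\<^bsub>Z\<^esub> y, v) - frag_of (x, v) - frag_of (y, v) | x y v.
        x \<in> carrier Z \<and> y \<in> carrier Z \<and> v \<in> carrier V} \<union>
     {frag_of (x, v \<oplus>\<^bsub>V\<^esub> w) - frag_of (x, v) - frag_of (x, w) | x v w.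
        x \<in> carrier Z \<and> v \<in> carrier V \<and> w \<in> carrier V} \<union>
     {frag_of (act x r, v) - frag_of (x, r \<odot>\<^bsub>V\<^esub> v) | x r v.
        x \<in> carrier Z \<and> r \<in> carrier R \<and> v \<in> carrier V}"

definition tensor_module ::
  "('r, 's) ring_scheme \<Rightarrow> ('a, 'x) module \<Rightarrow> ('x \<Rightarrow> 'r \<Rightarrow> 'x) \<Rightarrow> ('r, 'v) module
     \<Rightarrow> ('a, ('x \<times> 'v \<Rightarrow>\<^sub>0 int) set) module"
where
  "tensor_module R Z act V =
     (let F = free_Abelian_group (carrier Z \<times> carrier V);
          N = generate F (tensor_relations R Z act V)
      in \<lparr>carrier = rcosets\<^bsub>F\<^esub> N, monoid.mult = undefined, one = undefined,
          ring.zero = N, ring.add = set_mult F,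
          module.smult = (\<lambda>a Y. \<Union>y\<in>Y. N #>\<^bsub>F\<^esub> frag_extend (\<lambda>(x, v). frag_of (a \<odot>\<^bsub>Z\<^esub> x, v)) y)\<rparr>)"


section \<open>Free modules over a field\<close>

definition scale :: "'k::comm_ring_1 \<Rightarrow> ('b \<Rightarrow>\<^sub>0 'k) \<Rightarrow> ('b \<Rightarrow>\<^sub>0 'k)" where
  "scale c x = Poly_Mapping.map ((*) c) x"

definition bilinear_extension ::
  "('b \<Rightarrow> 'c \<Rightarrow> ('d \<Rightarrow>\<^sub>0 'k::comm_ring_1)) \<Rightarrow> ('b \<Rightarrow>\<^sub>0 'k) \<Rightarrow> ('c \<Rightarrow>\<^sub>0 'k) \<Rightarrow> ('d \<Rightarrow>\<^sub>0 'k)" where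
  "bilinear_extension \<beta> x y =
     (\<Sum>a\<in>Poly_Mapping.keys x. \<Sum>b\<in>Poly_Mapping.keys y.
        scale (Poly_Mapping.lookup x a * Poly_Mapping.lookup y b) (\<beta> a b))"

definition group_algebra :: "('g, 'n) monoid_scheme \<Rightarrow> ('k::comm_ring_1, 'g \<Rightarrow>\<^sub>0 'k) module" where
  "group_algebra \<Gamma> =
     \<lparr>carrier = {x. Poly_Mapping.keys x \<subseteq> carrier \<Gamma>},
      monoid.mult = bilinear_extension (\<lambda>g h. Poly_Mapping.single (g \<otimes>\<^bsub>\<Gamma>\<^esub> h) 1),
      one = Poly_Mapping.single \<one>\<^bsub>\<Gamma>\<^esub> 1, ring.zero = 0, ring.add = (+), module.smult = scale\<rparr>"

text \<open>
  For a family of subgroups \<open>M i\<close>, indexed by a finite set \<open>J\<close>: their sum, and the assertion that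
  this sum is direct.
\<close>

definition internal_sum :: "'i set \<Rightarrow> ('i \<Rightarrow> 'b::comm_monoid_add set) \<Rightarrow> 'b set" where
  "internal_sum J M = (\<lambda>y. \<Sum>i\<in>J. y i) ` (\<Pi>\<^sub>E i\<in>J. M i)"

definition sum_is_direct :: "'i set \<Rightarrow> ('i \<Rightarrow> 'b::comm_monoid_add set) \<Rightarrow> bool" where
  "sum_is_direct J M \<longleftrightarrow> inj_on (\<lambda>y. \<Sum>i\<in>J. y i) (\<Pi>\<^sub>E i\<in>J. M i)"

text \<open>
  The Moebius function of the finite set \<open>A\<close> partially ordered by \<open>rel\<close>, normalised to vanish
  outside the order relation.
\<close>

definition moebius :: "'b set \<Rightarrow> ('b \<Rightarrow> 'b \<Rightarrow> bool) \<Rightarrow> 'b \<Rightarrow> 'b \<Rightarrow> int" where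
  "moebius A rel = (THE \<mu>.
     (\<forall>x y. \<not> (x \<in> A \<and> y \<in> A \<and> rel x y) \<longrightarrow> \<mu> x y = 0) \<and>
     (\<forall>x\<in>A. \<forall>y\<in>A. rel x y \<longrightarrow>
        (\<Sum>z\<in>{z \<in> A. rel x z \<and> rel z y}. \<mu> x z) = (if x = y then 1 else 0)))"


section \<open>Sections and the section Burnside group\<close>

text \<open>
  A subset \<open>U\<close> of a direct product is a relation, so that \<open>p\<^sub>1(U)\<close> and \<open>p\<^sub>2(U)\<close> are \<^term>\<open>Domain U\<close>
  and \<^term>\<open>Range U\<close>, and \<open>S * U\<close> is the relational composite \<^term>\<open>S O U\<close>.  For \<open>k\<^sub>1\<close> and \<open>k\<^sub>2\<close> the group to
  supply is the other factor, whose identity element is involved.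
\<close>

definition k1 :: "('b, 'n) monoid_scheme \<Rightarrow> ('a \<times> 'b) set \<Rightarrow> 'a set" where
  "k1 H U = {g. (g, \<one>\<^bsub>H\<^esub>) \<in> U}"

definition k2 :: "('a, 'm) monoid_scheme \<Rightarrow> ('a \<times> 'b) set \<Rightarrow> 'b set" where
  "k2 G U = {h. (\<one>\<^bsub>G\<^esub>, h) \<in> U}"

definition sections :: "('x, 'm) monoid_scheme \<Rightarrow> ('x set \<times> 'x set) set" where
  "sections Z = {(T, S). subgroup T Z \<and> S \<lhd> (Z\<lparr>carrier := T\<rparr>)}"

definition left_invariants ::
  "('b, 'n) monoid_scheme \<Rightarrow> ('a \<times> 'b) set \<times> ('a \<times> 'b) set \<Rightarrow> 'a set \<times> 'a set \<times> 'a set \<times> 'a set" where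
  "left_invariants H = (\<lambda>(T, S). (Domain T, k1 H T, Domain S, k1 H S))"

definition right_invariants ::
  "('a, 'm) monoid_scheme \<Rightarrow> ('a \<times> 'b) set \<times> ('a \<times> 'b) set \<Rightarrow> 'b set \<times> 'b set \<times> 'b set \<times> 'b set" where
  "right_invariants G = (\<lambda>(T, S). (Range T, k2 G T, Range S, k2 G S))"

definition conjugate :: "('x, 'm) monoid_scheme \<Rightarrow> 'x \<Rightarrow> 'x set \<Rightarrow> 'x set" where
  "conjugate Z x S = (\<lambda>s. x \<otimes>\<^bsub>Z\<^esub> s \<otimes>\<^bsub>Z\<^esub> inv\<^bsub>Z\<^esub> x) ` S"

type_synonym ('a, 'b) section_classes = "(('a \<times> 'b) set \<times> ('a \<times> 'b) set) set"

type_synonym ('a, 'b, 'k) section_elts = "('a, 'b) section_classes \<Rightarrow>\<^sub>0 'k"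

definition section_class :: "('x, 'm) monoid_scheme \<Rightarrow> 'x set \<times> 'x set \<Rightarrow> ('x set \<times> 'x set) set" where
  "section_class Z = (\<lambda>(T, S). {(conjugate Z x T, conjugate Z x S) | x. x \<in> carrier Z})"

text \<open>The element \<open>[Z / S \<unlhd> T]\<close>, with the arguments in the order of the pair \<open>(T, S)\<close>.\<close>

definition section_elt ::
  "('x, 'm) monoid_scheme \<Rightarrow> 'x set \<Rightarrow> 'x set \<Rightarrow> (('x set \<times> 'x set) set \<Rightarrow>\<^sub>0 'k::comm_ring_1)" where
  "section_elt Z T S = Poly_Mapping.single (section_class Z (T, S)) 1"

text \<open>The \<open>k\<close>-linear section Burnside group \<open>k\<Gamma>(G, H)\<close>.\<close>

definition section_burnside ::
  "('a, 'm) monoid_scheme \<Rightarrow> ('b, 'n) monoid_scheme \<Rightarrow> ('a, 'b, 'k::comm_ring_1) section_elts set" where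
  "section_burnside G H = {x. Poly_Mapping.keys x \<subseteq> section_class (G \<times>\<times> H) ` sections (G \<times>\<times> H)}"

definition double_cosets :: "('a, 'm) monoid_scheme \<Rightarrow> 'a set \<Rightarrow> 'a set \<Rightarrow> 'a set set" where
  "double_cosets H A B = {(A #>\<^bsub>H\<^esub> t) <#>\<^bsub>H\<^esub> B | t. t \<in> carrier H}"

text \<open>
  The product of two basis elements, computed with chosen representatives of the two conjugacy
  classes and of each double coset; the result does not depend on these choices.
\<close>

definition section_comp_basis ::
  "('a, 'm) monoid_scheme \<Rightarrow> ('b, 'n) monoid_scheme \<Rightarrow> ('c, 'p) monoid_scheme
     \<Rightarrow> ('a, 'b) section_classes \<Rightarrow> ('b, 'c) section_classes \<Rightarrow> ('a, 'c, 'k::comm_ring_1) section_elts"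
where
  "section_comp_basis G H M C D =
     (let (T, S) = (SOME s. s \<in> C); (V, U) = (SOME s. s \<in> D)
      in \<Sum>d\<in>double_cosets H (Range S) (Domain U).
           let t = (SOME t. t \<in> d)
           in section_elt (G \<times>\<times> M)
                (T O conjugate (H \<times>\<times> M) (t, \<one>\<^bsub>M\<^esub>) V)
                (S O conjugate (H \<times>\<times> M) (t, \<one>\<^bsub>M\<^esub>) U))"

definition section_comp ::
  "('a, 'm) monoid_scheme \<Rightarrow> ('b, 'n) monoid_scheme \<Rightarrow> ('c, 'p) monoid_scheme
     \<Rightarrow> ('a, 'b, 'k::comm_ring_1) section_elts \<Rightarrow> ('b, 'c, 'k) section_elts \<Rightarrow> ('a, 'c, 'k) section_elts"
where
  "section_comp G H M = bilinear_extension (section_comp_basis G H M)"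

text \<open>\<open>\<Delta>(P)\<close> is \<^term>\<open>Id_on P\<close>.\<close>

definition section_algebra ::
  "('a, 'm) monoid_scheme \<Rightarrow> ('k::comm_ring_1, ('a, 'a, 'k) section_elts) module" where
  "section_algebra G =
     \<lparr>carrier = section_burnside G G, monoid.mult = section_comp G G G,
      one = section_elt (G \<times>\<times> G) (Id_on (carrier G)) (Id_on (carrier G)),
      ring.zero = 0, ring.add = (+), module.smult = scale\<rparr>"

text \<open>
  Up to isomorphism every finite group has its carrier in \<^typ>\<open>nat\<close>, so it suffices to let \<open>H\<close> range
  over such groups.
\<close>

definition essential_ideal :: "('a, 'm) monoid_scheme \<Rightarrow> ('a, 'a, 'k::comm_ring_1) section_elts set" where
  "essential_ideal G = Idl\<^bsub>section_algebra G\<^esub>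
     {section_comp G H G x y | (H :: nat monoid) x y.
        group H \<and> finite (carrier H) \<and> Coset.order H < Coset.order G \<and>
        x \<in> section_burnside G H \<and> y \<in> section_burnside H G}"

definition essential_algebra ::
  "('a, 'm) monoid_scheme \<Rightarrow> ('k::comm_ring_1, ('a, 'a, 'k) section_elts set) module" where
  "essential_algebra G = quotient_algebra (section_algebra G) (essential_ideal G)"

definition to_essential ::
  "('a, 'm) monoid_scheme \<Rightarrow> ('a, 'a, 'k::comm_ring_1) section_elts \<Rightarrow> ('a, 'a, 'k) section_elts set" where
  "to_essential G x = essential_ideal G +>\<^bsub>section_algebra G\<^esub> x"


section \<open>Covering sections and the elements e and f\<close>

definition covering_sections :: "('a, 'm) monoid_scheme \<Rightarrow> (('a \<times> 'a) set \<times> ('a \<times> 'a) set) set" where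
  "covering_sections G = {(T, S) \<in> sections (G \<times>\<times> G).
     Domain T = carrier G \<and> Range T = carrier G \<and> k1 G S = {\<one>\<^bsub>G\<^esub>} \<and> k2 G S = {\<one>\<^bsub>G\<^esub>}}"

definition covering_algebra :: "('a, 'm) monoid_scheme \<Rightarrow> ('a, 'a, 'k::comm_ring_1) section_elts set" where
  "covering_algebra G = {x. Poly_Mapping.keys x \<subseteq> section_class (G \<times>\<times> G) ` covering_sections G}"

definition normal_pairs :: "('a, 'm) monoid_scheme \<Rightarrow> ('a set \<times> 'a set) set" where
  "normal_pairs G = {(K, P). K \<lhd> G \<and> P \<lhd> G \<and>
     generate G (\<Union>x\<in>K. \<Union>y\<in>P. {x \<otimes>\<^bsub>G\<^esub> y \<otimes>\<^bsub>G\<^esub> inv\<^bsub>G\<^esub> x \<otimes>\<^bsub>G\<^esub> inv\<^bsub>G\<^esub> y}) = {\<one>\<^bsub>G\<^esub>}}"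

definition pair_le :: "'a set \<times> 'a set \<Rightarrow> 'a set \<times> 'a set \<Rightarrow> bool" where
  "pair_le = (\<lambda>(K, P) (L, Q). K \<subseteq> L \<and> Q \<subseteq> P)"

definition diagonal_mod :: "('a, 'm) monoid_scheme \<Rightarrow> 'a set \<Rightarrow> ('a \<times> 'a) set" where
  "diagonal_mod G K = {(g, h) \<in> carrier G \<times> carrier G. inv\<^bsub>G\<^esub> h \<otimes>\<^bsub>G\<^esub> g \<in> K}"

definition group_index :: "('a, 'm) monoid_scheme \<Rightarrow> 'a set \<Rightarrow> nat" where
  "group_index G P = card (rcosets\<^bsub>G\<^esub> P)"

definition e_elt ::
  "('a, 'm) monoid_scheme \<Rightarrow> 'a set \<times> 'a set \<Rightarrow> ('a, 'a, 'k::field_char_0) section_elts" where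
  "e_elt G = (\<lambda>(K, P).
     scale (1 / of_nat (group_index G P)) (section_elt (G \<times>\<times> G) (diagonal_mod G K) (Id_on P)))"

definition f_elt ::
  "('a, 'm) monoid_scheme \<Rightarrow> 'a set \<times> 'a set \<Rightarrow> ('a, 'a, 'k::field_char_0) section_elts" where
  "f_elt G p = (\<Sum>q\<in>{q \<in> normal_pairs G. pair_le p q}.
     scale (of_int (moebius (normal_pairs G) pair_le p q)) (e_elt G q))"

definition linked :: "('a, 'm) monoid_scheme \<Rightarrow> 'a set \<times> 'a set \<Rightarrow> 'a set \<times> 'a set \<Rightarrow> bool" where
  "linked G = (\<lambda>(K, P) (L, Q). \<exists>s\<in>sections (G \<times>\<times> G).
     left_invariants G s = (carrier G, K, P, {\<one>\<^bsub>G\<^esub>}) \<and>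
     right_invariants G s = (carrier G, L, Q, {\<one>\<^bsub>G\<^esub>}))"

definition linkage_class :: "('a, 'm) monoid_scheme \<Rightarrow> 'a set \<times> 'a set \<Rightarrow> ('a set \<times> 'a set) set" where
  "linkage_class G p = {q \<in> normal_pairs G. linked G p q}"

definition f_class ::
  "('a, 'm) monoid_scheme \<Rightarrow> ('a set \<times> 'a set) set \<Rightarrow> ('a, 'a, 'k::field_char_0) section_elts" where
  "f_class G C = (\<Sum>p\<in>C. f_elt G p)"

text \<open>Being reduced depends on the field, which therefore enters as a type argument.\<close>

definition reduced_pairs :: "'k::field_char_0 itself \<Rightarrow> ('a, 'm) monoid_scheme \<Rightarrow> ('a set \<times> 'a set) set" where
  "reduced_pairs k G =
     {p \<in> normal_pairs G. (e_elt G p :: ('a, 'a, 'k) section_elts) \<notin> essential_ideal G}"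

definition linkage_group ::
  "('a, 'm) monoid_scheme \<Rightarrow> 'a set \<times> 'a set \<Rightarrow> ('a, 'a, 'k::field_char_0) section_elts monoid" where
  "linkage_group G = (\<lambda>(K, P).
     \<lparr>carrier = {scale (1 / of_nat (group_index G P)) (section_elt (G \<times>\<times> G) T S) | T S.
        (T, S) \<in> sections (G \<times>\<times> G) \<and>
        left_invariants G (T, S) = (carrier G, K, P, {\<one>\<^bsub>G\<^esub>}) \<and>
        right_invariants G (T, S) = (carrier G, K, P, {\<one>\<^bsub>G\<^esub>})},
      monoid.mult = section_comp G G G, one = e_elt G (K, P)\<rparr>)"

text \<open>
  The elements of the linkage group are themselves elements of the section algebra; this is the
  linear extension of the inclusion to the group algebra.
\<close>

definition linear_inclusion :: "(('b \<Rightarrow>\<^sub>0 'k) \<Rightarrow>\<^sub>0 'k) \<Rightarrow> ('b \<Rightarrow>\<^sub>0 'k::comm_ring_1)" where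
  "linear_inclusion a = (\<Sum>\<gamma>\<in>Poly_Mapping.keys a. scale (Poly_Mapping.lookup a \<gamma>) \<gamma>)"

definition corner_map ::
  "('a, 'm) monoid_scheme \<Rightarrow> 'a set \<times> 'a set
     \<Rightarrow> (('a, 'a, 'k::field_char_0) section_elts \<Rightarrow>\<^sub>0 'k) \<Rightarrow> ('a, 'a, 'k) section_elts set" where
  "corner_map G p a =
     to_essential G (f_elt G p)
       \<otimes>\<^bsub>essential_algebra G\<^esub> to_essential G (linear_inclusion a)
       \<otimes>\<^bsub>essential_algebra G\<^esub> to_essential G (f_elt G p)"

text \<open>
  The left ideal of the essential algebra generated by the image of \<open>f\<close>, tensored with \<open>V\<close> over the
  group algebra of the linkage group, which acts from the right through \<^const>\<open>corner_map\<close>.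
\<close>

definition induced_module ::
  "('a, 'm) monoid_scheme \<Rightarrow> 'a set \<times> 'a set
     \<Rightarrow> (('a, 'a, 'k::field_char_0) section_elts \<Rightarrow>\<^sub>0 'k, 'v) module
     \<Rightarrow> (('a, 'a, 'k) section_elts set, (('a, 'a, 'k) section_elts set \<times> 'v \<Rightarrow>\<^sub>0 int) set) module" where
  "induced_module G p V =
     tensor_module (group_algebra (linkage_group G p))
       (principal_left_module (essential_algebra G) (to_essential G (f_elt G p)))
       (\<lambda>x a. x \<otimes>\<^bsub>essential_algebra G\<^esub> corner_map G p a) V"

end

theory Submission imports Defs begin

text \<open>
  Write \<open>s\<close> for a section \<open>(T, S)\<close> of \<open>G \<times> G\<close>, and rescale its basis element to \<open>|S| / |G| [T, S]\<close>.  In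
  this normalisation the product of two covering sections has a single term, the section
  \<open>(T O V, S O U)\<close> (\<open>basis_elt_mult\<close>): all the twists that occur in the product formula are conjugate.  The
  covering sections form a finite monoid in which the converse relation is a generalised inverse and
  whose idempotents are the sections \<open>(\<Delta>\<^sub>K(G), \<Delta>(P))\<close>, one for each pair \<open>p = (K, P)\<close> of commuting
  normal subgroups (\<open>compose_converse\<close>, \<open>diag_compose_diag\<close>).  It is thus an inverse monoid, and \<open>E\<^sup>c\<close> is spanned by a
  multiplicative image of it, so the theory of algebras of inverse monoids applies.  The idempotents
  \<open>e\<^bsub>p\<^esub>\<close> multiply by the join of pairs, and Moebius inversion turns them into orthogonal idempotents
  \<open>f\<^bsub>p\<^esub>\<close> with sum \<open>1\<close> (\<open>f_orthogonal\<close>, \<open>sum_f\<close>).  A covering section \<open>s\<close> with left pair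
  \<open>p = (k\<^sub>1(T), p\<^sub>1(S))\<close> and right pair \<open>q\<close> satisfies \<open>f\<^bsub>p\<^esub> s = s f\<^bsub>q\<^esub>\<close> (\<open>f_basis_elt_commute\<close>).  Hence
  \<open>f\<^bsub>p\<^esub>\<close> and \<open>f\<^bsub>q\<^esub>\<close> are isomorphic idempotents if \<open>p\<close> and \<open>q\<close> are linked, \<open>f\<^bsub>p\<^esub> E\<^sup>c f\<^bsub>q\<^esub> = 0\<close> otherwise
  (\<open>f_unlinked\<close>), and the sums of the \<open>f\<^bsub>p\<^esub>\<close> over linkage classes are central in \<open>E\<^sup>c\<close>.

  The ideal \<open>I\<close> enters through two facts.  A section that is not covering factors through the smaller
  group \<open>p\<^sub>2(T) / k\<^sub>2(S)\<close>, or through its analogue on the other side (\<open>noncovering_in_I\<close>); this gives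
  \<open>E = E\<^sup>c + I\<close>.  Conversely, let \<open>s\<close> be a covering section that occurs in a product of sections through a
  smaller group.  The invariants \<open>q = (k\<^sub>1(T), p\<^sub>1(S))\<close> of the first factor form a pair
  with \<open>e\<^bsub>q\<^esub>\<close> in \<open>I\<close> and \<open>e\<^bsub>q\<^esub> s = s\<close>.  If \<open>p\<close> is reduced then \<open>q\<close> does not lie below \<open>p\<close>, so
  \<open>f\<^bsub>p\<^esub> e\<^bsub>q\<^esub> = 0\<close> and \<open>f\<^bsub>p\<^esub> s = 0\<close>.  Therefore \<open>f\<^bsub>p\<^esub>\<close> annihilates \<open>E\<^sup>c \<inter> I\<close> for reduced \<open>p\<close>
  (\<open>covering_ideal_annihilated\<close>), whereas \<open>f\<^bsub>p\<^esub> = f\<^bsub>p\<^esub> e\<^bsub>p\<^esub>\<close> lies in \<open>I\<close> for all other \<open>p\<close>.  With the block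
  decomposition of \<open>E\<^sup>c\<close> this determines \<open>E\<^sup>c \<inter> I\<close> and identifies the essential algebra with the sum
  of the reduced blocks.

  For \<open>\<gamma>\<close> in the linkage group of \<open>p\<close>, the product \<open>f\<^bsub>p\<^esub> \<gamma>\<close> is \<open>\<gamma>\<close> plus terms whose left pair is
  strictly larger than \<open>p\<close>; so \<open>a \<mapsto> f\<^bsub>p\<^esub> a\<close> is injective on the group algebra, and \<open>f_corner\<close> shows that
  it maps onto \<open>f\<^bsub>p\<^esub> E\<^sup>c f\<^bsub>p\<^esub>\<close> (\<open>corner_iso\<close>).  What remains concerns modules only.  For a ring with a
  finite decomposition of \<open>1\<close> into orthogonal idempotents, any two of which are either isomorphic or have no
  nonzero maps between their left ideals, the simple modules correspond to the simple modules of the corners,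
  one corner being taken from each isomorphism class; the correspondence is \<open>V \<mapsto> A f\<^bsub>p\<^esub> \<otimes> V\<close>, with inverse
  \<open>M \<mapsto> f\<^bsub>p\<^esub> M\<close> (locale \<open>idempotent_system\<close>).
\<close>

section \<open>Linear algebra of finitely supported functions\<close>

lemma lookup_scale [simp]: "Poly_Mapping.lookup (scale c x) a = c * Poly_Mapping.lookup x a"
  by (simp add: scale_def map.rep_eq when_def)

global_interpretation scale: vector_space "scale :: 'k::field \<Rightarrow> ('b \<Rightarrow>\<^sub>0 'k) \<Rightarrow> ('b \<Rightarrow>\<^sub>0 'k)"
  by unfold_locales (auto intro!: poly_mapping_eqI simp: lookup_add algebra_simps)

lemma scale_single [simp]: "scale c (Poly_Mapping.single a d) = Poly_Mapping.single a (c * d)"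
  by (rule poly_mapping_eqI) (simp add: lookup_single when_def)

lemma finitely_supported_expand:
  assumes "finite A" "Poly_Mapping.keys x \<subseteq> A"
  shows "x = (\<Sum>a\<in>A. scale (Poly_Mapping.lookup x a) (Poly_Mapping.single a (1::'k::field)))"
  using assms
  by (intro poly_mapping_eqI)
     (auto simp: lookup_sum lookup_single when_def sum.delta in_keys_iff subset_iff)

lemma span_singles:
  "scale.span ((\<lambda>a. Poly_Mapping.single a (1::'k::field)) ` A) = {x. Poly_Mapping.keys x \<subseteq> A}"
    (is "scale.span ?S = ?K")
proof
  have "scale.subspace ?K"
  proof (rule scale.subspaceI)
    show "x + y \<in> ?K" if "x \<in> ?K" "y \<in> ?K" for x y
      using that Poly_Mapping.keys_add[of x y] by blast
  qed (auto simp: in_keys_iff subset_iff)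
  then show "scale.span ?S \<subseteq> ?K"
    by (intro scale.span_minimal) auto
next
  show "?K \<subseteq> scale.span ?S"
  proof
    fix x :: "_ \<Rightarrow>\<^sub>0 'k" assume x: "x \<in> ?K"
    have "(\<Sum>a\<in>Poly_Mapping.keys x. scale (Poly_Mapping.lookup x a) (Poly_Mapping.single a (1::'k)))
        \<in> scale.span ?S"
      using x by (intro scale.span_sum scale.span_scale scale.span_base) auto
    then show "x \<in> scale.span ?S"
      using finitely_supported_expand[of "Poly_Mapping.keys x" x] by simp
  qed
qed

lemma bilinear_extension_superset:
  fixes x :: "'b \<Rightarrow>\<^sub>0 'k::field" and y :: "'c \<Rightarrow>\<^sub>0 'k"
  assumes "finite A" "Poly_Mapping.keys x \<subseteq> A" "finite B" "Poly_Mapping.keys y \<subseteq> B"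
  shows "bilinear_extension \<beta> x y =
    (\<Sum>a\<in>A. \<Sum>b\<in>B. scale (Poly_Mapping.lookup x a * Poly_Mapping.lookup y b) (\<beta> a b))"
proof -
  have "bilinear_extension \<beta> x y = (\<Sum>a\<in>Poly_Mapping.keys x. \<Sum>b\<in>B.
      scale (Poly_Mapping.lookup x a * Poly_Mapping.lookup y b) (\<beta> a b))"
    unfolding bilinear_extension_def using assms(3,4)
    by (intro sum.cong refl sum.mono_neutral_left) (auto simp: in_keys_iff)
  also have "\<dots> = (\<Sum>a\<in>A. \<Sum>b\<in>B. scale (Poly_Mapping.lookup x a * Poly_Mapping.lookup y b) (\<beta> a b))"
    using assms(1,2)
    by (intro sum.mono_neutral_left) (auto simp: in_keys_iff)
  finally show ?thesis .
qed

context
  fixes \<beta> :: "'b \<Rightarrow> 'c \<Rightarrow> ('d \<Rightarrow>\<^sub>0 'k::field)"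
begin

lemma bilinear_extension_add_left:
  "bilinear_extension \<beta> (x + x') y = bilinear_extension \<beta> x y + bilinear_extension \<beta> x' y"
proof -
  define A where "A = Poly_Mapping.keys x \<union> Poly_Mapping.keys x' \<union> Poly_Mapping.keys (x + x')"
  show ?thesis
    by (subst (1 2 3) bilinear_extension_superset[where A = A and B = "Poly_Mapping.keys y"])
       (auto simp: A_def lookup_add algebra_simps scale.scale_left_distrib sum.distrib)
qed

lemma bilinear_extension_add_right:
  "bilinear_extension \<beta> x (y + y') = bilinear_extension \<beta> x y + bilinear_extension \<beta> x y'"
proof -
  define B where "B = Poly_Mapping.keys y \<union> Poly_Mapping.keys y' \<union> Poly_Mapping.keys (y + y')"
  show ?thesis
    by (subst (1 2 3) bilinear_extension_superset[where B = B and A = "Poly_Mapping.keys x"])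
       (auto simp: B_def lookup_add algebra_simps scale.scale_left_distrib sum.distrib)
qed

lemma bilinear_extension_scale_left:
  "bilinear_extension \<beta> (scale c x) y = scale c (bilinear_extension \<beta> x y)"
  by (subst (1 2) bilinear_extension_superset
        [where A = "Poly_Mapping.keys x" and B = "Poly_Mapping.keys y"])
     (auto simp: in_keys_iff scale.scale_sum_right mult.assoc)

lemma bilinear_extension_scale_right:
  "bilinear_extension \<beta> x (scale c y) = scale c (bilinear_extension \<beta> x y)"
  by (subst (1 2) bilinear_extension_superset
        [where A = "Poly_Mapping.keys x" and B = "Poly_Mapping.keys y"])
     (auto simp: in_keys_iff scale.scale_sum_right mult_ac)

lemma bilinear_extension_linear_left:
  "Vector_Spaces.linear scale scale (\<lambda>x. bilinear_extension \<beta> x y)"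
  by unfold_locales
     (simp_all add: bilinear_extension_add_left bilinear_extension_scale_left)

lemma bilinear_extension_linear_right:
  "Vector_Spaces.linear scale scale (bilinear_extension \<beta> x)"
  by unfold_locales
     (simp_all add: bilinear_extension_add_right bilinear_extension_scale_right)

lemmas bilinear_extension_sum_left =
  module_hom.sum[OF bilinear_extension_linear_left[THEN Vector_Spaces.linear.axioms(3)]]

lemmas bilinear_extension_sum_right =
  module_hom.sum[OF bilinear_extension_linear_right[THEN Vector_Spaces.linear.axioms(3)]]

lemmas bilinear_extension_zero_left [simp] =
  module_hom.zero[OF bilinear_extension_linear_left[THEN Vector_Spaces.linear.axioms(3)]]

lemmas bilinear_extension_zero_right [simp] =
  module_hom.zero[OF bilinear_extension_linear_right[THEN Vector_Spaces.linear.axioms(3)]]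

lemmas bilinear_extension_diff_right =
  module_hom.diff[OF bilinear_extension_linear_right[THEN Vector_Spaces.linear.axioms(3)]]

lemma bilinear_extension_single:
  "bilinear_extension \<beta> (Poly_Mapping.single a 1) (Poly_Mapping.single b 1) = \<beta> a b"
  by (simp add: bilinear_extension_def)

lemma bilinear_extension_closed:
  assumes "x \<in> scale.span U" and "y \<in> scale.span V" and "module.subspace scale W"
    and "\<And>a b. a \<in> U \<Longrightarrow> b \<in> V \<Longrightarrow> bilinear_extension \<beta> a b \<in> W"
  shows "bilinear_extension \<beta> x y \<in> W"
proof -
  have *: "bilinear_extension \<beta> a y \<in> W" if "a \<in> U" for a
    using assms(2)
  proof (rule scale.span_induct)
    show "scale.subspace {v. bilinear_extension \<beta> a v \<in> W}"
      using assms(3) by (intro scale.subspaceI)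
        (auto simp: bilinear_extension_add_right bilinear_extension_scale_right
           scale.subspace_def)
  qed (use that assms(4) in auto)
  show ?thesis using assms(1)
  proof (rule scale.span_induct)
    show "scale.subspace {v. bilinear_extension \<beta> v y \<in> W}"
      using assms(3) by (intro scale.subspaceI)
        (auto simp: bilinear_extension_add_left bilinear_extension_scale_left
           scale.subspace_def)
  qed (use * in auto)
qed

end

text \<open>
  Associativity is trilinear, so it passes from spanning sets to their spans, one argument at a time.
\<close>

lemma bilinear_extension_assoc:
  fixes \<beta> :: "'b \<Rightarrow> 'c \<Rightarrow> ('d \<Rightarrow>\<^sub>0 'k::field)" and \<gamma> :: "'d \<Rightarrow> 'e \<Rightarrow> ('f \<Rightarrow>\<^sub>0 'k)"
    and \<beta>' :: "'b \<Rightarrow> 'g \<Rightarrow> ('f \<Rightarrow>\<^sub>0 'k)" and \<gamma>' :: "'c \<Rightarrow> 'e \<Rightarrow> ('g \<Rightarrow>\<^sub>0 'k)"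
  assumes "x \<in> scale.span U" "y \<in> scale.span V" "z \<in> scale.span W"
    and base: "\<And>a b c. a \<in> U \<Longrightarrow> b \<in> V \<Longrightarrow> c \<in> W \<Longrightarrow>
      bilinear_extension \<gamma> (bilinear_extension \<beta> a b) c =
      bilinear_extension \<beta>' a (bilinear_extension \<gamma>' b c)"
  shows "bilinear_extension \<gamma> (bilinear_extension \<beta> x y) z =
      bilinear_extension \<beta>' x (bilinear_extension \<gamma>' y z)"
proof -
  note lin = bilinear_extension_add_left bilinear_extension_add_right
    bilinear_extension_scale_left bilinear_extension_scale_right
  let ?P = "\<lambda>x y z. bilinear_extension \<gamma> (bilinear_extension \<beta> x y) z =
      bilinear_extension \<beta>' x (bilinear_extension \<gamma>' y z)"
  have 1: "?P a b z" if "a \<in> U" "b \<in> V" for a b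
    using assms(3)
    by (rule scale.span_induct) (use that base in \<open>auto intro!: scale.subspaceI simp: lin\<close>)
  have 2: "?P a y z" if "a \<in> U" for a
    using assms(2)
    by (rule scale.span_induct) (use that 1 in \<open>auto intro!: scale.subspaceI simp: lin\<close>)
  show ?thesis
    using assms(1)
    by (rule scale.span_induct) (use 2 in \<open>auto intro!: scale.subspaceI simp: lin\<close>)
qed

text \<open>
  The ring and module axioms of a record over finitely supported functions, checked on a spanning
  set; both the section algebra and the group algebras are instances.
\<close>

lemma k_algebra_spanI:
  fixes A :: "('k::field, 'b \<Rightarrow>\<^sub>0 'k) module"
  assumes carr: "carrier A = scale.span U"
    and mult: "monoid.mult A = bilinear_extension \<beta>"
    and zero: "ring.zero A = 0" and add: "ring.add A = (+)" and smult: "module.smult A = scale"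
    and one_in: "monoid.one A \<in> scale.span U"
    and closed: "\<And>a b. a \<in> U \<Longrightarrow> b \<in> U \<Longrightarrow> bilinear_extension \<beta> a b \<in> scale.span U"
    and assoc: "\<And>a b c. a \<in> U \<Longrightarrow> b \<in> U \<Longrightarrow> c \<in> U \<Longrightarrow>
      bilinear_extension \<beta> (bilinear_extension \<beta> a b) c =
      bilinear_extension \<beta> a (bilinear_extension \<beta> b c)"
    and one: "\<And>a. a \<in> U \<Longrightarrow> bilinear_extension \<beta> (monoid.one A) a = a"
      "\<And>a. a \<in> U \<Longrightarrow> bilinear_extension \<beta> a (monoid.one A) = a"
  shows "k_algebra A"
proof -
  note lin = bilinear_extension_add_left bilinear_extension_add_right
    bilinear_extension_scale_left bilinear_extension_scale_right
  note recs = carr mult zero add smult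
  have ab: "abelian_group A"
  proof (rule abelian_groupI)
    fix x assume "x \<in> carrier A"
    then have "- x \<in> carrier A" "- x \<oplus>\<^bsub>A\<^esub> x = \<zero>\<^bsub>A\<^esub>"
      by (auto simp: recs scale.span_neg)
    then show "\<exists>y\<in>carrier A. y \<oplus>\<^bsub>A\<^esub> x = \<zero>\<^bsub>A\<^esub>" by blast
  qed (auto simp: recs scale.span_add scale.span_zero ac_simps)
  have one': "bilinear_extension \<beta> (monoid.one A) a = a" "bilinear_extension \<beta> a (monoid.one A) = a"
    if "a \<in> scale.span U" for a
     using that
     by (rule scale.span_induct, use one in \<open>auto intro!: scale.subspaceI simp: lin\<close>)+
  have closed': "bilinear_extension \<beta> a b \<in> scale.span U"
    if "a \<in> scale.span U" "b \<in> scale.span U" for a b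
    using that by (rule bilinear_extension_closed) (use closed in auto)
  have assoc': "bilinear_extension \<beta> (bilinear_extension \<beta> a b) c =
      bilinear_extension \<beta> a (bilinear_extension \<beta> b c)"
    if "a \<in> scale.span U" "b \<in> scale.span U" "c \<in> scale.span U" for a b c
    using that by (rule bilinear_extension_assoc) (use assoc in auto)
  have mon: "monoid A"
    by (rule monoidI) (auto simp: recs one_in one' closed' assoc')
  have ring: "ring A"
    by (rule ringI[OF ab mon]) (auto simp: recs lin)
  have "module ring_of_type_algebra A"
    by (rule Module.module.intro[OF cring_from_type_algebra ab], unfold_locales)
       (auto simp: recs ring_of_type_algebra_def scale.span_scale algebra_simps
          scale.scale_left_distrib)
  with ring show ?thesis
    by (intro k_algebra.intro) (auto simp: recs lin)
qed

section \<open>Subgroups of direct products as relations\<close>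

locale fin_group = group G for G (structure) +
  assumes finite_carrier [simp, intro]: "finite (carrier G)"

lemma (in group) inv_mult_cancel_left [simp]:
  assumes "x \<in> carrier G" "y \<in> carrier G"
  shows "inv x \<otimes> (x \<otimes> y) = y" and "x \<otimes> (inv x \<otimes> y) = y"
  using assms by (simp_all add: m_assoc[symmetric])

lemma (in group) conjugate_eq_vimage:
  assumes "x \<in> carrier G" "S \<subseteq> carrier G"
  shows "conjugate G x S = {y \<in> carrier G. inv x \<otimes> y \<otimes> x \<in> S}"
proof -
  have "x \<otimes> s \<otimes> inv x \<in> {y \<in> carrier G. inv x \<otimes> y \<otimes> x \<in> S}" if "s \<in> S" for s
    using that assms by (auto simp: m_assoc subset_iff)
  moreover have "y \<in> conjugate G x S" if "y \<in> carrier G" "inv x \<otimes> y \<otimes> x \<in> S" for y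
    unfolding conjugate_def using assms that
    by (intro image_eqI[where x = "inv x \<otimes> y \<otimes> x"]) (auto simp: m_assoc)
  ultimately show ?thesis unfolding conjugate_def by blast
qed

lemma (in group) conjugate_closed:
  "x \<in> carrier G \<Longrightarrow> S \<subseteq> carrier G \<Longrightarrow> conjugate G x S \<subseteq> carrier G"
  by (auto simp: conjugate_def)

lemma (in group) conjugate_mult:
  assumes "x \<in> carrier G" "y \<in> carrier G" "S \<subseteq> carrier G"
  shows "conjugate G (x \<otimes> y) S = conjugate G x (conjugate G y S)"
  unfolding conjugate_def image_image
  by (intro image_cong refl) (use assms in \<open>auto simp: m_assoc inv_mult_group subset_iff\<close>)

lemma (in group) conjugate_one [simp]: "S \<subseteq> carrier G \<Longrightarrow> conjugate G \<one> S = S"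
  unfolding conjugate_def by (auto simp: subset_iff image_iff)

lemma (in group) card_conjugate:
  assumes "x \<in> carrier G" "S \<subseteq> carrier G"
  shows "card (conjugate G x S) = card S"
  unfolding conjugate_def
  by (rule card_image) (use assms in \<open>auto intro!: inj_onI simp: subset_iff\<close>)

lemma (in group) section_class_conjugate_subset:
  assumes "x \<in> carrier G" "T \<subseteq> carrier G" "S \<subseteq> carrier G"
  shows "section_class G (conjugate G x T, conjugate G x S) \<subseteq> section_class G (T, S)"
proof -
  have "\<exists>z\<in>carrier G. conjugate G y (conjugate G x T) = conjugate G z T \<and>
       conjugate G y (conjugate G x S) = conjugate G z S" if "y \<in> carrier G" for y
    using that assms by (intro bexI[of _ "y \<otimes> x"]) (auto simp: conjugate_mult)
  then show ?thesis unfolding section_class_def by clarsimp blast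
qed

lemma (in group) section_class_conjugate:
  assumes "x \<in> carrier G" "T \<subseteq> carrier G" "S \<subseteq> carrier G"
  shows "section_class G (conjugate G x T, conjugate G x S) = section_class G (T, S)"
proof
  have inv: "conjugate G (inv x) (conjugate G x U) = U" if "U \<subseteq> carrier G" for U
    using that assms(1) by (simp add: conjugate_mult[symmetric])
  show "section_class G (T, S) \<subseteq> section_class G (conjugate G x T, conjugate G x S)"
    using section_class_conjugate_subset[of "inv x" "conjugate G x T" "conjugate G x S"] assms
    by (simp add: inv conjugate_closed)
qed (rule section_class_conjugate_subset[OF assms])

text \<open>
  Composition and converse of sections are those of relations; the coordinatewise form of the subgroup
  axioms lets membership in composites be checked elementwise.
\<close>

definition rel_subgroup ::
  "('a, 'm) monoid_scheme \<Rightarrow> ('b, 'n) monoid_scheme \<Rightarrow> ('a \<times> 'b) set \<Rightarrow> bool" where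
  "rel_subgroup G H T \<longleftrightarrow> T \<subseteq> carrier G \<times> carrier H \<and> (\<one>\<^bsub>G\<^esub>, \<one>\<^bsub>H\<^esub>) \<in> T \<and>
     (\<forall>a b c d. (a, b) \<in> T \<longrightarrow> (c, d) \<in> T \<longrightarrow> (a \<otimes>\<^bsub>G\<^esub> c, b \<otimes>\<^bsub>H\<^esub> d) \<in> T) \<and>
     (\<forall>a b. (a, b) \<in> T \<longrightarrow> (inv\<^bsub>G\<^esub> a, inv\<^bsub>H\<^esub> b) \<in> T)"

lemma rel_subgroupD:
  assumes "rel_subgroup G H T"
  shows "T \<subseteq> carrier G \<times> carrier H" "(\<one>\<^bsub>G\<^esub>, \<one>\<^bsub>H\<^esub>) \<in> T"
    and "(a, b) \<in> T \<Longrightarrow> a \<in> carrier G" "(a, b) \<in> T \<Longrightarrow> b \<in> carrier H"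
    and "(a, b) \<in> T \<Longrightarrow> (c, d) \<in> T \<Longrightarrow> (a \<otimes>\<^bsub>G\<^esub> c, b \<otimes>\<^bsub>H\<^esub> d) \<in> T"
    and "(a, b) \<in> T \<Longrightarrow> (inv\<^bsub>G\<^esub> a, inv\<^bsub>H\<^esub> b) \<in> T"
  using assms unfolding rel_subgroup_def by auto

lemma rel_subgroup_iff:
  assumes "group G" "group H"
  shows "rel_subgroup G H T \<longleftrightarrow> subgroup T (G \<times>\<times> H)"
proof
  assume "rel_subgroup G H T"
  then show "subgroup T (G \<times>\<times> H)"
    unfolding rel_subgroup_def using assms
    by (intro subgroup.intro) (auto simp: inv_DirProd)
next
  assume T: "subgroup T (G \<times>\<times> H)"
  show "rel_subgroup G H T"
    unfolding rel_subgroup_def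
  proof (intro conjI allI impI)
    show "T \<subseteq> carrier G \<times> carrier H" using subgroup.subset[OF T] by simp
    show "(\<one>\<^bsub>G\<^esub>, \<one>\<^bsub>H\<^esub>) \<in> T" using subgroup.one_closed[OF T] by simp
    show "(a \<otimes>\<^bsub>G\<^esub> c, b \<otimes>\<^bsub>H\<^esub> d) \<in> T" if "(a, b) \<in> T" "(c, d) \<in> T" for a b c d
      using subgroup.m_closed[OF T that] by simp
    show "(inv\<^bsub>G\<^esub> a, inv\<^bsub>H\<^esub> b) \<in> T" if "(a, b) \<in> T" for a b
      using subgroup.m_inv_closed[OF T that] subgroup.subset[OF T] that assms
      by (auto simp: inv_DirProd)
  qed
qed

lemma mem_sections:
  assumes G: "group G" and H: "group H"
  shows "(T, S) \<in> sections (G \<times>\<times> H) \<longleftrightarrow> rel_subgroup G H T \<and> rel_subgroup G H S \<and> S \<subseteq> T \<and>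
    (\<forall>a b c d. (a, b) \<in> T \<longrightarrow> (c, d) \<in> S \<longrightarrow>
       (a \<otimes>\<^bsub>G\<^esub> c \<otimes>\<^bsub>G\<^esub> inv\<^bsub>G\<^esub> a, b \<otimes>\<^bsub>H\<^esub> d \<otimes>\<^bsub>H\<^esub> inv\<^bsub>H\<^esub> b) \<in> S)"
    (is "_ \<longleftrightarrow> ?R")
proof -
  interpret Z: group "G \<times>\<times> H" by (rule DirProd_group[OF G H])
  have inv: "inv\<^bsub>(G \<times>\<times> H)\<lparr>carrier := T\<rparr>\<^esub> (a, b) = (inv\<^bsub>G\<^esub> a, inv\<^bsub>H\<^esub> b)"
    if "subgroup T (G \<times>\<times> H)" "(a, b) \<in> T" for a b
    using that subgroup.subset[OF that(1)]
    by (subst Z.m_inv_consistent) (auto simp: inv_DirProd[OF G H])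
  have "(T, S) \<in> sections (G \<times>\<times> H) \<longleftrightarrow>
     subgroup T (G \<times>\<times> H) \<and> S \<lhd> ((G \<times>\<times> H)\<lparr>carrier := T\<rparr>)"
    by (simp add: sections_def)
  also have "\<dots> \<longleftrightarrow> ?R"
  proof (intro iffI; elim conjE)
    assume T: "subgroup T (G \<times>\<times> H)" and S: "S \<lhd> ((G \<times>\<times> H)\<lparr>carrier := T\<rparr>)"
    interpret S: normal S "(G \<times>\<times> H)\<lparr>carrier := T\<rparr>" by (rule S)
    have "subgroup S (G \<times>\<times> H)"
      using Z.incl_subgroup[OF T] S.subgroup_axioms by blast
    moreover have "(a \<otimes>\<^bsub>G\<^esub> c \<otimes>\<^bsub>G\<^esub> inv\<^bsub>G\<^esub> a, b \<otimes>\<^bsub>H\<^esub> d \<otimes>\<^bsub>H\<^esub> inv\<^bsub>H\<^esub> b) \<in> S"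
      if "(a, b) \<in> T" "(c, d) \<in> S" for a b c d
      using S.inv_op_closed2[of "(a, b)" "(c, d)"] that by (simp add: inv[OF T])
    ultimately show ?R using T S.subset by (auto simp: rel_subgroup_iff[OF G H])
  next
    assume T: "rel_subgroup G H T" and S: "rel_subgroup G H S" and ST: "S \<subseteq> T"
      and n: "\<forall>a b c d. (a, b) \<in> T \<longrightarrow> (c, d) \<in> S \<longrightarrow>
       (a \<otimes>\<^bsub>G\<^esub> c \<otimes>\<^bsub>G\<^esub> inv\<^bsub>G\<^esub> a, b \<otimes>\<^bsub>H\<^esub> d \<otimes>\<^bsub>H\<^esub> inv\<^bsub>H\<^esub> b) \<in> S"
    have T': "subgroup T (G \<times>\<times> H)" using T by (simp add: rel_subgroup_iff[OF G H])
    interpret TT: group "(G \<times>\<times> H)\<lparr>carrier := T\<rparr>"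
      using Z.subgroup_imp_group[OF T'] .
    have "subgroup S ((G \<times>\<times> H)\<lparr>carrier := T\<rparr>)"
      using S ST by (simp add: rel_subgroup_iff[OF G H] T' Z.subgroup_incl)
    then have "S \<lhd> ((G \<times>\<times> H)\<lparr>carrier := T\<rparr>)"
      unfolding TT.normal_inv_iff using n ST by (auto simp: inv[OF T'])
    then show "subgroup T (G \<times>\<times> H) \<and> S \<lhd> ((G \<times>\<times> H)\<lparr>carrier := T\<rparr>)"
      using T' by blast
  qed
  finally show ?thesis .
qed

lemma card_eq_fibre_times_image:
  assumes "finite A" "\<And>y. y \<in> f ` A \<Longrightarrow> card {x \<in> A. f x = y} = n"
  shows "card A = card (f ` A) * n"
proof -
  have "card A = (\<Sum>y\<in>f ` A. card {x \<in> A. f x = y})"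
    using sum.image_gen[OF assms(1), of "\<lambda>_. 1::nat" f] by simp
  then show ?thesis using assms(2) by simp
qed

text \<open>
  A subgroup \<open>D\<close> of \<open>H \<times> M\<close>, cut down by subgroups of the factors, is counted by its second
  coordinates: the fibres are cosets of the set of first coordinates over the identity.
\<close>

lemma card_rel_subgroup_snd:
  assumes H: "group H" and M: "group M" and D: "rel_subgroup H M D"
    and A: "subgroup A H" and B: "subgroup B M" and fin: "finite D"
  shows "card {(h, m) \<in> D. h \<in> A \<and> m \<in> B} =
    card {m \<in> B. \<exists>h\<in>A. (h, m) \<in> D} * card {h \<in> A. (h, \<one>\<^bsub>M\<^esub>) \<in> D}"
proof -
  interpret H: group H by (rule H)
  interpret M: group M by (rule M)
  note D' = rel_subgroupD[OF D]
  let ?N = "{(h, m) \<in> D. h \<in> A \<and> m \<in> B}" and ?F = "{h \<in> A. (h, \<one>\<^bsub>M\<^esub>) \<in> D}"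
  have fib: "card {x \<in> ?N. snd x = m} = card ?F" if "m \<in> snd ` ?N" for m
  proof -
    from that obtain h0 where h0: "(h0, m) \<in> D" "h0 \<in> A" "m \<in> B" by auto
    have c: "h0 \<in> carrier H" "m \<in> carrier M" using D'(3,4) h0 by auto
    have "bij_betw (\<lambda>h. (h0 \<otimes>\<^bsub>H\<^esub> h, m)) ?F {x \<in> ?N. snd x = m}"
    proof (rule bij_betw_byWitness[where f' = "\<lambda>(h, _). inv\<^bsub>H\<^esub> h0 \<otimes>\<^bsub>H\<^esub> h"])
      show "(\<lambda>h. (h0 \<otimes>\<^bsub>H\<^esub> h, m)) ` ?F \<subseteq> {x \<in> ?N. snd x = m}"
        using h0 c D'(5)[OF h0(1)] subgroup.m_closed[OF A h0(2)] by fastforce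
      show "(\<lambda>(h, _). inv\<^bsub>H\<^esub> h0 \<otimes>\<^bsub>H\<^esub> h) ` {x \<in> ?N. snd x = m} \<subseteq> ?F"
        using h0 c D'(5)[OF D'(6)[OF h0(1)], of _ m]
          subgroup.m_closed[OF A subgroup.m_inv_closed[OF A h0(2)]] by fastforce
    qed (use c D'(3) in auto)
    then show ?thesis by (rule bij_betw_same_card[symmetric])
  qed
  have "finite ?N" by (rule finite_subset[OF _ fin]) auto
  from card_eq_fibre_times_image[OF this fib] have "card ?N = card (snd ` ?N) * card ?F" by blast
  moreover have "snd ` ?N = {m \<in> B. \<exists>h\<in>A. (h, m) \<in> D}" by force
  ultimately show ?thesis by simp
qed

lemma rel_subgroup_converse: "rel_subgroup G H (T\<inverse>) \<longleftrightarrow> rel_subgroup H G T"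
  unfolding rel_subgroup_def by auto

lemma card_rel_subgroup_fst:
  assumes H: "group H" and M: "group M" and D: "rel_subgroup H M D"
    and A: "subgroup A H" and B: "subgroup B M" and fin: "finite D"
  shows "card {(h, m) \<in> D. h \<in> A \<and> m \<in> B} =
    card {h \<in> A. \<exists>m\<in>B. (h, m) \<in> D} * card {m \<in> B. (\<one>\<^bsub>H\<^esub>, m) \<in> D}"
proof -
  have "card {(m, h) \<in> D\<inverse>. m \<in> B \<and> h \<in> A} =
    card {h \<in> A. \<exists>m\<in>B. (m, h) \<in> D\<inverse>} * card {m \<in> B. (m, \<one>\<^bsub>H\<^esub>) \<in> D\<inverse>}"
    using assms by (intro card_rel_subgroup_snd) (auto simp: rel_subgroup_converse)
  moreover have "bij_betw prod.swap {(h, m) \<in> D. h \<in> A \<and> m \<in> B} {(m, h) \<in> D\<inverse>. m \<in> B \<and> h \<in> A}"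
    by (rule bij_betw_byWitness[where f' = prod.swap]) auto
  ultimately show ?thesis using bij_betw_same_card by fastforce
qed

lemma rel_subgroup_comp:
  assumes "rel_subgroup G H T" "rel_subgroup H M V"
  shows "rel_subgroup G M (T O V)"
proof -
  note T = rel_subgroupD[OF assms(1)] and V = rel_subgroupD[OF assms(2)]
  show ?thesis
    unfolding rel_subgroup_def
    using T(1) V(1) relcompI[OF T(2) V(2)]
    by (auto dest: T(3) V(4) intro: relcompI[OF T(5) V(5)] relcompI[OF T(6) V(6)])
qed

lemma sections_comp:
  assumes "group G" "group H" "group M"
    and "(T, S) \<in> sections (G \<times>\<times> H)" "(V, U) \<in> sections (H \<times>\<times> M)"
  shows "(T O V, S O U) \<in> sections (G \<times>\<times> M)"
  using assms unfolding mem_sections[OF assms(1,2)] mem_sections[OF assms(2,3)]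
    mem_sections[OF assms(1,3)]
proof (elim conjE, intro conjI allI impI)
  assume n: "\<forall>a b c d. (a, b) \<in> T \<longrightarrow> (c, d) \<in> S \<longrightarrow>
       (a \<otimes>\<^bsub>G\<^esub> c \<otimes>\<^bsub>G\<^esub> inv\<^bsub>G\<^esub> a, b \<otimes>\<^bsub>H\<^esub> d \<otimes>\<^bsub>H\<^esub> inv\<^bsub>H\<^esub> b) \<in> S"
    "\<forall>a b c d. (a, b) \<in> V \<longrightarrow> (c, d) \<in> U \<longrightarrow>
       (a \<otimes>\<^bsub>H\<^esub> c \<otimes>\<^bsub>H\<^esub> inv\<^bsub>H\<^esub> a, b \<otimes>\<^bsub>M\<^esub> d \<otimes>\<^bsub>M\<^esub> inv\<^bsub>M\<^esub> b) \<in> U"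
  fix a b c d assume "(a, b) \<in> T O V" "(c, d) \<in> S O U"
  then obtain x y where "(a, x) \<in> T" "(x, b) \<in> V" "(c, y) \<in> S" "(y, d) \<in> U" by blast
  then show "(a \<otimes>\<^bsub>G\<^esub> c \<otimes>\<^bsub>G\<^esub> inv\<^bsub>G\<^esub> a, b \<otimes>\<^bsub>M\<^esub> d \<otimes>\<^bsub>M\<^esub> inv\<^bsub>M\<^esub> b) \<in> S O U"
    using n by (intro relcompI[where b = "x \<otimes>\<^bsub>H\<^esub> y \<otimes>\<^bsub>H\<^esub> inv\<^bsub>H\<^esub> x"]) auto
qed (auto intro: rel_subgroup_comp)

lemma sections_converse:
  assumes "group G" "group H" "(T, S) \<in> sections (G \<times>\<times> H)"
  shows "(T\<inverse>, S\<inverse>) \<in> sections (H \<times>\<times> G)"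
  using assms by (auto simp: mem_sections rel_subgroup_converse)

lemma finite_rel_subgroup:
  "rel_subgroup G H T \<Longrightarrow> finite (carrier G) \<Longrightarrow> finite (carrier H) \<Longrightarrow> finite T"
  by (auto dest!: rel_subgroupD(1) intro: finite_subset)

lemma subgroup_k1:
  assumes "group G" "group H" "rel_subgroup G H S"
  shows "subgroup (k1 H S) G"
proof -
  interpret H: group H by fact
  note S = rel_subgroupD[OF assms(3)]
  show ?thesis
    using S(1,2,3) S(5)[of _ "\<one>\<^bsub>H\<^esub>" _ "\<one>\<^bsub>H\<^esub>"] S(6)[of _ "\<one>\<^bsub>H\<^esub>"]
    by (intro subgroup.intro) (auto simp: k1_def)
qed

lemma subgroup_k2: "group G \<Longrightarrow> group H \<Longrightarrow> rel_subgroup G H S \<Longrightarrow> subgroup (k2 G S) H"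
  using subgroup_k1[of H G "S\<inverse>"] by (simp add: rel_subgroup_converse k1_def k2_def)

lemma subgroup_Range:
  assumes "group G" "group H" "rel_subgroup G H S"
  shows "subgroup (Range S) H"
proof -
  note S = rel_subgroupD[OF assms(3)]
  show ?thesis
    using S(2,4) by (intro subgroup.intro) (auto dest: S(5,6))
qed

lemma subgroup_Domain: "group G \<Longrightarrow> group H \<Longrightarrow> rel_subgroup G H S \<Longrightarrow> subgroup (Domain S) G"
  using subgroup_Range[of H G "S\<inverse>"] by (simp add: rel_subgroup_converse)

text \<open>
  The fibre product maps onto \<open>S O U\<close>, and the fibre over a point is a coset of
  \<open>k\<^sub>2(S) \<inter> k\<^sub>1(U)\<close>: two middle elements for the same outer pair differ
  by such an element.
\<close>

lemma card_fibre_product: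
  assumes "fin_group G" "fin_group H" "fin_group M"
    and S: "rel_subgroup G H S" and U: "rel_subgroup H M U"
  shows "card {(h, g, m). (g, h) \<in> S \<and> (h, m) \<in> U} = card (S O U) * card (k2 G S \<inter> k1 M U)"
proof -
  interpret G: fin_group G by fact
  interpret H: fin_group H by fact
  interpret M: fin_group M by fact
  let ?D = "{(h, g, m). (g, h) \<in> S \<and> (h, m) \<in> U}"
  interpret GM: group "G \<times>\<times> M" by (rule DirProd_group) unfold_locales
  have D: "rel_subgroup H (G \<times>\<times> M) ?D"
    using rel_subgroupD[OF S] rel_subgroupD[OF U] unfolding rel_subgroup_def
    by (auto simp: inv_DirProd[OF G.group_axioms M.group_axioms])
  have sub: "?D \<subseteq> carrier H \<times> carrier G \<times> carrier M"
    using rel_subgroupD[OF S] rel_subgroupD[OF U] by auto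
  then have fin: "finite ?D"
    by (rule finite_subset) simp
  have "card {(h, x) \<in> ?D. h \<in> carrier H \<and> x \<in> carrier (G \<times>\<times> M)} =
     card {x \<in> carrier (G \<times>\<times> M). \<exists>h\<in>carrier H. (h, x) \<in> ?D} *
     card {h \<in> carrier H. (h, \<one>\<^bsub>G \<times>\<times> M\<^esub>) \<in> ?D}"
    by (rule card_rel_subgroup_snd[OF H.group_axioms GM.group_axioms D H.subgroup_self
          GM.subgroup_self fin])
  moreover have "{(h, x) \<in> ?D. h \<in> carrier H \<and> x \<in> carrier (G \<times>\<times> M)} = ?D"
    using sub by auto
  moreover have "{x \<in> carrier (G \<times>\<times> M). \<exists>h\<in>carrier H. (h, x) \<in> ?D} = S O U"
    using sub by auto
  moreover have "{h \<in> carrier H. (h, \<one>\<^bsub>G \<times>\<times> M\<^esub>) \<in> ?D} = k2 G S \<inter> k1 M U"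
    using sub by (auto simp: k1_def k2_def)
  ultimately show ?thesis by simp
qed

text \<open>
  Both sides count the pairs in \<open>U\<close> with first coordinate in \<open>k\<^sub>2(S)\<close> and second in \<open>k\<^sub>1(W)\<close>.
\<close>

lemma card_kernels_cocycle:
  assumes "fin_group G" "fin_group H" "fin_group M" "fin_group N"
    and S: "rel_subgroup G H S" and U: "rel_subgroup H M U" and W: "rel_subgroup M N W"
  shows "card (k2 G S \<inter> k1 M U) * card (k2 G (S O U) \<inter> k1 N W) =
    card (k2 H U \<inter> k1 N W) * card (k2 G S \<inter> k1 N (U O W))"
proof -
  interpret G: fin_group G by fact
  interpret H: fin_group H by fact
  interpret M: fin_group M by fact
  interpret N: fin_group N by fact
  have *: "subgroup (k2 G S) H" "subgroup (k1 N W) M"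
    using S W G.group_axioms H.group_axioms M.group_axioms N.group_axioms
    by (auto intro: subgroup_k1 subgroup_k2)
  have fin: "finite U" by (rule finite_rel_subgroup[OF U]) auto
  have "k2 G (S O U) \<inter> k1 N W = {m \<in> k1 N W. \<exists>h\<in>k2 G S. (h, m) \<in> U}"
    "k2 G S \<inter> k1 M U = {h \<in> k2 G S. (h, \<one>\<^bsub>M\<^esub>) \<in> U}"
    "k2 G S \<inter> k1 N (U O W) = {h \<in> k2 G S. \<exists>m\<in>k1 N W. (h, m) \<in> U}"
    "k2 H U \<inter> k1 N W = {m \<in> k1 N W. (\<one>\<^bsub>H\<^esub>, m) \<in> U}"
    by (auto simp: k1_def k2_def)
  then show ?thesis
    using card_rel_subgroup_snd[OF H.group_axioms M.group_axioms U * fin]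
      card_rel_subgroup_fst[OF H.group_axioms M.group_axioms U * fin] by (simp add: mult.commute)
qed

section \<open>The product of two sections\<close>

lemma conjugate_comp:
  assumes "group G" "group H" "group M" "T \<subseteq> carrier G \<times> carrier H" "V \<subseteq> carrier H \<times> carrier M"
    and "x \<in> carrier G" "z \<in> carrier H" "y \<in> carrier M"
  shows "conjugate (G \<times>\<times> M) (x, y) (T O V) =
    conjugate (G \<times>\<times> H) (x, z) T O conjugate (H \<times>\<times> M) (z, y) V" (is "?L = ?A O ?B")
proof -
  interpret H: group H by fact
  have inv: "inv\<^bsub>G \<times>\<times> M\<^esub> (x, y) = (inv\<^bsub>G\<^esub> x, inv\<^bsub>M\<^esub> y)"
    "inv\<^bsub>G \<times>\<times> H\<^esub> (x, z) = (inv\<^bsub>G\<^esub> x, inv\<^bsub>H\<^esub> z)" "inv\<^bsub>H \<times>\<times> M\<^esub> (z, y) = (inv\<^bsub>H\<^esub> z, inv\<^bsub>M\<^esub> y)"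
    using assms by (simp_all add: inv_DirProd)
  have eq: "h = h'" if "h \<in> carrier H" "h' \<in> carrier H"
    "z \<otimes>\<^bsub>H\<^esub> h \<otimes>\<^bsub>H\<^esub> inv\<^bsub>H\<^esub> z = z \<otimes>\<^bsub>H\<^esub> h' \<otimes>\<^bsub>H\<^esub> inv\<^bsub>H\<^esub> z" for h h'
    using that assms(7) by simp
  have "?L \<subseteq> ?A O ?B"
  proof
    fix p assume "p \<in> ?L"
    then obtain g h m where "(g, h) \<in> T" "(h, m) \<in> V"
      "p = (x \<otimes>\<^bsub>G\<^esub> g \<otimes>\<^bsub>G\<^esub> inv\<^bsub>G\<^esub> x, y \<otimes>\<^bsub>M\<^esub> m \<otimes>\<^bsub>M\<^esub> inv\<^bsub>M\<^esub> y)"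
      by (auto simp: conjugate_def inv)
    note ghm = this
    have "(x \<otimes>\<^bsub>G\<^esub> g \<otimes>\<^bsub>G\<^esub> inv\<^bsub>G\<^esub> x, z \<otimes>\<^bsub>H\<^esub> h \<otimes>\<^bsub>H\<^esub> inv\<^bsub>H\<^esub> z) \<in> ?A"
      unfolding conjugate_def inv by (rule image_eqI[OF _ ghm(1)]) simp
    moreover have "(z \<otimes>\<^bsub>H\<^esub> h \<otimes>\<^bsub>H\<^esub> inv\<^bsub>H\<^esub> z, y \<otimes>\<^bsub>M\<^esub> m \<otimes>\<^bsub>M\<^esub> inv\<^bsub>M\<^esub> y) \<in> ?B"
      unfolding conjugate_def inv by (rule image_eqI[OF _ ghm(2)]) simp
    ultimately show "p \<in> ?A O ?B" unfolding ghm(3) by (rule relcompI)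
  qed
  moreover have "?A O ?B \<subseteq> ?L"
  proof
    fix p assume "p \<in> ?A O ?B"
    then obtain g h h' m where p: "(g, h) \<in> T" "(h', m) \<in> V"
      "p = (x \<otimes>\<^bsub>G\<^esub> g \<otimes>\<^bsub>G\<^esub> inv\<^bsub>G\<^esub> x, y \<otimes>\<^bsub>M\<^esub> m \<otimes>\<^bsub>M\<^esub> inv\<^bsub>M\<^esub> y)"
      "z \<otimes>\<^bsub>H\<^esub> h \<otimes>\<^bsub>H\<^esub> inv\<^bsub>H\<^esub> z = z \<otimes>\<^bsub>H\<^esub> h' \<otimes>\<^bsub>H\<^esub> inv\<^bsub>H\<^esub> z"
      by (auto simp: conjugate_def inv)
    have "h = h'" using assms(4,5) p(1,2) by (intro eq[OF _ _ p(4)]) blast+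
    then have "(g, m) \<in> T O V" using p(1,2) by blast
    then show "p \<in> ?L"
      unfolding conjugate_def using p(3) by (intro image_eqI[where x = "(g, m)"]) (auto simp: inv)
  qed
  ultimately show ?thesis by blast
qed

lemma conjugate_section:
  assumes "group G" "group H" "(T, S) \<in> sections (G \<times>\<times> H)" "x \<in> carrier G" "y \<in> carrier H"
  shows "(conjugate (G \<times>\<times> H) (x, y) T, conjugate (G \<times>\<times> H) (x, y) S) \<in> sections (G \<times>\<times> H)"
proof -
  interpret Z: group "G \<times>\<times> H" by (rule DirProd_group) fact+
  have xy: "(x, y) \<in> carrier (G \<times>\<times> H)" using assms by simp
  have inv: "inv\<^bsub>G \<times>\<times> H\<^esub> (x, y) = (inv\<^bsub>G\<^esub> x, inv\<^bsub>H\<^esub> y)"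
    using assms by (simp add: inv_DirProd)
  interpret G: group G by fact
  interpret H: group H by fact
  have sub: "rel_subgroup G H (conjugate (G \<times>\<times> H) (x, y) U)" if U: "rel_subgroup G H U" for U
  proof -
    note U' = rel_subgroupD[OF U]
    have U2: "U \<subseteq> carrier (G \<times>\<times> H)" using U'(1) by simp
    have mem: "(a, b) \<in> conjugate (G \<times>\<times> H) (x, y) U \<longleftrightarrow> a \<in> carrier G \<and> b \<in> carrier H \<and>
       (inv\<^bsub>G\<^esub> x \<otimes>\<^bsub>G\<^esub> a \<otimes>\<^bsub>G\<^esub> x, inv\<^bsub>H\<^esub> y \<otimes>\<^bsub>H\<^esub> b \<otimes>\<^bsub>H\<^esub> y) \<in> U" for a b
      unfolding Z.conjugate_eq_vimage[OF xy U2] inv by simp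
    show ?thesis
      unfolding rel_subgroup_def
    proof (intro conjI allI impI)
      show "conjugate (G \<times>\<times> H) (x, y) U \<subseteq> carrier G \<times> carrier H" using mem by auto
      show "(\<one>\<^bsub>G\<^esub>, \<one>\<^bsub>H\<^esub>) \<in> conjugate (G \<times>\<times> H) (x, y) U" using mem U'(2) assms(4,5) by simp
    next
      fix a b c d
      assume *: "(a, b) \<in> conjugate (G \<times>\<times> H) (x, y) U" "(c, d) \<in> conjugate (G \<times>\<times> H) (x, y) U"
      note m = *[unfolded mem]
      from U'(5)[OF m(1)[THEN conjunct2, THEN conjunct2] m(2)[THEN conjunct2, THEN conjunct2]]
      show "(a \<otimes>\<^bsub>G\<^esub> c, b \<otimes>\<^bsub>H\<^esub> d) \<in> conjugate (G \<times>\<times> H) (x, y) U"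
        using m assms(4,5) by (simp add: mem G.m_assoc H.m_assoc)
    next
      fix a b
      assume *: "(a, b) \<in> conjugate (G \<times>\<times> H) (x, y) U"
      note m = *[unfolded mem]
      from U'(6)[OF m[THEN conjunct2, THEN conjunct2]]
      show "(inv\<^bsub>G\<^esub> a, inv\<^bsub>H\<^esub> b) \<in> conjugate (G \<times>\<times> H) (x, y) U"
        using m assms(4,5) by (simp add: mem G.m_assoc H.m_assoc G.inv_mult_group H.inv_mult_group)
    qed
  qed
  have T: "rel_subgroup G H T" "rel_subgroup G H S" "S \<subseteq> T"
    and n: "\<And>a b c d. (a, b) \<in> T \<Longrightarrow> (c, d) \<in> S \<Longrightarrow>
       (a \<otimes>\<^bsub>G\<^esub> c \<otimes>\<^bsub>G\<^esub> inv\<^bsub>G\<^esub> a, b \<otimes>\<^bsub>H\<^esub> d \<otimes>\<^bsub>H\<^esub> inv\<^bsub>H\<^esub> b) \<in> S"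
    using assms(3) by (auto simp: mem_sections[OF assms(1,2)])
  have T2: "T \<subseteq> carrier (G \<times>\<times> H)" "S \<subseteq> carrier (G \<times>\<times> H)"
    using rel_subgroupD(1)[OF T(1)] rel_subgroupD(1)[OF T(2)] by auto
  show ?thesis
    unfolding mem_sections[OF assms(1,2)]
  proof (intro conjI allI impI sub T)
    show "conjugate (G \<times>\<times> H) (x, y) S \<subseteq> conjugate (G \<times>\<times> H) (x, y) T"
      using T(3) by (auto simp: conjugate_def)
  next
    fix a b c d
    assume *: "(a, b) \<in> conjugate (G \<times>\<times> H) (x, y) T" "(c, d) \<in> conjugate (G \<times>\<times> H) (x, y) S"
    then have "a \<in> carrier G" "b \<in> carrier H" "c \<in> carrier G" "d \<in> carrier H"
        "(inv\<^bsub>G\<^esub> x \<otimes>\<^bsub>G\<^esub> a \<otimes>\<^bsub>G\<^esub> x, inv\<^bsub>H\<^esub> y \<otimes>\<^bsub>H\<^esub> b \<otimes>\<^bsub>H\<^esub> y) \<in> T"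
        "(inv\<^bsub>G\<^esub> x \<otimes>\<^bsub>G\<^esub> c \<otimes>\<^bsub>G\<^esub> x, inv\<^bsub>H\<^esub> y \<otimes>\<^bsub>H\<^esub> d \<otimes>\<^bsub>H\<^esub> y) \<in> S"
      unfolding Z.conjugate_eq_vimage[OF xy T2(1)] Z.conjugate_eq_vimage[OF xy T2(2)] inv by auto
    note abcd = this
    show "(a \<otimes>\<^bsub>G\<^esub> c \<otimes>\<^bsub>G\<^esub> inv\<^bsub>G\<^esub> a, b \<otimes>\<^bsub>H\<^esub> d \<otimes>\<^bsub>H\<^esub> inv\<^bsub>H\<^esub> b) \<in> conjugate (G \<times>\<times> H) (x, y) S"
      unfolding Z.conjugate_eq_vimage[OF xy T2(2)] inv
      using n[OF abcd(5,6)] abcd(1-4) assms(4,5)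
      by (simp add: G.m_assoc H.m_assoc G.inv_mult_group H.inv_mult_group)
  qed
qed

lemma (in group) conjugate_self:
  assumes "(T, S) \<in> sections G" "t \<in> T"
  shows "conjugate G t T = T" "conjugate G t S = S"
proof -
  have T: "subgroup T G" and S: "S \<lhd> G\<lparr>carrier := T\<rparr>" using assms by (auto simp: sections_def)
  interpret T: group "G\<lparr>carrier := T\<rparr>" by (rule subgroup_imp_group[OF T])
  have inv: "inv\<^bsub>G\<lparr>carrier := T\<rparr>\<^esub> x = inv x" if "x \<in> T" for x
    using that T by (simp add: m_inv_consistent)
  note Tc = subgroup.m_closed[OF T] subgroup.m_inv_closed[OF T] subgroup.mem_carrier[OF T]
  have sub: "S \<subseteq> T" using normal_imp_subgroup[OF S] subgroup.subset by fastforce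
  have n: "x \<otimes> s \<otimes> inv x \<in> S" if "x \<in> T" "s \<in> S" for x s
    using normal.inv_op_closed2[OF S, of x s] that by (simp add: inv)
  have tG: "t \<in> carrier G" "T \<subseteq> carrier G" "S \<subseteq> carrier G" using assms(2) sub Tc(3) by auto
  show "conjugate G t T = T"
  proof
    show "conjugate G t T \<subseteq> T" using assms(2) by (auto simp: conjugate_def Tc)
    show "T \<subseteq> conjugate G t T"
      unfolding conjugate_eq_vimage[OF tG(1,2)] using assms(2) by (auto simp: Tc)
  qed
  show "conjugate G t S = S"
  proof
    show "conjugate G t S \<subseteq> S" using assms(2) n by (auto simp: conjugate_def)
    show "S \<subseteq> conjugate G t S"
      unfolding conjugate_eq_vimage[OF tG(1,3)]
      using n[of "inv t"] assms(2) tG sub by (auto simp: Tc)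
  qed
qed

definition double_coset :: "('a, 'm) monoid_scheme \<Rightarrow> 'a set \<Rightarrow> 'a set \<Rightarrow> 'a \<Rightarrow> 'a set" where
  "double_coset H A B t = (A #>\<^bsub>H\<^esub> t) <#>\<^bsub>H\<^esub> B"

lemma mem_double_coset:
  "y \<in> double_coset H A B t \<longleftrightarrow> (\<exists>a\<in>A. \<exists>b\<in>B. y = a \<otimes>\<^bsub>H\<^esub> t \<otimes>\<^bsub>H\<^esub> b)"
  by (auto simp: double_coset_def r_coset_def set_mult_def)

lemma (in group) double_coset_self:
  assumes "subgroup A G" "subgroup B G" "t \<in> carrier G"
  shows "t \<in> double_coset G A B t"
  unfolding mem_double_coset
  by (intro bexI[of _ \<one>]) (use assms in \<open>auto simp: subgroup.one_closed\<close>)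

lemma (in group) double_coset_eq:
  assumes A: "subgroup A G" and B: "subgroup B G" and t: "t \<in> carrier G"
    and s: "s \<in> double_coset G A B t"
  shows "s \<in> carrier G" "double_coset G A B s = double_coset G A B t"
proof -
  have *: "double_coset G A B s \<subseteq> double_coset G A B t"
    if "s \<in> double_coset G A B t" "t \<in> carrier G" for s t
  proof
    from that obtain a b where ab: "a \<in> A" "b \<in> B" "s = a \<otimes> t \<otimes> b" by (auto simp: mem_double_coset)
    fix y assume "y \<in> double_coset G A B s"
    then obtain a' b' where ab': "a' \<in> A" "b' \<in> B" "y = a' \<otimes> s \<otimes> b'" by (auto simp: mem_double_coset)
    have "y = (a' \<otimes> a) \<otimes> t \<otimes> (b \<otimes> b')"
      using ab ab' that(2) subgroup.mem_carrier[OF A] subgroup.mem_carrier[OF B] by (simp add: m_assoc)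
    then show "y \<in> double_coset G A B t"
      using ab ab' subgroup.m_closed[OF A] subgroup.m_closed[OF B] unfolding mem_double_coset by blast
  qed
  from s obtain a b where ab: "a \<in> A" "b \<in> B" "s = a \<otimes> t \<otimes> b" by (auto simp: mem_double_coset)
  have c: "a \<in> carrier G" "b \<in> carrier G"
    using ab subgroup.mem_carrier[OF A] subgroup.mem_carrier[OF B] by auto
  show sG: "s \<in> carrier G" using ab c t by simp
  have "t = inv a \<otimes> s \<otimes> inv b" using ab c t by (simp add: m_assoc)
  then have "t \<in> double_coset G A B s"
    using ab subgroup.m_inv_closed[OF A] subgroup.m_inv_closed[OF B] unfolding mem_double_coset by blast
  then show "double_coset G A B s = double_coset G A B t" using * s sG t by blast
qed

text \<open>
  The conjugate \<open>\<^sup>(\<^sup>t\<^sup>,\<^sup>1\<^sup>)V\<close> of the product formula.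
\<close>

definition twist ::
  "('b, 'n) monoid_scheme \<Rightarrow> ('c, 'p) monoid_scheme \<Rightarrow> 'b \<Rightarrow> ('b \<times> 'c) set \<Rightarrow> ('b \<times> 'c) set" where
  "twist H M t V = conjugate (H \<times>\<times> M) (t, \<one>\<^bsub>M\<^esub>) V"

lemma sections_subset:
  assumes "group G" "group H" "(T, S) \<in> sections (G \<times>\<times> H)"
  shows "T \<subseteq> carrier G \<times> carrier H" "S \<subseteq> carrier G \<times> carrier H"
    "rel_subgroup G H T" "rel_subgroup G H S" "S \<subseteq> T"
  using assms by (auto simp: mem_sections dest: rel_subgroupD(1))

lemma mem_twist:
  assumes "group H" "group M" "t \<in> carrier H" "V \<subseteq> carrier H \<times> carrier M"
  shows "(h, m) \<in> twist H M t V \<longleftrightarrow>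
    h \<in> carrier H \<and> m \<in> carrier M \<and> (inv\<^bsub>H\<^esub> t \<otimes>\<^bsub>H\<^esub> h \<otimes>\<^bsub>H\<^esub> t, m) \<in> V"
proof -
  interpret H: group H by fact
  interpret M: group M by fact
  interpret Z: group "H \<times>\<times> M" by (rule DirProd_group) fact+
  show ?thesis
    unfolding twist_def using assms
    by (subst Z.conjugate_eq_vimage) (auto simp: inv_DirProd)
qed

lemma twist_section:
  assumes "group G" "group H" "(T, S) \<in> sections (G \<times>\<times> H)" "x \<in> carrier G"
  shows "(twist G H x T, twist G H x S) \<in> sections (G \<times>\<times> H)"
  unfolding twist_def using assms by (intro conjugate_section) (auto simp: group.is_monoid)

lemma twist_comp:
  assumes "group H" "group M" "group N" "V \<subseteq> carrier H \<times> carrier M"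
    "W \<subseteq> carrier M \<times> carrier N" "t \<in> carrier H"
  shows "twist H N t (V O W) = twist H M t V O W"
proof -
  interpret M: group M by fact
  interpret N: group N by fact
  interpret Z: group "M \<times>\<times> N" by (rule DirProd_group) fact+
  have "conjugate (M \<times>\<times> N) (\<one>\<^bsub>M\<^esub>, \<one>\<^bsub>N\<^esub>) W = W" using Z.conjugate_one[of W] assms(5) by simp
  then show ?thesis
    unfolding twist_def using conjugate_comp[OF assms(1-5) assms(6), of "\<one>\<^bsub>M\<^esub>" "\<one>\<^bsub>N\<^esub>"] by simp
qed

locale three_groups = G: fin_group G + H: fin_group H + M: fin_group M
  for G :: "('a, 'm) monoid_scheme" and H :: "('b, 'n) monoid_scheme"
    and M :: "('c, 'p) monoid_scheme"
begin

sublocale GH: group "G \<times>\<times> H" by (rule DirProd_group) unfold_locales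
sublocale HM: group "H \<times>\<times> M" by (rule DirProd_group) unfold_locales
sublocale GM: group "G \<times>\<times> M" by (rule DirProd_group) unfold_locales

lemmas groups = G.group_axioms H.group_axioms M.group_axioms

text \<open>
  Conjugating both factors changes the composite by an outer conjugation and a change of the twisting
  element; all invariance properties of the product formula are instances of this.
\<close>

lemma comp_conjugate:
  assumes "T \<subseteq> carrier G \<times> carrier H" "V \<subseteq> carrier H \<times> carrier M"
    and "x \<in> carrier G" "y \<in> carrier H" "z \<in> carrier H" "u \<in> carrier M" "t \<in> carrier H"
  shows "conjugate (G \<times>\<times> H) (x, y) T O twist H M t (conjugate (H \<times>\<times> M) (z, u) V) =
    conjugate (G \<times>\<times> M) (x, u) (T O twist H M (inv\<^bsub>H\<^esub> y \<otimes>\<^bsub>H\<^esub> t \<otimes>\<^bsub>H\<^esub> z) V)"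
proof -
  define s where "s = inv\<^bsub>H\<^esub> y \<otimes>\<^bsub>H\<^esub> t \<otimes>\<^bsub>H\<^esub> z"
  have s: "s \<in> carrier H" "y \<otimes>\<^bsub>H\<^esub> s = t \<otimes>\<^bsub>H\<^esub> z" using assms by (auto simp: s_def H.m_assoc)
  have V: "V \<subseteq> carrier (H \<times>\<times> M)" using assms by simp
  have "conjugate (H \<times>\<times> M) (y, u) (conjugate (H \<times>\<times> M) (s, \<one>\<^bsub>M\<^esub>) V) =
    conjugate (H \<times>\<times> M) (t, \<one>\<^bsub>M\<^esub>) (conjugate (H \<times>\<times> M) (z, u) V)"
    using assms s by (subst (1 2) HM.conjugate_mult[symmetric]) (auto simp: s)
  moreover have "conjugate (H \<times>\<times> M) (s, \<one>\<^bsub>M\<^esub>) V \<subseteq> carrier H \<times> carrier M"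
    using HM.conjugate_closed[OF _ V, of "(s, \<one>\<^bsub>M\<^esub>)"] s by simp
  ultimately show ?thesis
    using conjugate_comp[OF groups assms(1) _ assms(3,4,6)]
    unfolding twist_def s_def[symmetric] by presburger
qed

lemma section_elt_conjugate:
  assumes "x \<in> carrier G" "u \<in> carrier M" "T \<subseteq> carrier G \<times> carrier M" "S \<subseteq> carrier G \<times> carrier M"
  shows "section_elt (G \<times>\<times> M) (conjugate (G \<times>\<times> M) (x, u) T) (conjugate (G \<times>\<times> M) (x, u) S) =
    section_elt (G \<times>\<times> M) T S"
  unfolding section_elt_def using assms by (subst GM.section_class_conjugate) auto

lemma comp_subset:
  assumes "S \<subseteq> carrier G \<times> carrier H" "U \<subseteq> carrier H \<times> carrier M" "t \<in> carrier H"
  shows "S O twist H M t U \<subseteq> carrier G \<times> carrier M"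
  using assms by (auto simp: mem_twist[OF groups(2,3)])

text \<open>
  Twisting by \<open>a t b\<close> with \<open>(c, a) \<in> T\<close> and \<open>(b, d) \<in> V\<close> conjugates the composite by \<open>(c, d\<^sup>-\<^sup>1)\<close>, since
  every section is normalised by its larger group.
\<close>

lemma section_elt_twist_shift:
  assumes TS: "(T, S) \<in> sections (G \<times>\<times> H)" and VU: "(V, U) \<in> sections (H \<times>\<times> M)"
    and "a \<in> Range T" "b \<in> Domain V" "t \<in> carrier H"
  shows "section_elt (G \<times>\<times> M) (T O twist H M (a \<otimes>\<^bsub>H\<^esub> t \<otimes>\<^bsub>H\<^esub> b) V)
      (S O twist H M (a \<otimes>\<^bsub>H\<^esub> t \<otimes>\<^bsub>H\<^esub> b) U) =
    section_elt (G \<times>\<times> M) (T O twist H M t V) (S O twist H M t U)"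
proof -
  from assms obtain c d where cd: "(c, a) \<in> T" "(b, d) \<in> V" by blast
  note T = sections_subset[OF groups(1,2) TS] and V = sections_subset[OF groups(2,3) VU]
  have cG: "c \<in> carrier G" "a \<in> carrier H" "b \<in> carrier H" "d \<in> carrier M" using cd T V by auto
  have Ti: "(inv\<^bsub>G\<^esub> c, inv\<^bsub>H\<^esub> a) \<in> T" by (rule rel_subgroupD(6)[OF T(3) cd(1)])
  note e = GH.conjugate_self[OF TS Ti] HM.conjugate_self[OF VU cd(2)]
  have *: "X1 O twist H M t X2 = conjugate (G \<times>\<times> M) (inv\<^bsub>G\<^esub> c, d) (X1 O twist H M (a \<otimes>\<^bsub>H\<^esub> t \<otimes>\<^bsub>H\<^esub> b) X2)"
    if "conjugate (G \<times>\<times> H) (inv\<^bsub>G\<^esub> c, inv\<^bsub>H\<^esub> a) X1 = X1" "conjugate (H \<times>\<times> M) (b, d) X2 = X2"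
      "X1 \<subseteq> carrier G \<times> carrier H" "X2 \<subseteq> carrier H \<times> carrier M" for X1 X2
    using comp_conjugate[OF that(3,4), of "inv\<^bsub>G\<^esub> c" "inv\<^bsub>H\<^esub> a" b d t] cG assms(5) that(1,2) by simp
  show ?thesis
    unfolding *[OF e(1,3) T(1) V(1)] *[OF e(2,4) T(2) V(2)]
    using cG assms(5)
    by (intro section_elt_conjugate[symmetric] comp_subset T(1,2) V(1,2) G.inv_closed H.m_closed)
qed

lemma twist_rel_subgroup:
  assumes U: "rel_subgroup H M U" and t: "t \<in> carrier H"
  shows "rel_subgroup H M (twist H M t U)"
proof -
  have "(U, U) \<in> sections (H \<times>\<times> M)"
    unfolding mem_sections[OF groups(2,3)]
    by (intro conjI U subset_refl allI impI rel_subgroupD(5)[OF U] rel_subgroupD(6)[OF U])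
  from twist_section[OF groups(2,3) this t] show ?thesis
    by (rule sections_subset(3)[OF groups(2,3)])
qed

text \<open>
  For \<open>y = a\<^sub>0 t b\<^sub>0\<close>, the solutions of \<open>a t b = y\<close> correspond to the triples counted by
  the fibre product.
\<close>

lemma card_double_coset:
  assumes S: "rel_subgroup G H S" and U: "rel_subgroup H M U" and t: "t \<in> carrier H"
  shows "card (double_coset H (Range S) (Domain U) t) *
      (card (S O twist H M t U) * card (k2 G S \<inter> k1 M (twist H M t U))) = card S * card U"
proof -
  note S' = rel_subgroupD[OF S] and U' = rel_subgroupD[OF U]
  let ?f = "\<lambda>((g, a), (b, m)). a \<otimes>\<^bsub>H\<^esub> t \<otimes>\<^bsub>H\<^esub> b"
  let ?F = "{(h, g, m). (g, h) \<in> S \<and> (h, m) \<in> twist H M t U}"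
  have fin: "finite S" "finite U"
    using finite_rel_subgroup[OF S] finite_rel_subgroup[OF U] by auto
  note U2 = twist_rel_subgroup[OF U t]
  have mem: "(h, m) \<in> twist H M t U \<longleftrightarrow> h \<in> carrier H \<and> (inv\<^bsub>H\<^esub> t \<otimes>\<^bsub>H\<^esub> h \<otimes>\<^bsub>H\<^esub> t, m) \<in> U" for h m
    using U'(1) by (auto simp: mem_twist[OF groups(2,3) t U'(1)])
  have "card {x \<in> S \<times> U. ?f x = y} = card ?F" if y: "y \<in> ?f ` (S \<times> U)" for y
  proof -
    from y obtain g0 a0 b0 m0 where 0: "(g0, a0) \<in> S" "(b0, m0) \<in> U"
      "y = a0 \<otimes>\<^bsub>H\<^esub> t \<otimes>\<^bsub>H\<^esub> b0" by auto
    have c: "g0 \<in> carrier G" "a0 \<in> carrier H" "b0 \<in> carrier H" "m0 \<in> carrier M"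
      using 0 S' U' by auto
    have "bij_betw (\<lambda>((g, a), (b, m)). (inv\<^bsub>H\<^esub> a0 \<otimes>\<^bsub>H\<^esub> a, inv\<^bsub>G\<^esub> g0 \<otimes>\<^bsub>G\<^esub> g, m0 \<otimes>\<^bsub>M\<^esub> inv\<^bsub>M\<^esub> m))
       {x \<in> S \<times> U. ?f x = y} ?F"
    proof (rule bij_betw_byWitness[where f' = "\<lambda>(h, g, m).
        ((g0 \<otimes>\<^bsub>G\<^esub> g, a0 \<otimes>\<^bsub>H\<^esub> h), (inv\<^bsub>H\<^esub> (inv\<^bsub>H\<^esub> t \<otimes>\<^bsub>H\<^esub> h \<otimes>\<^bsub>H\<^esub> t) \<otimes>\<^bsub>H\<^esub> b0, inv\<^bsub>M\<^esub> m \<otimes>\<^bsub>M\<^esub> m0))"],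
        goal_cases)
      case 1
      show ?case
      proof (intro ballI, goal_cases)
        case (1 x)
        then obtain g a b m where x: "x = ((g, a), (b, m))"
          and *: "(g, a) \<in> S" "(b, m) \<in> U" "a \<otimes>\<^bsub>H\<^esub> t \<otimes>\<^bsub>H\<^esub> b = y" by auto
        have c': "g \<in> carrier G" "a \<in> carrier H" "b \<in> carrier H" "m \<in> carrier M"
          using * S' U' by auto
        have 1: "g0 \<otimes>\<^bsub>G\<^esub> (inv\<^bsub>G\<^esub> g0 \<otimes>\<^bsub>G\<^esub> g) = g" "a0 \<otimes>\<^bsub>H\<^esub> (inv\<^bsub>H\<^esub> a0 \<otimes>\<^bsub>H\<^esub> a) = a"
          "inv\<^bsub>M\<^esub> (m0 \<otimes>\<^bsub>M\<^esub> inv\<^bsub>M\<^esub> m) \<otimes>\<^bsub>M\<^esub> m0 = m"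
          using c c' by (simp_all add: M.inv_mult_group M.m_assoc)
        have "inv\<^bsub>H\<^esub> (inv\<^bsub>H\<^esub> t \<otimes>\<^bsub>H\<^esub> (inv\<^bsub>H\<^esub> a0 \<otimes>\<^bsub>H\<^esub> a) \<otimes>\<^bsub>H\<^esub> t) \<otimes>\<^bsub>H\<^esub> b0 =
           inv\<^bsub>H\<^esub> t \<otimes>\<^bsub>H\<^esub> (inv\<^bsub>H\<^esub> a \<otimes>\<^bsub>H\<^esub> (a0 \<otimes>\<^bsub>H\<^esub> t \<otimes>\<^bsub>H\<^esub> b0))"
          using c c' t by (simp add: H.inv_mult_group H.m_assoc)
        also have "\<dots> = b"
          unfolding 0(3)[symmetric] *(3)[symmetric] using c c' t by (simp add: H.m_assoc)
        finally show ?case using 1 by (simp add: x)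
      qed
    next
      case 2
      show ?case
      proof (intro ballI, goal_cases)
        case (1 x)
        then obtain h g m where x: "x = (h, g, m)"
          and *: "(g, h) \<in> S" "(h, m) \<in> twist H M t U" by auto
        have c': "g \<in> carrier G" "h \<in> carrier H" "m \<in> carrier M"
          using * S' rel_subgroupD[OF U2] by auto
        have "inv\<^bsub>H\<^esub> a0 \<otimes>\<^bsub>H\<^esub> (a0 \<otimes>\<^bsub>H\<^esub> h) = h" "inv\<^bsub>G\<^esub> g0 \<otimes>\<^bsub>G\<^esub> (g0 \<otimes>\<^bsub>G\<^esub> g) = g"
          "m0 \<otimes>\<^bsub>M\<^esub> inv\<^bsub>M\<^esub> (inv\<^bsub>M\<^esub> m \<otimes>\<^bsub>M\<^esub> m0) = m"
          using c c' by (simp_all add: M.inv_mult_group M.m_assoc)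
        then show ?case by (simp add: x)
      qed
    next
      case 3
      show ?case
      proof (rule image_subsetI, goal_cases)
        case (1 x)
        then obtain g a b m where x: "x = ((g, a), (b, m))"
          and *: "(g, a) \<in> S" "(b, m) \<in> U" "a \<otimes>\<^bsub>H\<^esub> t \<otimes>\<^bsub>H\<^esub> b = y" by auto
        have c': "g \<in> carrier G" "a \<in> carrier H" "b \<in> carrier H" "m \<in> carrier M"
          using * S' U' by auto
        have 1: "(inv\<^bsub>G\<^esub> g0 \<otimes>\<^bsub>G\<^esub> g, inv\<^bsub>H\<^esub> a0 \<otimes>\<^bsub>H\<^esub> a) \<in> S" by (rule S'(5)[OF S'(6)[OF 0(1)] *(1)])
        have "b0 = inv\<^bsub>H\<^esub> t \<otimes>\<^bsub>H\<^esub> (inv\<^bsub>H\<^esub> a0 \<otimes>\<^bsub>H\<^esub> (a0 \<otimes>\<^bsub>H\<^esub> t \<otimes>\<^bsub>H\<^esub> b0))"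
          using c t by (simp add: H.m_assoc)
        also have "\<dots> = inv\<^bsub>H\<^esub> t \<otimes>\<^bsub>H\<^esub> (inv\<^bsub>H\<^esub> a0 \<otimes>\<^bsub>H\<^esub> (a \<otimes>\<^bsub>H\<^esub> t \<otimes>\<^bsub>H\<^esub> b))"
          unfolding 0(3)[symmetric] *(3)[symmetric] ..
        finally have "b0 \<otimes>\<^bsub>H\<^esub> inv\<^bsub>H\<^esub> b = inv\<^bsub>H\<^esub> t \<otimes>\<^bsub>H\<^esub> (inv\<^bsub>H\<^esub> a0 \<otimes>\<^bsub>H\<^esub> a) \<otimes>\<^bsub>H\<^esub> t"
          using c c' t by (simp add: H.m_assoc)
        then have "(inv\<^bsub>H\<^esub> a0 \<otimes>\<^bsub>H\<^esub> a, m0 \<otimes>\<^bsub>M\<^esub> inv\<^bsub>M\<^esub> m) \<in> twist H M t U"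
          using U'(5)[OF 0(2) U'(6)[OF *(2)]] c c' by (simp add: mem)
        with 1 show ?case by (simp add: x)
      qed
    next
      case 4
      show ?case
      proof (rule image_subsetI, goal_cases)
        case (1 x)
        then obtain h g m where x: "x = (h, g, m)"
          and *: "(g, h) \<in> S" "(h, m) \<in> twist H M t U" by auto
        have c': "g \<in> carrier G" "h \<in> carrier H" "m \<in> carrier M"
          using * S' rel_subgroupD[OF U2] by auto
        have 1: "(g0 \<otimes>\<^bsub>G\<^esub> g, a0 \<otimes>\<^bsub>H\<^esub> h) \<in> S" by (rule S'(5)[OF 0(1) *(1)])
        have "(inv\<^bsub>H\<^esub> t \<otimes>\<^bsub>H\<^esub> h \<otimes>\<^bsub>H\<^esub> t, m) \<in> U" using * by (simp add: mem)
        then have 2: "(inv\<^bsub>H\<^esub> (inv\<^bsub>H\<^esub> t \<otimes>\<^bsub>H\<^esub> h \<otimes>\<^bsub>H\<^esub> t) \<otimes>\<^bsub>H\<^esub> b0, inv\<^bsub>M\<^esub> m \<otimes>\<^bsub>M\<^esub> m0) \<in> U"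
          by (intro U'(5)[OF U'(6) 0(2)])
        have "a0 \<otimes>\<^bsub>H\<^esub> h \<otimes>\<^bsub>H\<^esub> t \<otimes>\<^bsub>H\<^esub> (inv\<^bsub>H\<^esub> (inv\<^bsub>H\<^esub> t \<otimes>\<^bsub>H\<^esub> h \<otimes>\<^bsub>H\<^esub> t) \<otimes>\<^bsub>H\<^esub> b0) = y"
          unfolding 0(3) using c c' t by (simp add: H.m_assoc H.inv_mult_group)
        with 1 2 show ?case by (simp add: x)
      qed
    qed
    then show ?thesis by (rule bij_betw_same_card)
  qed
  from card_eq_fibre_times_image[of "S \<times> U" ?f, OF _ this]
  have "card (S \<times> U) = card (?f ` (S \<times> U)) * card ?F" using fin by blast
  moreover have "?f ` (S \<times> U) = double_coset H (Range S) (Domain U) t"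
    by (force simp: mem_double_coset)
  moreover have "card ?F = card (S O twist H M t U) * card (k2 G S \<inter> k1 M (twist H M t U))"
    by (rule card_fibre_product[OF G.fin_group_axioms H.fin_group_axioms M.fin_group_axioms S U2])
  ultimately show ?thesis by (simp add: card_cartesian_product)
qed

text \<open>
  A sum over double cosets becomes a sum over \<open>H\<close> in which every \<open>t\<close> is
  weighted by the inverse size of its double coset, computed by \<open>card_double_coset\<close>. This
  form involves no choice of representatives.
\<close>

lemma sum_double_cosets:
  assumes TS: "(T, S) \<in> sections (G \<times>\<times> H)" and VU: "(V, U) \<in> sections (H \<times>\<times> M)"
  shows "(\<Sum>d\<in>double_cosets H (Range S) (Domain U).
           let t = (SOME t. t \<in> d)
           in section_elt (G \<times>\<times> M) (T O conjugate (H \<times>\<times> M) (t, \<one>\<^bsub>M\<^esub>) V)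
                (S O conjugate (H \<times>\<times> M) (t, \<one>\<^bsub>M\<^esub>) U)) =
    (\<Sum>t\<in>carrier H. scale
       (of_nat (card (S O twist H M t U) * card (k2 G S \<inter> k1 M (twist H M t U))) /
          of_nat (card S * card U))
       (section_elt (G \<times>\<times> M) (T O twist H M t V) (S O twist H M t U)
          :: ('a, 'c, 'k::field_char_0) section_elts))"
    (is "?L = (\<Sum>t\<in>_. scale (?w t) (?\<Phi> t))")
proof -
  note T = sections_subset[OF groups(1,2) TS] and V = sections_subset[OF groups(2,3) VU]
  let ?dc = "double_coset H (Range S) (Domain U)"
  have sub: "subgroup (Range S) H" "subgroup (Domain U) H"
    using subgroup_Range[OF groups(1,2) T(4)] subgroup_Domain[OF groups(2,3) V(4)] .
  note dc = H.double_coset_self[OF sub] H.double_coset_eq[OF sub]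
  have cards: "card S > 0" "card U > 0"
    using finite_rel_subgroup[OF T(4)] finite_rel_subgroup[OF V(4)] rel_subgroupD(2)[OF T(4)]
      rel_subgroupD(2)[OF V(4)] by (auto simp: card_gt_0_iff)
  have w: "?w t = (1 / of_nat (card (?dc t)) :: 'k)" if t: "t \<in> carrier H" for t
  proof -
    have "of_nat (card (?dc t)) * of_nat (card (S O twist H M t U) * card (k2 G S \<inter> k1 M (twist H M t U)))
       = (of_nat (card S * card U) :: 'k)"
      unfolding of_nat_mult[symmetric] using card_double_coset[OF T(4) V(4) t] by simp
    moreover from this have "of_nat (card (?dc t)) \<noteq> (0 :: 'k)" using cards by fastforce
    ultimately show ?thesis using cards by (simp add: field_simps)
  qed
  have \<Phi>: "?\<Phi> s = ?\<Phi> t" if t: "t \<in> carrier H" and s: "s \<in> ?dc t" for s t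
  proof -
    from s obtain a b where "a \<in> Range S" "b \<in> Domain U" "s = a \<otimes>\<^bsub>H\<^esub> t \<otimes>\<^bsub>H\<^esub> b"
      unfolding mem_double_coset by blast
    then show ?thesis
      using section_elt_twist_shift[OF TS VU, of a b t] T(5) V(5) t by auto
  qed
  have "?L = (\<Sum>d\<in>?dc ` carrier H. ?\<Phi> (SOME t. t \<in> d))"
    by (rule sum.cong) (auto simp: double_cosets_def double_coset_def Let_def twist_def)
  also have "\<dots> = (\<Sum>d\<in>?dc ` carrier H. \<Sum>t\<in>{t \<in> carrier H. ?dc t = d}. scale (?w t) (?\<Phi> t))"
  proof (rule sum.cong[OF refl])
    fix d assume "d \<in> ?dc ` carrier H"
    then obtain t where t: "t \<in> carrier H" "d = ?dc t" by blast
    have d: "{s \<in> carrier H. ?dc s = d} = d"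
      unfolding t(2) using dc(1) dc(2,3)[OF t(1)] by blast
    have "finite d" "d \<noteq> {}" using d dc(1)[OF t(1)] t finite_subset[of d "carrier H"] by auto
    then have card: "of_nat (card d) \<noteq> (0::'k)" by simp
    have "(SOME t. t \<in> d) \<in> d" using dc(1)[OF t(1)] t(2) by (auto intro: someI)
    then have "?\<Phi> (SOME t. t \<in> d) = ?\<Phi> t" using \<Phi>[OF t(1)] t(2) by blast
    moreover have "(\<Sum>s\<in>{s \<in> carrier H. ?dc s = d}. scale (?w s) (?\<Phi> s)) =
      (\<Sum>s\<in>d. scale (1 / of_nat (card d)) (?\<Phi> t))"
    proof (rule sum.cong[OF d])
      fix s assume "s \<in> d"
      then have "s \<in> carrier H" "?dc s = d" using d by blast+
      moreover have "?\<Phi> s = ?\<Phi> t" using \<Phi>[OF t(1)] t(2) \<open>s \<in> d\<close> by blast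
      ultimately show "scale (?w s) (?\<Phi> s) = scale (1 / of_nat (card d)) (?\<Phi> t)"
        by (simp only: w)
    qed
    moreover have "(\<Sum>s\<in>d. scale (1 / of_nat (card d)) (?\<Phi> t)) = ?\<Phi> t"
      unfolding scale.scale_sum_left[symmetric] using card by simp
    ultimately show "?\<Phi> (SOME t. t \<in> d) =
      (\<Sum>s\<in>{s \<in> carrier H. ?dc s = d}. scale (?w s) (?\<Phi> s))" by simp
  qed
  also have "\<dots> = (\<Sum>t\<in>carrier H. scale (?w t) (?\<Phi> t))"
    by (rule sum.image_gen[symmetric]) simp
  finally show ?thesis .
qed

text \<open>
  The right-hand side of the product formula is unchanged when both sections are replaced by
  conjugates: substitute \<open>y\<^sup>-\<^sup>1 t z\<close> for \<open>t\<close>.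
\<close>

lemma twisted_sum_conjugate:
  assumes TS: "(T, S) \<in> sections (G \<times>\<times> H)" and VU: "(V, U) \<in> sections (H \<times>\<times> M)"
    and x: "x \<in> carrier G" "y \<in> carrier H" "z \<in> carrier H" "u \<in> carrier M"
    and T': "T' = conjugate (G \<times>\<times> H) (x, y) T" "S' = conjugate (G \<times>\<times> H) (x, y) S"
    and V': "V' = conjugate (H \<times>\<times> M) (z, u) V" "U' = conjugate (H \<times>\<times> M) (z, u) U"
  shows "(\<Sum>t\<in>carrier H. scale
       (of_nat (card (S' O twist H M t U') * card (k2 G S' \<inter> k1 M (twist H M t U'))) /
          of_nat (card S' * card U'))
       (section_elt (G \<times>\<times> M) (T' O twist H M t V') (S' O twist H M t U')
          :: ('a, 'c, 'k::field_char_0) section_elts)) =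
    (\<Sum>t\<in>carrier H. scale
       (of_nat (card (S O twist H M t U) * card (k2 G S \<inter> k1 M (twist H M t U))) /
          of_nat (card S * card U))
       (section_elt (G \<times>\<times> M) (T O twist H M t V) (S O twist H M t U)))"
    (is "(\<Sum>t\<in>_. ?f' t) = (\<Sum>t\<in>_. ?f t)")
proof (rule sum.reindex_bij_witness[where j = "\<lambda>t. inv\<^bsub>H\<^esub> y \<otimes>\<^bsub>H\<^esub> t \<otimes>\<^bsub>H\<^esub> z"
      and i = "\<lambda>t. y \<otimes>\<^bsub>H\<^esub> t \<otimes>\<^bsub>H\<^esub> inv\<^bsub>H\<^esub> z"])
  note T = sections_subset[OF groups(1,2) TS] and V = sections_subset[OF groups(2,3) VU]
  fix t assume t: "t \<in> carrier H"
  let ?s = "inv\<^bsub>H\<^esub> y \<otimes>\<^bsub>H\<^esub> t \<otimes>\<^bsub>H\<^esub> z"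
  have s: "?s \<in> carrier H" using t x by simp
  note e = comp_conjugate[OF _ _ x t]
  have c: "card S' = card S" "card U' = card U"
    unfolding T' V' using GH.card_conjugate[of "(x, y)" S] HM.card_conjugate[of "(z, u)" U] x T(2) V(2)
    by simp_all
  have cc: "card (S' O twist H M t U') = card (S O twist H M ?s U)"
    unfolding T' V' e[OF T(2) V(2)]
    using GM.card_conjugate[of "(x, u)" "S O twist H M ?s U"] x comp_subset[OF T(2) V(2) s] by simp
  have "k2 G S' \<inter> k1 M (twist H M t U') =
    conjugate H y (k2 G S \<inter> k1 M (twist H M ?s U))"
  proof -
    have memS: "(\<one>\<^bsub>G\<^esub>, h) \<in> S' \<longleftrightarrow> (\<one>\<^bsub>G\<^esub>, inv\<^bsub>H\<^esub> y \<otimes>\<^bsub>H\<^esub> h \<otimes>\<^bsub>H\<^esub> y) \<in> S"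
      if "h \<in> carrier H" for h
      unfolding T' using GH.conjugate_eq_vimage[of "(x, y)" S] T(2) x that
      by (auto simp: inv_DirProd[OF groups(1,2)])
    have memU: "(h, \<one>\<^bsub>M\<^esub>) \<in> twist H M t U' \<longleftrightarrow>
       (inv\<^bsub>H\<^esub> y \<otimes>\<^bsub>H\<^esub> h \<otimes>\<^bsub>H\<^esub> y, \<one>\<^bsub>M\<^esub>) \<in> twist H M ?s U" if "h \<in> carrier H" for h
    proof -
      have U': "U' \<subseteq> carrier H \<times> carrier M"
        unfolding V' using HM.conjugate_closed[of "(z, u)" U] V(2) x by simp
      show ?thesis
        unfolding mem_twist[OF groups(2,3) t U'] mem_twist[OF groups(2,3) s V(2)]
        unfolding V' using HM.conjugate_eq_vimage[of "(z, u)" U] V(2) x that t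
        by (simp add: inv_DirProd[OF groups(2,3)] H.m_assoc H.inv_mult_group)
    qed
    have sub: "k2 G S' \<subseteq> carrier H"
      unfolding T' using GH.conjugate_closed[of "(x, y)" S] T(2) x by (auto simp: k2_def)
    have "k2 G S \<inter> k1 M (twist H M ?s U) \<subseteq> carrier H" using T(2) by (auto simp: k2_def)
    from H.conjugate_eq_vimage[OF x(2) this] show ?thesis
      using sub memS memU by (auto simp: k1_def k2_def)
  qed
  moreover have "k2 G S \<inter> k1 M (twist H M ?s U) \<subseteq> carrier H" using T(2) by (auto simp: k2_def)
  ultimately have k: "card (k2 G S' \<inter> k1 M (twist H M t U')) =
    card (k2 G S \<inter> k1 M (twist H M ?s U))"
    using H.card_conjugate[OF x(2)] by simp
  have "(section_elt (G \<times>\<times> M) (T' O twist H M t V') (S' O twist H M t U') :: ('a, 'c, 'k) section_elts)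
    = section_elt (G \<times>\<times> M) (T O twist H M ?s V) (S O twist H M ?s U)"
    unfolding T' V' e[OF T(2) V(2)] e[OF T(1) V(1)]
    by (rule section_elt_conjugate[OF x(1,4) comp_subset[OF T(1) V(1) s] comp_subset[OF T(2) V(2) s]])
  then show "?f ?s = ?f' t" by (simp only: c cc k)
qed (use x in \<open>auto simp: H.m_assoc\<close>)

text \<open>
  The product is defined through chosen representatives of the two conjugacy classes; by
  \<open>twisted_sum_conjugate\<close> the choice does not affect the sum over \<open>H\<close>.
\<close>

lemma section_comp_section_elt:
  assumes TS: "(T, S) \<in> sections (G \<times>\<times> H)" and VU: "(V, U) \<in> sections (H \<times>\<times> M)"
  shows "section_comp G H M (section_elt (G \<times>\<times> H) T S) (section_elt (H \<times>\<times> M) V U) =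
    (\<Sum>t\<in>carrier H. scale
       (of_nat (card (S O twist H M t U) * card (k2 G S \<inter> k1 M (twist H M t U))) /
          of_nat (card S * card U))
       (section_elt (G \<times>\<times> M) (T O twist H M t V) (S O twist H M t U)
          :: ('a, 'c, 'k::field_char_0) section_elts))"
proof -
  let ?C = "section_class (G \<times>\<times> H) (T, S)" and ?D = "section_class (H \<times>\<times> M) (V, U)"
  obtain T' S' where C: "(SOME s. s \<in> ?C) = (T', S')" by fastforce
  obtain V' U' where D: "(SOME s. s \<in> ?D) = (V', U')" by fastforce
  have "(conjugate (G \<times>\<times> H) \<one>\<^bsub>G \<times>\<times> H\<^esub> T, conjugate (G \<times>\<times> H) \<one>\<^bsub>G \<times>\<times> H\<^esub> S) \<in> ?C"
    unfolding section_class_def by blast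
  then have "(T', S') \<in> ?C" using someI[of "\<lambda>s. s \<in> ?C"] C by metis
  then obtain x y where x: "x \<in> carrier G" "y \<in> carrier H"
    and T': "T' = conjugate (G \<times>\<times> H) (x, y) T" "S' = conjugate (G \<times>\<times> H) (x, y) S"
    by (auto simp: section_class_def)
  have "(conjugate (H \<times>\<times> M) \<one>\<^bsub>H \<times>\<times> M\<^esub> V, conjugate (H \<times>\<times> M) \<one>\<^bsub>H \<times>\<times> M\<^esub> U) \<in> ?D"
    unfolding section_class_def by blast
  then have "(V', U') \<in> ?D" using someI[of "\<lambda>s. s \<in> ?D"] D by metis
  then obtain z u where z: "z \<in> carrier H" "u \<in> carrier M"
    and V': "V' = conjugate (H \<times>\<times> M) (z, u) V" "U' = conjugate (H \<times>\<times> M) (z, u) U"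
    by (auto simp: section_class_def)
  have TS': "(T', S') \<in> sections (G \<times>\<times> H)" "(V', U') \<in> sections (H \<times>\<times> M)"
    unfolding T' V'
    by (rule conjugate_section[OF groups(1,2) TS x] conjugate_section[OF groups(2,3) VU z])+
  have "section_comp G H M (section_elt (G \<times>\<times> H) T S) (section_elt (H \<times>\<times> M) V U) =
    (section_comp_basis G H M ?C ?D :: ('a, 'c, 'k) section_elts)"
    unfolding section_comp_def section_elt_def by (rule bilinear_extension_single)
  also have "\<dots> = (\<Sum>d\<in>double_cosets H (Range S') (Domain U').
           let t = (SOME t. t \<in> d)
           in section_elt (G \<times>\<times> M) (T' O conjugate (H \<times>\<times> M) (t, \<one>\<^bsub>M\<^esub>) V')
                (S' O conjugate (H \<times>\<times> M) (t, \<one>\<^bsub>M\<^esub>) U'))"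
    unfolding section_comp_basis_def C D by simp
  finally show ?thesis
    unfolding sum_double_cosets[OF TS'] twisted_sum_conjugate[OF TS VU x z T' V'] .
qed

end

text \<open>
  With each basis element scaled by \<open>|S| / |G|\<close>, the structure constants of the composition become
  orders of intersections of kernels, up to averaging over \<open>H\<close>.
\<close>

definition normalized_elt ::
  "('a, 'm) monoid_scheme \<Rightarrow> ('b, 'n) monoid_scheme \<Rightarrow> ('a \<times> 'b) set \<times> ('a \<times> 'b) set
    \<Rightarrow> ('a, 'b, 'k::field_char_0) section_elts" where
  "normalized_elt G H = (\<lambda>(T, S).
     scale (of_nat (card S) / of_nat (card (carrier G))) (section_elt (G \<times>\<times> H) T S))"

abbreviation section_compose ::
  "('a \<times> 'b) set \<times> ('a \<times> 'b) set \<Rightarrow> ('b \<times> 'c) set \<times> ('b \<times> 'c) set \<Rightarrow>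
     ('a \<times> 'c) set \<times> ('a \<times> 'c) set" where
  "section_compose s v \<equiv> (fst s O fst v, snd s O snd v)"

lemma section_comp_normalized_elt:
  assumes "fin_group G" "fin_group H" "fin_group M"
    and TS: "(T, S) \<in> sections (G \<times>\<times> H)" and VU: "(V, U) \<in> sections (H \<times>\<times> M)"
  shows "section_comp G H M (normalized_elt G H (T, S)) (normalized_elt H M (V, U)) =
    (\<Sum>t\<in>carrier H. scale
       (of_nat (card (k2 G S \<inter> k1 M (twist H M t U))) / of_nat (card (carrier H)))
       (normalized_elt G M (T O twist H M t V, S O twist H M t U)
          :: ('a, 'c, 'k::field_char_0) section_elts))"
proof -
  interpret three_groups G H M using assms(1-3) by (simp add: three_groups_def)
  note T = sections_subset[OF groups(1,2) TS] and V = sections_subset[OF groups(2,3) VU]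
  have cards: "card S > 0" "card U > 0"
    using finite_rel_subgroup[OF T(4)] finite_rel_subgroup[OF V(4)] rel_subgroupD(2)[OF T(4)]
      rel_subgroupD(2)[OF V(4)] by (auto simp: card_gt_0_iff)
  show ?thesis
    unfolding normalized_elt_def prod.case section_comp_def
      bilinear_extension_scale_left bilinear_extension_scale_right
    unfolding section_comp_def[symmetric] section_comp_section_elt[OF TS VU] scale.scale_sum_right
    by (rule sum.cong) (use cards in simp_all)
qed

lemma normalized_elt_in_section_burnside:
  "s \<in> sections (G \<times>\<times> H) \<Longrightarrow> normalized_elt G H s \<in> section_burnside G H"
  by (cases s) (auto simp: normalized_elt_def section_burnside_def section_elt_def split: if_splits)

lemma section_elt_normalized:
  assumes "fin_group G" "fin_group H" "(T, S) \<in> sections (G \<times>\<times> H)"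
  shows "section_elt (G \<times>\<times> H) T S =
    scale (of_nat (card (carrier G)) / of_nat (card S)) (normalized_elt G H (T, S))"
proof -
  interpret G: fin_group G by fact
  interpret H: fin_group H by fact
  have S: "rel_subgroup G H S"
    using assms(3) by (simp add: mem_sections[OF G.group_axioms H.group_axioms])
  then have "card S > 0" using finite_rel_subgroup[OF S] rel_subgroupD(2)[OF S]
    by (auto simp: card_gt_0_iff)
  moreover have "card (carrier G) > 0" using G.one_closed by (auto simp: card_gt_0_iff)
  ultimately show ?thesis using G.one_closed by (auto simp: normalized_elt_def)
qed

text \<open>
  The normalised elements are nonzero multiples of the basis elements.
\<close>

lemma span_normalized_elt:
  assumes "fin_group G" "fin_group H" "Y \<subseteq> sections (G \<times>\<times> H)"
  shows "scale.span (normalized_elt G H ` Y) =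
    {x :: ('a, 'b, 'k::field_char_0) section_elts. Poly_Mapping.keys x \<subseteq> section_class (G \<times>\<times> H) ` Y}"
proof -
  have "{x :: ('a, 'b, 'k) section_elts. Poly_Mapping.keys x \<subseteq> section_class (G \<times>\<times> H) ` Y} =
    scale.span ((\<lambda>(T, S). section_elt (G \<times>\<times> H) T S) ` Y)"
    by (simp add: span_singles[symmetric] image_image section_elt_def case_prod_beta)
  also have "\<dots> = scale.span (normalized_elt G H ` Y)"
  proof (rule scale.span_eq[THEN iffD2], intro conjI image_subsetI; clarify)
    fix T S assume TS: "(T, S) \<in> Y"
    then have "normalized_elt G H (T, S) \<in> normalized_elt G H ` Y" by blast
    then show "section_elt (G \<times>\<times> H) T S \<in> scale.span (normalized_elt G H ` Y)"
      using TS assms(3)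
      by (subst section_elt_normalized[OF assms(1,2)]) (auto intro: scale.span_scale scale.span_base)
    have "section_elt (G \<times>\<times> H) T S \<in> (\<lambda>(T, S). section_elt (G \<times>\<times> H) T S) ` Y"
      using TS by force
    then show "normalized_elt G H (T, S) \<in>
       scale.span ((\<lambda>(T, S). section_elt (G \<times>\<times> H) T S) ` Y :: ('a, 'b, 'k) section_elts set)"
      unfolding normalized_elt_def prod.case by (intro scale.span_scale scale.span_base)
  qed
  finally show ?thesis ..
qed

lemmas section_burnside_span =
  span_normalized_elt[OF _ _ subset_refl, folded section_burnside_def, symmetric]

text \<open>
  Both bracketings are double sums over twists of the two inner groups, with the same composite section
  at each pair of twists; the coefficients agree by \<open>card_kernels_cocycle\<close>.
\<close>

lemma section_comp_assoc_normalized: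
  assumes "fin_group G" "fin_group H" "fin_group M" "fin_group N"
    and TS: "(T, S) \<in> sections (G \<times>\<times> H)" and VU: "(V, U) \<in> sections (H \<times>\<times> M)"
    and ZW: "(Z, W) \<in> sections (M \<times>\<times> N)"
  shows "section_comp G M N
      (section_comp G H M (normalized_elt G H (T, S)) (normalized_elt H M (V, U)))
      (normalized_elt M N (Z, W)) =
    (section_comp G H N (normalized_elt G H (T, S))
      (section_comp H M N (normalized_elt H M (V, U)) (normalized_elt M N (Z, W)))
      :: ('a, 'd, 'k::field_char_0) section_elts)"
proof -
  interpret G: fin_group G by fact
  interpret H: fin_group H by fact
  interpret M: fin_group M by fact
  interpret N: fin_group N by fact
  note gr = G.group_axioms H.group_axioms M.group_axioms N.group_axioms
  note T = sections_subset[OF gr(1,2) TS] and V = sections_subset[OF gr(2,3) VU]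
    and Z = sections_subset[OF gr(3,4) ZW]
  have tV: "(twist H M t V, twist H M t U) \<in> sections (H \<times>\<times> M)" if "t \<in> carrier H" for t
    by (rule twist_section[OF gr(2,3) VU that])
  have rZ: "(twist M N r Z, twist M N r W) \<in> sections (M \<times>\<times> N)" if "r \<in> carrier M" for r
    by (rule twist_section[OF gr(3,4) ZW that])
  let ?a = "\<lambda>t. of_nat (card (k2 G S \<inter> k1 M (twist H M t U))) / of_nat (card (carrier H)) :: 'k"
  let ?b = "\<lambda>t r. of_nat (card (k2 G (S O twist H M t U) \<inter> k1 N (twist M N r W))) /
      of_nat (card (carrier M)) :: 'k"
  let ?c = "\<lambda>r. of_nat (card (k2 H U \<inter> k1 N (twist M N r W))) / of_nat (card (carrier M)) :: 'k"
  let ?d = "\<lambda>t r. of_nat (card (k2 G S \<inter> k1 N (twist H N t (U O twist M N r W)))) /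
      of_nat (card (carrier H)) :: 'k"
  have "section_comp G M N
      (section_comp G H M (normalized_elt G H (T, S)) (normalized_elt H M (V, U)))
      (normalized_elt M N (Z, W)) =
    (\<Sum>t\<in>carrier H. scale (?a t) (\<Sum>r\<in>carrier M. scale (?b t r)
       (normalized_elt G N ((T O twist H M t V) O twist M N r Z, (S O twist H M t U) O twist M N r W))))"
    unfolding section_comp_normalized_elt[OF assms(1-3) TS VU]
    unfolding section_comp_def bilinear_extension_sum_left bilinear_extension_scale_left
    unfolding section_comp_def[symmetric]
    by (intro sum.cong refl arg_cong[where f = "scale _"])
       (rule section_comp_normalized_elt[OF assms(1,3,4) sections_comp[OF gr(1,2,3) TS tV] ZW])
  also have "\<dots> = (\<Sum>r\<in>carrier M. \<Sum>t\<in>carrier H. scale (?a t * ?b t r)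
       (normalized_elt G N ((T O twist H M t V) O twist M N r Z, (S O twist H M t U) O twist M N r W)))"
    unfolding scale.scale_sum_right scale.scale_scale by (rule sum.swap)
  also have "\<dots> = (\<Sum>r\<in>carrier M. \<Sum>t\<in>carrier H. scale (?c r * ?d t r)
       (normalized_elt G N (T O twist H N t (V O twist M N r Z), S O twist H N t (U O twist M N r W))))"
  proof (intro sum.cong refl)
    fix r t assume r: "r \<in> carrier M" and t: "t \<in> carrier H"
    note r' = sections_subset[OF gr(3,4) rZ[OF r]] and t' = sections_subset[OF gr(2,3) tV[OF t]]
    have k2: "k2 H (twist H M t U) = k2 H U"
      using t V(2) by (auto simp: k2_def mem_twist[OF gr(2,3) t V(2)])
    have "?a t * ?b t r = ?c r * ?d t r"
      using arg_cong[OF card_kernels_cocycle[OF assms(1-4) T(4) t'(4) r'(4)], of "of_nat :: nat \<Rightarrow> 'k"]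
      by (simp add: twist_comp[OF gr(2,3,4) V(2) r'(2) t] k2 field_simps)
    then show "scale (?a t * ?b t r) (normalized_elt G N ((T O twist H M t V) O twist M N r Z, (S O twist H M t U) O twist M N r W)) =
      scale (?c r * ?d t r) (normalized_elt G N (T O twist H N t (V O twist M N r Z), S O twist H N t (U O twist M N r W)))"
      by (simp only: twist_comp[OF gr(2,3,4) V(2) r'(2) t] twist_comp[OF gr(2,3,4) V(1) r'(1) t] O_assoc)
  qed
  also have "\<dots> = (\<Sum>r\<in>carrier M. scale (?c r) (\<Sum>t\<in>carrier H. scale (?d t r)
       (normalized_elt G N (T O twist H N t (V O twist M N r Z), S O twist H N t (U O twist M N r W)))))"
    unfolding scale.scale_sum_right scale.scale_scale ..
  also have "\<dots> = section_comp G H N (normalized_elt G H (T, S))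
      (section_comp H M N (normalized_elt H M (V, U)) (normalized_elt M N (Z, W)))"
    unfolding section_comp_normalized_elt[OF assms(2-4) VU ZW]
    unfolding section_comp_def bilinear_extension_sum_right bilinear_extension_scale_right
    unfolding section_comp_def[symmetric]
    by (intro sum.cong refl arg_cong[where f = "scale _"])
       (rule section_comp_normalized_elt[OF assms(1,2,4) TS sections_comp[OF gr(2,3,4) VU rZ], symmetric])
  finally show ?thesis .
qed

lemma section_comp_assoc:
  assumes "fin_group G" "fin_group H" "fin_group M" "fin_group N"
    and "x \<in> section_burnside G H" "y \<in> section_burnside H M" "z \<in> section_burnside M N"
  shows "section_comp G M N (section_comp G H M x y) z =
    (section_comp G H N x (section_comp H M N y z) :: ('a, 'd, 'k::field_char_0) section_elts)"
proof -
  show ?thesis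
    using assms(5-7) unfolding section_comp_def
      section_burnside_span[OF assms(1,2)] section_burnside_span[OF assms(2,3)]
      section_burnside_span[OF assms(3,4)]
  proof (rule bilinear_extension_assoc; clarify)
    show "bilinear_extension (section_comp_basis G M N)
      (bilinear_extension (section_comp_basis G H M) (normalized_elt G H (T, S)) (normalized_elt H M (V, U)))
      (normalized_elt M N (Z, W)) =
      (bilinear_extension (section_comp_basis G H N) (normalized_elt G H (T, S))
       (bilinear_extension (section_comp_basis H M N) (normalized_elt H M (V, U)) (normalized_elt M N (Z, W)))
        :: ('a, 'd, 'k::field_char_0) section_elts)"
      if "(T, S) \<in> sections (G \<times>\<times> H)" "(V, U) \<in> sections (H \<times>\<times> M)" "(Z, W) \<in> sections (M \<times>\<times> N)"
      for T S V U Z W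
      using section_comp_assoc_normalized[OF assms(1-4) that] unfolding section_comp_def .
  qed
qed

section \<open>Products of right covering sections\<close>

text \<open>
  If the larger group of the left factor projects onto \<open>H\<close>, all twists of the right factor give
  conjugate composites, so the averaged sum collapses to one term.
\<close>

lemma (in three_groups) section_comp_right_covering:
  assumes TS: "(T, S) \<in> sections (G \<times>\<times> H)" and VU: "(V, U) \<in> sections (H \<times>\<times> M)"
    and onto: "Range T = carrier H"
  shows "section_comp G H M (normalized_elt G H (T, S)) (normalized_elt H M (V, U)) =
    scale (of_nat (card (k2 G S \<inter> k1 M U)))
       (normalized_elt G M (T O V, S O U) :: ('a, 'c, 'k::field_char_0) section_elts)"
proof -
  note T = sections_subset[OF groups(1,2) TS] and V = sections_subset[OF groups(2,3) VU]
  have 1: "section_elt (G \<times>\<times> M) (T O twist H M t V) (S O twist H M t U) = section_elt (G \<times>\<times> M) (T O V) (S O U)"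
      "card (S O twist H M t U) = card (S O U)"
      "card (k2 G S \<inter> k1 M (twist H M t U)) = card (k2 G S \<inter> k1 M U)"
    if t: "t \<in> carrier H" for t
  proof -
    from t onto obtain c where ct: "(c, t) \<in> T" by blast
    then have c: "c \<in> carrier G" using T(1) by blast
    have V2: "V \<subseteq> carrier (H \<times>\<times> M)" "U \<subseteq> carrier (H \<times>\<times> M)" using V by simp_all
    note e = GH.conjugate_self[OF TS ct] HM.conjugate_one[OF V2(1)] HM.conjugate_one[OF V2(2)]
    have tw: "twist H M \<one>\<^bsub>H\<^esub> V = V" "twist H M \<one>\<^bsub>H\<^esub> U = U"
      using e(3,4) by (simp_all add: twist_def)
    have 2: "T O twist H M t V = conjugate (G \<times>\<times> M) (c, \<one>\<^bsub>M\<^esub>) (T O V)"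
      using comp_conjugate[OF T(1) V(1) c t H.one_closed M.one_closed t] e tw t by simp
    have 3: "S O twist H M t U = conjugate (G \<times>\<times> M) (c, \<one>\<^bsub>M\<^esub>) (S O U)"
      using comp_conjugate[OF T(2) V(2) c t H.one_closed M.one_closed t] e tw t by simp
    have sub: "T O V \<subseteq> carrier G \<times> carrier M" "S O U \<subseteq> carrier G \<times> carrier M" using T V by auto
    show "section_elt (G \<times>\<times> M) (T O twist H M t V) (S O twist H M t U) = section_elt (G \<times>\<times> M) (T O V) (S O U)"
      unfolding 2 3 by (rule section_elt_conjugate[OF c M.one_closed sub])
    show "card (S O twist H M t U) = card (S O U)"
      unfolding 3 using GM.card_conjugate[of "(c, \<one>\<^bsub>M\<^esub>)" "S O U"] sub c by simp
    have S: "(\<one>\<^bsub>G\<^esub>, h) \<in> S \<longleftrightarrow> (\<one>\<^bsub>G\<^esub>, inv\<^bsub>H\<^esub> t \<otimes>\<^bsub>H\<^esub> h \<otimes>\<^bsub>H\<^esub> t) \<in> S" if h: "h \<in> carrier H" for h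
    proof -
      have "(\<one>\<^bsub>G\<^esub>, h) \<in> S \<longleftrightarrow> (\<one>\<^bsub>G\<^esub>, h) \<in> conjugate (G \<times>\<times> H) (c, t) S" using e(2) by simp
      also have "\<dots> \<longleftrightarrow> (\<one>\<^bsub>G\<^esub>, inv\<^bsub>H\<^esub> t \<otimes>\<^bsub>H\<^esub> h \<otimes>\<^bsub>H\<^esub> t) \<in> S"
        using GH.conjugate_eq_vimage[of "(c, t)" S] T(2) c t h by (simp add: inv_DirProd[OF groups(1,2)])
      finally show ?thesis .
    qed
    have "k2 G S \<inter> k1 M U \<subseteq> carrier H" using T(2) by (auto simp: k2_def)
    note c = H.card_conjugate[OF t this] H.conjugate_eq_vimage[OF t this]
    have "k2 G S \<inter> k1 M (twist H M t U) = conjugate H t (k2 G S \<inter> k1 M U)"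
      unfolding c(2) using S T(2) by (auto simp: k1_def k2_def mem_twist[OF groups(2,3) t V(2)])
    then show "card (k2 G S \<inter> k1 M (twist H M t U)) = card (k2 G S \<inter> k1 M U)" using c(1) by simp
  qed
  have "carrier H \<noteq> {}" using H.one_closed by auto
  then have H0: "of_nat (card (carrier H)) \<noteq> (0 :: 'k)" by simp
  have "section_comp G H M (normalized_elt G H (T, S)) (normalized_elt H M (V, U)) =
    (\<Sum>t\<in>carrier H. scale (of_nat (card (k2 G S \<inter> k1 M U)) / of_nat (card (carrier H)))
       (normalized_elt G M (T O V, S O U)))"
    unfolding section_comp_normalized_elt[OF G.fin_group_axioms H.fin_group_axioms M.fin_group_axioms TS VU]
    by (intro sum.cong refl) (simp add: 1 normalized_elt_def)
  then show ?thesis using H0 unfolding scale.scale_sum_left[symmetric] by simp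
qed

section \<open>Factorization through smaller groups\<close>

text \<open>
  With \<open>N\<close> a copy of \<open>p\<^sub>2(T) / k\<^sub>2(S)\<close> on natural numbers and
  \<open>R\<close> the graph of the projection \<open>p\<^sub>2(T) \<rightarrow> N\<close>, the section
  is recovered from \<open>(T O R, S O R)\<close> because \<open>k\<^sub>2(S)\<close> is contained in
  \<open>k\<^sub>2(T)\<close>. The pushed-forward section covers \<open>N\<close> on the right, so
  products with it have one term.
\<close>

lemma section_factor:
  assumes G: "fin_group G" and H: "fin_group H" and TS: "(T, S) \<in> sections (G \<times>\<times> H)"
  obtains N :: "nat monoid" and R where "fin_group N" "Coset.order N * card (k2 G S) = card (Range T)"
    "(R, R) \<in> sections (H \<times>\<times> N)" "Range (T O R) = carrier N" "k2 G (S O R) = {\<one>\<^bsub>N\<^esub>}"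
    "(T O R) O R\<inverse> = T" "(S O R) O R\<inverse> = S" "k2 H R = {\<one>\<^bsub>N\<^esub>}" "Range R = carrier N"
    "Domain R = Range T"
proof -
  interpret G: fin_group G by (rule G)
  interpret H: fin_group H by (rule H)
  note gr = G.group_axioms H.group_axioms
  note T = sections_subset[OF gr TS]
  have n: "(a \<otimes>\<^bsub>G\<^esub> c \<otimes>\<^bsub>G\<^esub> inv\<^bsub>G\<^esub> a, b \<otimes>\<^bsub>H\<^esub> d \<otimes>\<^bsub>H\<^esub> inv\<^bsub>H\<^esub> b) \<in> S"
    if "(a, b) \<in> T" "(c, d) \<in> S" for a b c d
    using TS that unfolding mem_sections[OF gr] by blast
  define B where "B = H\<lparr>carrier := Range T\<rparr>"
  define Y where "Y = k2 G S"
  have subB: "subgroup (Range T) H" by (rule subgroup_Range[OF gr T(3)])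
  interpret B: group B unfolding B_def by (rule H.subgroup_imp_group[OF subB])
  have YB: "Y \<subseteq> Range T" using T(5) by (auto simp: Y_def k2_def)
  have subY: "subgroup Y B"
    unfolding B_def Y_def by (rule H.subgroup_incl[OF subgroup_k2[OF gr T(4)] subB YB[unfolded Y_def]])
  have invB: "inv\<^bsub>B\<^esub> b = inv\<^bsub>H\<^esub> b" if "b \<in> Range T" for b
    unfolding B_def using that subB by (simp add: H.m_inv_consistent)
  have Y: "Y \<lhd> B"
    unfolding B.normal_inv_iff
  proof (intro conjI ballI subY)
    fix b y assume b: "b \<in> carrier B" and y: "y \<in> Y"
    from b obtain a where "(a, b) \<in> T" by (auto simp: B_def)
    note ab = this
    have "(\<one>\<^bsub>G\<^esub>, b \<otimes>\<^bsub>H\<^esub> y \<otimes>\<^bsub>H\<^esub> inv\<^bsub>H\<^esub> b) \<in> S"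
      using n[OF ab, of "\<one>\<^bsub>G\<^esub>" y] y ab T(1) by (auto simp: Y_def k2_def)
    moreover have "inv\<^bsub>B\<^esub> b = inv\<^bsub>H\<^esub> b" using ab by (intro invB) blast
    ultimately show "b \<otimes>\<^bsub>B\<^esub> y \<otimes>\<^bsub>B\<^esub> inv\<^bsub>B\<^esub> b \<in> Y"
      unfolding Y_def k2_def by (simp add: B_def)
  qed
  interpret Y: normal Y B by (rule Y)
  have finB: "finite (carrier B)" using finite_subset[OF subgroup.subset[OF subB]] by (simp add: B_def)
  have "finite (rcosets\<^bsub>B\<^esub> Y)" using finB by (simp add: RCOSETS_def)
  then obtain e :: "_ \<Rightarrow> nat" where e: "inj_on e (rcosets\<^bsub>B\<^esub> Y)"
    using finite_imp_inj_to_nat_seg by blast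
  define f where "f b = e (Y #>\<^bsub>B\<^esub> b)" for b
  have f: "f a = f b \<longleftrightarrow> a \<otimes>\<^bsub>B\<^esub> inv\<^bsub>B\<^esub> b \<in> Y" if "a \<in> carrier B" "b \<in> carrier B" for a b
  proof -
    have "f a = f b \<longleftrightarrow> Y #>\<^bsub>B\<^esub> a = Y #>\<^bsub>B\<^esub> b"
      using that e unfolding f_def by (auto simp: inj_on_def RCOSETS_def)
    also have "\<dots> \<longleftrightarrow> a \<otimes>\<^bsub>B\<^esub> inv\<^bsub>B\<^esub> b \<in> Y"
    proof
      assume "Y #>\<^bsub>B\<^esub> a = Y #>\<^bsub>B\<^esub> b"
      then have "a \<in> Y #>\<^bsub>B\<^esub> b" using B.rcos_self[OF that(1) subY] by simp
      then obtain y where "y \<in> Y" "a = y \<otimes>\<^bsub>B\<^esub> b" by (auto simp: r_coset_def)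
      then show "a \<otimes>\<^bsub>B\<^esub> inv\<^bsub>B\<^esub> b \<in> Y" using that Y.subset by (auto simp: B.m_assoc)
    next
      assume *: "a \<otimes>\<^bsub>B\<^esub> inv\<^bsub>B\<^esub> b \<in> Y"
      have "a \<in> Y #>\<^bsub>B\<^esub> b"
        unfolding r_coset_def using * that by (auto intro!: bexI[OF _ *] simp: B.m_assoc)
      then show "Y #>\<^bsub>B\<^esub> a = Y #>\<^bsub>B\<^esub> b"
        using B.repr_independence[OF _ that(2) subY] by simp
    qed
    finally show ?thesis .
  qed
  have w: "weak_group_morphism f Y B" by (rule weak_group_morphismsI[OF Y f])
  define N where "N = image_group f B"
  interpret N: group N unfolding N_def by (rule B.image_group_is_group[OF w])
  interpret f: group_hom B N f unfolding N_def by (rule B.weak_group_morphism_group_hom[OF w])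
  have carrN: "carrier N = f ` Range T" by (simp add: N_def image_group_def B_def)
  have fN: "fin_group N"
    by unfold_locales (use finB in \<open>simp add: carrN B_def\<close>)
  have cB: "carrier B = Range T" by (simp add: B_def)
  have mB: "a \<otimes>\<^bsub>B\<^esub> b = a \<otimes>\<^bsub>H\<^esub> b" for a b by (simp add: B_def)
  have oB: "\<one>\<^bsub>B\<^esub> = \<one>\<^bsub>H\<^esub>" by (simp add: B_def)
  have f1: "f b = \<one>\<^bsub>N\<^esub> \<longleftrightarrow> b \<in> Y" if "b \<in> Range T" for b
    using f[of b "\<one>\<^bsub>B\<^esub>"] B.one_closed that by (simp add: cB)
  have "card (carrier N) = card (rcosets\<^bsub>B\<^esub> Y)"
  proof -
    have "carrier N = e ` (rcosets\<^bsub>B\<^esub> Y)"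
      by (auto simp: carrN f_def RCOSETS_def cB)
    then show ?thesis using card_image[OF e] by simp
  qed
  then have ord: "Coset.order N * card (k2 G S) = card (Range T)"
    using B.lagrange[OF subY] by (simp add: Coset.order_def cB Y_def mult.commute)
  define R where "R = {(b, f b) | b. b \<in> Range T}"
  have Rsub: "rel_subgroup H N R"
    unfolding rel_subgroup_def
  proof (intro conjI allI impI)
    show "R \<subseteq> carrier H \<times> carrier N" using T(1) by (auto simp: R_def carrN)
    show "(\<one>\<^bsub>H\<^esub>, \<one>\<^bsub>N\<^esub>) \<in> R"
      using B.one_closed f.hom_one by (auto simp: R_def cB oB)
    show "(a \<otimes>\<^bsub>H\<^esub> c, b \<otimes>\<^bsub>N\<^esub> d) \<in> R" if "(a, b) \<in> R" "(c, d) \<in> R" for a b c d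
      using that B.m_closed[of a c] f.hom_mult[of a c] by (auto simp: R_def cB mB)
    show "(inv\<^bsub>H\<^esub> a, inv\<^bsub>N\<^esub> b) \<in> R" if "(a, b) \<in> R" for a b
      using that B.inv_closed[of a] f.hom_inv[of a] by (auto simp: R_def cB invB)
  qed
  have RR: "(R, R) \<in> sections (H \<times>\<times> N)"
    unfolding mem_sections[OF H.group_axioms N.group_axioms]
    by (intro conjI Rsub subset_refl allI impI rel_subgroupD(5)[OF Rsub] rel_subgroupD(6)[OF Rsub])
  have eqB: "(\<one>\<^bsub>G\<^esub>, inv\<^bsub>H\<^esub> b \<otimes>\<^bsub>H\<^esub> b') \<in> S" if "b \<in> Range T" "b' \<in> Range T" "f b = f b'" for b b'
  proof -
    have "f (inv\<^bsub>B\<^esub> b \<otimes>\<^bsub>B\<^esub> b') = \<one>\<^bsub>N\<^esub>"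
      using that by (simp add: cB[symmetric])
    then show ?thesis
      using f1 that B.m_closed[OF B.inv_closed, of b b'] by (simp add: cB mB invB Y_def k2_def)
  qed
  have TRR: "(W O R) O R\<inverse> = W" if W: "rel_subgroup G H W" and ST: "S \<subseteq> W" "W \<subseteq> T" for W
  proof
    show "(W O R) O R\<inverse> \<subseteq> W"
    proof
      fix p assume "p \<in> (W O R) O R\<inverse>"
      then obtain g b b' where p: "p = (g, b')" "(g, b) \<in> W" "b \<in> Range T" "b' \<in> Range T" "f b = f b'"
        unfolding R_def by (elim relcompE converseE) simp
      have bc: "g \<in> carrier G" "b \<in> carrier H" "b' \<in> carrier H" using p T(1) rel_subgroupD(1)[OF W] by auto
      have "(g \<otimes>\<^bsub>G\<^esub> \<one>\<^bsub>G\<^esub>, b \<otimes>\<^bsub>H\<^esub> (inv\<^bsub>H\<^esub> b \<otimes>\<^bsub>H\<^esub> b')) \<in> W"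
        using rel_subgroupD(5)[OF W p(2)] eqB[OF p(3-5)] ST by blast
      then show "p \<in> W" using bc p(1) by simp
    qed
    show "W \<subseteq> (W O R) O R\<inverse>" using ST by (auto simp: R_def) blast
  qed
  have "k2 G (S O R) = {\<one>\<^bsub>N\<^esub>}"
  proof
    show "k2 G (S O R) \<subseteq> {\<one>\<^bsub>N\<^esub>}" using f1 T(5) by (auto simp: k2_def R_def Y_def)
    show "{\<one>\<^bsub>N\<^esub>} \<subseteq> k2 G (S O R)"
      using rel_subgroupD(2)[OF rel_subgroup_comp[OF T(4) Rsub]] by (simp add: k2_def)
  qed
  moreover have "k2 H R = {\<one>\<^bsub>N\<^esub>}"
    using B.one_closed f.hom_one by (auto simp: k2_def R_def cB oB)
  moreover have "Range (T O R) = carrier N" "Range R = carrier N" "Domain R = Range T"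
    by (auto simp: R_def carrN)
  ultimately show ?thesis
    using that[OF fN ord RR] TRR[OF T(3) T(5) subset_refl] TRR[OF T(4) subset_refl T(5)] by blast
qed

section \<open>The monoid of covering sections\<close>

definition left_pair :: "('a, 'm) monoid_scheme \<Rightarrow> ('a \<times> 'a) set \<times> ('a \<times> 'a) set \<Rightarrow> 'a set \<times> 'a set" where
  "left_pair G s = (k1 G (fst s), Domain (snd s))"

definition right_pair :: "('a, 'm) monoid_scheme \<Rightarrow> ('a \<times> 'a) set \<times> ('a \<times> 'a) set \<Rightarrow> 'a set \<times> 'a set" where
  "right_pair G s = (k2 G (fst s), Range (snd s))"

definition diag_section :: "('a, 'm) monoid_scheme \<Rightarrow> 'a set \<times> 'a set \<Rightarrow> ('a \<times> 'a) set \<times> ('a \<times> 'a) set" where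
  "diag_section G p = (diagonal_mod G (fst p), Id_on (snd p))"

definition section_converse :: "('a \<times> 'b) set \<times> ('a \<times> 'b) set \<Rightarrow> ('b \<times> 'a) set \<times> ('b \<times> 'a) set" where
  "section_converse s = ((fst s)\<inverse>, (snd s)\<inverse>)"

text \<open>The reverse of the natural partial order of the inverse monoid of covering sections.\<close>

definition section_le :: "('a \<times> 'b) set \<times> ('a \<times> 'b) set \<Rightarrow> ('a \<times> 'b) set \<times> ('a \<times> 'b) set \<Rightarrow> bool" where
  "section_le s s' \<longleftrightarrow> fst s \<subseteq> fst s' \<and> snd s' \<subseteq> snd s"

lemma pair_le_iff: "pair_le p q \<longleftrightarrow> fst p \<subseteq> fst q \<and> snd q \<subseteq> snd p"
  by (auto simp: pair_le_def split: prod.splits)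

lemma left_pair_converse: "left_pair G (section_converse s) = right_pair G s"
  and right_pair_converse: "right_pair G (section_converse s) = left_pair G s"
  and converse_converse_section: "section_converse (section_converse s) = s"
  by (simp_all add: left_pair_def right_pair_def section_converse_def k1_def k2_def)

lemma section_converse_compose:
  "section_converse (section_compose s v) = section_compose (section_converse v) (section_converse s)"
  by (simp add: section_converse_def converse_relcomp)

context fin_group
begin

lemma mem_covering_sections:
  "s \<in> covering_sections G \<longleftrightarrow> rel_subgroup G G (fst s) \<and> rel_subgroup G G (snd s) \<and> snd s \<subseteq> fst s \<and>
    (\<forall>a b c d. (a, b) \<in> fst s \<longrightarrow> (c, d) \<in> snd s \<longrightarrow>
       (a \<otimes> c \<otimes> inv a, b \<otimes> d \<otimes> inv b) \<in> snd s) \<and>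
    Domain (fst s) = carrier G \<and> Range (fst s) = carrier G \<and> k1 G (snd s) = {\<one>} \<and> k2 G (snd s) = {\<one>}"
  using mem_sections[OF group_axioms group_axioms, of "fst s" "snd s"]
  by (cases s) (simp add: covering_sections_def)

lemma covering_sections_subset: "covering_sections G \<subseteq> sections (G \<times>\<times> G)"
  by (auto simp: covering_sections_def)

context
  fixes s :: "('a \<times> 'a) set \<times> ('a \<times> 'a) set"
  assumes s: "s \<in> covering_sections G"
begin

lemma cov_rel: "rel_subgroup G G (fst s)" "rel_subgroup G G (snd s)" "snd s \<subseteq> fst s"
  and cov_onto: "Domain (fst s) = carrier G" "Range (fst s) = carrier G"
  and cov_kernel: "k1 G (snd s) = {\<one>}" "k2 G (snd s) = {\<one>}"
  using s unfolding mem_covering_sections by blast+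

lemma cov_normal: "(a, b) \<in> fst s \<Longrightarrow> (c, d) \<in> snd s \<Longrightarrow> (a \<otimes> c \<otimes> inv a, b \<otimes> d \<otimes> inv b) \<in> snd s"
  using s unfolding mem_covering_sections by blast

lemma cov_carrier:
  "(a, b) \<in> fst s \<Longrightarrow> a \<in> carrier G" "(a, b) \<in> fst s \<Longrightarrow> b \<in> carrier G"
  "(a, b) \<in> snd s \<Longrightarrow> a \<in> carrier G" "(a, b) \<in> snd s \<Longrightarrow> b \<in> carrier G"
  using rel_subgroupD(3,4)[OF cov_rel(1)] rel_subgroupD(3,4)[OF cov_rel(2)] by auto

lemma cov_inj:
  "(a, b) \<in> snd s \<Longrightarrow> (a', b) \<in> snd s \<Longrightarrow> a = a'"
  "(a, b) \<in> snd s \<Longrightarrow> (a, b') \<in> snd s \<Longrightarrow> b = b'"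
proof -
  note S = rel_subgroupD[OF cov_rel(2)]
  show "a = a'" if ab: "(a, b) \<in> snd s" "(a', b) \<in> snd s"
  proof -
    have c: "a \<in> carrier G" "a' \<in> carrier G" "b \<in> carrier G" using ab cov_carrier by auto
    have "a \<otimes> inv a' \<in> k1 G (snd s)"
      using S(5)[OF ab(1) S(6)[OF ab(2)]] c by (simp add: k1_def)
    then have "a \<otimes> inv a' = \<one>" unfolding cov_kernel by simp
    then show ?thesis using c by (metis inv_equality inv_inv inv_closed)
  qed
  show "b = b'" if ab: "(a, b) \<in> snd s" "(a, b') \<in> snd s"
  proof -
    have c: "b \<in> carrier G" "b' \<in> carrier G" "a \<in> carrier G" using ab cov_carrier by auto
    have "b \<otimes> inv b' \<in> k2 G (snd s)"
      using S(5)[OF ab(1) S(6)[OF ab(2)]] c by (simp add: k2_def)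
    then have "b \<otimes> inv b' = \<one>" unfolding cov_kernel by simp
    then show ?thesis using c by (metis inv_equality inv_inv inv_closed)
  qed
qed

lemma section_converse_covering: "section_converse s \<in> covering_sections G"
  using s unfolding mem_covering_sections
  by (simp add: section_converse_def rel_subgroup_converse k1_def k2_def converse_mono)

end

lemma section_compose_covering:
  assumes s: "s \<in> covering_sections G" and v: "v \<in> covering_sections G"
  shows "section_compose s v \<in> covering_sections G"
proof -
  have "(fst s O fst v, snd s O snd v) \<in> sections (G \<times>\<times> G)"
    using sections_comp[OF group_axioms group_axioms group_axioms, of "fst s" "snd s" "fst v" "snd v"]
      s v covering_sections_subset by auto
  moreover have "Domain (fst s O fst v) = carrier G" "Range (fst s O fst v) = carrier G"
    using cov_onto[OF s] cov_onto[OF v] by (auto simp: Domain_iff Range_iff relcomp_unfold set_eq_iff) metis+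
  moreover have "k1 G (snd s O snd v) = {\<one>}" "k2 G (snd s O snd v) = {\<one>}"
    using cov_kernel[OF s] cov_kernel[OF v] by (auto simp: k1_def k2_def set_eq_iff)
  ultimately show ?thesis by (simp add: covering_sections_def)
qed

lemma mem_normal_pairs:
  "p \<in> normal_pairs G \<longleftrightarrow> fst p \<lhd> G \<and> snd p \<lhd> G \<and> (\<forall>x\<in>fst p. \<forall>y\<in>snd p. x \<otimes> y = y \<otimes> x)"
proof -
  obtain K P where p: "p = (K, P)" by fastforce
  let ?C = "\<Union>x\<in>K. \<Union>y\<in>P. {x \<otimes> y \<otimes> inv x \<otimes> inv y}"
  have "generate G ?C = {\<one>} \<longleftrightarrow> (\<forall>x\<in>K. \<forall>y\<in>P. x \<otimes> y = y \<otimes> x)" if "K \<lhd> G" "P \<lhd> G"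
  proof -
    have c: "x \<in> carrier G" "y \<in> carrier G" if "x \<in> K" "y \<in> P" for x y
      using that \<open>K \<lhd> G\<close> \<open>P \<lhd> G\<close> normal_imp_subgroup subgroup.mem_carrier by metis+
    have comm: "x \<otimes> y \<otimes> inv x \<otimes> inv y = \<one> \<longleftrightarrow> x \<otimes> y = y \<otimes> x" if "x \<in> K" "y \<in> P" for x y
    proof
      assume "x \<otimes> y \<otimes> inv x \<otimes> inv y = \<one>"
      then have "(x \<otimes> y \<otimes> inv x \<otimes> inv y) \<otimes> y \<otimes> x = y \<otimes> x" using c[OF that] by simp
      then show "x \<otimes> y = y \<otimes> x" using c[OF that] by (simp add: m_assoc)
    next
      assume "x \<otimes> y = y \<otimes> x"
      then show "x \<otimes> y \<otimes> inv x \<otimes> inv y = \<one>" using c[OF that] by (simp add: m_assoc)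
    qed
    have "generate G ?C = {\<one>} \<longleftrightarrow> ?C \<subseteq> {\<one>}"
    proof
      assume "generate G ?C = {\<one>}"
      moreover have "?C \<subseteq> generate G ?C" by (rule subsetI, rule generate.incl)
      ultimately show "?C \<subseteq> {\<one>}" by simp
    next
      assume "?C \<subseteq> {\<one>}"
      then have "generate G ?C \<subseteq> {\<one>}"
        by (rule generate_subgroup_incl[OF _ triv_subgroup])
      then show "generate G ?C = {\<one>}" using generate.one by blast
    qed
    also have "\<dots> \<longleftrightarrow> (\<forall>x\<in>K. \<forall>y\<in>P. x \<otimes> y = y \<otimes> x)"
      unfolding UN_subset_iff insert_subset singleton_iff using comm by simp
    finally show ?thesis .
  qed
  then show ?thesis unfolding p normal_pairs_def by auto
qed

lemma normal_pairs_subgroup: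
  assumes "p \<in> normal_pairs G" shows "subgroup (fst p) G" "subgroup (snd p) G"
  using assms unfolding mem_normal_pairs by (simp_all add: normal_imp_subgroup)

lemma finite_normal_pairs: "finite (normal_pairs G)"
proof (rule finite_subset)
  show "normal_pairs G \<subseteq> Pow (carrier G) \<times> Pow (carrier G)"
    by (auto simp: normal_pairs_def dest!: normal_imp_subgroup subgroup.subset)
qed simp

text \<open>
  The commutator of \<open>x \<in> k\<^sub>1(T)\<close> and \<open>y \<in> p\<^sub>1(S)\<close> lies in
  \<open>k\<^sub>1(S) = 1\<close>: conjugate \<open>(y, z) \<in> S\<close> by
  \<open>(x, 1) \<in> T\<close>.
\<close>

lemma left_pair_normal:
  assumes s: "s \<in> covering_sections G"
  shows "left_pair G s \<in> normal_pairs G"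
proof -
  note gr = group_axioms group_axioms and S = rel_subgroupD[OF cov_rel(2)[OF s]]
    and T = rel_subgroupD[OF cov_rel(1)[OF s]]
  have 1: "k1 G (fst s) \<lhd> G"
    unfolding normal_inv_iff
  proof (intro conjI ballI subgroup_k1[OF gr cov_rel(1)[OF s]])
    fix g x assume g: "g \<in> carrier G" and x: "x \<in> k1 G (fst s)"
    from g obtain h where h: "(g, h) \<in> fst s" using cov_onto[OF s] by blast
    then have "(g \<otimes> x \<otimes> inv g, h \<otimes> \<one> \<otimes> inv h) \<in> fst s"
      using x by (intro T(5)[OF T(5) T(6)]) (auto simp: k1_def)
    then show "g \<otimes> x \<otimes> inv g \<in> k1 G (fst s)" using T(4)[OF h] by (simp add: k1_def)
  qed
  have 2: "Domain (snd s) \<lhd> G"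
    unfolding normal_inv_iff
  proof (intro conjI ballI subgroup_Domain[OF gr cov_rel(2)[OF s]])
    fix g x assume g: "g \<in> carrier G" and x: "x \<in> Domain (snd s)"
    from g obtain h where "(g, h) \<in> fst s" using cov_onto[OF s] by blast
    moreover from x obtain y where "(x, y) \<in> snd s" by blast
    ultimately show "g \<otimes> x \<otimes> inv g \<in> Domain (snd s)" using cov_normal[OF s] by blast
  qed
  have "x \<otimes> y = y \<otimes> x" if x: "x \<in> k1 G (fst s)" and y: "y \<in> Domain (snd s)" for x y
  proof -
    from x have x': "(x, \<one>) \<in> fst s" by (simp add: k1_def)
    from y obtain q where q: "(y, q) \<in> snd s" by blast
    have c: "x \<in> carrier G" "y \<in> carrier G" "q \<in> carrier G"
      using x' q cov_carrier[OF s] by auto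
    have "(x \<otimes> y \<otimes> inv x, q) \<in> snd s" using cov_normal[OF s x' q] c by simp
    then have "x \<otimes> y \<otimes> inv x = y" using cov_inj(1)[OF s _ q] by blast
    then have "x \<otimes> y \<otimes> inv x \<otimes> x = y \<otimes> x" by simp
    then show ?thesis using c by (simp add: m_assoc)
  qed
  with 1 2 show ?thesis unfolding mem_normal_pairs left_pair_def fst_conv snd_conv by blast
qed

lemma right_pair_normal:
  assumes "s \<in> covering_sections G"
  shows "right_pair G s \<in> normal_pairs G"
  using left_pair_normal[OF section_converse_covering[OF assms]] by (simp add: left_pair_converse)

lemma diag_section_covering:
  assumes p: "p \<in> normal_pairs G"
  shows "diag_section G p \<in> covering_sections G"
proof -
  obtain K P where pe: "p = (K, P)" by fastforce
  have K: "K \<lhd> G" and P: "P \<lhd> G" and comm: "\<And>x y. x \<in> K \<Longrightarrow> y \<in> P \<Longrightarrow> x \<otimes> y = y \<otimes> x"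
    using p unfolding mem_normal_pairs pe by auto
  interpret K: normal K G by (rule K)
  interpret P: normal P G by (rule P)
  have mem: "(g, h) \<in> diagonal_mod G K \<longleftrightarrow> g \<in> carrier G \<and> h \<in> carrier G \<and> inv h \<otimes> g \<in> K" for g h
    by (auto simp: diagonal_mod_def)
  have T: "rel_subgroup G G (diagonal_mod G K)"
    unfolding rel_subgroup_def
  proof (intro conjI allI impI)
    fix a b c d assume *: "(a, b) \<in> diagonal_mod G K" "(c, d) \<in> diagonal_mod G K"
    note m = *[unfolded mem]
    have "inv d \<otimes> (inv b \<otimes> a) \<otimes> inv (inv d) \<in> K"
      using m by (intro K.inv_op_closed2) auto
    then have "(inv d \<otimes> (inv b \<otimes> a) \<otimes> inv (inv d)) \<otimes> (inv d \<otimes> c) \<in> K" using m by blast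
    then show "(a \<otimes> c, b \<otimes> d) \<in> diagonal_mod G K"
      using m by (simp add: mem m_assoc inv_mult_group)
  next
    fix a b assume *: "(a, b) \<in> diagonal_mod G K"
    note m = *[unfolded mem]
    have "b \<otimes> inv (inv b \<otimes> a) \<otimes> inv b \<in> K"
      using m by (intro K.inv_op_closed2) auto
    then show "(inv a, inv b) \<in> diagonal_mod G K"
      using m by (simp add: mem m_assoc inv_mult_group)
  qed (auto simp: mem)
  have S: "rel_subgroup G G (Id_on P)"
    unfolding rel_subgroup_def using P.subset by auto
  have n: "(a \<otimes> c \<otimes> inv a, b \<otimes> d \<otimes> inv b) \<in> Id_on P"
    if "(a, b) \<in> diagonal_mod G K" "(c, d) \<in> Id_on P" for a b c d
  proof -
    note m = that(1)[unfolded mem]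
    have cd: "d = c" "c \<in> P" using that(2) by auto
    have cc: "c \<in> carrier G" using cd P.subset by blast
    have "a \<otimes> c \<otimes> inv a = b \<otimes> ((inv b \<otimes> a) \<otimes> c) \<otimes> inv a" using m cc by (simp add: m_assoc)
    also have "\<dots> = b \<otimes> (c \<otimes> (inv b \<otimes> a)) \<otimes> inv a" using comm[of "inv b \<otimes> a" c] m cd by simp
    also have "\<dots> = b \<otimes> c \<otimes> inv b" using m cc by (simp add: m_assoc)
    finally show ?thesis using m cd P.inv_op_closed2 by auto
  qed
  have "Id_on (carrier G) \<subseteq> diagonal_mod G K" by (auto simp: mem)
  then have "Domain (diagonal_mod G K) = carrier G" "Range (diagonal_mod G K) = carrier G"
    by (auto simp: mem)
  moreover have "k1 G (Id_on P) = {\<one>}" "k2 G (Id_on P) = {\<one>}"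
    by (auto simp: k1_def k2_def)
  moreover have "Id_on P \<subseteq> diagonal_mod G K" using P.subset by (auto simp: mem)
  ultimately show ?thesis
    unfolding mem_covering_sections diag_section_def pe using T S n by simp
qed

lemma left_pair_diag [simp]:
  assumes "p \<in> normal_pairs G" shows "left_pair G (diag_section G p) = p"
proof -
  have "fst p \<subseteq> carrier G" using subgroup.subset[OF normal_pairs_subgroup(1)[OF assms]] .
  then show ?thesis
    by (cases p) (auto simp: left_pair_def diag_section_def k1_def diagonal_mod_def)
qed

lemma right_pair_diag [simp]:
  assumes "p \<in> normal_pairs G" shows "right_pair G (diag_section G p) = p"
proof -
  note K = normal_pairs_subgroup(1)[OF assms]
  have "inv h \<in> fst p \<longleftrightarrow> h \<in> fst p" if "h \<in> carrier G" for h
    using subgroup.m_inv_closed[OF K, of h] subgroup.m_inv_closed[OF K, of "inv h"] that by auto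
  then show ?thesis using subgroup.subset[OF K]
    by (cases p) (auto simp: right_pair_def diag_section_def k2_def diagonal_mod_def)
qed

text \<open>
  Enlarging \<open>T\<close> and shrinking \<open>S\<close> amounts to multiplication by an idempotent.
\<close>

lemma section_le_diag_right:
  assumes s: "s \<in> covering_sections G" and s': "s' \<in> covering_sections G" and le: "section_le s s'"
  shows "section_compose s (diag_section G (right_pair G s')) = s'"
proof -
  note T' = rel_subgroupD[OF cov_rel(1)[OF s']]
  have le': "fst s \<subseteq> fst s'" "snd s' \<subseteq> snd s" using le by (auto simp: section_le_def)
  have "fst s O diagonal_mod G (k2 G (fst s')) = fst s'"
  proof
    show "fst s O diagonal_mod G (k2 G (fst s')) \<subseteq> fst s'"
    proof
      fix p assume "p \<in> fst s O diagonal_mod G (k2 G (fst s'))"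
      then obtain g h h' where p: "p = (g, h')" "(g, h) \<in> fst s" "h \<in> carrier G" "h' \<in> carrier G"
        "(\<one>, inv h' \<otimes> h) \<in> fst s'" by (auto simp: diagonal_mod_def k2_def)
      have gc: "g \<in> carrier G" using cov_carrier[OF s] p(2) by blast
      have "(g \<otimes> inv \<one>, h \<otimes> inv (inv h' \<otimes> h)) \<in> fst s'"
        using p le' by (intro T'(5) T'(6)) auto
      then show "p \<in> fst s'" using p gc by (simp add: inv_mult_group)
    qed
    show "fst s' \<subseteq> fst s O diagonal_mod G (k2 G (fst s'))"
    proof
      fix p assume "p \<in> fst s'"
      then obtain g h where p: "p = (g, h)" "(g, h) \<in> fst s'" by (cases p) auto
      have c: "g \<in> carrier G" "h \<in> carrier G" using cov_carrier[OF s'] p(2) by auto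
      then obtain h' where h': "(g, h') \<in> fst s" using cov_onto[OF s] by blast
      have hc: "h' \<in> carrier G" using cov_carrier[OF s] h' by auto
      have "(inv g \<otimes> g, inv h \<otimes> h') \<in> fst s'" using T'(5)[OF T'(6)[OF p(2)], of g h'] h' le' by blast
      then have "(h', h) \<in> diagonal_mod G (k2 G (fst s'))"
        using c hc by (simp add: diagonal_mod_def k2_def)
      then show "p \<in> fst s O diagonal_mod G (k2 G (fst s'))" using h' p(1) by blast
    qed
  qed
  moreover have "snd s O Id_on (Range (snd s')) = snd s'"
  proof
    show "snd s O Id_on (Range (snd s')) \<subseteq> snd s'"
      using le' cov_inj(1)[OF s] by (auto simp: Id_on_def) blast
  qed (use le' in auto)
  ultimately show ?thesis by (simp add: diag_section_def right_pair_def)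
qed

lemma section_converse_diag:
  assumes "p \<in> normal_pairs G" shows "section_converse (diag_section G p) = diag_section G p"
proof -
  note K = normal_pairs_subgroup(1)[OF assms]
  have "inv h \<otimes> g \<in> fst p \<longleftrightarrow> inv g \<otimes> h \<in> fst p" if "g \<in> carrier G" "h \<in> carrier G" for g h
    using subgroup.m_inv_closed[OF K, of "inv h \<otimes> g"] subgroup.m_inv_closed[OF K, of "inv g \<otimes> h"] that
    by (auto simp: inv_mult_group)
  then show ?thesis
    by (auto simp: section_converse_def diag_section_def diagonal_mod_def)
qed

lemma section_le_diag_left:
  assumes s: "s \<in> covering_sections G" and s': "s' \<in> covering_sections G" and le: "section_le s s'"
  shows "section_compose (diag_section G (left_pair G s')) s = s'"
proof -
  have "section_le (section_converse s) (section_converse s')"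
    using le by (auto simp: section_le_def section_converse_def)
  from section_le_diag_right[OF section_converse_covering[OF s] section_converse_covering[OF s'] this]
  have "section_converse (section_compose (section_converse s) (diag_section G (left_pair G s'))) =
    section_converse (section_converse s')"
    by (simp add: right_pair_converse)
  then show ?thesis
    by (simp only: section_converse_compose converse_converse_section
        section_converse_diag[OF left_pair_normal[OF s']])
qed

lemma section_le_refl: "section_le s s"
  by (simp add: section_le_def)

lemma diag_left_pair_compose:
  "s \<in> covering_sections G \<Longrightarrow> section_compose (diag_section G (left_pair G s)) s = s"
  and diag_right_pair_compose:
  "s \<in> covering_sections G \<Longrightarrow> section_compose s (diag_section G (right_pair G s)) = s"
  by (rule section_le_diag_left section_le_diag_right; simp add: section_le_refl)+

lemma pair_le_left_pair: "section_le s s' \<Longrightarrow> pair_le (left_pair G s) (left_pair G s')"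
  by (auto simp: section_le_def pair_le_iff left_pair_def k1_def)

lemma pair_le_right_pair: "section_le s s' \<Longrightarrow> pair_le (right_pair G s) (right_pair G s')"
  by (auto simp: section_le_def pair_le_iff right_pair_def k2_def)

lemma Id_on_subset_diag: "p \<in> normal_pairs G \<Longrightarrow> Id_on (carrier G) \<subseteq> fst (diag_section G p)"
  using normal_pairs_subgroup(1)[of p, THEN subgroup.one_closed]
  unfolding diag_section_def diagonal_mod_def by auto

lemma top_pair_normal: "({\<one>}, carrier G) \<in> normal_pairs G"
  unfolding mem_normal_pairs by (auto simp: normal_self one_is_normal)

lemma diag_section_top: "diag_section G ({\<one>}, carrier G) = (Id_on (carrier G), Id_on (carrier G))"
proof -
  have "inv h \<otimes> g = \<one> \<longleftrightarrow> g = h" if "g \<in> carrier G" "h \<in> carrier G" for g h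
    using that by (metis inv_closed inv_mult_cancel_left(2) l_inv r_one)
  then show ?thesis by (auto simp: diag_section_def diagonal_mod_def)
qed

text \<open>
  The diagonal sections are the only covering sections above the identity for \<open>section_le\<close>:
  such a section is the product of its left idempotent with the identity.
\<close>

lemma diag_sectionI:
  assumes s: "s \<in> covering_sections G" and "Id_on (carrier G) \<subseteq> fst s" "snd s \<subseteq> Id"
  shows "s = diag_section G (left_pair G s)"
proof -
  have "section_le (diag_section G ({\<one>}, carrier G)) s"
    unfolding diag_section_top section_le_def using assms(2,3) cov_carrier[OF s] by auto
  from section_le_diag_left[OF diag_section_covering[OF top_pair_normal] s this]
  have "section_compose (diag_section G (left_pair G s)) (diag_section G ({\<one>}, carrier G)) = s" .
  moreover have "fst (diag_section G (left_pair G s)) \<subseteq> carrier G \<times> carrier G"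
    "snd (diag_section G (left_pair G s)) \<subseteq> carrier G \<times> carrier G"
    using rel_subgroupD(1)[OF cov_rel(1)] rel_subgroupD(1)[OF cov_rel(2)]
      diag_section_covering[OF left_pair_normal[OF s]] by blast+
  then have "section_compose (diag_section G (left_pair G s)) (diag_section G ({\<one>}, carrier G)) =
    diag_section G (left_pair G s)"
    unfolding diag_section_top by (auto simp: Id_on_def prod_eq_iff)
  ultimately show ?thesis by simp
qed

text \<open>
  Since \<open>k\<^sub>1(S) = 1\<close>, the relation \<open>S\<close> is injective and \<open>S O S\<inverse>\<close> is the diagonal of \<open>p\<^sub>1(S)\<close>; since \<open>p\<^sub>1(T) = G\<close>, the relation \<open>T O T\<inverse>\<close> contains the diagonal.
\<close>

lemma compose_converse:
  assumes s: "s \<in> covering_sections G"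
  shows "section_compose s (section_converse s) = diag_section G (left_pair G s)"
proof -
  let ?d = "section_compose s (section_converse s)"
  have d: "?d \<in> covering_sections G"
    by (intro section_compose_covering s section_converse_covering)
  have "?d = diag_section G (left_pair G ?d)"
  proof (rule diag_sectionI[OF d])
    show "Id_on (carrier G) \<subseteq> fst ?d" using cov_onto[OF s] by (auto simp: section_converse_def)
    show "snd ?d \<subseteq> Id" using cov_inj(1)[OF s] by (auto simp: section_converse_def)
  qed
  moreover have "left_pair G ?d = left_pair G s"
  proof -
    note T = rel_subgroupD[OF cov_rel(1)[OF s]]
    have "(g, \<one>) \<in> fst s" if gh: "(g, h) \<in> fst s" "(\<one>, h) \<in> fst s" for g h
      using T(5)[OF gh(1) T(6)[OF gh(2)]] T(3,4)[OF gh(1)] by simp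
    then have "k1 G (fst s O (fst s)\<inverse>) = k1 G (fst s)"
      using T(2) by (auto simp: k1_def)
    then show ?thesis by (auto simp: left_pair_def section_converse_def)
  qed
  ultimately show ?thesis by simp
qed

lemma converse_compose:
  assumes s: "s \<in> covering_sections G"
  shows "section_compose (section_converse s) s = diag_section G (right_pair G s)"
  using compose_converse[OF section_converse_covering[OF s]]
  by (simp add: converse_converse_section left_pair_converse)

text \<open>
  Above the left pair of \<open>s\<close>, multiplication by diagonal sections produces an element over
  \<open>s\<close> with any prescribed left pair.
\<close>

lemma left_pair_compose_diag:
  assumes s: "s \<in> covering_sections G" and p: "p \<in> normal_pairs G" and le: "pair_le (left_pair G s) p"
  shows "left_pair G (section_compose (diag_section G p) s) = p"
    and "section_le s (section_compose (diag_section G p) s)"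
proof -
  have le': "k1 G (fst s) \<subseteq> fst p" "snd p \<subseteq> Domain (snd s)" using le by (auto simp: pair_le_iff left_pair_def)
  have sub: "Id_on (carrier G) \<subseteq> fst (diag_section G p)" by (rule Id_on_subset_diag[OF p])
  note K = normal_pairs_subgroup(1)[OF p]
  have "k1 G (diagonal_mod G (fst p) O fst s) = fst p"
  proof
    show "k1 G (diagonal_mod G (fst p) O fst s) \<subseteq> fst p"
    proof
      fix g assume "g \<in> k1 G (diagonal_mod G (fst p) O fst s)"
      then obtain h where h: "g \<in> carrier G" "h \<in> carrier G" "inv h \<otimes> g \<in> fst p" "h \<in> k1 G (fst s)"
        by (auto simp: k1_def diagonal_mod_def)
      then have "h \<otimes> (inv h \<otimes> g) \<in> fst p"
        using le'(1) subgroup.m_closed[OF K, of h "inv h \<otimes> g"] by blast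
      then show "g \<in> fst p" using h by simp
    qed
    show "fst p \<subseteq> k1 G (diagonal_mod G (fst p) O fst s)"
    proof
      fix g assume g: "g \<in> fst p"
      then have "(g, \<one>) \<in> diagonal_mod G (fst p)" using subgroup.mem_carrier[OF K g] by (simp add: diagonal_mod_def)
      moreover have "(\<one>, \<one>) \<in> fst s" by (rule rel_subgroupD(2)[OF cov_rel(1)[OF s]])
      ultimately show "g \<in> k1 G (diagonal_mod G (fst p) O fst s)" by (auto simp: k1_def)
    qed
  qed
  moreover have "Domain (Id_on (snd p) O snd s) = snd p" using le'(2) by blast
  ultimately show "left_pair G (section_compose (diag_section G p) s) = p"
    by (simp add: left_pair_def diag_section_def)
  show "section_le s (section_compose (diag_section G p) s)"
    unfolding section_le_def using sub cov_carrier[OF s]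
    by (auto simp: diag_section_def Id_on_def subset_iff)
qed

text \<open>The join of the semilattice of pairs, computed as a product of idempotents.\<close>

definition pair_join :: "'a set \<times> 'a set \<Rightarrow> 'a set \<times> 'a set \<Rightarrow> 'a set \<times> 'a set" where
  "pair_join p q = left_pair G (section_compose (diag_section G p) (diag_section G q))"

context
  fixes p q assumes p: "p \<in> normal_pairs G" and q: "q \<in> normal_pairs G"
begin

lemma diag_compose_diag:
  "section_compose (diag_section G p) (diag_section G q) = diag_section G (pair_join p q)"
  unfolding pair_join_def
proof (rule diag_sectionI[OF section_compose_covering[OF diag_section_covering[OF p] diag_section_covering[OF q]]])
  show "Id_on (carrier G) \<subseteq> fst (section_compose (diag_section G p) (diag_section G q))"
    using Id_on_subset_diag[OF p] Id_on_subset_diag[OF q] by (auto simp: subset_iff Id_on_def)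
qed (auto simp: diag_section_def)

lemma pair_join_normal: "pair_join p q \<in> normal_pairs G"
  unfolding pair_join_def
  by (intro left_pair_normal section_compose_covering diag_section_covering p q)

text \<open>
  The products of diagonal sections are joins, so the order of pairs is the one of the semilattice of
  idempotents.
\<close>

lemma pair_le_join_iff:
  assumes r: "r \<in> normal_pairs G"
  shows "pair_le (pair_join p q) r \<longleftrightarrow> pair_le p r \<and> pair_le q r"
proof -
  note K = normal_pairs_subgroup(1)[OF p] normal_pairs_subgroup(1)[OF q] normal_pairs_subgroup(1)[OF r]
  have "fst (pair_join p q) = {g \<in> carrier G. \<exists>h. inv h \<otimes> g \<in> fst p \<and> h \<in> fst q}"
    using subgroup.mem_carrier[OF K(2)]
    by (auto simp: pair_join_def left_pair_def diag_section_def k1_def diagonal_mod_def relcomp_unfold)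
       (metis l_one)
  moreover have "snd (pair_join p q) = snd p \<inter> snd q"
    by (auto simp: pair_join_def left_pair_def diag_section_def)
  moreover have "{g \<in> carrier G. \<exists>h. inv h \<otimes> g \<in> fst p \<and> h \<in> fst q} \<subseteq> fst r \<longleftrightarrow>
    fst p \<subseteq> fst r \<and> fst q \<subseteq> fst r"
  proof (intro iffI conjI subsetI)
    assume *: "{g \<in> carrier G. \<exists>h. inv h \<otimes> g \<in> fst p \<and> h \<in> fst q} \<subseteq> fst r"
    show "x \<in> fst r" if "x \<in> fst p" for x
      using that * subgroup.one_closed[OF K(2)] subgroup.mem_carrier[OF K(1) that]
      by (intro subsetD[OF *]) (auto intro!: exI[of _ \<one>])
    show "x \<in> fst r" if "x \<in> fst q" for x
      using that * subgroup.one_closed[OF K(1)] subgroup.mem_carrier[OF K(2) that]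
      by (intro subsetD[OF *]) (auto intro!: exI[of _ x])
  next
    fix x assume *: "fst p \<subseteq> fst r \<and> fst q \<subseteq> fst r"
      and "x \<in> {g \<in> carrier G. \<exists>h. inv h \<otimes> g \<in> fst p \<and> h \<in> fst q}"
    then obtain h where h: "x \<in> carrier G" "inv h \<otimes> x \<in> fst p" "h \<in> fst q" by blast
    then have "h \<otimes> (inv h \<otimes> x) \<in> fst r"
      using * subgroup.m_closed[OF K(3), of h "inv h \<otimes> x"] by blast
    then show "x \<in> fst r" using h subgroup.mem_carrier[OF K(2) h(3)] by simp
  qed
  moreover have "snd r \<subseteq> snd p \<inter> snd q \<longleftrightarrow> snd r \<subseteq> snd p \<and> snd r \<subseteq> snd q" by blast
  ultimately show ?thesis unfolding pair_le_iff by simp blast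
qed

end

lemma pair_le_refl [simp]: "pair_le p p"
  and pair_le_trans [trans]: "pair_le p q \<Longrightarrow> pair_le q r \<Longrightarrow> pair_le p r"
  and pair_le_antisym: "pair_le p q \<Longrightarrow> pair_le q p \<Longrightarrow> p = q"
  by (auto simp: pair_le_iff prod_eq_iff)

lemma pair_join_absorb:
  assumes "p \<in> normal_pairs G" "q \<in> normal_pairs G" "pair_le p q"
  shows "pair_join p q = q" "pair_join q p = q"
proof -
  have "pair_join p q \<in> normal_pairs G" "pair_join q p \<in> normal_pairs G"
    by (intro pair_join_normal assms)+
  then show "pair_join p q = q" "pair_join q p = q"
    using pair_le_join_iff[OF assms(1,2)] pair_le_join_iff[OF assms(2,1)] assms
    by (meson pair_le_refl pair_le_antisym)+
qed

lemma pair_join_commute: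
  assumes "p \<in> normal_pairs G" "q \<in> normal_pairs G"
  shows "pair_join p q = pair_join q p"
proof -
  have "pair_join p q \<in> normal_pairs G" "pair_join q p \<in> normal_pairs G"
    by (intro pair_join_normal assms)+
  then show ?thesis
    using pair_le_join_iff[OF assms] pair_le_join_iff[OF assms(2,1)]
    by (meson pair_le_refl pair_le_antisym)
qed

text \<open>
  A section that links two pairs is automatically covering: its invariants contain \<open>p\<^sub>1(T) = G\<close>, \<open>k\<^sub>1(S) = 1\<close> and their analogues on the right.
\<close>

lemma linked_iff:
  "linked G p q \<longleftrightarrow> (\<exists>s\<in>covering_sections G. left_pair G s = p \<and> right_pair G s = q)"
proof -
  obtain K P where p: "p = (K, P)" by fastforce
  obtain L Q where q: "q = (L, Q)" by fastforce
  show ?thesis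
    unfolding linked_def p q covering_sections_def left_pair_def right_pair_def
      left_invariants_def right_invariants_def Bex_def split_paired_Ex
    by auto
qed

lemma linked_refl: "p \<in> normal_pairs G \<Longrightarrow> linked G p p"
  unfolding linked_iff using diag_section_covering left_pair_diag right_pair_diag by blast

lemma linked_sym: "linked G p q \<Longrightarrow> linked G q p"
  unfolding linked_iff using section_converse_covering left_pair_converse right_pair_converse by metis

lemma compose_pairs:
  assumes s: "s \<in> covering_sections G" and v: "v \<in> covering_sections G"
    and eq: "right_pair G s = left_pair G v"
  shows "left_pair G (section_compose s v) = left_pair G s"
    "right_pair G (section_compose s v) = right_pair G v"
proof -
  note T = rel_subgroupD[OF cov_rel(1)[OF s]] and V = rel_subgroupD[OF cov_rel(1)[OF v]]
  from eq have k: "(\<one>, h) \<in> fst s \<longleftrightarrow> (h, \<one>) \<in> fst v" for h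
    by (auto simp: right_pair_def left_pair_def k1_def k2_def set_eq_iff)
  from eq have r: "Range (snd s) = Domain (snd v)" by (simp add: right_pair_def left_pair_def)
  have "(g, \<one>) \<in> fst s" if gh: "(g, h) \<in> fst s" "(\<one>, h) \<in> fst s" for g h
    using T(5)[OF gh(1) T(6)[OF gh(2)]] T(3,4)[OF gh(1)] by simp
  then have "k1 G (fst s O fst v) = k1 G (fst s)"
    using V(2) k by (auto simp: k1_def)
  moreover have "Domain (snd s O snd v) = Domain (snd s)" using r by blast
  ultimately show "left_pair G (section_compose s v) = left_pair G s" by (simp add: left_pair_def)
  have "(\<one>, m) \<in> fst v" if gh: "(h, m) \<in> fst v" "(h, \<one>) \<in> fst v" for h m
    using V(5)[OF V(6)[OF gh(2)] gh(1)] V(3,4)[OF gh(1)] by simp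
  then have "k2 G (fst s O fst v) = k2 G (fst v)"
    using T(2) k by (auto simp: k2_def)
  moreover have "Range (snd s O snd v) = Range (snd v)" using r by blast
  ultimately show "right_pair G (section_compose s v) = right_pair G v" by (simp add: right_pair_def)
qed

lemma linked_trans: "linked G p q \<Longrightarrow> linked G q r \<Longrightarrow> linked G p r"
  unfolding linked_iff using section_compose_covering compose_pairs by metis

lemma normal_conjugate_iff:
  assumes "N \<lhd> G" "x \<in> carrier G" "a \<in> carrier G"
  shows "inv x \<otimes> a \<otimes> x \<in> N \<longleftrightarrow> a \<in> N"
proof
  assume "inv x \<otimes> a \<otimes> x \<in> N"
  then have "x \<otimes> (inv x \<otimes> a \<otimes> x) \<otimes> inv x \<in> N" by (rule normal.inv_op_closed2[OF assms(1,2)])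
  then show "a \<in> N" using assms by (simp add: m_assoc)
next
  assume "a \<in> N"
  then show "inv x \<otimes> a \<otimes> x \<in> N" by (rule normal.inv_op_closed1[OF assms(1,2)])
qed

text \<open>Conjugation does not move normal subgroups, so both pairs depend only on the class.\<close>

lemma conjugate_invariants:
  assumes xy: "x \<in> carrier G" "y \<in> carrier G" and U: "U \<subseteq> carrier G \<times> carrier G"
    and V: "V = conjugate (G \<times>\<times> G) (x, y) U"
  shows "Domain U \<lhd> G \<Longrightarrow> Domain V = Domain U" "Range U \<lhd> G \<Longrightarrow> Range V = Range U"
    "k1 G U \<lhd> G \<Longrightarrow> k1 G V = k1 G U" "k2 G U \<lhd> G \<Longrightarrow> k2 G V = k2 G U"
proof -
  interpret Z: group "G \<times>\<times> G" by (rule DirProd_group) (rule group_axioms)+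
  have mem: "(a, b) \<in> V \<longleftrightarrow> a \<in> carrier G \<and> b \<in> carrier G \<and> (inv x \<otimes> a \<otimes> x, inv y \<otimes> b \<otimes> y) \<in> U" for a b
    unfolding V using U xy by (subst Z.conjugate_eq_vimage) (auto simp: inv_DirProd[OF group_axioms group_axioms])
  have dom: "a \<in> Domain V \<longleftrightarrow> a \<in> carrier G \<and> inv x \<otimes> a \<otimes> x \<in> Domain U" for a
  proof
    assume "a \<in> carrier G \<and> inv x \<otimes> a \<otimes> x \<in> Domain U"
    then obtain b where b: "a \<in> carrier G" "(inv x \<otimes> a \<otimes> x, b) \<in> U" by blast
    then have bc: "b \<in> carrier G" using U by blast
    then have "inv y \<otimes> (y \<otimes> b \<otimes> inv y) \<otimes> y = b" using xy by (simp add: m_assoc)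
    then have "(a, y \<otimes> b \<otimes> inv y) \<in> V" unfolding mem using b bc xy by simp
    then show "a \<in> Domain V" by blast
  qed (auto simp: mem)
  have ran: "b \<in> Range V \<longleftrightarrow> b \<in> carrier G \<and> inv y \<otimes> b \<otimes> y \<in> Range U" for b
  proof
    assume "b \<in> carrier G \<and> inv y \<otimes> b \<otimes> y \<in> Range U"
    then obtain a where b: "b \<in> carrier G" "(a, inv y \<otimes> b \<otimes> y) \<in> U" by blast
    then have bc: "a \<in> carrier G" using U by blast
    then have "inv x \<otimes> (x \<otimes> a \<otimes> inv x) \<otimes> x = a" using xy by (simp add: m_assoc)
    then have "(x \<otimes> a \<otimes> inv x, b) \<in> V" unfolding mem using b bc xy by simp
    then show "b \<in> Range V" by blast
  qed (auto simp: mem)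
  have kk: "g \<in> k1 G V \<longleftrightarrow> g \<in> carrier G \<and> inv x \<otimes> g \<otimes> x \<in> k1 G U"
    "g \<in> k2 G V \<longleftrightarrow> g \<in> carrier G \<and> inv y \<otimes> g \<otimes> y \<in> k2 G U" for g
    using xy by (simp_all add: k1_def k2_def mem)
  have sub: "N \<subseteq> carrier G" if "N \<lhd> G" for N
    using that by (rule subgroup.subset[OF normal_imp_subgroup])
  show "Domain V = Domain U" if "Domain U \<lhd> G"
  proof (rule Set.set_eqI)
    fix a show "a \<in> Domain V \<longleftrightarrow> a \<in> Domain U"
      using dom[of a] subsetD[OF sub[OF that], of a] normal_conjugate_iff[OF that xy(1), of a] by blast
  qed
  show "Range V = Range U" if "Range U \<lhd> G"
  proof (rule Set.set_eqI)
    fix a show "a \<in> Range V \<longleftrightarrow> a \<in> Range U"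
      using ran[of a] subsetD[OF sub[OF that], of a] normal_conjugate_iff[OF that xy(2), of a] by blast
  qed
  show "k1 G V = k1 G U" if "k1 G U \<lhd> G"
  proof (rule Set.set_eqI)
    fix a show "a \<in> k1 G V \<longleftrightarrow> a \<in> k1 G U"
      using kk(1)[of a] subsetD[OF sub[OF that], of a] normal_conjugate_iff[OF that xy(1), of a] by blast
  qed
  show "k2 G V = k2 G U" if "k2 G U \<lhd> G"
  proof (rule Set.set_eqI)
    fix a show "a \<in> k2 G V \<longleftrightarrow> a \<in> k2 G U"
      using kk(2)[of a] subsetD[OF sub[OF that], of a] normal_conjugate_iff[OF that xy(2), of a] by blast
  qed
qed

lemma same_class_invariants:
  assumes s: "s \<in> covering_sections G" and v: "v \<in> sections (G \<times>\<times> G)"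
    and eq: "section_class (G \<times>\<times> G) v = section_class (G \<times>\<times> G) s"
  shows "v \<in> covering_sections G" "left_pair G v = left_pair G s" "right_pair G v = right_pair G s"
proof -
  interpret Z: group "G \<times>\<times> G" by (rule DirProd_group) (rule group_axioms)+
  note sv = sections_subset[OF group_axioms group_axioms]
  have vs: "fst v \<subseteq> carrier (G \<times>\<times> G)" "snd v \<subseteq> carrier (G \<times>\<times> G)"
    using sv[of "fst v" "snd v"] v by simp_all
  have ss: "fst s \<subseteq> carrier G \<times> carrier G" "snd s \<subseteq> carrier G \<times> carrier G"
    using rel_subgroupD(1)[OF cov_rel(1)[OF s]] rel_subgroupD(1)[OF cov_rel(2)[OF s]] .
  have "(conjugate (G \<times>\<times> G) \<one>\<^bsub>G \<times>\<times> G\<^esub> (fst v), conjugate (G \<times>\<times> G) \<one>\<^bsub>G \<times>\<times> G\<^esub> (snd v))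
     \<in> section_class (G \<times>\<times> G) v"
    unfolding section_class_def by (cases v) force
  then have "v \<in> section_class (G \<times>\<times> G) s"
    unfolding eq[symmetric] Z.conjugate_one[OF vs(1)] Z.conjugate_one[OF vs(2)] by simp
  then obtain x y where xy: "x \<in> carrier G" "y \<in> carrier G"
    and T: "fst v = conjugate (G \<times>\<times> G) (x, y) (fst s)" and S: "snd v = conjugate (G \<times>\<times> G) (x, y) (snd s)"
    unfolding section_class_def by (cases s) auto
  note iT = conjugate_invariants[OF xy ss(1) T] and iS = conjugate_invariants[OF xy ss(2) S]
  have n: "k1 G (fst s) \<lhd> G" "Domain (snd s) \<lhd> G" "k2 G (fst s) \<lhd> G" "Range (snd s) \<lhd> G"
    using left_pair_normal[OF s] right_pair_normal[OF s]
    by (simp_all add: mem_normal_pairs left_pair_def right_pair_def)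
  show "left_pair G v = left_pair G s" "right_pair G v = right_pair G s"
    using iT(3,4) iS(1,2) n by (simp_all add: left_pair_def right_pair_def)
  have "Domain (fst v) = carrier G" "Range (fst v) = carrier G"
    using iT(1,2) cov_onto[OF s] normal_self by simp_all
  moreover have "k1 G (snd v) = {\<one>}" "k2 G (snd v) = {\<one>}"
    using iS(3,4) cov_kernel[OF s] one_is_normal by simp_all
  ultimately show "v \<in> covering_sections G"
    using v unfolding covering_sections_def by (simp add: case_prod_beta)
qed

end

section \<open>Moebius functions of finite partial orders\<close>

text \<open>
  The Moebius function is given by a definite description. Well-founded recursion along the order
  provides a function with the defining property, and well-founded induction shows that there is only
  one.
\<close>

lemma moebius_props:
  assumes fin: "finite A"
    and refl: "\<And>x. x \<in> A \<Longrightarrow> rel x x"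
    and antisym: "\<And>x y. x \<in> A \<Longrightarrow> y \<in> A \<Longrightarrow> rel x y \<Longrightarrow> rel y x \<Longrightarrow> x = y"
    and trans: "\<And>x y z. x \<in> A \<Longrightarrow> y \<in> A \<Longrightarrow> z \<in> A \<Longrightarrow> rel x y \<Longrightarrow> rel y z \<Longrightarrow> rel x z"
  shows "wf {(z, y). z \<in> A \<and> y \<in> A \<and> rel z y \<and> z \<noteq> y}"
    and "x \<in> A \<Longrightarrow> y \<in> A \<Longrightarrow> rel x y \<Longrightarrow>
      (\<Sum>z\<in>{z \<in> A. rel x z \<and> rel z y}. moebius A rel x z) = (if x = y then 1 else 0)"
proof -
  let ?R = "{(z, y). z \<in> A \<and> y \<in> A \<and> rel z y \<and> z \<noteq> y}"
  \<comment> \<open>Strictly larger elements have strictly larger down-sets.\<close>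
  have "?R \<subseteq> measure (\<lambda>y. card {w \<in> A. rel w y})"
  proof (clarsimp, intro psubset_card_mono)
    fix z y assume zy: "z \<in> A" "y \<in> A" "rel z y" "z \<noteq> y"
    show "finite {w \<in> A. rel w y}" using fin by simp
    have "{w \<in> A. rel w z} \<subseteq> {w \<in> A. rel w y}" using trans[OF _ zy(1,2) _ zy(3)] by blast
    moreover have "y \<in> {w \<in> A. rel w y}" "y \<notin> {w \<in> A. rel w z}"
      using refl[OF zy(2)] antisym[OF zy(1,2,3)] zy by auto
    ultimately show "{w \<in> A. rel w z} \<subset> {w \<in> A. rel w y}" by blast
  qed
  then show wf: "wf ?R" by (rule wf_subset[OF wf_measure])
  let ?I = "\<lambda>x y. {z \<in> A. rel x z \<and> rel z y}"
  let ?P = "\<lambda>\<mu> :: 'a \<Rightarrow> 'a \<Rightarrow> int.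
     (\<forall>x y. \<not> (x \<in> A \<and> y \<in> A \<and> rel x y) \<longrightarrow> \<mu> x y = 0) \<and>
     (\<forall>x\<in>A. \<forall>y\<in>A. rel x y \<longrightarrow> (\<Sum>z\<in>?I x y. \<mu> x z) = (if x = y then 1 else 0))"
  have split: "(\<Sum>z\<in>?I x y. g z) = g y + (\<Sum>z\<in>?I x y - {y}. g z)"
    if "x \<in> A" "y \<in> A" "rel x y" for x y and g :: "'a \<Rightarrow> int"
    using that refl fin by (intro sum.remove) auto
  define F where "F x f y = (if x \<in> A \<and> y \<in> A \<and> rel x y
      then (if x = y then 1 else 0) - (\<Sum>z\<in>?I x y - {y}. f z) else 0)" for x y and f :: "'a \<Rightarrow> int"
  define m where "m x = wfrec ?R (F x)" for x
  have m: "m x y = F x (m x) y" for x y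
  proof -
    have "m x y = F x (cut (m x) ?R y) y" unfolding m_def by (subst wfrec[OF wf]) simp
    also have "\<dots> = F x (m x) y"
      unfolding F_def by (auto intro!: sum.cong simp: cut_def)
    finally show ?thesis .
  qed
  have Pm: "?P m"
  proof (intro conjI allI ballI impI)
    show "m x y = 0" if "\<not> (x \<in> A \<and> y \<in> A \<and> rel x y)" for x y
      unfolding m[of x y] F_def using that by argo
    show "(\<Sum>z\<in>?I x y. m x z) = (if x = y then 1 else 0)" if "x \<in> A" "y \<in> A" "rel x y" for x y
      unfolding split[OF that] m[of x y] F_def using that by simp
  qed
  have unique: "\<mu> = \<nu>" if \<mu>: "?P \<mu>" and \<nu>: "?P \<nu>" for \<mu> \<nu>
  proof (intro ext)
    fix x y show "\<mu> x y = \<nu> x y" using wf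
    proof (induction y rule: wf_induct_rule)
      case (less y)
      show ?case
      proof (cases "x \<in> A \<and> y \<in> A \<and> rel x y")
        case True
        have "(\<Sum>z\<in>?I x y - {y}. \<mu> x z) = (\<Sum>z\<in>?I x y - {y}. \<nu> x z)"
          using True by (intro sum.cong refl less) auto
        moreover have "(\<Sum>z\<in>?I x y. \<mu> x z) = (\<Sum>z\<in>?I x y. \<nu> x z)"
          using \<mu>[THEN conjunct2] \<nu>[THEN conjunct2] True by presburger
        ultimately show ?thesis
          using split[of x y "\<mu> x"] split[of x y "\<nu> x"] True by linarith
      next
        case False
        then have "\<mu> x y = 0" "\<nu> x y = 0"
          using \<mu>[THEN conjunct1, rule_format, of x y] \<nu>[THEN conjunct1, rule_format, of x y] by blast+
        then show ?thesis by simp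
      qed
    qed
  qed
  have "?P (moebius A rel)"
    unfolding moebius_def by (rule theI[of ?P, OF Pm]) (rule unique[OF _ Pm])
  then show "(\<Sum>z\<in>?I x y. moebius A rel x z) = (if x = y then 1 else 0)"
    if "x \<in> A" "y \<in> A" "rel x y" using that by blast
qed

section \<open>The section algebra\<close>

lemmas section_comp_add_left =
    bilinear_extension_add_left[of "section_comp_basis G H M" for G H M, folded section_comp_def]
  and section_comp_add_right =
    bilinear_extension_add_right[of "section_comp_basis G H M" for G H M, folded section_comp_def]
  and section_comp_scale_left =
    bilinear_extension_scale_left[of "section_comp_basis G H M" for G H M, folded section_comp_def]
  and section_comp_scale_right =
    bilinear_extension_scale_right[of "section_comp_basis G H M" for G H M, folded section_comp_def]
  and section_comp_sum_left =
    bilinear_extension_sum_left[of "section_comp_basis G H M" for G H M, folded section_comp_def]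
  and section_comp_sum_right =
    bilinear_extension_sum_right[of "section_comp_basis G H M" for G H M, folded section_comp_def]
  and section_comp_zero_left [simp] =
    bilinear_extension_zero_left[of "section_comp_basis G H M" for G H M, folded section_comp_def]
  and section_comp_zero_right [simp] =
    bilinear_extension_zero_right[of "section_comp_basis G H M" for G H M, folded section_comp_def]
  and section_comp_diff_right =
    bilinear_extension_diff_right[of "section_comp_basis G H M" for G H M, folded section_comp_def]

lemmas section_comp_linear =
  section_comp_add_left section_comp_add_right section_comp_scale_left section_comp_scale_right

lemma section_comp_closed:
  fixes x :: "('a, 'b, 'k::field_char_0) section_elts"
  assumes "fin_group G" "fin_group H" "fin_group M"
    and "x \<in> section_burnside G H" "y \<in> section_burnside H M"
  shows "section_comp G H M x y \<in> section_burnside G M"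
proof -
  interpret G: fin_group G by fact
  interpret H: fin_group H by fact
  interpret M: fin_group M by fact
  note gr = G.group_axioms H.group_axioms M.group_axioms
  have x: "x \<in> scale.span (normalized_elt G H ` sections (G \<times>\<times> H))"
    and y: "y \<in> scale.span (normalized_elt H M ` sections (H \<times>\<times> M))"
    using assms by (simp_all add: section_burnside_span)
  have "section_comp G H M x y \<in> scale.span (normalized_elt G M ` sections (G \<times>\<times> M))"
    unfolding section_comp_def
  proof (rule bilinear_extension_closed[OF x y scale.subspace_span]; clarify)
    fix T S V U assume TS: "(T, S) \<in> sections (G \<times>\<times> H)" and VU: "(V, U) \<in> sections (H \<times>\<times> M)"
    show "bilinear_extension (section_comp_basis G H M) (normalized_elt G H (T, S)) (normalized_elt H M (V, U))
      \<in> scale.span (normalized_elt G M ` sections (G \<times>\<times> M))"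
      unfolding section_comp_def[symmetric] section_comp_normalized_elt[OF assms(1-3) TS VU]
      by (intro scale.span_sum scale.span_scale scale.span_base imageI sections_comp[OF gr TS]
          twist_section[OF gr(2,3) VU])
  qed
  then show ?thesis using assms by (simp add: section_burnside_span)
qed

context fin_group
begin

abbreviation star (infixl \<open>\<star>\<close> 70) where
  "x \<star> y \<equiv> section_comp G G G x y"

abbreviation basis_elt :: "('a \<times> 'a) set \<times> ('a \<times> 'a) set \<Rightarrow> ('a, 'a, 'k::field_char_0) section_elts" where
  "basis_elt \<equiv> normalized_elt G G"

abbreviation top_pair :: "'a set \<times> 'a set" where
  "top_pair \<equiv> ({\<one>}, carrier G)"

lemma card_carrier_neq_0: "of_nat (card (carrier G)) \<noteq> (0 :: 'k::field_char_0)"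
  using one_closed by auto

lemma card_Id_on: "card (Id_on P) = card P"
proof -
  have "Id_on P = (\<lambda>x. (x, x)) ` P" by (auto simp: Id_on_def)
  then show ?thesis by (simp add: card_image inj_on_def)
qed

text \<open>
  This identifies the scaling of \<open>e_elt\<close> with that of \<open>normalized_elt\<close>.
\<close>

lemma inverse_group_index:
  assumes P: "subgroup P G"
  shows "1 / of_nat (group_index G P) =
    (of_nat (card P) / of_nat (card (carrier G)) :: 'k::field_char_0)"
proof -
  have "card P * group_index G P = card (carrier G)"
    using lagrange[OF P] by (simp add: group_index_def Coset.order_def mult.commute)
  moreover from this have "group_index G P \<noteq> 0" using card_carrier_neq_0[where 'k = 'k] by (intro notI) auto
  ultimately show ?thesis
    using card_carrier_neq_0[where 'k = 'k] by (simp add: field_simps flip: of_nat_mult)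
qed

lemma e_elt_eq:
  assumes "p \<in> normal_pairs G"
  shows "e_elt G p = (basis_elt (diag_section G p) :: ('a, 'a, 'k::field_char_0) section_elts)"
proof -
  obtain K P where p: "p = (K, P)" by fastforce
  have "subgroup P G" using normal_pairs_subgroup(2)[OF assms] p by simp
  from inverse_group_index[OF this, where 'k = 'k] show ?thesis
    by (simp add: p e_elt_def normalized_elt_def diag_section_def card_Id_on)
qed

lemma one_eq_e_elt:
  "section_elt (G \<times>\<times> G) (Id_on (carrier G)) (Id_on (carrier G)) = e_elt G top_pair"
  unfolding e_elt_eq[OF top_pair_normal] diag_section_top
  using card_carrier_neq_0 by (simp add: normalized_elt_def card_Id_on)

text \<open>
  A covering section is surjective on the right, so the product has one term; its coefficient is
  \<open>1\<close> because \<open>k\<^sub>2(S)\<close> is trivial.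
\<close>

lemma basis_elt_mult:
  assumes s: "s \<in> covering_sections G" and v: "v \<in> sections (G \<times>\<times> G)"
  shows "basis_elt s \<star> basis_elt v = basis_elt (section_compose s v)"
proof -
  interpret three_groups G G G by unfold_locales
  obtain T S where s': "s = (T, S)" by fastforce
  obtain V U where v': "v = (V, U)" by fastforce
  have "rel_subgroup G G U" using v unfolding v' mem_sections[OF group_axioms group_axioms] by blast
  then have "\<one> \<in> k1 G U" by (simp add: k1_def rel_subgroup_def)
  then have "k2 G S \<inter> k1 G U = {\<one>}" using cov_kernel[OF s] s' by auto
  moreover have "(T, S) \<in> sections (G \<times>\<times> G)" "Range T = carrier G"
    using s covering_sections_subset cov_onto[OF s] s' by auto
  ultimately show ?thesis
    using section_comp_right_covering[of T S V U] v unfolding s' v' by simp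
qed

text \<open>
  The identity is a unit on the right as well: all twists of the diagonal give the section itself, and
  \<open>p\<^sub>2(S) \ G / G\<close> is a single double coset.
\<close>

lemma basis_elt_one_right:
  assumes v: "v \<in> sections (G \<times>\<times> G)"
  shows "basis_elt v \<star> e_elt G top_pair = (basis_elt v :: ('a, 'a, 'k::field_char_0) section_elts)"
proof -
  interpret three_groups G G G by unfold_locales
  obtain T S where v': "v = (T, S)" by fastforce
  let ?I = "Id_on (carrier G)"
  note gr = group_axioms group_axioms
  have TS: "(T, S) \<in> sections (G \<times>\<times> G)" using v v' by simp
  note T = sections_subset[OF gr TS]
  have I: "(?I, ?I) \<in> sections (G \<times>\<times> G)"
    using diag_section_covering[OF top_pair_normal] covering_sections_subset
    unfolding diag_section_top by blast
  note I' = sections_subset[OF gr I]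
  have tw1: "twist G G \<one> ?I = ?I"
    using GH.conjugate_one[of ?I] I'(1) by (simp add: twist_def)
  have WI: "W O ?I = W" if "W \<subseteq> carrier G \<times> carrier G" for W using that by (auto simp: Id_on_def)
  have elt: "section_elt (G \<times>\<times> G) (T O twist G G t ?I) (S O twist G G t ?I) = section_elt (G \<times>\<times> G) T S"
    if t: "t \<in> carrier G" for t
  proof -
    have "\<one> \<in> Range T" "t \<in> Domain ?I" using rel_subgroupD(2)[OF T(3)] t by auto
    from section_elt_twist_shift[OF TS I this one_closed] show ?thesis
      using t by (simp add: tw1 WI T(1,2))
  qed
  have S0: "card S \<noteq> 0" using finite_rel_subgroup[OF T(4)] rel_subgroupD(2)[OF T(4)] by auto
  have card: "card (S O twist G G t ?I) * card (k2 G S \<inter> k1 G (twist G G t ?I)) = card S"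
    if t: "t \<in> carrier G" for t
  proof -
    have "double_coset G (Range S) (Domain ?I) t = carrier G"
    proof
      show "double_coset G (Range S) (Domain ?I) t \<subseteq> carrier G"
        using t by (auto simp: mem_double_coset dest!: subsetD[OF T(2)])
      show "carrier G \<subseteq> double_coset G (Range S) (Domain ?I) t"
      proof
        fix y assume y: "y \<in> carrier G"
        then have "y = \<one> \<otimes> t \<otimes> (inv t \<otimes> y)" using t by simp
        moreover have "\<one> \<in> Range S" using rel_subgroupD(2)[OF T(4)] by blast
        moreover have "inv t \<otimes> y \<in> Domain ?I" using t y by simp
        ultimately show "y \<in> double_coset G (Range S) (Domain ?I) t" unfolding mem_double_coset by blast
      qed
    qed
    then show ?thesis
      using card_double_coset[OF T(4) I'(4) t] one_closed by (auto simp: card_Id_on)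
  qed
  have "section_comp G G G (section_elt (G \<times>\<times> G) T S) (section_elt (G \<times>\<times> G) ?I ?I) =
     (\<Sum>t\<in>carrier G. scale (of_nat (card S) / of_nat (card S * card ?I))
        (section_elt (G \<times>\<times> G) T S :: ('a, 'a, 'k) section_elts))"
    unfolding section_comp_section_elt[OF TS I] by (intro sum.cong refl) (simp only: card elt)
  also have "\<dots> = section_elt (G \<times>\<times> G) T S"
    unfolding scale.scale_sum_left[symmetric] using S0 card_carrier_neq_0 by (simp add: card_Id_on)
  finally show ?thesis
    unfolding one_eq_e_elt v' normalized_elt_def prod.case section_comp_scale_left by simp
qed

lemma section_burnside_span_basis:
  "section_burnside G G = scale.span (basis_elt ` sections (G \<times>\<times> G))"
  by (rule section_burnside_span[OF fin_group_axioms fin_group_axioms])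

lemma covering_algebra_span:
  "covering_algebra G = scale.span (basis_elt ` covering_sections G)"
  unfolding covering_algebra_def
  by (rule span_normalized_elt[OF fin_group_axioms fin_group_axioms covering_sections_subset, symmetric])

lemma covering_subset_burnside:
  "covering_algebra G \<subseteq> (section_burnside G G :: ('a, 'a, 'k::field_char_0) section_elts set)"
  unfolding covering_algebra_span section_burnside_span_basis
  by (intro scale.span_mono image_mono covering_sections_subset)

lemma basis_elt_covering: "s \<in> covering_sections G \<Longrightarrow> basis_elt s \<in> covering_algebra G"
  unfolding covering_algebra_span by (intro scale.span_base imageI)

lemma basis_elt_burnside: "s \<in> sections (G \<times>\<times> G) \<Longrightarrow> basis_elt s \<in> section_burnside G G"
  by (rule normalized_elt_in_section_burnside)

lemma e_elt_covering: "p \<in> normal_pairs G \<Longrightarrow> e_elt G p \<in> covering_algebra G"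
  by (simp add: e_elt_eq basis_elt_covering diag_section_covering)

lemma f_elt_covering: "f_elt G p \<in> covering_algebra G"
  unfolding f_elt_def covering_algebra_span
  by (intro scale.span_sum scale.span_scale) (use e_elt_covering covering_algebra_span in auto)

lemma subspace_burnside: "scale.subspace (section_burnside G G :: ('a, 'a, 'k::field_char_0) section_elts set)"
  and subspace_covering: "scale.subspace (covering_algebra G :: ('a, 'a, 'k::field_char_0) section_elts set)"
  unfolding section_burnside_span_basis covering_algebra_span by (rule scale.subspace_span)+

lemma star_burnside:
  "x \<in> section_burnside G G \<Longrightarrow> y \<in> section_burnside G G \<Longrightarrow>
   (x \<star> y :: ('a, 'a, 'k::field_char_0) section_elts) \<in> section_burnside G G"
  by (rule section_comp_closed[OF fin_group_axioms fin_group_axioms fin_group_axioms])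

lemma star_covering:
  assumes "x \<in> covering_algebra G" "y \<in> covering_algebra G"
  shows "(x \<star> y :: ('a, 'a, 'k::field_char_0) section_elts) \<in> covering_algebra G"
  using assms unfolding covering_algebra_span section_comp_def
proof (rule bilinear_extension_closed[OF _ _ scale.subspace_span]; clarify)
  fix T S V U assume "(T, S) \<in> covering_sections G" "(V, U) \<in> covering_sections G"
  then show "bilinear_extension (section_comp_basis G G G) (basis_elt (T, S)) (basis_elt (V, U))
    \<in> scale.span (basis_elt ` covering_sections G :: ('a, 'a, 'k) section_elts set)"
    using basis_elt_mult[of "(T, S)" "(V, U)"] section_compose_covering[of "(T, S)" "(V, U)"]
      covering_sections_subset
    by (auto simp: section_comp_def intro!: scale.span_base)
qed

lemma star_assoc:
  assumes "x \<in> section_burnside G G" "y \<in> section_burnside G G" "z \<in> section_burnside G G"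
  shows "x \<star> y \<star> z = (x \<star> (y \<star> z) :: ('a, 'a, 'k::field_char_0) section_elts)"
  by (rule section_comp_assoc[OF fin_group_axioms fin_group_axioms fin_group_axioms fin_group_axioms assms])

lemma star_one:
  assumes "x \<in> section_burnside G G"
  shows "e_elt G top_pair \<star> x = x" "x \<star> e_elt G top_pair = (x :: ('a, 'a, 'k::field_char_0) section_elts)"
proof -
  have 1: "e_elt G top_pair \<star> basis_elt v = basis_elt v" if "v \<in> sections (G \<times>\<times> G)" for v
  proof -
    obtain T S where v: "v = (T, S)" by fastforce
    note sub = sections_subset(1,2)[OF group_axioms group_axioms that[unfolded v]]
    have "Id_on (carrier G) O W = W" if "W \<subseteq> carrier G \<times> carrier G" for W :: "('a \<times> 'a) set"
      using that by (auto simp: Id_on_def)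
    from this[OF sub(1)] this[OF sub(2)] have "section_compose (diag_section G top_pair) v = v"
      unfolding diag_section_top v by simp
    then show ?thesis
      using basis_elt_mult[OF diag_section_covering[OF top_pair_normal] that]
      by (simp add: e_elt_eq[OF top_pair_normal])
  qed
  have x: "x \<in> scale.span (basis_elt ` sections (G \<times>\<times> G))"
    using assms by (simp add: section_burnside_span_basis)
  show "e_elt G top_pair \<star> x = x"
    using x by (rule scale.span_induct)
      (use 1 in \<open>auto intro!: scale.subspaceI simp: section_comp_linear\<close>)
  show "x \<star> e_elt G top_pair = x"
    using x by (rule scale.span_induct)
      (use basis_elt_one_right in \<open>auto intro!: scale.subspaceI simp: section_comp_linear\<close>)
qed

lemma section_algebra_simps [simp]:
  "carrier (section_algebra G) = section_burnside G G"
  "x \<otimes>\<^bsub>section_algebra G\<^esub> y = x \<star> y"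
  "\<one>\<^bsub>section_algebra G\<^esub> = e_elt G top_pair"
  "\<zero>\<^bsub>section_algebra G\<^esub> = 0"
  "x \<oplus>\<^bsub>section_algebra G\<^esub> y = x + y"
  "c \<odot>\<^bsub>section_algebra G\<^esub> x = scale c x"
  by (simp_all add: section_algebra_def one_eq_e_elt)

lemma k_algebra_section_algebra:
  "k_algebra (section_algebra G :: ('k::field_char_0, ('a, 'a, 'k) section_elts) module)"
proof (rule k_algebra_spanI[where \<beta> = "section_comp_basis G G G" and U = "basis_elt ` sections (G \<times>\<times> G)"])
  let ?E = "section_algebra G :: ('k::field_char_0, ('a, 'a, 'k) section_elts) module"
  show "carrier ?E = scale.span (basis_elt ` sections (G \<times>\<times> G))"
    by (simp add: section_burnside_span_basis)
  have one: "monoid.one ?E \<in> section_burnside G G"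
    using e_elt_covering[OF top_pair_normal] covering_subset_burnside by auto
  then show "monoid.one ?E \<in> scale.span (basis_elt ` sections (G \<times>\<times> G))"
    by (simp only: section_burnside_span_basis)
  note b = basis_elt_burnside
  show "bilinear_extension (section_comp_basis G G G) x y \<in> scale.span (basis_elt ` sections (G \<times>\<times> G))"
    if "x \<in> basis_elt ` sections (G \<times>\<times> G)" "y \<in> basis_elt ` sections (G \<times>\<times> G)"
    for x y :: "('a, 'a, 'k) section_elts"
    unfolding section_comp_def[symmetric] section_burnside_span_basis[symmetric]
    using that b by (intro star_burnside) blast+
  show "bilinear_extension (section_comp_basis G G G) (bilinear_extension (section_comp_basis G G G) x y) z =
     bilinear_extension (section_comp_basis G G G) x (bilinear_extension (section_comp_basis G G G) y z)"
    if "x \<in> basis_elt ` sections (G \<times>\<times> G)" "y \<in> basis_elt ` sections (G \<times>\<times> G)"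
      "z \<in> basis_elt ` sections (G \<times>\<times> G)" for x y z :: "('a, 'a, 'k) section_elts"
    unfolding section_comp_def[symmetric] using that b by (intro star_assoc) blast+
  show "bilinear_extension (section_comp_basis G G G) (monoid.one ?E) x = x"
    "bilinear_extension (section_comp_basis G G G) x (monoid.one ?E) = x"
    if "x \<in> basis_elt ` sections (G \<times>\<times> G)" for x :: "('a, 'a, 'k) section_elts"
  proof -
    have "x \<in> section_burnside G G" using that b by blast
    from star_one[OF this] show "bilinear_extension (section_comp_basis G G G) (monoid.one ?E) x = x"
      "bilinear_extension (section_comp_basis G G G) x (monoid.one ?E) = x"
      by (simp_all add: section_comp_def)
  qed
qed (simp_all add: section_algebra_def section_comp_def fun_eq_iff)

end

section \<open>Orthogonal idempotents of the covering algebra\<close>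

text \<open>
  The field enters through its type only; the parameter \<open>k\<close> makes that type fixed in this context.
\<close>

locale fin_group_over = fin_group G for G :: "('a, 'g) monoid_scheme" (structure) +
  fixes k :: "'k::field_char_0 itself"
begin

abbreviation e :: "'a set \<times> 'a set \<Rightarrow> ('a, 'a, 'k) section_elts" where
  "e \<equiv> e_elt G"

abbreviation f :: "'a set \<times> 'a set \<Rightarrow> ('a, 'a, 'k) section_elts" where
  "f \<equiv> f_elt G"

abbreviation pairs :: "('a set \<times> 'a set) set" where
  "pairs \<equiv> normal_pairs G"

abbreviation mu :: "'a set \<times> 'a set \<Rightarrow> 'a set \<times> 'a set \<Rightarrow> int" where
  "mu \<equiv> moebius pairs pair_le"

lemma mu_sum:
  "p \<in> pairs \<Longrightarrow> q \<in> pairs \<Longrightarrow> pair_le p q \<Longrightarrow>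
    (\<Sum>r\<in>{r \<in> pairs. pair_le p r \<and> pair_le r q}. mu p r) = (if p = q then 1 else 0)"
  by (rule moebius_props(2)[where A = pairs and rel = pair_le])
     (assumption | rule finite_normal_pairs pair_le_refl | erule (1) pair_le_antisym pair_le_trans)+

lemma wf_pairs: "wf {(p, q). p \<in> pairs \<and> q \<in> pairs \<and> pair_le p q \<and> p \<noteq> q}"
  by (rule moebius_props(1)[where A = pairs and rel = pair_le])
     (assumption | rule finite_normal_pairs pair_le_refl | erule (1) pair_le_antisym pair_le_trans)+

lemma mu_self: "p \<in> pairs \<Longrightarrow> mu p p = 1"
proof -
  assume p: "p \<in> pairs"
  have "{r \<in> pairs. pair_le p r \<and> pair_le r p} = {p}"
    using p pair_le_antisym pair_le_refl by blast
  with mu_sum[OF p p pair_le_refl] show ?thesis by simp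
qed

lemma e_mult:
  assumes "p \<in> pairs" "q \<in> pairs"
  shows "e p \<star> e q = (e (pair_join p q) :: ('a, 'a, 'k) section_elts)"
  using basis_elt_mult[OF diag_section_covering[OF assms(1)], of "diag_section G q"]
    diag_section_covering[OF assms(2)] covering_sections_subset diag_compose_diag[OF assms]
    pair_join_normal[OF assms] assms
  by (auto simp: e_elt_eq)

lemma f_elt_altdef: "f p = (\<Sum>q\<in>{q \<in> pairs. pair_le p q}. scale (of_int (mu p q)) (e q))"
  by (simp add: f_elt_def)

lemma f_elt_eq_e_plus:
  assumes p: "p \<in> pairs"
  shows "f p = e p + (\<Sum>q\<in>{q \<in> pairs. pair_le p q \<and> p \<noteq> q}. scale (of_int (mu p q)) (e q))"
proof -
  have "f p = scale (of_int (mu p p)) (e p) +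
     (\<Sum>q\<in>{q \<in> pairs. pair_le p q} - {p}. scale (of_int (mu p q)) (e q))"
    unfolding f_elt_altdef using p finite_normal_pairs by (intro sum.remove) auto
  moreover have "{q \<in> pairs. pair_le p q} - {p} = {q \<in> pairs. pair_le p q \<and> p \<noteq> q}" by blast
  ultimately show ?thesis using mu_self[OF p] by simp
qed

text \<open>
  Weisner's theorem: summing the left-hand side over all \<open>w \<preceq> y\<close> gives a sum of \<open>\<mu>(p, q)\<close> over an
  interval from \<open>p\<close> to \<open>y\<close>, which vanishes unless \<open>y = p\<close>.
\<close>

lemma mu_weisner:
  assumes p: "p \<in> pairs" and r: "r \<in> pairs" and nle: "\<not> pair_le r p" and w: "w \<in> pairs"
  shows "(\<Sum>q\<in>{q \<in> pairs. pair_le p q \<and> pair_join r q = w}. mu p q) = 0"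
    (is "?c w = 0")
proof -
  have total: "(\<Sum>w\<in>{w \<in> pairs. pair_le w y}. ?c w) = 0" if y: "y \<in> pairs" for y
  proof -
    have le: "pair_le (pair_join r q) y \<longleftrightarrow> pair_le r y \<and> pair_le q y" if "q \<in> pairs" for q
      by (rule pair_le_join_iff[OF r that y])
    have "(\<Sum>w\<in>{w \<in> pairs. pair_le w y}. ?c w) =
      (\<Sum>w\<in>{w \<in> pairs. pair_le w y}. \<Sum>q\<in>{q \<in> {q \<in> pairs. pair_le p q \<and> pair_le (pair_join r q) y}. pair_join r q = w}. mu p q)"
      by (intro sum.cong refl) auto
    also have "\<dots> = (\<Sum>q\<in>{q \<in> pairs. pair_le p q \<and> pair_le (pair_join r q) y}. mu p q)"
      using finite_normal_pairs pair_join_normal[OF r] by (intro sum.group) auto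
    also have "{q \<in> pairs. pair_le p q \<and> pair_le (pair_join r q) y} =
      (if pair_le r y then {q \<in> pairs. pair_le p q \<and> pair_le q y} else {})"
      using le by auto
    also have "(\<Sum>q\<in>\<dots>. mu p q) = 0"
    proof (cases "pair_le r y \<and> pair_le p y")
      case True
      then have "p \<noteq> y" using nle by blast
      then show ?thesis using True mu_sum[OF p y] by simp
    next
      case False
      then have "\<not> (pair_le p q \<and> pair_le q y)" if "pair_le r y" for q
        using that pair_le_trans by blast
      then have "(if pair_le r y then {q \<in> pairs. pair_le p q \<and> pair_le q y} else {}) = {}"
        unfolding if_splits(1)[of "\<lambda>A. A = {}"] by blast
      then show ?thesis by (simp only: sum.empty)
    qed
    finally show ?thesis .
  qed
  show ?thesis using wf_pairs w
  proof (induction w rule: wf_induct_rule)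
    case (less w)
    have 1: "(\<Sum>v\<in>{v \<in> pairs. pair_le v w}. ?c v) =
       ?c w + (\<Sum>v\<in>{v \<in> pairs. pair_le v w} - {w}. ?c v)"
      using less.prems finite_normal_pairs by (intro sum.remove) auto
    have 2: "(\<Sum>v\<in>{v \<in> pairs. pair_le v w} - {w}. ?c v) = 0"
      using less by (intro sum.neutral) auto
    show ?case
      using trans[OF 1[symmetric] total[OF less.prems]] unfolding 2 add_0_right .
  qed
qed

text \<open>
  If \<open>r\<close> is not below \<open>p\<close>, expand \<open>f\<^bsub>p\<^esub>\<close> and
  collect the terms \<open>e\<^bsub>r\<^esub> e\<^bsub>q\<^esub>\<close> by the join of \<open>r\<close>
  and \<open>q\<close>; every coefficient vanishes by \<open>mu_weisner\<close>.
\<close>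

lemma e_f:
  assumes r: "r \<in> pairs" and p: "p \<in> pairs"
  shows "e r \<star> f p = (if pair_le r p then f p else (0 :: ('a, 'a, 'k) section_elts))"
proof (cases "pair_le r p")
  case True
  have "e r \<star> e q = (e q :: ('a, 'a, 'k) section_elts)" if "q \<in> pairs" "pair_le p q" for q
    using e_mult[OF r that(1)] pair_join_absorb(1)[OF r that(1) pair_le_trans[OF True that(2)]] by simp
  then have "e r \<star> f p = (f p :: ('a, 'a, 'k) section_elts)"
    unfolding f_elt_altdef section_comp_sum_right section_comp_scale_right
    by (intro sum.cong refl) auto
  then show ?thesis using True by simp
next
  case False
  have "e r \<star> f p = (\<Sum>q\<in>{q \<in> pairs. pair_le p q}. scale (of_int (mu p q)) (e (pair_join r q)))"
    unfolding f_elt_altdef section_comp_sum_right section_comp_scale_right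
    using e_mult[OF r] by (intro sum.cong refl) auto
  also have "\<dots> = (\<Sum>w\<in>pairs. \<Sum>q\<in>{q \<in> {q \<in> pairs. pair_le p q}. pair_join r q = w}.
      scale (of_int (mu p q)) (e (pair_join r q)))"
    using finite_normal_pairs pair_join_normal[OF r] by (intro sum.group[symmetric]) auto
  also have "\<dots> = (\<Sum>w\<in>pairs. scale (of_int (\<Sum>q\<in>{q \<in> pairs. pair_le p q \<and> pair_join r q = w}. mu p q)) (e w))"
  proof (intro sum.cong refl)
    fix w
    show "(\<Sum>q\<in>{q \<in> {q \<in> pairs. pair_le p q}. pair_join r q = w}.
        scale (of_int (mu p q)) (e (pair_join r q))) =
      scale (of_int (\<Sum>q\<in>{q \<in> pairs. pair_le p q \<and> pair_join r q = w}. mu p q)) (e w)"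
      unfolding of_int_sum scale.scale_sum_left by (intro sum.cong) auto
  qed
  also have "\<dots> = 0"
    using mu_weisner[OF p r False] by (intro sum.neutral) auto
  finally show ?thesis using False by simp
qed

lemma e_f_commute:
  assumes r: "r \<in> pairs" and p: "p \<in> pairs"
  shows "f p \<star> e r = (e r \<star> f p :: ('a, 'a, 'k) section_elts)"
proof -
  have "e q \<star> e r = (e r \<star> e q :: ('a, 'a, 'k) section_elts)" if "q \<in> pairs" for q
    using that r pair_join_commute by (simp add: e_mult)
  then show ?thesis
    unfolding f_elt_altdef section_comp_sum_right section_comp_scale_right
      section_comp_sum_left section_comp_scale_left
    by (intro sum.cong refl) auto
qed

lemma f_e:
  assumes "r \<in> pairs" "p \<in> pairs"
  shows "f p \<star> e r = (if pair_le r p then f p else (0 :: ('a, 'a, 'k) section_elts))"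
  using e_f[OF assms] e_f_commute[OF assms] by simp

lemma f_orthogonal:
  assumes q: "q \<in> pairs" and p: "p \<in> pairs"
  shows "f q \<star> f p = (if q = p then f p else (0 :: ('a, 'a, 'k) section_elts))"
proof -
  have "f q \<star> f p = (\<Sum>r\<in>{r \<in> pairs. pair_le q r}. if pair_le r p
        then scale (of_int (mu q r)) (f p) else (0 :: ('a, 'a, 'k) section_elts))"
    unfolding f_elt_altdef[of q] section_comp_sum_left section_comp_scale_left
    using e_f[OF _ p] by (intro sum.cong refl) auto
  also have "\<dots> = (\<Sum>r\<in>{r \<in> {r \<in> pairs. pair_le q r}. pair_le r p}. scale (of_int (mu q r)) (f p))"
    using finite_normal_pairs by (intro sum.inter_filter[symmetric]) auto
  also have "\<dots> = scale (of_int (\<Sum>r\<in>{r \<in> pairs. pair_le q r \<and> pair_le r p}. mu q r)) (f p)"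
    unfolding of_int_sum scale.scale_sum_left by (intro sum.cong) auto
  also have "\<dots> = (if q = p then f p else 0)"
  proof (cases "pair_le q p")
    case True
    then show ?thesis using mu_sum[OF q p] by simp
  next
    case False
    then have none: "{r \<in> pairs. pair_le q r \<and> pair_le r p} = {}" using pair_le_trans by blast
    show ?thesis unfolding none using False by auto
  qed
  finally show ?thesis .
qed

text \<open>
  Moebius inversion, in the form of a downward induction along the triangular system
  \<open>f_elt_eq_e_plus\<close>.
\<close>

lemma e_in_span_f:
  assumes "p \<in> pairs"
  shows "(e p :: ('a, 'a, 'k) section_elts) \<in> scale.span (f ` pairs)"
proof -
  have "wf {(q, p). p \<in> pairs \<and> q \<in> pairs \<and> pair_le p q \<and> p \<noteq> q}"
  proof (rule finite_acyclic_wf)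
    show "finite {(q, p). p \<in> pairs \<and> q \<in> pairs \<and> pair_le p q \<and> p \<noteq> q}"
      by (rule finite_subset[of _ "pairs \<times> pairs"]) (use finite_normal_pairs in auto)
    have "{(q, p). p \<in> pairs \<and> q \<in> pairs \<and> pair_le p q \<and> p \<noteq> q} =
      {(p, q). p \<in> pairs \<and> q \<in> pairs \<and> pair_le p q \<and> p \<noteq> q}\<inverse>" by auto
    then show "acyclic {(q, p). p \<in> pairs \<and> q \<in> pairs \<and> pair_le p q \<and> p \<noteq> q}"
      using wf_acyclic[OF wf_pairs] by simp
  qed
  then show ?thesis using assms
  proof (induction p rule: wf_induct_rule)
    case (less p)
    have "(e p :: ('a, 'a, 'k) section_elts) =
      f p - (\<Sum>q\<in>{q \<in> pairs. pair_le p q \<and> p \<noteq> q}. scale (of_int (mu p q)) (e q))"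
      using f_elt_eq_e_plus[OF less.prems] by simp
    also have "\<dots> \<in> scale.span (f ` pairs)"
      using less by (intro scale.span_diff scale.span_sum scale.span_scale) (auto intro: scale.span_base)
    finally show ?case .
  qed
qed

lemma pair_le_top: "p \<in> pairs \<Longrightarrow> pair_le top_pair p"
  using normal_pairs_subgroup[of p] subgroup.one_closed subgroup.subset
  by (auto simp: pair_le_iff) blast

text \<open>
  The identity \<open>e\<^bsub>(1, G)\<^esub>\<close> lies in the span of the orthogonal idempotents
  \<open>f\<^bsub>p\<^esub>\<close>, on which the sum of the \<open>f\<^bsub>p\<^esub>\<close> acts as
  the identity.
\<close>

lemma sum_f: "(\<Sum>p\<in>pairs. f p) = (e top_pair :: ('a, 'a, 'k) section_elts)"
proof -
  have *: "x = (\<Sum>p\<in>pairs. x \<star> f p)" if "x \<in> scale.span (f ` pairs)"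
    for x :: "('a, 'a, 'k) section_elts"
    using that
  proof (rule scale.span_induct)
    show "scale.subspace {x :: ('a, 'a, 'k) section_elts. x = (\<Sum>p\<in>pairs. x \<star> f p)}"
      by (intro scale.subspaceI)
         (auto simp: section_comp_linear sum.distrib scale.scale_sum_right[symmetric])
    fix y :: "('a, 'a, 'k) section_elts" assume "y \<in> f ` pairs"
    then obtain q where q: "q \<in> pairs" "y = f q" by blast
    have "(\<Sum>p\<in>pairs. y \<star> f p) = (\<Sum>p\<in>pairs. if q = p then f p else 0)"
      unfolding q(2) using q(1) by (intro sum.cong refl) (simp add: f_orthogonal)
    also have "\<dots> = y" using q finite_normal_pairs by (simp add: sum.delta)
    finally show "y = (\<Sum>p\<in>pairs. y \<star> f p)" ..
  qed
  have "(e top_pair :: ('a, 'a, 'k) section_elts) = (\<Sum>p\<in>pairs. e top_pair \<star> f p)"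
    by (rule *[OF e_in_span_f[OF top_pair_normal]])
  also have "\<dots> = (\<Sum>p\<in>pairs. f p)"
    using e_f[OF top_pair_normal] pair_le_top by (intro sum.cong refl) auto
  finally show ?thesis ..
qed

section \<open>Multiplication of sections by the idempotents\<close>

lemma f_burnside: "f p \<in> (section_burnside G G :: ('a, 'a, 'k) section_elts set)"
  and e_burnside: "q \<in> pairs \<Longrightarrow> e q \<in> (section_burnside G G :: ('a, 'a, 'k) section_elts set)"
  and cov_burnside: "s \<in> covering_sections G \<Longrightarrow>
    basis_elt s \<in> (section_burnside G G :: ('a, 'a, 'k) section_elts set)"
  using f_elt_covering e_elt_covering covering_subset_burnside basis_elt_covering by blast+

lemma e_basis_elt:
  assumes "p \<in> pairs" "s \<in> covering_sections G"
  shows "e p \<star> basis_elt s = basis_elt (section_compose (diag_section G p) s)"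
    "basis_elt s \<star> e p = basis_elt (section_compose s (diag_section G p))"
  using assms covering_sections_subset diag_section_covering[OF assms(1)]
  by (auto simp: e_elt_eq basis_elt_mult)

lemma e_left_pair: "s \<in> covering_sections G \<Longrightarrow> e (left_pair G s) \<star> basis_elt s = basis_elt s"
  and e_right_pair: "s \<in> covering_sections G \<Longrightarrow> basis_elt s \<star> e (right_pair G s) = basis_elt s"
  using diag_left_pair_compose diag_right_pair_compose
  by (simp_all add: e_basis_elt left_pair_normal right_pair_normal)

lemma right_pair_compose_diag:
  assumes s: "s \<in> covering_sections G" and q: "q \<in> pairs" and le: "pair_le (right_pair G s) q"
  shows "right_pair G (section_compose s (diag_section G q)) = q"
    and "section_le s (section_compose s (diag_section G q))"
proof -
  have eq: "section_converse (section_compose s (diag_section G q)) =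
    section_compose (diag_section G q) (section_converse s)"
    by (simp only: section_converse_compose section_converse_diag[OF q])
  note * = left_pair_compose_diag[OF section_converse_covering[OF s] q, unfolded left_pair_converse,
      OF le, folded eq]
  show "right_pair G (section_compose s (diag_section G q)) = q"
    using *(1) by (simp only: left_pair_converse)
  show "section_le s (section_compose s (diag_section G q))"
    using *(2) by (auto simp: section_le_def section_converse_def)
qed

text \<open>
  Both products equal \<open>f\<^bsub>p\<^esub> s f\<^bsub>q\<^esub>\<close>: if \<open>p \<prec> p'\<close>, then \<open>e\<^bsub>p'\<^esub> s = s e\<^bsub>q'\<^esub>\<close> for some \<open>q \<prec> q'\<close>, and
  \<open>e\<^bsub>q'\<^esub> f\<^bsub>q\<^esub> = 0\<close>.
\<close>

lemma f_basis_elt_commute: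
  assumes s: "s \<in> covering_sections G"
  shows "f (left_pair G s) \<star> basis_elt s =
    (basis_elt s \<star> f (right_pair G s) :: ('a, 'a, 'k) section_elts)"
proof -
  let ?p = "left_pair G s" and ?q = "right_pair G s"
  let ?b = "basis_elt :: _ \<Rightarrow> ('a, 'a, 'k) section_elts"
  have p: "?p \<in> pairs" and q: "?q \<in> pairs" by (rule left_pair_normal[OF s] right_pair_normal[OF s])+
  have 1: "e p' \<star> ?b s \<star> f ?q = 0" if p': "p' \<in> pairs" "pair_le ?p p'" "?p \<noteq> p'" for p'
  proof -
    let ?s = "section_compose (diag_section G p') s"
    have c: "?s \<in> covering_sections G"
      by (rule section_compose_covering[OF diag_section_covering[OF p'(1)] s])
    note l = left_pair_compose_diag[OF s p'(1,2)]
    have s': "?s = section_compose s (diag_section G (right_pair G ?s))"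
      by (rule section_le_diag_right[OF s c l(2), symmetric])
    have "\<not> pair_le (right_pair G ?s) ?q"
    proof
      assume "pair_le (right_pair G ?s) ?q"
      then have "right_pair G ?s = ?q"
        using pair_le_right_pair[OF l(2)] pair_le_antisym by blast
      then have "?s = s" using s' diag_right_pair_compose[OF s] by metis
      then show False using l(1) p'(3) by simp
    qed
    moreover have "right_pair G ?s \<in> pairs" by (rule right_pair_normal[OF c])
    moreover have "e p' \<star> ?b s = ?b s \<star> e (right_pair G ?s)"
      using e_basis_elt[OF p'(1) s] e_basis_elt[OF right_pair_normal[OF c] s] s' by metis
    ultimately show ?thesis
      using e_f[OF _ q, of "right_pair G ?s"]
        star_assoc[OF cov_burnside[OF s] e_burnside f_burnside, of "right_pair G ?s" ?q] by simp
  qed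
  have 2: "f ?p \<star> (?b s \<star> e q') = 0" if q': "q' \<in> pairs" "pair_le ?q q'" "?q \<noteq> q'" for q'
  proof -
    let ?s = "section_compose s (diag_section G q')"
    have c: "?s \<in> covering_sections G"
      by (rule section_compose_covering[OF s diag_section_covering[OF q'(1)]])
    note r = right_pair_compose_diag[OF s q'(1,2)]
    have s': "?s = section_compose (diag_section G (left_pair G ?s)) s"
      by (rule section_le_diag_left[OF s c r(2), symmetric])
    have "\<not> pair_le (left_pair G ?s) ?p"
    proof
      assume "pair_le (left_pair G ?s) ?p"
      then have "left_pair G ?s = ?p"
        using pair_le_left_pair[OF r(2)] pair_le_antisym by blast
      then have "?s = s" using s' diag_left_pair_compose[OF s] by metis
      then show False using r(1) q'(3) by simp
    qed
    moreover have l: "left_pair G ?s \<in> pairs" by (rule left_pair_normal[OF c])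
    moreover have "?b s \<star> e q' = e (left_pair G ?s) \<star> ?b s"
      using e_basis_elt[OF q'(1) s] e_basis_elt[OF l s] s' by metis
    ultimately show ?thesis
      using f_e[OF _ p, of "left_pair G ?s"]
        star_assoc[OF f_burnside e_burnside cov_burnside[OF s], of "left_pair G ?s" ?p] by simp
  qed
  have "f ?p \<star> ?b s \<star> f ?q = ?b s \<star> f ?q"
    unfolding f_elt_eq_e_plus[OF p] section_comp_add_left section_comp_sum_left section_comp_scale_left
    using 1 by (simp add: e_left_pair[OF s])
  moreover have "f ?p \<star> (?b s \<star> f ?q) = f ?p \<star> ?b s"
    unfolding f_elt_eq_e_plus[OF q] section_comp_add_right section_comp_sum_right section_comp_scale_right
    using 2 by (simp add: e_right_pair[OF s])
  ultimately show ?thesis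
    by (simp add: star_assoc cov_burnside[OF s] f_burnside)
qed

text \<open>
  Insert \<open>e\<^bsub>l\<^esub> s = s\<close> for the left pair \<open>l\<close> of \<open>s\<close>.
  If \<open>l\<close> is not below \<open>a\<close>, then \<open>f\<^bsub>a\<^esub> e\<^bsub>l\<^esub> =
  0\<close>; otherwise \<open>f\<^bsub>a\<^esub> = f\<^bsub>a\<^esub> e\<^bsub>a\<^esub>\<close>
  replaces \<open>s\<close> by a section with left pair \<open>a\<close>.
\<close>

lemma f_basis_elt:
  assumes s: "s \<in> covering_sections G" and a: "a \<in> pairs"
  shows "\<not> pair_le (left_pair G s) a \<Longrightarrow> f a \<star> basis_elt s = (0 :: ('a, 'a, 'k) section_elts)"
    and "pair_le (left_pair G s) a \<Longrightarrow> f a \<star> basis_elt s =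
      (basis_elt (section_compose (diag_section G a) s) \<star>
        f (right_pair G (section_compose (diag_section G a) s)) :: ('a, 'a, 'k) section_elts)"
proof -
  note b = cov_burnside[OF s] e_burnside f_burnside
  have l: "left_pair G s \<in> pairs" by (rule left_pair_normal[OF s])
  have "f a \<star> basis_elt s = (f a \<star> e (left_pair G s) \<star> basis_elt s :: ('a, 'a, 'k) section_elts)"
    using e_left_pair[OF s] l by (simp add: star_assoc b)
  then show "f a \<star> basis_elt s = (0 :: ('a, 'a, 'k) section_elts)" if "\<not> pair_le (left_pair G s) a"
    using that f_e[OF l a] by simp
  show "f a \<star> basis_elt s = (basis_elt (section_compose (diag_section G a) s) \<star>
        f (right_pair G (section_compose (diag_section G a) s)) :: ('a, 'a, 'k) section_elts)"
    if le: "pair_le (left_pair G s) a"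
  proof -
    let ?s = "section_compose (diag_section G a) s"
    have c: "?s \<in> covering_sections G"
      by (rule section_compose_covering[OF diag_section_covering[OF a] s])
    have "f a \<star> basis_elt s = (f a \<star> e a \<star> basis_elt s :: ('a, 'a, 'k) section_elts)"
      using f_e[OF a a] by simp
    also have "\<dots> = f a \<star> basis_elt ?s"
      using a e_basis_elt(1)[OF a s] by (simp add: star_assoc b)
    finally show ?thesis
      using f_basis_elt_commute[OF c] left_pair_compose_diag(1)[OF s a le] by simp
  qed
qed

lemma covering_induct [consumes 1, case_names basis add scale zero]:
  assumes x: "(x :: ('a, 'a, 'k) section_elts) \<in> covering_algebra G"
    and basis: "\<And>s. s \<in> covering_sections G \<Longrightarrow> P (basis_elt s)"
    and add: "\<And>x y. P x \<Longrightarrow> P y \<Longrightarrow> P (x + y)"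
    and scale: "\<And>c x. P x \<Longrightarrow> P (scale c x)"
    and zero: "P 0"
  shows "P x"
  using x unfolding covering_algebra_span
proof (rule scale.span_induct)
  show "scale.subspace {x. P x}" using add scale zero by (intro scale.subspaceI) auto
qed (use basis in auto)

text \<open>
  By \<open>f_basis_elt\<close>, \<open>f\<^bsub>a\<^esub> s\<close> is zero or ends in
  \<open>f\<^bsub>q\<^esub>\<close> for a pair \<open>q\<close> linked to \<open>a\<close>, which is
  orthogonal to \<open>f\<^bsub>b\<^esub>\<close>.
\<close>

lemma f_unlinked:
  assumes a: "a \<in> pairs" and b: "b \<in> pairs" and nl: "\<not> linked G a b" and x: "x \<in> covering_algebra G"
  shows "f a \<star> x \<star> f b = (0 :: ('a, 'a, 'k) section_elts)"
  using x
proof (induction x rule: covering_induct)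
  case (basis s)
  show ?case
  proof (cases "pair_le (left_pair G s) a")
    case True
    let ?s = "section_compose (diag_section G a) s"
    have c: "?s \<in> covering_sections G"
      by (rule section_compose_covering[OF diag_section_covering[OF a] basis])
    have "linked G a (right_pair G ?s)"
      unfolding linked_iff using c left_pair_compose_diag(1)[OF basis a True] by blast
    then have "right_pair G ?s \<noteq> b" using nl by blast
    then show ?thesis
      using f_basis_elt(2)[OF basis a True] f_orthogonal[OF right_pair_normal[OF c] b]
        star_assoc[OF cov_burnside[OF c] f_burnside f_burnside, of "right_pair G ?s" b] by simp
  qed (use f_basis_elt(1)[OF basis a] in simp)
qed (simp_all add: section_comp_linear)

lemma linkage_class_subset: "linkage_class G p \<subseteq> pairs"
  and linkage_class_self: "p \<in> pairs \<Longrightarrow> p \<in> linkage_class G p"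
  and linkage_class_eq: "q \<in> linkage_class G p \<Longrightarrow> linkage_class G q = linkage_class G p"
  using linked_refl linked_sym linked_trans unfolding linkage_class_def by blast+

lemma f_sandwich:
  assumes x: "(x :: ('a, 'a, 'k) section_elts) \<in> covering_algebra G"
  shows "x = (\<Sum>b\<in>pairs. x \<star> f b)" "x = (\<Sum>a\<in>pairs. f a \<star> x)"
  using star_one[of x] x covering_subset_burnside
  unfolding section_comp_sum_right[symmetric] section_comp_sum_left[symmetric] sum_f by auto

text \<open>
  Both products equal the sum of \<open>f\<^bsub>a\<^esub> x f\<^bsub>b\<^esub>\<close> over
  \<open>a\<close> and \<open>b\<close> in the class, since the terms with exactly one of
  \<open>a\<close> and \<open>b\<close> in the class vanish.
\<close>

lemma f_class_central:
  assumes p: "p \<in> pairs" and x: "x \<in> covering_algebra G"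
  shows "f_class G (linkage_class G p) \<star> x =
    (x \<star> f_class G (linkage_class G p) :: ('a, 'a, 'k) section_elts)"
proof -
  let ?C = "linkage_class G p"
  note fin = finite_normal_pairs and sub = linkage_class_subset[of p]
  have C: "\<not> linked G a b" if "a \<in> ?C \<longleftrightarrow> b \<notin> ?C" "a \<in> pairs" "b \<in> pairs" for a b
    using that linked_sym linked_trans unfolding linkage_class_def by blast
  have cl: "f a \<star> x \<in> covering_algebra G" "x \<star> f a \<in> covering_algebra G" for a
    using star_covering f_elt_covering x by blast+
  have "f_class G ?C \<star> x = (\<Sum>a\<in>?C. \<Sum>b\<in>?C. f a \<star> x \<star> f b)"
    unfolding f_class_def section_comp_sum_left
  proof (rule sum.cong[OF refl])
    fix a assume a: "a \<in> ?C"
    have "f a \<star> x = (\<Sum>b\<in>pairs. f a \<star> x \<star> f b)" by (rule f_sandwich(1)[OF cl(1)])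
    also have "\<dots> = (\<Sum>b\<in>?C. f a \<star> x \<star> f b)"
      using fin sub a by (intro sum.mono_neutral_right ballI f_unlinked[OF _ _ C x]) auto
    finally show "f a \<star> x = (\<Sum>b\<in>?C. f a \<star> x \<star> f b)" .
  qed
  also have "\<dots> = (\<Sum>b\<in>?C. \<Sum>a\<in>?C. f a \<star> x \<star> f b)" by (rule sum.swap)
  also have "\<dots> = x \<star> f_class G ?C"
    unfolding f_class_def section_comp_sum_right
  proof (rule sum.cong[OF refl])
    fix b assume b: "b \<in> ?C"
    have "(\<Sum>a\<in>?C. f a \<star> x \<star> f b) = (\<Sum>a\<in>pairs. f a \<star> x \<star> f b)"
      using fin sub b by (intro sum.mono_neutral_left ballI f_unlinked[OF _ _ C x]) auto
    also have "\<dots> = (\<Sum>a\<in>pairs. f a \<star> (x \<star> f b))"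
      using x covering_subset_burnside by (intro sum.cong refl star_assoc f_burnside) auto
    also have "\<dots> = x \<star> f b" by (rule f_sandwich(2)[OF cl(2), symmetric])
    finally show "(\<Sum>a\<in>?C. f a \<star> x \<star> f b) = x \<star> f b" .
  qed
  finally show ?thesis .
qed

end

section \<open>The ideal of elements factoring through smaller groups\<close>

context fin_group_over
begin

abbreviation EE :: "('k, ('a, 'a, 'k) section_elts) module" where
  "EE \<equiv> section_algebra G"

abbreviation Ec :: "('a, 'a, 'k) section_elts set" where
  "Ec \<equiv> covering_algebra G"

abbreviation I :: "('a, 'a, 'k) section_elts set" where
  "I \<equiv> essential_ideal G"

abbreviation Red :: "('a set \<times> 'a set) set" where
  "Red \<equiv> reduced_pairs k G"

definition factoring_products :: "('a, 'a, 'k) section_elts set" where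
  "factoring_products = {section_comp G H G x y | (H :: nat monoid) x y.
        group H \<and> finite (carrier H) \<and> Coset.order H < Coset.order G \<and>
        x \<in> section_burnside G H \<and> y \<in> section_burnside H G}"

lemma E_ring: "ring EE"
  by (rule k_algebra.is_ring[OF k_algebra_section_algebra])

lemma factoring_productsE:
  assumes "z \<in> factoring_products"
  obtains H :: "nat monoid" and x y where "fin_group H" "Coset.order H < Coset.order G"
    "x \<in> section_burnside G H" "y \<in> section_burnside H G" "z = section_comp G H G x y"
  using assms unfolding factoring_products_def mem_Collect_eq
proof (elim exE conjE)
  fix H :: "nat monoid" and x y
  assume "group H" "finite (carrier H)"
  then have "fin_group H" by (simp add: fin_group_def fin_group_axioms_def)
  then show "Coset.order H < Coset.order G \<Longrightarrow> x \<in> section_burnside G H \<Longrightarrow> y \<in> section_burnside H G \<Longrightarrow>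
    z = section_comp G H G x y \<Longrightarrow> thesis" by (rule that)
qed

lemma factoring_productsI:
  assumes "fin_group (H :: nat monoid)" "Coset.order H < Coset.order G"
    "x \<in> section_burnside G H" "y \<in> section_burnside H G"
  shows "section_comp G H G x y \<in> factoring_products"
  unfolding factoring_products_def mem_Collect_eq
  using assms fin_group.finite_carrier[OF assms(1)] fin_group.axioms(1)[OF assms(1)]
  by (intro exI[of _ H] exI[of _ x] exI[of _ y] conjI refl)

lemma factoring_products_subset: "factoring_products \<subseteq> section_burnside G G"
proof
  fix z assume "z \<in> factoring_products"
  then show "z \<in> section_burnside G G"
    by (rule factoring_productsE) (simp add: section_comp_closed[OF fin_group_axioms _ fin_group_axioms])
qed

lemma I_ideal: "ideal I EE"
  unfolding essential_ideal_def factoring_products_def[symmetric]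
  using factoring_products_subset by (intro ring.genideal_ideal[OF E_ring]) simp

lemma factoring_products_in_I: "factoring_products \<subseteq> I"
  unfolding essential_ideal_def factoring_products_def[symmetric]
  using factoring_products_subset by (intro ring.genideal_self[OF E_ring]) simp

lemma I_subset: "I \<subseteq> section_burnside G G"
  using additive_subgroup.a_subset[OF ideal.axioms(1)[OF I_ideal]] by simp

lemma I_star:
  assumes "x \<in> I" "y \<in> section_burnside G G"
  shows "y \<star> x \<in> I" "x \<star> y \<in> I"
  using ideal.I_l_closed[OF I_ideal assms(1), of y] ideal.I_r_closed[OF I_ideal assms(1), of y] assms(2)
  by simp_all

lemma subspace_I: "scale.subspace I"
proof (rule scale.subspaceI)
  note a = ideal.axioms(1)[OF I_ideal]
  show "0 \<in> I" using additive_subgroup.zero_closed[OF a] by simp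
  show "x + y \<in> I" if "x \<in> I" "y \<in> I" for x y
    using additive_subgroup.a_closed[OF a that] by simp
  show "scale c x \<in> I" if "x \<in> I" for c x
  proof -
    have "scale c (e top_pair) \<in> section_burnside G G"
      using e_burnside[OF top_pair_normal] scale.subspace_scale[OF subspace_burnside] by blast
    from I_star(1)[OF that this] show ?thesis
      using star_one(1)[of x] subsetD[OF I_subset that] by (auto simp: section_comp_scale_left)
  qed
qed

lemma I_closed:
  "0 \<in> I" "x \<in> I \<Longrightarrow> y \<in> I \<Longrightarrow> x + y \<in> I" "x \<in> I \<Longrightarrow> y \<in> I \<Longrightarrow> x - y \<in> I" "x \<in> I \<Longrightarrow> scale c x \<in> I"
  using subspace_I scale.subspace_0 scale.subspace_add scale.subspace_diff scale.subspace_scale by blast+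

text \<open>
  By associativity the span of the products through smaller groups is already closed under
  multiplication from both sides.
\<close>

lemma I_eq_span: "I = scale.span factoring_products"
proof
  show "scale.span factoring_products \<subseteq> I"
    by (rule scale.span_minimal[OF factoring_products_in_I subspace_I])
  have sub: "scale.span factoring_products \<subseteq> section_burnside G G"
    by (rule scale.span_minimal[OF factoring_products_subset subspace_burnside])
  have prod: "z \<star> x \<in> scale.span factoring_products \<and> x \<star> z \<in> scale.span factoring_products"
    if x: "x \<in> scale.span factoring_products" and z: "z \<in> section_burnside G G" for x z
    using x
  proof (rule scale.span_induct)
    show "scale.subspace {x. z \<star> x \<in> scale.span factoring_products \<and> x \<star> z \<in> scale.span factoring_products}"
      by (intro scale.subspaceI)
         (auto simp: section_comp_linear scale.span_zero intro: scale.span_add scale.span_scale)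
    fix y assume "y \<in> factoring_products"
    then obtain H :: "nat monoid" and a b where H: "fin_group H" and y: "Coset.order H < Coset.order G"
      "a \<in> section_burnside G H" "b \<in> section_burnside H G" "y = section_comp G H G a b"
      by (rule factoring_productsE)
    have "z \<star> y = section_comp G H G (section_comp G G H z a) b"
      unfolding y(4)
      by (rule section_comp_assoc[OF fin_group_axioms fin_group_axioms H fin_group_axioms z y(2,3), symmetric])
    moreover have "y \<star> z = section_comp G H G a (section_comp H G G b z)"
      unfolding y(4)
      by (rule section_comp_assoc[OF fin_group_axioms H fin_group_axioms fin_group_axioms y(2,3) z])
    moreover have "section_comp G G H z a \<in> section_burnside G H"
      by (rule section_comp_closed[OF fin_group_axioms fin_group_axioms H z y(2)])
    moreover have "section_comp H G G b z \<in> section_burnside H G"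
      by (rule section_comp_closed[OF H fin_group_axioms fin_group_axioms y(3) z])
    ultimately show "z \<star> y \<in> scale.span factoring_products \<and> y \<star> z \<in> scale.span factoring_products"
      using factoring_productsI[OF H y(1)] y(2,3) by (simp add: scale.span_base)
  qed
  interpret ring EE by (rule E_ring)
  have neg: "\<ominus>\<^bsub>EE\<^esub> x = - x" if "x \<in> section_burnside G G" for x
    using that by (intro minus_equality) (auto intro: scale.subspace_neg[OF subspace_burnside])
  have "ideal (scale.span factoring_products) EE"
  proof (rule idealI[OF E_ring])
    show "subgroup (scale.span factoring_products) (add_monoid EE)"
    proof (rule add.subgroupI)
      show "\<ominus>\<^bsub>EE\<^esub> x \<in> scale.span factoring_products" if "x \<in> scale.span factoring_products" for x
        unfolding neg[OF subsetD[OF sub that]] by (rule scale.span_neg[OF that])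
    qed (use sub in \<open>auto intro: scale.span_add scale.span_zero\<close>)
  qed (use prod in auto)
  then show "I \<subseteq> scale.span factoring_products"
    unfolding essential_ideal_def factoring_products_def[symmetric]
    by (rule ring.genideal_minimal[OF E_ring]) (rule scale.span_superset)
qed

text \<open>
  The first factor covers the smaller group on the right and \<open>k\<^sub>2(S)\<close> is trivial, so
  the product of the two sections is exactly their composite.
\<close>

lemma factor_in_I:
  fixes H :: "nat monoid"
  assumes H: "fin_group H" "Coset.order H < Coset.order G"
    and TS: "(T, S) \<in> sections (G \<times>\<times> H)" and VU: "(V, U) \<in> sections (H \<times>\<times> G)"
    and onto: "Range T = carrier H" and ker: "k2 G S = {\<one>\<^bsub>H\<^esub>}"
  shows "(basis_elt (T O V, S O U) :: ('a, 'a, 'k) section_elts) \<in> I"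
proof -
  interpret H: fin_group H by (rule H)
  interpret three_groups G H G by unfold_locales
  have "rel_subgroup H G U" using VU by (simp add: mem_sections[OF groups(2,3)])
  then have "k2 G S \<inter> k1 G U = {\<one>\<^bsub>H\<^esub>}" using ker rel_subgroupD(2) by (auto simp: k1_def)
  then have eq: "section_comp G H G (normalized_elt G H (T, S)) (normalized_elt H G (V, U)) =
    (basis_elt (T O V, S O U) :: ('a, 'a, 'k) section_elts)"
    using section_comp_right_covering[OF TS VU onto] by simp
  have "section_comp G H G (normalized_elt G H (T, S)) (normalized_elt H G (V, U) :: (nat, 'a, 'k) section_elts)
    \<in> factoring_products"
    by (rule factoring_productsI[OF H normalized_elt_in_section_burnside[OF TS]
          normalized_elt_in_section_burnside[OF VU]])
  then show ?thesis using factoring_products_in_I eq by auto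
qed

text \<open>
  A section that does not cover on the right factors through the quotient \<open>p\<^sub>2(T) / k\<^sub>2(S)\<close> of smaller
  order; on the left, factor the converse section.
\<close>

lemma noncovering_in_I:
  assumes s: "s \<in> sections (G \<times>\<times> G)" "s \<notin> covering_sections G"
  shows "(basis_elt s :: ('a, 'a, 'k) section_elts) \<in> I"
proof -
  note gr = group_axioms group_axioms
  \<comment> \<open>Here \<open>n\<close> is the order of \<open>p\<^sub>2(T) / k\<^sub>2(S)\<close>.\<close>
  have small: "n < Coset.order G"
    if TS: "(T, S) \<in> sections (G \<times>\<times> G)" and n: "n * card (k2 G S) = card (Range T)"
      and nc: "Range T \<noteq> carrier G \<or> k2 G S \<noteq> {\<one>}" for T S and n :: nat
  proof -
    note T = sections_subset[OF gr TS]
    have R: "Range T \<subseteq> carrier G" using T(1) by blast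
    have K: "subgroup (k2 G S) G" by (rule subgroup_k2[OF gr T(4)])
    have finK: "finite (k2 G S)" using finite_subset[OF subgroup.subset[OF K]] by simp
    have one: "\<one> \<in> k2 G S" by (rule subgroup.one_closed[OF K])
    then have K0: "card (k2 G S) > 0" using finK by (auto simp: card_gt_0_iff)
    have le: "card (Range T) \<le> card (carrier G)" using R by (intro card_mono) auto
    have "\<one> \<in> Range T" using rel_subgroupD(2)[OF T(3)] by blast
    then have R0: "card (Range T) > 0" using R by (auto simp: card_gt_0_iff intro: finite_subset)
    show ?thesis unfolding Coset.order_def
    proof (cases "Range T = carrier G")
      case False
      then have "card (Range T) < card (carrier G)" using R by (intro psubset_card_mono) auto
      moreover have "n \<le> n * card (k2 G S)" using K0 by simp
      ultimately show "n < card (carrier G)" using n by linarith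
    next
      case True
      then have "card (k2 G S) \<noteq> 1" using nc one by (metis card_1_singletonE singletonD)
      then have "2 \<le> card (k2 G S)" using K0 by linarith
      then have "n * 2 \<le> n * card (k2 G S)" by simp
      then show "n < card (carrier G)" using n R0 le by linarith
    qed
  qed
  obtain T S where s': "s = (T, S)" by fastforce
  have TS: "(T, S) \<in> sections (G \<times>\<times> G)" using s s' by simp
  show ?thesis
  proof (cases "Range T = carrier G \<and> k2 G S = {\<one>}")
    case False
    obtain N :: "nat monoid" and R where N: "fin_group N" "Coset.order N * card (k2 G S) = card (Range T)"
      "(R, R) \<in> sections (G \<times>\<times> N)" "Range (T O R) = carrier N" "k2 G (S O R) = {\<one>\<^bsub>N\<^esub>}"
      "(T O R) O R\<inverse> = T" "(S O R) O R\<inverse> = S"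
      using section_factor[OF fin_group_axioms fin_group_axioms TS] by metis
    interpret N: fin_group N by (rule N)
    have "(basis_elt ((T O R) O R\<inverse>, (S O R) O R\<inverse>) :: ('a, 'a, 'k) section_elts) \<in> I"
      using False N(2) by (intro factor_in_I[OF N(1) small[OF TS]] N(4,5)
          sections_comp[OF gr N.group_axioms TS N(3)] sections_converse[OF group_axioms N.group_axioms N(3)]) auto
    then show ?thesis by (simp only: N(6,7) s')
  next
    case True
    have TS': "(T\<inverse>, S\<inverse>) \<in> sections (G \<times>\<times> G)" by (rule sections_converse[OF gr TS])
    have nc: "Range (T\<inverse>) \<noteq> carrier G \<or> k2 G (S\<inverse>) \<noteq> {\<one>}"
      using s True unfolding s' covering_sections_def by (auto simp: k1_def k2_def)
    obtain N :: "nat monoid" and R where N: "fin_group N" "Coset.order N * card (k2 G (S\<inverse>)) = card (Range (T\<inverse>))"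
      "(R, R) \<in> sections (G \<times>\<times> N)" "(T\<inverse> O R) O R\<inverse> = T\<inverse>" "(S\<inverse> O R) O R\<inverse> = S\<inverse>"
      "k2 G R = {\<one>\<^bsub>N\<^esub>}" "Range R = carrier N"
      using section_factor[OF fin_group_axioms fin_group_axioms TS'] by metis
    interpret N: fin_group N by (rule N)
    have "((T\<inverse> O R) O R\<inverse>)\<inverse> = R O (R\<inverse> O T)" "((S\<inverse> O R) O R\<inverse>)\<inverse> = R O (R\<inverse> O S)"
      by (simp_all add: converse_relcomp)
    then have eq: "R O (R\<inverse> O T) = T" "R O (R\<inverse> O S) = S" unfolding N(4,5) by simp_all
    have "(basis_elt (R O (R\<inverse> O T), R O (R\<inverse> O S)) :: ('a, 'a, 'k) section_elts) \<in> I"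
      using nc N(2) by (intro factor_in_I[OF N(1) small[OF TS']] N(3,6,7)
          sections_comp[OF N.group_axioms gr sections_converse[OF group_axioms N.group_axioms N(3)] TS]) auto
    then show ?thesis by (simp only: eq s')
  qed
qed

lemma section_algebra_covering_plus_ideal:
  assumes "x \<in> section_burnside G G"
  obtains y z where "y \<in> Ec" "z \<in> I" "x = y + z"
proof -
  have "x \<in> scale.span (basis_elt ` covering_sections G \<union> basis_elt ` (sections (G \<times>\<times> G) - covering_sections G))"
    using assms covering_sections_subset
    by (simp add: section_burnside_span_basis image_Un[symmetric] Un_absorb1)
  then obtain y z where "x = y + z" "y \<in> scale.span (basis_elt ` covering_sections G)"
    "z \<in> scale.span (basis_elt ` (sections (G \<times>\<times> G) - covering_sections G))"
    unfolding scale.span_Un by blast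
  moreover have "scale.span (basis_elt ` (sections (G \<times>\<times> G) - covering_sections G)) \<subseteq> I"
    by (rule scale.span_minimal[OF _ subspace_I]) (use noncovering_in_I in auto)
  ultimately show ?thesis using that by (auto simp: covering_algebra_span)
qed

text \<open>
  If the first factor of a product through a smaller group has a covering constituent, then its left
  invariants form a pair whose idempotent already lies in the ideal: compose the section, pushed
  forward to \<open>p\<^sub>2(T) / k\<^sub>2(S)\<close>, with its converse.
\<close>

lemma left_invariants_in_I:
  fixes H :: "nat monoid"
  assumes H: "fin_group H" "Coset.order H < Coset.order G"
    and TS: "(T, S) \<in> sections (G \<times>\<times> H)"
    and onto: "Domain T = carrier G" and ker: "k1 H S = {\<one>}"
  shows "(k1 H T, Domain S) \<in> pairs" "e (k1 H T, Domain S) \<in> I"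
proof -
  interpret H: fin_group H by (rule H)
  note gr = group_axioms H.group_axioms and T = sections_subset[OF group_axioms H.group_axioms TS]
  obtain N :: "nat monoid" and R where N: "fin_group N" "Coset.order N * card (k2 G S) = card (Range T)"
      "(R, R) \<in> sections (H \<times>\<times> N)" "Range (T O R) = carrier N" "k2 G (S O R) = {\<one>\<^bsub>N\<^esub>}"
      "(T O R) O R\<inverse> = T" "(S O R) O R\<inverse> = S"
    using section_factor[OF fin_group_axioms H(1) TS] by metis
  interpret N: fin_group N by (rule N)
  have TR: "(T O R, S O R) \<in> sections (G \<times>\<times> N)"
    by (rule sections_comp[OF gr N.group_axioms TS N(3)])
  have "Range T \<subseteq> carrier H" using T(1) by blast
  then have "card (Range T) \<le> card (carrier H)" by (intro card_mono) auto
  moreover have "\<one>\<^bsub>H\<^esub> \<in> k2 G S" using rel_subgroupD(2)[OF T(4)] by (simp add: k2_def)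
  then have "card (k2 G S) > 0" using T(2) finite_subset[of "k2 G S" "carrier H"]
    by (auto simp: card_gt_0_iff k2_def)
  then have "Coset.order N \<le> Coset.order N * card (k2 G S)" by simp
  ultimately have "Coset.order N < Coset.order G" using N(2) H(2) unfolding Coset.order_def by linarith
  \<comment> \<open>The pushed-forward section times its converse; the middle factor \<open>R O R\<inverse>\<close> is absorbed by \<open>T\<close> and \<open>S\<close>.\<close>
  then have "(basis_elt ((T O R) O (T O R)\<inverse>, (S O R) O (S O R)\<inverse>) :: ('a, 'a, 'k) section_elts) \<in> I"
    by (intro factor_in_I[OF N(1) _ TR sections_converse[OF group_axioms N.group_axioms TR] N(4,5)])
  moreover have "(T O R) O (T O R)\<inverse> = ((T O R) O R\<inverse>) O T\<inverse>" "(S O R) O (S O R)\<inverse> = ((S O R) O R\<inverse>) O S\<inverse>"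
    by (simp_all add: converse_relcomp O_assoc)
  ultimately have *: "(basis_elt (T O T\<inverse>, S O S\<inverse>) :: ('a, 'a, 'k) section_elts) \<in> I"
    by (simp only: N(6,7))
  have inj: "a = a'" if "(a, b) \<in> S" "(a', b) \<in> S" for a a' b
  proof -
    have c: "a \<in> carrier G" "a' \<in> carrier G" "b \<in> carrier H" using that T(2) by auto
    have "(a \<otimes> inv a', \<one>\<^bsub>H\<^esub>) \<in> S"
      using rel_subgroupD(5)[OF T(4) that(1) rel_subgroupD(6)[OF T(4) that(2)]] c by simp
    then have "a \<otimes> inv a' = \<one>" using ker by (auto simp: k1_def)
    then show ?thesis using c by (metis inv_equality inv_inv inv_closed)
  qed
  let ?d = "(T O T\<inverse>, S O S\<inverse>)"
  have dom: "Domain (T O T\<inverse>) = carrier G" "Range (T O T\<inverse>) = carrier G" using onto by blast+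
  have "S O S\<inverse> \<subseteq> Id" using inj by blast
  moreover have "(\<one>, \<one>) \<in> S O S\<inverse>" using rel_subgroupD(2)[OF T(4)] by blast
  ultimately have "k1 G (S O S\<inverse>) = {\<one>}" "k2 G (S O S\<inverse>) = {\<one>}"
    unfolding k1_def k2_def by blast+
  then have d: "?d \<in> covering_sections G"
    using dom sections_comp[OF gr group_axioms TS sections_converse[OF gr TS]]
    by (simp add: covering_sections_def)
  have eq: "?d = diag_section G (left_pair G ?d)"
  proof (rule diag_sectionI[OF d])
    show "Id_on (carrier G) \<subseteq> fst ?d" using onto by auto
  qed (use \<open>S O S\<inverse> \<subseteq> Id\<close> in simp)
  have "(g, \<one>\<^bsub>H\<^esub>) \<in> T" if gh: "(g, h) \<in> T" "(\<one>, h) \<in> T" for g h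
    using rel_subgroupD(5)[OF T(3) gh(1) rel_subgroupD(6)[OF T(3) gh(2)]] T(1) gh by auto
  then have "left_pair G ?d = (k1 H T, Domain S)"
    using rel_subgroupD(2)[OF T(3)] by (auto simp: left_pair_def k1_def)
  then show "(k1 H T, Domain S) \<in> pairs" "e (k1 H T, Domain S) \<in> I"
    using * eq left_pair_normal[OF d] e_elt_eq[of "(k1 H T, Domain S)", where 'k = 'k] by simp_all
qed

lemma e_in_I_mono:
  assumes p: "p \<in> pairs" "q \<in> pairs" "pair_le p q" "e p \<in> I"
  shows "e q \<in> I"
  using I_star(2)[OF p(4) e_burnside[OF p(2)]] e_mult[OF p(1,2)] pair_join_absorb(1)[OF p(1-3)] by simp

text \<open>
  The left pair of a covering constituent lies above a pair whose idempotent is in \<open>I\<close>; if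
  it were below \<open>p\<close>, then \<open>e\<^bsub>p\<^esub>\<close> would be in \<open>I\<close> as
  well.
\<close>

lemma covering_constituent_annihilated:
  fixes H :: "nat monoid"
  assumes H: "fin_group H" "Coset.order H < Coset.order G"
    and TS: "(T, S) \<in> sections (G \<times>\<times> H)" and VU: "(V, U) \<in> sections (H \<times>\<times> G)"
    and t: "t \<in> carrier H"
    and cov: "(T O twist H G t V, S O twist H G t U) \<in> covering_sections G" and p: "p \<in> Red"
  shows "f p \<star> basis_elt (T O twist H G t V, S O twist H G t U) = (0 :: ('a, 'a, 'k) section_elts)"
proof -
  interpret H: fin_group H by (rule H)
  let ?s = "(T O twist H G t V, S O twist H G t U)"
  note gr = group_axioms H.group_axioms and T = sections_subset[OF group_axioms H.group_axioms TS]
  have tw: "(twist H G t V, twist H G t U) \<in> sections (H \<times>\<times> G)"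
    by (rule twist_section[OF H.group_axioms group_axioms VU t])
  note V = sections_subset[OF H.group_axioms group_axioms tw]
  have one: "(\<one>\<^bsub>H\<^esub>, \<one>) \<in> twist H G t V" "(\<one>\<^bsub>H\<^esub>, \<one>) \<in> twist H G t U"
    using rel_subgroupD(2)[OF V(3)] rel_subgroupD(2)[OF V(4)] by auto
  have onto: "Domain T = carrier G" using cov_onto(1)[OF cov] T(1) by auto
  have ker: "k1 H S = {\<one>}"
    using cov_kernel(1)[OF cov] one(2) rel_subgroupD(2)[OF T(4)] by (auto simp: k1_def)
  let ?p = "(k1 H T, Domain S)"
  note p0 = left_invariants_in_I[OF H TS onto ker]
  have "pair_le ?p (left_pair G ?s)"
    using one(1) by (auto simp: pair_le_iff left_pair_def k1_def)
  then have "\<not> pair_le (left_pair G ?s) p"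
    using p e_in_I_mono[OF p0(1) _ _ p0(2), of p] pair_le_trans unfolding reduced_pairs_def by blast
  moreover have "p \<in> pairs" using p by (simp add: reduced_pairs_def)
  ultimately show ?thesis using f_basis_elt(1)[OF cov] by blast
qed

text \<open>
  An element of \<open>I\<close> is a combination of non-covering sections and of covering constituents
  of products through smaller groups. If it lies in \<open>E\<^sup>c\<close>, its non-covering part is
  zero, because a conjugate of a covering section is covering; each covering constituent is annihilated
  by \<open>f\<^bsub>p\<^esub>\<close>.
\<close>

lemma covering_ideal_annihilated:
  assumes z: "z \<in> Ec" "z \<in> I" and p: "p \<in> Red"
  shows "f p \<star> z = 0"
proof -
  let ?nc = "sections (G \<times>\<times> G) - covering_sections G"
  define J where "J = {z \<in> Ec. f p \<star> z = 0}"
  have J: "scale.subspace J"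
    unfolding J_def using subspace_covering[where 'k = 'k]
    by (intro scale.subspaceI) (auto simp: section_comp_linear scale.subspace_def)
  \<comment> \<open>The subspace \<open>Q\<close> contains \<open>I\<close>: it suffices to check products of basis elements, term by term.\<close>
  define Q where "Q = {x + y | x y. x \<in> scale.span (basis_elt ` ?nc) \<and> y \<in> J}"
  have Q: "scale.subspace Q"
    unfolding Q_def by (rule scale.subspace_sums[OF scale.subspace_span J])
  have QI: "x \<in> Q" if "x \<in> scale.span (basis_elt ` ?nc)" for x
    unfolding Q_def using that scale.subspace_0[OF J] by force
  have QJ: "x \<in> Q" if "x \<in> J" for x
    unfolding Q_def using that scale.span_zero[of "basis_elt ` ?nc"] by force
  have "factoring_products \<subseteq> Q"
  proof
    fix w assume "w \<in> factoring_products"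
    then obtain H :: "nat monoid" and x y where H: "fin_group H" and w: "Coset.order H < Coset.order G"
      "x \<in> section_burnside G H" "y \<in> section_burnside H G" "w = section_comp G H G x y"
      by (rule factoring_productsE)
    note gH = fin_group.axioms(1)[OF H]
    have x: "x \<in> scale.span (normalized_elt G H ` sections (G \<times>\<times> H))"
      and y: "y \<in> scale.span (normalized_elt H G ` sections (H \<times>\<times> G))"
      using w section_burnside_span[OF fin_group_axioms H] section_burnside_span[OF H fin_group_axioms] by auto
    show "w \<in> Q"
      unfolding w(4) section_comp_def
    proof (rule bilinear_extension_closed[OF x y Q]; clarify)
      fix T S V U assume TS: "(T, S) \<in> sections (G \<times>\<times> H)" and VU: "(V, U) \<in> sections (H \<times>\<times> G)"
      show "bilinear_extension (section_comp_basis G H G) (normalized_elt G H (T, S)) (normalized_elt H G (V, U)) \<in> Q"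
        unfolding section_comp_def[symmetric] section_comp_normalized_elt[OF fin_group_axioms H fin_group_axioms TS VU]
      proof (intro scale.subspace_sum[OF Q] scale.subspace_scale[OF Q])
        fix t assume t: "t \<in> carrier H"
        let ?s = "(T O twist H G t V, S O twist H G t U)"
        have s: "?s \<in> sections (G \<times>\<times> G)"
          by (rule sections_comp[OF group_axioms gH group_axioms TS
                twist_section[OF gH group_axioms VU t]])
        show "basis_elt ?s \<in> Q"
        proof (cases "?s \<in> covering_sections G")
          case True
          then show ?thesis
            using covering_constituent_annihilated[OF H w(1) TS VU t True p] basis_elt_covering[OF True]
            by (intro QJ) (simp add: J_def)
        next
          case False
          then show ?thesis using s by (intro QI scale.span_base) blast
        qed
      qed
    qed
  qed
  then have "I \<subseteq> Q" unfolding I_eq_span by (rule scale.span_minimal[OF _ Q])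
  then obtain x y where xy: "z = x + y" "x \<in> scale.span (basis_elt ` ?nc)" "y \<in> J"
    using z(2) unfolding Q_def by blast
  have "x = z - y" using xy(1) by simp
  then have "x \<in> Ec" using z(1) xy(3) scale.subspace_diff[OF subspace_covering] by (auto simp: J_def)
  then have "Poly_Mapping.keys x \<subseteq> section_class (G \<times>\<times> G) ` covering_sections G"
    by (simp add: covering_algebra_def)
  moreover have "Poly_Mapping.keys x \<subseteq> section_class (G \<times>\<times> G) ` ?nc"
    using xy(2) span_normalized_elt[OF fin_group_axioms fin_group_axioms, of ?nc] by auto
  moreover have "section_class (G \<times>\<times> G) ` covering_sections G \<inter> section_class (G \<times>\<times> G) ` ?nc = {}"
    using same_class_invariants(1) by fastforce
  ultimately have "Poly_Mapping.keys x = {}" by blast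
  then have "x = 0" by simp
  then show ?thesis using xy by (simp add: J_def)
qed

text \<open>
  Here \<open>f\<^bsub>p\<^esub> = e\<^bsub>p\<^esub> f\<^bsub>p\<^esub>\<close> with
  \<open>e\<^bsub>p\<^esub> \<in> I\<close>.
\<close>

lemma f_nonreduced_in_I:
  assumes "p \<in> pairs - Red" shows "f p \<in> I"
proof -
  have p: "p \<in> pairs" "e p \<in> I" using assms by (auto simp: reduced_pairs_def)
  from I_star(2)[OF p(2) f_burnside[of p]] show ?thesis using e_f[OF p(1) p(1)] by simp
qed

text \<open>
  If \<open>s\<close> has left pair \<open>p\<close> and right pair \<open>q\<close>, then
  \<open>e\<^bsub>p\<^esub> = s e\<^bsub>q\<^esub> s\<^sup>\<circ>\<close> for the converse
  \<open>s\<^sup>\<circ>\<close>.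
\<close>

lemma reduced_linked:
  assumes p: "p \<in> Red" and l: "linked G p q"
  shows "q \<in> Red"
proof (rule ccontr)
  assume nq: "q \<notin> Red"
  from l obtain s where s: "s \<in> covering_sections G" "left_pair G s = p" "right_pair G s = q"
    unfolding linked_iff by blast
  have pq: "p \<in> pairs" "q \<in> pairs" using s left_pair_normal right_pair_normal by blast+
  have c: "section_converse s \<in> covering_sections G" by (rule section_converse_covering[OF s(1)])
  have "e q \<in> I" using nq pq by (simp add: reduced_pairs_def)
  then have "basis_elt s \<star> e q \<star> basis_elt (section_converse s) \<in> I"
    by (intro I_star cov_burnside s(1) c)
  moreover have "basis_elt s \<star> e q = (basis_elt s :: ('a, 'a, 'k) section_elts)" using e_right_pair[OF s(1)] s(3) by simp
  moreover have "basis_elt s \<star> basis_elt (section_converse s) =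
      (basis_elt (section_compose s (section_converse s)) :: ('a, 'a, 'k) section_elts)"
    by (rule basis_elt_mult[OF s(1) subsetD[OF covering_sections_subset c]])
  then have "basis_elt s \<star> basis_elt (section_converse s) = (e p :: ('a, 'a, 'k) section_elts)"
    using compose_converse[OF s(1)] s(2) e_elt_eq[OF pq(1), where 'k = 'k] by simp
  ultimately show False using p by (simp add: reduced_pairs_def)
qed

end

section \<open>The covering algebra and its blocks\<close>

context fin_group_over
begin

abbreviation block :: "('a set \<times> 'a set) set \<Rightarrow> ('a, 'a, 'k) section_elts set" where
  "block C \<equiv> f_class G C <#\<^bsub>EE\<^esub> Ec"

lemma subalgebra_k_algebra:
  assumes B: "scale.subspace B" "B \<subseteq> section_burnside G G"
    and closed: "\<And>x y. x \<in> B \<Longrightarrow> y \<in> B \<Longrightarrow> x \<star> y \<in> B"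
    and u: "u \<in> B" "\<And>x. x \<in> B \<Longrightarrow> u \<star> x = x" "\<And>x. x \<in> B \<Longrightarrow> x \<star> u = x"
  shows "k_algebra (EE\<lparr>carrier := B, monoid.one := u\<rparr>)"
proof (rule k_algebra_spanI[where \<beta> = "section_comp_basis G G G" and U = B])
  have sB: "scale.span B = B" by (rule scale.span_eq_iff[THEN iffD2, OF B(1)])
  show "carrier (EE\<lparr>carrier := B, monoid.one := u\<rparr>) = scale.span B" by (simp add: sB)
  show "monoid.one (EE\<lparr>carrier := B, monoid.one := u\<rparr>) \<in> scale.span B" by (simp add: sB u)
  show "bilinear_extension (section_comp_basis G G G) x y \<in> scale.span B" if "x \<in> B" "y \<in> B" for x y
    using closed[OF that] by (simp add: sB section_comp_def)
  show "bilinear_extension (section_comp_basis G G G) (bilinear_extension (section_comp_basis G G G) x y) z =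
     bilinear_extension (section_comp_basis G G G) x (bilinear_extension (section_comp_basis G G G) y z)"
    if "x \<in> B" "y \<in> B" "z \<in> B" for x y z
    using star_assoc[of x y z] that B(2) by (auto simp: section_comp_def subset_iff)
qed (use u in \<open>simp_all add: section_algebra_def section_comp_def fun_eq_iff\<close>)

lemma covering_subalgebra: "k_subalgebra EE Ec \<one>\<^bsub>EE\<^esub>"
  unfolding k_subalgebra_def
proof (intro conjI k_algebra_section_algebra subalgebra_k_algebra subspace_covering covering_subset_burnside)
  show "Ec \<subseteq> carrier EE" using covering_subset_burnside by simp
  show "\<one>\<^bsub>EE\<^esub> \<in> Ec" using e_elt_covering[OF top_pair_normal] by simp
  show "x \<star> y \<in> Ec" if "x \<in> Ec" "y \<in> Ec" for x y by (rule star_covering[OF that])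
  show "\<one>\<^bsub>EE\<^esub> \<star> x = x" "x \<star> \<one>\<^bsub>EE\<^esub> = x" if "x \<in> Ec" for x
    using star_one[OF subsetD[OF covering_subset_burnside that]] by simp_all
qed

lemma covering_plus_ideal: "carrier EE = Ec <+>\<^bsub>EE\<^esub> I"
proof -
  have "Ec <+>\<^bsub>EE\<^esub> I = {x + y | x y. x \<in> Ec \<and> y \<in> I}"
    unfolding set_add_defs by auto
  moreover have "x + y \<in> section_burnside G G" if "x \<in> Ec" "y \<in> I" for x y
    using that covering_subset_burnside I_subset scale.subspace_add[OF subspace_burnside] by blast
  moreover have "\<exists>y z. x = y + z \<and> y \<in> Ec \<and> z \<in> I" if "x \<in> section_burnside G G" for x
    using section_algebra_covering_plus_ideal[OF that] by metis
  ultimately show ?thesis by auto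
qed

text \<open>
  For a union \<open>A\<close> of linkage classes this is the central idempotent that projects onto the
  blocks in \<open>A\<close>.
\<close>

definition f_sum :: "('a set \<times> 'a set) set \<Rightarrow> ('a, 'a, 'k) section_elts" where
  "f_sum A = (\<Sum>p\<in>A. f p)"

definition linkage_closed :: "('a set \<times> 'a set) set \<Rightarrow> bool" where
  "linkage_closed A \<longleftrightarrow> A \<subseteq> pairs \<and> (\<forall>p\<in>A. linkage_class G p \<subseteq> A)"

lemma f_sum_mult:
  assumes "A \<subseteq> pairs" "B \<subseteq> pairs"
  shows "f_sum A \<star> f_sum B = f_sum (A \<inter> B)"
proof -
  have fin: "finite A" "finite B" using assms finite_normal_pairs finite_subset by blast+
  have "f_sum A \<star> f_sum B = (\<Sum>a\<in>A. \<Sum>b\<in>B. if a = b then f b else 0)"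
    unfolding f_sum_def section_comp_sum_left unfolding section_comp_sum_right
    using assms by (intro sum.cong refl f_orthogonal) blast+
  also have "\<dots> = (\<Sum>a\<in>A. if a \<in> B then f a else 0)"
    using fin by (simp add: sum.delta)
  also have "\<dots> = f_sum (A \<inter> B)"
    unfolding f_sum_def using fin by (simp add: sum.inter_restrict)
  finally show ?thesis .
qed

lemma f_sum_covering: "f_sum A \<in> Ec"
  unfolding f_sum_def by (rule scale.subspace_sum[OF subspace_covering f_elt_covering])

lemma f_class_eq: "f_class G C = f_sum C"
  by (simp add: f_class_def f_sum_def)

lemma sum_f_class:
  assumes "linkage_closed A"
  shows "(\<Sum>C\<in>linkage_class G ` A. f_class G C) = f_sum A"
proof -
  have A: "A \<subseteq> pairs" "\<And>p. p \<in> A \<Longrightarrow> linkage_class G p \<subseteq> A" using assms by (auto simp: linkage_closed_def)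
  have fin: "finite A" using A(1) finite_normal_pairs finite_subset by blast
  have "f_sum A = (\<Sum>C\<in>linkage_class G ` A. \<Sum>p\<in>{p \<in> A. linkage_class G p = C}. f p)"
    unfolding f_sum_def by (rule sum.image_gen[OF fin])
  also have "\<dots> = (\<Sum>C\<in>linkage_class G ` A. f_class G C)"
  proof (rule sum.cong[OF refl])
    fix C assume "C \<in> linkage_class G ` A"
    then obtain q where q: "q \<in> A" "C = linkage_class G q" by blast
    have "{p \<in> A. linkage_class G p = C} = C"
      unfolding q(2) using A q(1) linkage_class_self linkage_class_eq by blast
    then show "(\<Sum>p\<in>{p \<in> A. linkage_class G p = C}. f p) = f_class G C" by (simp add: f_class_def)
  qed
  finally show ?thesis ..
qed

lemma f_class_orthogonal:
  assumes "C \<in> linkage_class G ` pairs" "D \<in> linkage_class G ` pairs" "C \<noteq> D"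
  shows "f_class G C \<star> f_class G D = (0 :: ('a, 'a, 'k) section_elts)"
proof -
  have "C \<subseteq> pairs" "D \<subseteq> pairs" using assms linkage_class_subset by blast+
  moreover have "C \<inter> D = {}" using assms linkage_class_eq by blast
  ultimately show ?thesis unfolding f_class_eq by (simp add: f_sum_mult) (simp add: f_sum_def)
qed

lemma f_class_idem:
  assumes "C \<in> linkage_class G ` pairs"
  shows "f_class G C \<star> f_class G C = (f_class G C :: ('a, 'a, 'k) section_elts)"
proof -
  have "C \<subseteq> pairs" using assms linkage_class_subset by blast
  then show ?thesis unfolding f_class_eq by (simp add: f_sum_mult)
qed

lemma f_sum_central:
  assumes A: "linkage_closed A" and x: "x \<in> Ec"
  shows "f_sum A \<star> x = x \<star> f_sum A"
proof -
  have "A \<subseteq> pairs" using A by (simp add: linkage_closed_def)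
  then show ?thesis
    unfolding sum_f_class[OF A, symmetric] section_comp_sum_left section_comp_sum_right
    using f_class_central[OF _ x] by (intro sum.cong refl) auto
qed

lemma mem_block: "z \<in> block C \<longleftrightarrow> (\<exists>x\<in>Ec. z = f_class G C \<star> x)"
  by (auto simp: l_coset_def)

lemma f_class_covering: "(f_class G C :: ('a, 'a, 'k) section_elts) \<in> Ec"
  unfolding f_class_eq by (rule f_sum_covering)

lemma f_class_block:
  assumes "C \<in> linkage_class G ` pairs" "D \<in> linkage_class G ` pairs" "z \<in> block D"
  shows "f_class G C \<star> z = (if C = D then z else 0)"
proof -
  obtain x where x: "x \<in> Ec" "z = f_class G D \<star> x" using assms(3) unfolding mem_block by blast
  have "f_class G C \<star> z = f_class G C \<star> f_class G D \<star> x"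
    unfolding x(2) using x(1) f_class_covering covering_subset_burnside by (intro star_assoc[symmetric]) blast+
  then show ?thesis
    using f_class_idem[OF assms(1)] f_class_orthogonal[OF assms(1,2)] x(2) by auto
qed

lemma f_class_sum_blocks:
  assumes J: "J \<subseteq> linkage_class G ` pairs" and y: "y \<in> (\<Pi>\<^sub>E C\<in>J. block C)" and C: "C \<in> J"
  shows "f_class G C \<star> (\<Sum>D\<in>J. y D) = y C"
proof -
  have fin: "finite J" using J finite_normal_pairs by (auto intro: finite_subset)
  have "f_class G C \<star> (\<Sum>D\<in>J. y D) = (\<Sum>D\<in>J. if C = D then y D else 0)"
    unfolding section_comp_sum_right
  proof (rule sum.cong[OF refl])
    fix D assume "D \<in> J"
    then show "f_class G C \<star> y D = (if C = D then y D else 0)"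
      using J C y by (intro f_class_block) (blast, blast, simp add: PiE_iff)
  qed
  also have "\<dots> = y C" using fin C by (simp add: sum.delta)
  finally show ?thesis .
qed

lemma blocks_direct:
  assumes "J \<subseteq> linkage_class G ` pairs"
  shows "sum_is_direct J block"
  unfolding sum_is_direct_def
proof (rule inj_onI)
  fix y y' assume y: "y \<in> (\<Pi>\<^sub>E C\<in>J. block C)" "y' \<in> (\<Pi>\<^sub>E C\<in>J. block C)"
    and eq: "(\<Sum>C\<in>J. y C) = (\<Sum>C\<in>J. y' C)"
  show "y = y'"
    by (rule PiE_ext[OF y]) (metis f_class_sum_blocks[OF assms y(1)] f_class_sum_blocks[OF assms y(2)] eq)
qed

text \<open>
  Multiplication by the central idempotent \<open>f_sum A\<close> is the projection of
  \<open>E\<^sup>c\<close> onto the sum of the blocks in \<open>A\<close>, and multiplication by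
  \<open>f\<close> of a class picks out a single component.
\<close>

lemma internal_sum_blocks:
  assumes A: "linkage_closed A"
  shows "internal_sum (linkage_class G ` A) block = {z \<in> Ec. f_sum A \<star> z = z}"
proof -
  let ?J = "linkage_class G ` A"
  have sub: "A \<subseteq> pairs" using A by (simp add: linkage_closed_def)
  then have J: "?J \<subseteq> linkage_class G ` pairs" by blast
  have blockE: "block C \<subseteq> Ec" for C
    using star_covering[OF f_class_covering] by (auto simp: mem_block)
  show ?thesis
  proof (intro equalityI subsetI)
    fix z assume "z \<in> internal_sum ?J block"
    then obtain y where y: "y \<in> (\<Pi>\<^sub>E C\<in>?J. block C)" "z = (\<Sum>C\<in>?J. y C)"
      unfolding internal_sum_def by blast
    have "z \<in> Ec" unfolding y(2)
      using y(1) blockE by (intro scale.subspace_sum[OF subspace_covering]) blast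
    moreover have "f_sum A \<star> z = (\<Sum>C\<in>?J. f_class G C \<star> z)"
      unfolding sum_f_class[OF A, symmetric] section_comp_sum_left ..
    moreover have "\<dots> = z"
      unfolding y(2) by (intro sum.cong refl f_class_sum_blocks[OF J y(1)])
    ultimately show "z \<in> {z \<in> Ec. f_sum A \<star> z = z}" by simp
  next
    fix z assume "z \<in> {z \<in> Ec. f_sum A \<star> z = z}"
    then have z: "z \<in> Ec" "f_sum A \<star> z = z" by auto
    have "z = (\<Sum>C\<in>?J. f_class G C \<star> z)"
      using z(2) unfolding sum_f_class[OF A, symmetric] section_comp_sum_left by simp
    also have "\<dots> = (\<Sum>C\<in>?J. restrict (\<lambda>C. f_class G C \<star> z) ?J C)" by (intro sum.cong) auto
    finally show "z \<in> internal_sum ?J block"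
      unfolding internal_sum_def using z(1)
      by (intro image_eqI[where x = "restrict (\<lambda>C. f_class G C \<star> z) ?J"]) (auto simp: mem_block)
  qed
qed

lemma reduced_closed: "linkage_closed Red" "linkage_closed (pairs - Red)"
proof -
  have sub: "Red \<subseteq> pairs" by (auto simp: reduced_pairs_def)
  show "linkage_closed Red"
    unfolding linkage_closed_def using sub reduced_linked by (auto simp: linkage_class_def)
  show "linkage_closed (pairs - Red)"
    unfolding linkage_closed_def using reduced_linked linked_sym by (auto simp: linkage_class_def)
qed

abbreviation u :: "('a, 'a, 'k) section_elts" where "u \<equiv> f_sum Red"
abbreviation u' :: "('a, 'a, 'k) section_elts" where "u' \<equiv> f_sum (pairs - Red)"

lemma u_plus_u': "u + u' = e top_pair"
proof -
  have "Red \<subseteq> pairs" by (auto simp: reduced_pairs_def)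
  then have "pairs = Red \<union> (pairs - Red)" by blast
  then have "(\<Sum>p\<in>pairs. f p) = u + u'"
    unfolding f_sum_def using finite_normal_pairs
    by (metis Diff_disjoint finite_Un sum.union_disjoint)
  then show ?thesis using sum_f by simp
qed

lemma u'_in_I: "u' \<in> I"
  unfolding f_sum_def by (rule scale.subspace_sum[OF subspace_I]) (rule f_nonreduced_in_I)

lemma u_annihilates_ideal:
  assumes "z \<in> Ec" "z \<in> I" shows "u \<star> z = 0"
  unfolding f_sum_def section_comp_sum_left
  using covering_ideal_annihilated[OF assms] by (intro sum.neutral) auto

lemma covering_split:
  assumes "z \<in> Ec" shows "z = u \<star> z + u' \<star> z"
  using star_one(1)[of z] assms covering_subset_burnside
  unfolding section_comp_add_left[symmetric] u_plus_u' by auto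

text \<open>
  Split \<open>z = u z + u' z\<close> with \<open>u\<close>, \<open>u'\<close> the sums of the
  \<open>f\<^bsub>p\<^esub>\<close> over the reduced and the other pairs: \<open>u\<close> annihilates
  \<open>E\<^sup>c \<inter> I\<close>, and \<open>u'\<close> lies in \<open>I\<close>.
\<close>

lemma covering_inter_ideal: "Ec \<inter> I = internal_sum (linkage_class G ` (pairs - Red)) block"
  unfolding internal_sum_blocks[OF reduced_closed(2)]
proof (intro equalityI subsetI)
  fix z assume z: "z \<in> Ec \<inter> I"
  then show "z \<in> {z \<in> Ec. u' \<star> z = z}"
    using covering_split[of z] u_annihilates_ideal[of z] by auto
next
  fix z assume z: "z \<in> {z \<in> Ec. u' \<star> z = z}"
  then have "u' \<star> z \<in> I" using covering_subset_burnside by (intro I_star(2) u'_in_I) auto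
  then show "z \<in> Ec \<inter> I" using z by auto
qed

lemma reduced_subalgebra: "k_subalgebra (EE\<lparr>carrier := Ec\<rparr>) {z \<in> Ec. u \<star> z = z} u"
  unfolding k_subalgebra_def
proof (intro conjI)
  show "k_algebra (EE\<lparr>carrier := Ec\<rparr>)"
    using covering_subalgebra unfolding k_subalgebra_def by (simp add: section_algebra_def)
  have "u \<star> u = u" using f_sum_mult[of Red Red] by (auto simp: reduced_pairs_def)
  note b = covering_subset_burnside[THEN subsetD]
  have "k_algebra (EE\<lparr>carrier := {z \<in> Ec. u \<star> z = z}, monoid.one := u\<rparr>)"
  proof (rule subalgebra_k_algebra)
    show "scale.subspace {z \<in> Ec. u \<star> z = z}"
      using subspace_covering[where 'k = 'k]
      by (intro scale.subspaceI) (auto simp: section_comp_linear scale.subspace_def)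
    show "x \<star> y \<in> {z \<in> Ec. u \<star> z = z}" if "x \<in> {z \<in> Ec. u \<star> z = z}" "y \<in> {z \<in> Ec. u \<star> z = z}" for x y
    proof -
      have "u \<star> (x \<star> y) = u \<star> x \<star> y"
        using that f_sum_covering b by (intro star_assoc[symmetric]) auto
      then show ?thesis using that star_covering[of x y] by simp
    qed
    show "x \<star> u = x" if "x \<in> {z \<in> Ec. u \<star> z = z}" for x
      using that f_sum_central[OF reduced_closed(1), of x] by auto
  qed (use b \<open>u \<star> u = u\<close> f_sum_covering in auto)
  then show "k_algebra (EE\<lparr>carrier := Ec, carrier := {z \<in> Ec. u \<star> z = z}, monoid.one := u\<rparr>)"
    by simp
qed auto

section \<open>The essential algebra\<close>

abbreviation Eb :: "('k, ('a, 'a, 'k) section_elts set) module" where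
  "Eb \<equiv> essential_algebra G"

abbreviation bar :: "('a, 'a, 'k) section_elts \<Rightarrow> ('a, 'a, 'k) section_elts set" where
  "bar \<equiv> to_essential G"

lemma bar_altdef: "bar x = {i + x | i. i \<in> I}"
  unfolding to_essential_def a_r_coset_def' by auto

lemma bar_eq_iff: "bar x = bar y \<longleftrightarrow> x - y \<in> I"
proof
  assume "bar x = bar y"
  then have "x \<in> bar y" using I_closed(1) unfolding bar_altdef by force
  then show "x - y \<in> I" unfolding bar_altdef by auto
next
  assume *: "x - y \<in> I"
  have "\<exists>j\<in>I. i + x = j + y" if "i \<in> I" for i
    using I_closed(2)[OF that *] by (intro bexI[of _ "i + (x - y)"]) auto
  moreover have "\<exists>j\<in>I. i + y = j + x" if "i \<in> I" for i
    using I_closed(3)[OF that *] by (intro bexI[of _ "i - (x - y)"]) auto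
  ultimately show "bar x = bar y" unfolding bar_altdef by blast
qed

lemma Eb_simps:
  "carrier Eb = bar ` section_burnside G G"
  "\<one>\<^bsub>Eb\<^esub> = bar (e top_pair)"
  "\<zero>\<^bsub>Eb\<^esub> = bar 0"
  "x \<in> section_burnside G G \<Longrightarrow> y \<in> section_burnside G G \<Longrightarrow> bar x \<otimes>\<^bsub>Eb\<^esub> bar y = bar (x \<star> y)"
  "x \<in> section_burnside G G \<Longrightarrow> y \<in> section_burnside G G \<Longrightarrow> bar x \<oplus>\<^bsub>Eb\<^esub> bar y = bar (x + y)"
  "c \<odot>\<^bsub>Eb\<^esub> bar x = bar (scale c x)"
proof -
  have h: "(+>\<^bsub>EE\<^esub>) I \<in> ring_hom EE (EE Quot I)" by (rule ideal.rcos_ring_hom[OF I_ideal])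
  have rec: "carrier Eb = carrier (EE Quot I)" "monoid.mult Eb = monoid.mult (EE Quot I)"
    "monoid.one Eb = monoid.one (EE Quot I)" "ring.zero Eb = I" "ring.add Eb = ring.add (EE Quot I)"
    by (simp_all add: essential_algebra_def quotient_algebra_def ring.defs FactRing_def)
  show "carrier Eb = bar ` section_burnside G G"
    unfolding rec by (auto simp: FactRing_def A_RCOSETS_def' to_essential_def)
  show "\<one>\<^bsub>Eb\<^esub> = bar (e top_pair)" unfolding rec by (simp add: FactRing_def to_essential_def)
  have "bar 0 = I" by (simp add: bar_altdef)
  then show "\<zero>\<^bsub>Eb\<^esub> = bar 0" unfolding rec by simp
  show "bar x \<otimes>\<^bsub>Eb\<^esub> bar y = bar (x \<star> y)" if "x \<in> section_burnside G G" "y \<in> section_burnside G G"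
    using ring_hom_mult[OF h, of x y] that unfolding rec by (simp add: to_essential_def)
  show "bar x \<oplus>\<^bsub>Eb\<^esub> bar y = bar (x + y)" if "x \<in> section_burnside G G" "y \<in> section_burnside G G"
    using ring_hom_add[OF h, of x y] that unfolding rec by (simp add: to_essential_def)
  have "c \<odot>\<^bsub>Eb\<^esub> bar x = (\<Union>y\<in>bar x. bar (scale c y))"
    by (simp add: essential_algebra_def quotient_algebra_def ring.defs module.defs to_essential_def)
  also have "\<dots> = bar (scale c x)"
  proof -
    have "bar (scale c y) = bar (scale c x)" if "y \<in> bar x" for y
      using that I_closed(4) unfolding bar_eq_iff scale.scale_right_diff_distrib[symmetric]
      by (auto simp: bar_altdef)
    moreover have "x \<in> bar x" using I_closed(1) unfolding bar_altdef by force
    ultimately show ?thesis by blast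
  qed
  finally show "c \<odot>\<^bsub>Eb\<^esub> bar x = bar (scale c x)" .
qed

lemma Eb_ring: "ring Eb"
proof -
  interpret Q: ring "EE Quot I" by (rule ideal.quotient_is_ring[OF I_ideal])
  have rec: "carrier Eb = carrier (EE Quot I)" "monoid.mult Eb = monoid.mult (EE Quot I)"
    "monoid.one Eb = monoid.one (EE Quot I)" "ring.zero Eb = ring.zero (EE Quot I)"
    "ring.add Eb = ring.add (EE Quot I)"
    by (simp_all add: essential_algebra_def quotient_algebra_def ring.defs FactRing_def)
  show ?thesis
  proof (rule ringI)
    show "abelian_group Eb"
    proof (rule abelian_groupI)
      show "\<exists>y\<in>carrier Eb. y \<oplus>\<^bsub>Eb\<^esub> x = \<zero>\<^bsub>Eb\<^esub>" if "x \<in> carrier Eb" for x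
        using that unfolding rec by (intro bexI[of _ "\<ominus>\<^bsub>EE Quot I\<^esub> x"]) (auto simp: Q.l_neg)
    qed (auto simp: rec Q.a_ac)
    show "monoid Eb" by (rule monoidI) (auto simp: rec Q.m_assoc)
  qed (auto simp: rec Q.l_distr Q.r_distr)
qed

text \<open>
  Modulo \<open>I\<close>, every element lies in \<open>E\<^sup>c\<close>, and there \<open>u\<close>
  acts as the identity because \<open>1 - u = u' \<in> I\<close>.
\<close>

lemma carrier_Eb_covering: "carrier Eb = bar ` {z \<in> Ec. u \<star> z = z}"
proof -
  have "\<exists>z\<in>{z \<in> Ec. u \<star> z = z}. bar x = bar z" if x: "x \<in> section_burnside G G" for x
  proof -
    obtain y i where y: "y \<in> Ec" "i \<in> I" "x = y + i" using section_algebra_covering_plus_ideal[OF x] by metis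
    have yb: "y \<in> section_burnside G G" using y covering_subset_burnside by blast
    have "u' \<star> y \<in> I" using yb by (intro I_star(2) u'_in_I)
    moreover have "y - u \<star> y = u' \<star> y" by (subst (1) covering_split[OF y(1)]) simp
    moreover have "x - u \<star> y = i + (y - u \<star> y)" by (simp add: y(3))
    ultimately have "bar x = bar (u \<star> y)"
      using I_closed(2)[OF y(2)] by (simp add: bar_eq_iff)
    moreover have "u \<star> y \<in> Ec" by (rule star_covering[OF f_sum_covering y(1)])
    moreover have "u \<star> (u \<star> y) = u \<star> y"
    proof -
      have "u \<star> u = u" using f_sum_mult[of Red Red] by (auto simp: reduced_pairs_def)
      moreover have "u \<in> section_burnside G G" using f_sum_covering covering_subset_burnside by blast
      ultimately show ?thesis using star_assoc[of u u y] yb by simp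
    qed
    ultimately show ?thesis by blast
  qed
  then show ?thesis unfolding Eb_simps(1) using covering_subset_burnside by blast
qed

text \<open>
  Injectivity: an element of \<open>u E\<^sup>c\<close> that lies in \<open>I\<close> is annihilated by
  \<open>u\<close>, yet fixed by it.
\<close>

lemma reduced_iso: "bar \<in> k_algebra_iso (EE\<lparr>carrier := {z \<in> Ec. u \<star> z = z}, monoid.one := u\<rparr>) Eb"
proof -
  note b = covering_subset_burnside[THEN subsetD]
  have "e top_pair - u = u'" using u_plus_u' by (metis add_diff_cancel_left')
  then have "bar (e top_pair) = bar u" using u'_in_I by (simp add: bar_eq_iff)
  then have "bar \<in> ring_hom (EE\<lparr>carrier := {z \<in> Ec. u \<star> z = z}, monoid.one := u\<rparr>) Eb"
    using b by (intro ring_hom_memI) (auto simp: Eb_simps)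
  moreover have "inj_on bar {z \<in> Ec. u \<star> z = z}"
  proof (rule inj_onI)
    fix x y assume xy: "x \<in> {z \<in> Ec. u \<star> z = z}" "y \<in> {z \<in> Ec. u \<star> z = z}" "bar x = bar y"
    have "x - y \<in> Ec" using xy scale.subspace_diff[OF subspace_covering] by auto
    then have "u \<star> (x - y) = 0" using xy(3) by (intro u_annihilates_ideal) (auto simp: bar_eq_iff)
    then show "x = y" using xy by (simp add: section_comp_diff_right)
  qed
  ultimately show ?thesis
    unfolding k_algebra_iso_def ring_iso_def bij_betw_def using carrier_Eb_covering
    by (simp add: Eb_simps(6))
qed

end

section \<open>Simple modules and Schur's lemma\<close>

context left_module
begin

lemma smult_l_null: "x \<in> carrier M \<Longrightarrow> \<zero>\<^bsub>R\<^esub> \<odot>\<^bsub>M\<^esub> x = \<zero>\<^bsub>M\<^esub>"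
proof -
  assume x: "x \<in> carrier M"
  have "\<zero>\<^bsub>R\<^esub> \<odot>\<^bsub>M\<^esub> x \<oplus>\<^bsub>M\<^esub> \<zero>\<^bsub>R\<^esub> \<odot>\<^bsub>M\<^esub> x = \<zero>\<^bsub>R\<^esub> \<odot>\<^bsub>M\<^esub> x"
    using smult_l_distr[of "\<zero>\<^bsub>R\<^esub>" "\<zero>\<^bsub>R\<^esub>" x] x by simp
  then show ?thesis using smult_closed[OF R.zero_closed x] M.add.l_cancel_one by auto
qed

lemma smult_r_null: "a \<in> carrier R \<Longrightarrow> a \<odot>\<^bsub>M\<^esub> \<zero>\<^bsub>M\<^esub> = \<zero>\<^bsub>M\<^esub>"
proof -
  assume a: "a \<in> carrier R"
  have "a \<odot>\<^bsub>M\<^esub> \<zero>\<^bsub>M\<^esub> \<oplus>\<^bsub>M\<^esub> a \<odot>\<^bsub>M\<^esub> \<zero>\<^bsub>M\<^esub> = a \<odot>\<^bsub>M\<^esub> \<zero>\<^bsub>M\<^esub>"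
    using smult_r_distr[OF a M.zero_closed M.zero_closed] by simp
  then show ?thesis using smult_closed[OF a M.zero_closed] M.add.l_cancel_one by auto
qed

lemma smult_l_minus: "x \<in> carrier M \<Longrightarrow> (\<ominus>\<^bsub>R\<^esub> \<one>\<^bsub>R\<^esub>) \<odot>\<^bsub>M\<^esub> x = \<ominus>\<^bsub>M\<^esub> x"
proof -
  assume x: "x \<in> carrier M"
  have "(\<ominus>\<^bsub>R\<^esub> \<one>\<^bsub>R\<^esub>) \<odot>\<^bsub>M\<^esub> x \<oplus>\<^bsub>M\<^esub> x = (\<ominus>\<^bsub>R\<^esub> \<one>\<^bsub>R\<^esub> \<oplus>\<^bsub>R\<^esub> \<one>\<^bsub>R\<^esub>) \<odot>\<^bsub>M\<^esub> x"
    using smult_l_distr[of "\<ominus>\<^bsub>R\<^esub> \<one>\<^bsub>R\<^esub>" "\<one>\<^bsub>R\<^esub>" x] x by (simp add: smult_one)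
  then have "(\<ominus>\<^bsub>R\<^esub> \<one>\<^bsub>R\<^esub>) \<odot>\<^bsub>M\<^esub> x \<oplus>\<^bsub>M\<^esub> x = \<zero>\<^bsub>M\<^esub>" using x by (simp add: R.l_neg smult_l_null)
  then show ?thesis using x smult_closed[of "\<ominus>\<^bsub>R\<^esub> \<one>\<^bsub>R\<^esub>" x] by (metis M.minus_equality R.a_inv_closed R.one_closed)
qed

lemma submoduleI':
  assumes "N \<subseteq> carrier M" "\<zero>\<^bsub>M\<^esub> \<in> N"
    and "\<And>x y. x \<in> N \<Longrightarrow> y \<in> N \<Longrightarrow> x \<oplus>\<^bsub>M\<^esub> y \<in> N"
    and "\<And>a x. a \<in> carrier R \<Longrightarrow> x \<in> N \<Longrightarrow> a \<odot>\<^bsub>M\<^esub> x \<in> N"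
  shows "submodule N R M"
proof (intro submodule.intro submodule_axioms.intro M.add.subgroupI)
  show "\<ominus>\<^bsub>M\<^esub> x \<in> N" if "x \<in> N" for x
    using assms(4)[of "\<ominus>\<^bsub>R\<^esub> \<one>\<^bsub>R\<^esub>" x] smult_l_minus[of x] assms(1) that by auto
qed (use assms in auto)

end

lemma submoduleD:
  assumes "submodule N R M"
  shows "N \<subseteq> carrier M" "\<zero>\<^bsub>M\<^esub> \<in> N" "x \<in> N \<Longrightarrow> y \<in> N \<Longrightarrow> x \<oplus>\<^bsub>M\<^esub> y \<in> N"
    "a \<in> carrier R \<Longrightarrow> x \<in> N \<Longrightarrow> a \<odot>\<^bsub>M\<^esub> x \<in> N"
proof -
  note g = submodule.axioms(1)[OF assms]
  show "N \<subseteq> carrier M" "\<zero>\<^bsub>M\<^esub> \<in> N" using subgroup.subset[OF g] subgroup.one_closed[OF g] by simp_all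
  show "x \<in> N \<Longrightarrow> y \<in> N \<Longrightarrow> x \<oplus>\<^bsub>M\<^esub> y \<in> N" using subgroup.m_closed[OF g, of x y] by simp
  show "a \<in> carrier R \<Longrightarrow> x \<in> N \<Longrightarrow> a \<odot>\<^bsub>M\<^esub> x \<in> N" by (rule submodule.smult_closed[OF assms])
qed

definition linear_maps :: "('r, 's) ring_scheme \<Rightarrow> ('r, 'v) module \<Rightarrow> ('r, 'w) module \<Rightarrow> ('v \<Rightarrow> 'w) set" where
  "linear_maps R M N = {\<phi> \<in> hom (add_monoid M) (add_monoid N).
     \<forall>a\<in>carrier R. \<forall>x\<in>carrier M. \<phi> (a \<odot>\<^bsub>M\<^esub> x) = a \<odot>\<^bsub>N\<^esub> \<phi> x}"

lemma linear_mapsD: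
  assumes "\<phi> \<in> linear_maps R M N"
  shows "x \<in> carrier M \<Longrightarrow> \<phi> x \<in> carrier N"
    "x \<in> carrier M \<Longrightarrow> y \<in> carrier M \<Longrightarrow> \<phi> (x \<oplus>\<^bsub>M\<^esub> y) = \<phi> x \<oplus>\<^bsub>N\<^esub> \<phi> y"
    "a \<in> carrier R \<Longrightarrow> x \<in> carrier M \<Longrightarrow> \<phi> (a \<odot>\<^bsub>M\<^esub> x) = a \<odot>\<^bsub>N\<^esub> \<phi> x"
  using assms unfolding linear_maps_def by (auto simp: hom_def)

lemma linear_mapsI:
  assumes "\<And>x. x \<in> carrier M \<Longrightarrow> \<phi> x \<in> carrier N"
    "\<And>x y. x \<in> carrier M \<Longrightarrow> y \<in> carrier M \<Longrightarrow> \<phi> (x \<oplus>\<^bsub>M\<^esub> y) = \<phi> x \<oplus>\<^bsub>N\<^esub> \<phi> y"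
    "\<And>a x. a \<in> carrier R \<Longrightarrow> x \<in> carrier M \<Longrightarrow> \<phi> (a \<odot>\<^bsub>M\<^esub> x) = a \<odot>\<^bsub>N\<^esub> \<phi> x"
  shows "\<phi> \<in> linear_maps R M N"
  using assms unfolding linear_maps_def by (auto simp: hom_def)

lemma module_isomorphic_iff:
  "module_isomorphic R M N \<longleftrightarrow> (\<exists>\<phi>\<in>linear_maps R M N. bij_betw \<phi> (carrier M) (carrier N))"
  unfolding module_isomorphic_def linear_maps_def iso_def by auto

lemma linear_maps_zero:
  assumes "left_module R M" "left_module R N" "\<phi> \<in> linear_maps R M N"
  shows "\<phi> \<zero>\<^bsub>M\<^esub> = \<zero>\<^bsub>N\<^esub>"
proof -
  interpret M: left_module R M by fact
  interpret N: left_module R N by fact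
  have "\<phi> (\<zero>\<^bsub>R\<^esub> \<odot>\<^bsub>M\<^esub> \<zero>\<^bsub>M\<^esub>) = \<zero>\<^bsub>R\<^esub> \<odot>\<^bsub>N\<^esub> \<phi> \<zero>\<^bsub>M\<^esub>"
    by (rule linear_mapsD(3)[OF assms(3)]) auto
  then show ?thesis
    using linear_mapsD(1)[OF assms(3), of "\<zero>\<^bsub>M\<^esub>"] by (simp add: M.smult_l_null N.smult_l_null)
qed

lemma module_isomorphic_sym:
  assumes "left_module R M" "left_module R N" "module_isomorphic R M N"
  shows "module_isomorphic R N M"
proof -
  interpret M: left_module R M by fact
  interpret N: left_module R N by fact
  obtain \<phi> where \<phi>: "\<phi> \<in> linear_maps R M N" "bij_betw \<phi> (carrier M) (carrier N)"
    using assms(3) unfolding module_isomorphic_iff by blast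
  let ?\<psi> = "inv_into (carrier M) \<phi>"
  have \<psi>: "bij_betw ?\<psi> (carrier N) (carrier M)" by (rule bij_betw_inv_into[OF \<phi>(2)])
  have in_M: "?\<psi> y \<in> carrier M" if "y \<in> carrier N" for y using \<psi> that by (auto simp: bij_betw_def)
  have inv1: "\<phi> (?\<psi> y) = y" if "y \<in> carrier N" for y
    using bij_betw_inv_into_right[OF \<phi>(2) that] .
  have inv2: "?\<psi> (\<phi> x) = x" if "x \<in> carrier M" for x
    using bij_betw_inv_into_left[OF \<phi>(2) that] .
  have "?\<psi> \<in> linear_maps R N M"
  proof (rule linear_mapsI)
    show "?\<psi> (x \<oplus>\<^bsub>N\<^esub> y) = ?\<psi> x \<oplus>\<^bsub>M\<^esub> ?\<psi> y" if "x \<in> carrier N" "y \<in> carrier N" for x y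
      using linear_mapsD(2)[OF \<phi>(1) in_M[OF that(1)] in_M[OF that(2)]] inv1 that
        inv2[of "?\<psi> x \<oplus>\<^bsub>M\<^esub> ?\<psi> y"] in_M by simp
    show "?\<psi> (a \<odot>\<^bsub>N\<^esub> x) = a \<odot>\<^bsub>M\<^esub> ?\<psi> x" if "a \<in> carrier R" "x \<in> carrier N" for a x
      using linear_mapsD(3)[OF \<phi>(1) that(1) in_M[OF that(2)]] inv1 that
        inv2[of "a \<odot>\<^bsub>M\<^esub> ?\<psi> x"] in_M M.smult_closed by simp
  qed (rule in_M)
  then show ?thesis using \<psi> unfolding module_isomorphic_iff by blast
qed

lemma simple_moduleD:
  assumes "simple_module R M"
  shows "left_module R M" "\<exists>x\<in>carrier M. x \<noteq> \<zero>\<^bsub>M\<^esub>"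
    "submodule N R M \<Longrightarrow> N = {\<zero>\<^bsub>M\<^esub>} \<or> N = carrier M"
proof -
  show l: "left_module R M" using assms by (simp add: simple_module_def)
  interpret left_module R M by (rule l)
  have "carrier M \<noteq> {\<zero>\<^bsub>M\<^esub>}" using assms by (simp add: simple_module_def)
  then show "\<exists>x\<in>carrier M. x \<noteq> \<zero>\<^bsub>M\<^esub>" using M.zero_closed by blast
  show "submodule N R M \<Longrightarrow> N = {\<zero>\<^bsub>M\<^esub>} \<or> N = carrier M"
    using assms by (auto simp: simple_module_def)
qed

text \<open>
  A linear map between simple modules that is nonzero at some point has kernel zero and full image.
\<close>

lemma schur:
  assumes M: "simple_module R M" and N: "simple_module R N" and \<phi>: "\<phi> \<in> linear_maps R M N"
    and nz: "x \<in> carrier M" "\<phi> x \<noteq> \<zero>\<^bsub>N\<^esub>"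
  shows "module_isomorphic R M N"
proof -
  interpret M: left_module R M by (rule simple_moduleD(1)[OF M])
  interpret N: left_module R N by (rule simple_moduleD(1)[OF N])
  note \<phi>' = linear_mapsD[OF \<phi>] and z = linear_maps_zero[OF M.left_module_axioms N.left_module_axioms \<phi>]
  let ?K = "{y \<in> carrier M. \<phi> y = \<zero>\<^bsub>N\<^esub>}"
  have "submodule ?K R M"
    by (rule M.submoduleI') (auto simp: z \<phi>' N.smult_r_null M.smult_closed)
  then have K: "?K = {\<zero>\<^bsub>M\<^esub>}" using simple_moduleD(3)[OF M] nz by blast
  have "submodule (\<phi> ` carrier M) R N"
  proof (rule N.submoduleI')
    show "\<zero>\<^bsub>N\<^esub> \<in> \<phi> ` carrier M" using z M.M.zero_closed by (metis imageI)
    fix u v assume "u \<in> \<phi> ` carrier M" "v \<in> \<phi> ` carrier M"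
    then obtain y y' where "y \<in> carrier M" "y' \<in> carrier M" "u = \<phi> y" "v = \<phi> y'" by blast
    then show "u \<oplus>\<^bsub>N\<^esub> v \<in> \<phi> ` carrier M"
      by (intro image_eqI[where x = "y \<oplus>\<^bsub>M\<^esub> y'"]) (auto simp: \<phi>')
  next
    fix a u assume a: "a \<in> carrier R" "u \<in> \<phi> ` carrier M"
    then obtain y where "y \<in> carrier M" "u = \<phi> y" by blast
    then show "a \<odot>\<^bsub>N\<^esub> u \<in> \<phi> ` carrier M" using a(1)
      by (intro image_eqI[where x = "a \<odot>\<^bsub>M\<^esub> y"]) (auto simp: \<phi>' M.smult_closed)
  qed (auto simp: \<phi>')
  then have im: "\<phi> ` carrier M = carrier N" using simple_moduleD(3)[OF N] nz by blast
  have "inj_on \<phi> (carrier M)"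
  proof (rule inj_onI)
    fix y y' assume y: "y \<in> carrier M" "y' \<in> carrier M" "\<phi> y = \<phi> y'"
    have m: "\<ominus>\<^bsub>M\<^esub> y' = (\<ominus>\<^bsub>R\<^esub> \<one>\<^bsub>R\<^esub>) \<odot>\<^bsub>M\<^esub> y'" "\<ominus>\<^bsub>N\<^esub> \<phi> y' = (\<ominus>\<^bsub>R\<^esub> \<one>\<^bsub>R\<^esub>) \<odot>\<^bsub>N\<^esub> \<phi> y'"
      using y \<phi>' by (simp_all add: M.smult_l_minus N.smult_l_minus)
    have "\<phi> (y \<oplus>\<^bsub>M\<^esub> \<ominus>\<^bsub>M\<^esub> y') = \<phi> y \<oplus>\<^bsub>N\<^esub> \<ominus>\<^bsub>N\<^esub> \<phi> y'"
      using y by (subst \<phi>'(2)) (auto simp: m M.smult_closed \<phi>'(3))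
    also have "\<dots> = \<zero>\<^bsub>N\<^esub>" using y \<phi>'(1) by (simp add: N.M.r_neg)
    finally have "y \<oplus>\<^bsub>M\<^esub> \<ominus>\<^bsub>M\<^esub> y' \<in> ?K" using y by simp
    then have "y \<oplus>\<^bsub>M\<^esub> \<ominus>\<^bsub>M\<^esub> y' = \<zero>\<^bsub>M\<^esub>" unfolding K by simp
    then show "y = y'" using y by (metis M.M.minus_equality M.M.minus_minus M.M.a_inv_closed)
  qed
  then show ?thesis using \<phi> im unfolding module_isomorphic_iff bij_betw_def by blast
qed

section \<open>Induction from a corner\<close>

text \<open>
  The ring \<open>R\<close> is a copy of the corner \<open>e A e\<close> by way of \<open>c\<close>, and
  so acts on \<open>A e\<close> from the right. In what follows \<open>Z = A e\<close>, the module
  \<open>T\<close> is \<open>Z \<otimes> V\<close> over \<open>R\<close>, and \<open>\<tau> x v\<close>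
  is the tensor \<open>x \<otimes> v\<close>.
\<close>

locale corner_tensor = A: ring A + R: ring R + V: left_module R V
  for A :: "('a, 's) ring_scheme" and R :: "('r, 't) ring_scheme" and V :: "('r, 'v) module" +
  fixes e :: 'a and c :: "'r \<Rightarrow> 'a"
  assumes e: "e \<in> carrier A" "e \<otimes>\<^bsub>A\<^esub> e = e"
    and c_bij: "bij_betw c (carrier R) ((\<lambda>x. e \<otimes>\<^bsub>A\<^esub> x \<otimes>\<^bsub>A\<^esub> e) ` carrier A)"
    and c_mult: "\<lbrakk>r \<in> carrier R; s \<in> carrier R\<rbrakk> \<Longrightarrow> c (r \<otimes>\<^bsub>R\<^esub> s) = c r \<otimes>\<^bsub>A\<^esub> c s"
    and c_add: "\<lbrakk>r \<in> carrier R; s \<in> carrier R\<rbrakk> \<Longrightarrow> c (r \<oplus>\<^bsub>R\<^esub> s) = c r \<oplus>\<^bsub>A\<^esub> c s"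
    and c_one: "c \<one>\<^bsub>R\<^esub> = e"
begin

definition Z :: "('a, 'a) module" where "Z = principal_left_module A e"

definition T :: "('a, ('a \<times> 'v \<Rightarrow>\<^sub>0 int) set) module" where
  "T = tensor_module R Z (\<lambda>x r. x \<otimes>\<^bsub>A\<^esub> c r) V"

abbreviation FF :: "('a \<times> 'v \<Rightarrow>\<^sub>0 int) monoid" where
  "FF \<equiv> free_Abelian_group (carrier Z \<times> carrier V)"

abbreviation rels :: "('a \<times> 'v \<Rightarrow>\<^sub>0 int) set" where
  "rels \<equiv> tensor_relations R Z (\<lambda>x r. x \<otimes>\<^bsub>A\<^esub> c r) V"

definition NN :: "('a \<times> 'v \<Rightarrow>\<^sub>0 int) set" where "NN = generate FF rels"

definition \<tau> :: "'a \<Rightarrow> 'v \<Rightarrow> ('a \<times> 'v \<Rightarrow>\<^sub>0 int) set" where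
  "\<tau> x v = NN #>\<^bsub>FF\<^esub> frag_of (x, v)"

lemma Z_simps: "carrier Z = (\<lambda>x. x \<otimes>\<^bsub>A\<^esub> e) ` carrier A" "ring.add Z = ring.add A" "module.smult Z = monoid.mult A"
  by (auto simp: Z_def principal_left_module_def r_coset_def)

lemma Z_iff: "x \<in> carrier Z \<longleftrightarrow> x \<in> carrier A \<and> x \<otimes>\<^bsub>A\<^esub> e = x"
proof
  assume "x \<in> carrier Z"
  then show "x \<in> carrier A \<and> x \<otimes>\<^bsub>A\<^esub> e = x" using e by (auto simp: Z_simps A.m_assoc)
next
  assume "x \<in> carrier A \<and> x \<otimes>\<^bsub>A\<^esub> e = x"
  then show "x \<in> carrier Z" unfolding Z_simps by (metis imageI)
qed

lemma c_corner: "r \<in> carrier R \<Longrightarrow> c r \<in> carrier A" "r \<in> carrier R \<Longrightarrow> e \<otimes>\<^bsub>A\<^esub> c r = c r"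
  "r \<in> carrier R \<Longrightarrow> c r \<otimes>\<^bsub>A\<^esub> e = c r"
proof -
  assume "r \<in> carrier R"
  then obtain x where "x \<in> carrier A" "c r = e \<otimes>\<^bsub>A\<^esub> x \<otimes>\<^bsub>A\<^esub> e" using c_bij by (auto simp: bij_betw_def)
  then show "c r \<in> carrier A" "e \<otimes>\<^bsub>A\<^esub> c r = c r" "c r \<otimes>\<^bsub>A\<^esub> e = c r"
    using e by (simp_all add: A.m_assoc) (simp add: A.m_assoc[symmetric])
qed

lemma c_surj:
  assumes "x \<in> carrier A" "e \<otimes>\<^bsub>A\<^esub> x = x" "x \<otimes>\<^bsub>A\<^esub> e = x"
  obtains r where "r \<in> carrier R" "c r = x"
proof -
  have "x = e \<otimes>\<^bsub>A\<^esub> x \<otimes>\<^bsub>A\<^esub> e" using assms by simp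
  then have "x \<in> (\<lambda>x. e \<otimes>\<^bsub>A\<^esub> x \<otimes>\<^bsub>A\<^esub> e) ` carrier A" using assms(1) by blast
  then show ?thesis using that c_bij unfolding bij_betw_def by (metis imageE)
qed

lemma Z_closed:
  "x \<in> carrier Z \<Longrightarrow> x \<in> carrier A" "e \<in> carrier Z"
  "x \<in> carrier Z \<Longrightarrow> y \<in> carrier Z \<Longrightarrow> x \<oplus>\<^bsub>A\<^esub> y \<in> carrier Z"
  "a \<in> carrier A \<Longrightarrow> x \<in> carrier Z \<Longrightarrow> a \<otimes>\<^bsub>A\<^esub> x \<in> carrier Z"
  "x \<in> carrier Z \<Longrightarrow> r \<in> carrier R \<Longrightarrow> x \<otimes>\<^bsub>A\<^esub> c r \<in> carrier Z"
  "\<zero>\<^bsub>A\<^esub> \<in> carrier Z"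
  using e c_corner by (auto simp: Z_iff A.m_assoc A.l_distr)

lemma rels_cases [consumes 1]:
  assumes "z \<in> rels"
  obtains (left) x y v where "x \<in> carrier Z" "y \<in> carrier Z" "v \<in> carrier V"
      "z = frag_of (x \<oplus>\<^bsub>A\<^esub> y, v) - frag_of (x, v) - frag_of (y, v)"
    | (right) x v w where "x \<in> carrier Z" "v \<in> carrier V" "w \<in> carrier V"
      "z = frag_of (x, v \<oplus>\<^bsub>V\<^esub> w) - frag_of (x, v) - frag_of (x, w)"
    | (balance) x r v where "x \<in> carrier Z" "r \<in> carrier R" "v \<in> carrier V"
      "z = frag_of (x \<otimes>\<^bsub>A\<^esub> c r, v) - frag_of (x, r \<odot>\<^bsub>V\<^esub> v)"
  using assms unfolding tensor_relations_def Z_simps(2) by blast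

lemma rels_intros:
  "\<lbrakk>x \<in> carrier Z; y \<in> carrier Z; v \<in> carrier V\<rbrakk> \<Longrightarrow>
    frag_of (x \<oplus>\<^bsub>A\<^esub> y, v) - frag_of (x, v) - frag_of (y, v) \<in> rels"
  "\<lbrakk>x \<in> carrier Z; v \<in> carrier V; w \<in> carrier V\<rbrakk> \<Longrightarrow>
    frag_of (x, v \<oplus>\<^bsub>V\<^esub> w) - frag_of (x, v) - frag_of (x, w) \<in> rels"
  "\<lbrakk>x \<in> carrier Z; r \<in> carrier R; v \<in> carrier V\<rbrakk> \<Longrightarrow>
    frag_of (x \<otimes>\<^bsub>A\<^esub> c r, v) - frag_of (x, r \<odot>\<^bsub>V\<^esub> v) \<in> rels"
  unfolding tensor_relations_def Z_simps(2) by blast+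

lemma diff_closed: "x \<in> carrier FF \<Longrightarrow> y \<in> carrier FF \<Longrightarrow> x - y \<in> carrier FF"
  using keys_diff[of x y] by auto

lemma rels_subset: "rels \<subseteq> carrier FF"
proof
  fix z assume "z \<in> rels"
  then show "z \<in> carrier FF"
    by (cases rule: rels_cases)
       (auto intro!: diff_closed simp: Z_closed V.smult_closed simp del: carrier_free_Abelian_group_iff)
qed

lemma NN_subgroup: "subgroup NN FF"
  unfolding NN_def by (rule group.generate_is_subgroup[OF group_free_Abelian_group rels_subset])

lemma NN_normal: "NN \<lhd> FF"
proof -
  interpret FF: comm_group FF by (rule abelian_free_Abelian_group)
  show ?thesis using NN_subgroup by (simp add: FF.normal_iff_subgroup)
qed

lemma T_simps: "carrier T = rcosets\<^bsub>FF\<^esub> NN" "\<zero>\<^bsub>T\<^esub> = NN" "ring.add T = set_mult FF"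
  "a \<odot>\<^bsub>T\<^esub> Y = (\<Union>y\<in>Y. NN #>\<^bsub>FF\<^esub> frag_extend (\<lambda>(x, v). frag_of (a \<otimes>\<^bsub>A\<^esub> x, v)) y)"
  by (simp_all add: T_def tensor_module_def NN_def Let_def Z_simps)

lemma T_eq_FactGroup:
  "carrier T = carrier (FF Mod NN)" "\<zero>\<^bsub>T\<^esub> = \<one>\<^bsub>FF Mod NN\<^esub>" "ring.add T = monoid.mult (FF Mod NN)"
  by (simp_all add: T_simps FactGroup_def)

lemma T_abelian: "abelian_group T"
proof -
  interpret FF: comm_group FF by (rule abelian_free_Abelian_group)
  interpret Q: comm_group "FF Mod NN" by (rule FF.abelian_FactGroup[OF NN_subgroup])
  show ?thesis
  proof (rule abelian_groupI)
    show "\<exists>y\<in>carrier T. y \<oplus>\<^bsub>T\<^esub> x = \<zero>\<^bsub>T\<^esub>" if "x \<in> carrier T" for x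
      using that unfolding T_eq_FactGroup by (intro bexI[of _ "inv\<^bsub>FF Mod NN\<^esub> x"] Q.l_inv Q.inv_closed)
  qed (unfold T_eq_FactGroup, (rule Q.m_closed Q.one_closed Q.m_assoc Q.m_comm Q.l_one; assumption)+)
qed

lemma coset_in_T: "x \<in> carrier FF \<Longrightarrow> NN #>\<^bsub>FF\<^esub> x \<in> carrier T"
  unfolding T_simps RCOSETS_def by blast

lemma T_cases:
  assumes "t \<in> carrier T" obtains x where "x \<in> carrier FF" "t = NN #>\<^bsub>FF\<^esub> x"
  using assms unfolding T_simps RCOSETS_def by blast

lemma coset_add: "x \<in> carrier FF \<Longrightarrow> y \<in> carrier FF \<Longrightarrow>
    (NN #>\<^bsub>FF\<^esub> x) \<oplus>\<^bsub>T\<^esub> (NN #>\<^bsub>FF\<^esub> y) = NN #>\<^bsub>FF\<^esub> (x + y)"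
  unfolding T_simps using normal.rcos_sum[OF NN_normal, of x y] by simp

lemma coset_eq_iff:
  assumes "x \<in> carrier FF" "y \<in> carrier FF"
  shows "NN #>\<^bsub>FF\<^esub> x = NN #>\<^bsub>FF\<^esub> y \<longleftrightarrow> x - y \<in> NN"
proof -
  interpret FF: group FF by simp
  have eq: "NN #>\<^bsub>FF\<^esub> z = {n + z | n. n \<in> NN}" for z by (auto simp: r_coset_def)
  show ?thesis
  proof
    assume "NN #>\<^bsub>FF\<^esub> x = NN #>\<^bsub>FF\<^esub> y"
    then have "x \<in> NN #>\<^bsub>FF\<^esub> y" using FF.rcos_self[OF assms(1) NN_subgroup] by simp
    then show "x - y \<in> NN" unfolding eq by auto
  next
    assume *: "x - y \<in> NN"
    have "x \<in> NN #>\<^bsub>FF\<^esub> y" unfolding eq using * by (intro CollectI exI[of _ "x - y"]) simp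
    then show "NN #>\<^bsub>FF\<^esub> x = NN #>\<^bsub>FF\<^esub> y" using FF.repr_independence[OF _ assms(2) NN_subgroup] by simp
  qed
qed

lemma \<tau>_closed: "x \<in> carrier Z \<Longrightarrow> v \<in> carrier V \<Longrightarrow> \<tau> x v \<in> carrier T"
  unfolding \<tau>_def by (rule coset_in_T) simp

lemma rels_NN: "z \<in> rels \<Longrightarrow> z \<in> NN"
  unfolding NN_def by (rule generate.incl)

lemma \<tau>_add_left: "\<lbrakk>x \<in> carrier Z; y \<in> carrier Z; v \<in> carrier V\<rbrakk> \<Longrightarrow> \<tau> (x \<oplus>\<^bsub>A\<^esub> y) v = \<tau> x v \<oplus>\<^bsub>T\<^esub> \<tau> y v"
proof -
  assume *: "x \<in> carrier Z" "y \<in> carrier Z" "v \<in> carrier V"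
  have f: "frag_of (x \<oplus>\<^bsub>A\<^esub> y, v) \<in> carrier FF" "frag_of (x, v) \<in> carrier FF" "frag_of (y, v) \<in> carrier FF"
    using * Z_closed by auto
  have "frag_of (x, v) + frag_of (y, v) \<in> carrier FF"
    using monoid.m_closed[OF group.is_monoid[OF group_free_Abelian_group] f(2,3)] by simp
  from coset_eq_iff[OF f(1) this] show ?thesis unfolding \<tau>_def coset_add[OF f(2,3)]
    using rels_NN[OF rels_intros(1)[OF *]] by (simp add: diff_diff_eq)
qed

lemma \<tau>_add_right: "\<lbrakk>x \<in> carrier Z; v \<in> carrier V; w \<in> carrier V\<rbrakk> \<Longrightarrow> \<tau> x (v \<oplus>\<^bsub>V\<^esub> w) = \<tau> x v \<oplus>\<^bsub>T\<^esub> \<tau> x w"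
proof -
  assume *: "x \<in> carrier Z" "v \<in> carrier V" "w \<in> carrier V"
  have f: "frag_of (x, v \<oplus>\<^bsub>V\<^esub> w) \<in> carrier FF" "frag_of (x, v) \<in> carrier FF" "frag_of (x, w) \<in> carrier FF"
    using * by auto
  have "frag_of (x, v) + frag_of (x, w) \<in> carrier FF"
    using monoid.m_closed[OF group.is_monoid[OF group_free_Abelian_group] f(2,3)] by simp
  from coset_eq_iff[OF f(1) this] show ?thesis unfolding \<tau>_def coset_add[OF f(2,3)]
    using rels_NN[OF rels_intros(2)[OF *]] by (simp add: diff_diff_eq)
qed

lemma \<tau>_balanced: "\<lbrakk>x \<in> carrier Z; r \<in> carrier R; v \<in> carrier V\<rbrakk> \<Longrightarrow> \<tau> (x \<otimes>\<^bsub>A\<^esub> c r) v = \<tau> x (r \<odot>\<^bsub>V\<^esub> v)"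
proof -
  assume *: "x \<in> carrier Z" "r \<in> carrier R" "v \<in> carrier V"
  have "frag_of (x \<otimes>\<^bsub>A\<^esub> c r, v) \<in> carrier FF" "frag_of (x, r \<odot>\<^bsub>V\<^esub> v) \<in> carrier FF"
    using * Z_closed V.smult_closed by auto
  from coset_eq_iff[OF this] show ?thesis
    unfolding \<tau>_def using rels_NN[OF rels_intros(3)[OF *]] by blast
qed

text \<open>
  Extend \<open>\<beta>\<close> to the free abelian group on \<open>Z \<times> V\<close>; the extension
  kills the relations, hence the subgroup that they generate.
\<close>

lemma tensor_universal:
  fixes L :: "('q, 'l) module"
  assumes L: "abelian_group L"
    and closed: "\<And>x v. x \<in> carrier Z \<Longrightarrow> v \<in> carrier V \<Longrightarrow> \<beta> x v \<in> carrier L"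
    and left: "\<And>x y v. \<lbrakk>x \<in> carrier Z; y \<in> carrier Z; v \<in> carrier V\<rbrakk> \<Longrightarrow> \<beta> (x \<oplus>\<^bsub>A\<^esub> y) v = \<beta> x v \<oplus>\<^bsub>L\<^esub> \<beta> y v"
    and right: "\<And>x v w. \<lbrakk>x \<in> carrier Z; v \<in> carrier V; w \<in> carrier V\<rbrakk> \<Longrightarrow> \<beta> x (v \<oplus>\<^bsub>V\<^esub> w) = \<beta> x v \<oplus>\<^bsub>L\<^esub> \<beta> x w"
    and bal: "\<And>x r v. \<lbrakk>x \<in> carrier Z; r \<in> carrier R; v \<in> carrier V\<rbrakk> \<Longrightarrow> \<beta> (x \<otimes>\<^bsub>A\<^esub> c r) v = \<beta> x (r \<odot>\<^bsub>V\<^esub> v)"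
  shows "\<exists>h \<in> hom (add_monoid T) (add_monoid L).
    \<forall>x\<in>carrier Z. \<forall>v\<in>carrier V. h (\<tau> x v) = \<beta> x v"
proof -
  interpret L: abelian_group L by (rule L)
  have im: "(\<lambda>(x, v). \<beta> x v) ` (carrier Z \<times> carrier V) \<subseteq> carrier (add_monoid L)"
    using closed by auto
  have "\<exists>g \<in> hom FF (add_monoid L). \<forall>p \<in> carrier Z \<times> carrier V. g (frag_of p) = (\<lambda>(x, v). \<beta> x v) p"
    by (rule comm_group.free_Abelian_group_universal[OF L.a_comm_group im]) blast
  then obtain g where g: "g \<in> hom FF (add_monoid L)"
    "\<And>p. p \<in> carrier Z \<times> carrier V \<Longrightarrow> g (frag_of p) = (\<lambda>(x, v). \<beta> x v) p"
    by blast
  interpret g: group_hom FF "add_monoid L" g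
    using g(1) by (simp add: group_hom_def group_hom_axioms_def comm_group.axioms(2)[OF L.a_comm_group])
  have gdiff: "g (x - y) = g x \<oplus>\<^bsub>L\<^esub> \<ominus>\<^bsub>L\<^esub> g y" if "x \<in> carrier FF" "y \<in> carrier FF" for x y
  proof -
    have "g (x \<otimes>\<^bsub>FF\<^esub> inv\<^bsub>FF\<^esub> y) = g x \<oplus>\<^bsub>L\<^esub> \<ominus>\<^bsub>L\<^esub> g y"
      using that g.hom_mult[of x "inv\<^bsub>FF\<^esub> y"] g.hom_inv[of y] g.G.inv_closed[of y]
      by (simp add: a_inv_def del: inv_free_Abelian_group carrier_free_Abelian_group_iff)
    then show ?thesis using that by simp
  qed
  have gfrag: "g (frag_of (x, v)) = \<beta> x v" if "x \<in> carrier Z" "v \<in> carrier V" for x v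
    using g(2)[of "(x, v)"] that by simp
  have minus: "(p \<oplus>\<^bsub>L\<^esub> q) \<oplus>\<^bsub>L\<^esub> \<ominus>\<^bsub>L\<^esub> p \<oplus>\<^bsub>L\<^esub> \<ominus>\<^bsub>L\<^esub> q = \<zero>\<^bsub>L\<^esub>" if "p \<in> carrier L" "q \<in> carrier L" for p q
    using that by (simp add: L.a_ac L.r_neg) (metis L.a_assoc L.a_inv_closed L.add.m_lcomm L.r_neg L.r_zero L.zero_closed)
  have "rels \<subseteq> kernel FF (add_monoid L) g"
  proof
    fix z assume z: "z \<in> rels"
    then have "g z = \<zero>\<^bsub>L\<^esub>"
    proof (cases rule: rels_cases)
      case (left x y v)
      then show ?thesis
        using assms(3)[of x y v] minus closed
        by (simp add: gdiff diff_closed gfrag Z_closed del: carrier_free_Abelian_group_iff)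
    next
      case (right x v w)
      then show ?thesis
        using assms(4)[of x v w] minus closed
        by (simp add: gdiff diff_closed gfrag Z_closed del: carrier_free_Abelian_group_iff)
    next
      case (balance x r v)
      then show ?thesis
        using bal[of x r v] closed L.r_neg V.smult_closed
        by (simp add: gdiff diff_closed gfrag Z_closed del: carrier_free_Abelian_group_iff)
    qed
    then show "z \<in> kernel FF (add_monoid L) g" using subsetD[OF rels_subset z] by (simp add: kernel_def)
  qed
  then have "NN \<subseteq> kernel FF (add_monoid L) g"
    unfolding NN_def by (rule g.G.generate_subgroup_incl[OF _ g.subgroup_kernel])
  then have "\<exists>h \<in> hom (FF Mod NN) (add_monoid L). \<forall>x\<in>carrier FF. h (NN #>\<^bsub>FF\<^esub> x) = g x"
    by (rule g.FactGroup_universal_kernel[OF NN_normal]) blast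
  then obtain h where h: "h \<in> hom (FF Mod NN) (add_monoid L)" "\<And>x. x \<in> carrier FF \<Longrightarrow> h (NN #>\<^bsub>FF\<^esub> x) = g x"
    by blast
  have "h \<in> hom (add_monoid T) (add_monoid L)"
    using h(1) unfolding hom_def by (simp add: T_eq_FactGroup del: mult_FactGroup)
  moreover have "h (\<tau> x v) = \<beta> x v" if "x \<in> carrier Z" "v \<in> carrier V" for x v
    unfolding \<tau>_def using h(2)[of "frag_of (x, v)"] gfrag that by simp
  ultimately show ?thesis by blast
qed

text \<open>
  The free abelian group is generated by its basis under differences, and this passes to the quotient.
\<close>

lemma tensor_induct [consumes 1, case_names zero gen diff]:
  assumes t: "t \<in> carrier T"
    and zero: "P \<zero>\<^bsub>T\<^esub>"
    and gen: "\<And>x v. x \<in> carrier Z \<Longrightarrow> v \<in> carrier V \<Longrightarrow> P (\<tau> x v)"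
    and diff: "\<And>s t. \<lbrakk>s \<in> carrier T; t \<in> carrier T; P s; P t\<rbrakk> \<Longrightarrow> P (s \<ominus>\<^bsub>T\<^esub> t)"
  shows "P t"
proof -
  interpret T: abelian_group T by (rule T_abelian)
  obtain z where z: "z \<in> carrier FF" "t = NN #>\<^bsub>FF\<^esub> z" using t by (rule T_cases)
  have "Poly_Mapping.keys z \<subseteq> carrier Z \<times> carrier V" using z(1) by simp
  then have "P (NN #>\<^bsub>FF\<^esub> z)"
  proof (rule free_Abelian_group_induct[where P = "\<lambda>z. P (NN #>\<^bsub>FF\<^esub> z)"])
    interpret FF: group FF by simp
    have "NN #>\<^bsub>FF\<^esub> \<one>\<^bsub>FF\<^esub> = NN" using subgroup.subset[OF NN_subgroup] by (rule FF.coset_mult_one)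
    then show "P (NN #>\<^bsub>FF\<^esub> 0)" using zero by (simp add: T_simps)
  next
    fix x y assume "Poly_Mapping.keys x \<subseteq> carrier Z \<times> carrier V" "Poly_Mapping.keys y \<subseteq> carrier Z \<times> carrier V"
      and P: "P (NN #>\<^bsub>FF\<^esub> x)" "P (NN #>\<^bsub>FF\<^esub> y)"
    then have xy: "x \<in> carrier FF" "y \<in> carrier FF" by auto
    note d = diff_closed[OF xy]
    have "NN #>\<^bsub>FF\<^esub> x = (NN #>\<^bsub>FF\<^esub> (x - y)) \<oplus>\<^bsub>T\<^esub> (NN #>\<^bsub>FF\<^esub> y)"
      unfolding coset_add[OF d xy(2)] by simp
    then have "NN #>\<^bsub>FF\<^esub> (x - y) = (NN #>\<^bsub>FF\<^esub> x) \<ominus>\<^bsub>T\<^esub> (NN #>\<^bsub>FF\<^esub> y)"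
      using coset_in_T[OF xy(2)] coset_in_T[OF d]
      by (simp add: a_minus_def T.a_assoc T.r_neg)
    then show "P (NN #>\<^bsub>FF\<^esub> (x - y))" using diff[OF coset_in_T[OF xy(1)] coset_in_T[OF xy(2)] P] by simp
  next
    fix p assume "p \<in> carrier Z \<times> carrier V"
    then show "P (NN #>\<^bsub>FF\<^esub> frag_of p)" using gen unfolding \<tau>_def by (cases p) auto
  qed
  then show ?thesis using z(2) by simp
qed

abbreviation scalar :: "'a \<Rightarrow> ('a \<times> 'v \<Rightarrow>\<^sub>0 int) \<Rightarrow> ('a \<times> 'v \<Rightarrow>\<^sub>0 int)" where
  "scalar a \<equiv> frag_extend (\<lambda>(x, v). frag_of (a \<otimes>\<^bsub>A\<^esub> x, v))"

lemma scalar_closed: "a \<in> carrier A \<Longrightarrow> z \<in> carrier FF \<Longrightarrow> scalar a z \<in> carrier FF"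
  using keys_frag_extend[of "\<lambda>(x, v). frag_of (a \<otimes>\<^bsub>A\<^esub> x, v)" z] Z_closed(4)[of a] by force

lemma scalar_NN:
  assumes a: "a \<in> carrier A" and z: "z \<in> NN"
  shows "scalar a z \<in> NN"
proof -
  have r: "scalar a y \<in> NN" if y: "y \<in> rels" for y
    using y
  proof (cases rule: rels_cases)
    case (left x x' v)
    have "frag_of (a \<otimes>\<^bsub>A\<^esub> x \<oplus>\<^bsub>A\<^esub> a \<otimes>\<^bsub>A\<^esub> x', v) - frag_of (a \<otimes>\<^bsub>A\<^esub> x, v) - frag_of (a \<otimes>\<^bsub>A\<^esub> x', v) \<in> NN"
      using left Z_closed(4)[OF a] by (intro rels_NN rels_intros) auto
    then show ?thesis using left a Z_closed(1) by (simp add: frag_extend_diff A.r_distr)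
  next
    case (right x v w)
    have "frag_of (a \<otimes>\<^bsub>A\<^esub> x, v \<oplus>\<^bsub>V\<^esub> w) - frag_of (a \<otimes>\<^bsub>A\<^esub> x, v) - frag_of (a \<otimes>\<^bsub>A\<^esub> x, w) \<in> NN"
      using right Z_closed(4)[OF a] by (intro rels_NN rels_intros) auto
    then show ?thesis using right by (simp add: frag_extend_diff)
  next
    case (balance x r v)
    have "frag_of ((a \<otimes>\<^bsub>A\<^esub> x) \<otimes>\<^bsub>A\<^esub> c r, v) - frag_of (a \<otimes>\<^bsub>A\<^esub> x, r \<odot>\<^bsub>V\<^esub> v) \<in> NN"
      using balance Z_closed(4)[OF a] by (intro rels_NN rels_intros) auto
    then show ?thesis using balance a Z_closed(1) c_corner(1) by (simp add: frag_extend_diff A.m_assoc)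
  qed
  have inv: "- w \<in> NN" if "w \<in> NN" for w
    using subgroup.m_inv_closed[OF NN_subgroup that] subgroup.mem_carrier[OF NN_subgroup that] by simp
  have add: "v + w \<in> NN" if "v \<in> NN" "w \<in> NN" for v w
    using subgroup.m_closed[OF NN_subgroup that] by simp
  have one: "0 \<in> NN" using subgroup.one_closed[OF NN_subgroup] by simp
  show ?thesis
    using z unfolding NN_def
  proof (induction z rule: generate.induct)
    case (inv h)
    have "h \<in> carrier FF" by (rule subsetD[OF rels_subset inv])
    then have "inv\<^bsub>FF\<^esub> h = - h" by simp
    then show ?case using \<open>\<And>w. w \<in> NN \<Longrightarrow> - w \<in> NN\<close> r[OF inv] by (simp add: frag_extend_minus NN_def)
  qed (use one r add in \<open>auto simp: frag_extend_add NN_def\<close>)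
qed

lemma smult_coset:
  assumes a: "a \<in> carrier A" and z: "z \<in> carrier FF"
  shows "a \<odot>\<^bsub>T\<^esub> (NN #>\<^bsub>FF\<^esub> z) = NN #>\<^bsub>FF\<^esub> scalar a z"
proof -
  interpret FF: group FF by simp
  have zz: "z \<in> NN #>\<^bsub>FF\<^esub> z" by (rule FF.rcos_self[OF z NN_subgroup])
  have "NN #>\<^bsub>FF\<^esub> scalar a y = NN #>\<^bsub>FF\<^esub> scalar a z" if y: "y \<in> NN #>\<^bsub>FF\<^esub> z" for y
  proof -
    obtain n where n: "n \<in> NN" "y = n + z" using y by (auto simp: r_coset_def)
    have nF: "n \<in> carrier FF" by (rule subgroup.mem_carrier[OF NN_subgroup n(1)])
    then have yF: "y \<in> carrier FF" using FF.m_closed[OF nF z] n(2) by simp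
    have "scalar a y - scalar a z = scalar a n" by (simp add: n(2) frag_extend_add)
    then show ?thesis
      using scalar_NN[OF a n(1)] coset_eq_iff[OF scalar_closed[OF a yF] scalar_closed[OF a z]] by simp
  qed
  then show ?thesis unfolding T_simps using zz by blast
qed

lemma smult_\<tau>: "a \<in> carrier A \<Longrightarrow> x \<in> carrier Z \<Longrightarrow> v \<in> carrier V \<Longrightarrow> a \<odot>\<^bsub>T\<^esub> \<tau> x v = \<tau> (a \<otimes>\<^bsub>A\<^esub> x) v"
  unfolding \<tau>_def by (subst smult_coset) auto

lemma T_module: "left_module A T"
proof -
  interpret T: abelian_group T by (rule T_abelian)
  have closed: "a \<odot>\<^bsub>T\<^esub> t \<in> carrier T" if "a \<in> carrier A" "t \<in> carrier T" for a t
    using that by (elim T_cases) (simp add: smult_coset coset_in_T scalar_closed del: carrier_free_Abelian_group_iff)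
  have rdist: "a \<odot>\<^bsub>T\<^esub> (s \<oplus>\<^bsub>T\<^esub> t) = a \<odot>\<^bsub>T\<^esub> s \<oplus>\<^bsub>T\<^esub> a \<odot>\<^bsub>T\<^esub> t"
    if a: "a \<in> carrier A" and s: "s \<in> carrier T" and t: "t \<in> carrier T" for a s t
  proof -
    obtain x y where x: "x \<in> carrier FF" "s = NN #>\<^bsub>FF\<^esub> x" and y: "y \<in> carrier FF" "t = NN #>\<^bsub>FF\<^esub> y"
      using s t by (metis T_cases)
    have "x + y \<in> carrier FF" using x(1) y(1) keys_add[of x y] by auto
    then show ?thesis unfolding x(2) y(2)
      using x(1) y(1) a scalar_closed[OF a]
      by (simp add: smult_coset coset_add frag_extend_add del: carrier_free_Abelian_group_iff)
  qed
  have neg: "a \<odot>\<^bsub>T\<^esub> (s \<ominus>\<^bsub>T\<^esub> t) = a \<odot>\<^bsub>T\<^esub> s \<ominus>\<^bsub>T\<^esub> a \<odot>\<^bsub>T\<^esub> t"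
    if "a \<in> carrier A" "s \<in> carrier T" "t \<in> carrier T" for a s t
  proof -
    have "a \<odot>\<^bsub>T\<^esub> s = a \<odot>\<^bsub>T\<^esub> (s \<ominus>\<^bsub>T\<^esub> t) \<oplus>\<^bsub>T\<^esub> a \<odot>\<^bsub>T\<^esub> t"
      using rdist[OF that(1) T.minus_closed[OF that(2,3)] that(3)] that
      by (simp add: a_minus_def T.a_assoc T.l_neg)
    then show ?thesis using closed that by (simp add: a_minus_def T.a_assoc T.r_neg)
  qed
  have ac: "(p \<ominus>\<^bsub>T\<^esub> q) \<oplus>\<^bsub>T\<^esub> (p' \<ominus>\<^bsub>T\<^esub> q') = (p \<oplus>\<^bsub>T\<^esub> p') \<ominus>\<^bsub>T\<^esub> (q \<oplus>\<^bsub>T\<^esub> q')"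
    if "p \<in> carrier T" "q \<in> carrier T" "p' \<in> carrier T" "q' \<in> carrier T" for p q p' q'
    using that by (simp add: a_minus_def T.minus_add T.a_ac)
  have zero: "a \<odot>\<^bsub>T\<^esub> \<zero>\<^bsub>T\<^esub> = \<zero>\<^bsub>T\<^esub>" if "a \<in> carrier A" for a
    using neg[OF that T.zero_closed T.zero_closed] closed[OF that T.zero_closed]
    by (simp add: a_minus_def T.r_neg)
  show ?thesis
  proof (intro left_module.intro A.ring_axioms T_abelian left_module_axioms.intro closed rdist)
    fix a b t assume ab: "a \<in> carrier A" "b \<in> carrier A" and t: "t \<in> carrier T"
    show "(a \<oplus>\<^bsub>A\<^esub> b) \<odot>\<^bsub>T\<^esub> t = a \<odot>\<^bsub>T\<^esub> t \<oplus>\<^bsub>T\<^esub> b \<odot>\<^bsub>T\<^esub> t" using t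
    proof (induction t rule: tensor_induct)
      case zero
      then show ?case using ab \<open>\<And>a. a \<in> carrier A \<Longrightarrow> a \<odot>\<^bsub>T\<^esub> \<zero>\<^bsub>T\<^esub> = \<zero>\<^bsub>T\<^esub>\<close> by simp
    next
      case (gen x v)
      then show ?case using ab Z_closed(1,4) by (simp add: smult_\<tau> A.l_distr \<tau>_add_left)
    next
      case (diff s t)
      then show ?case using ab by (simp add: neg ac closed)
    qed
    show "(a \<otimes>\<^bsub>A\<^esub> b) \<odot>\<^bsub>T\<^esub> t = a \<odot>\<^bsub>T\<^esub> (b \<odot>\<^bsub>T\<^esub> t)" using t
    proof (induction t rule: tensor_induct)
      case zero
      then show ?case using ab \<open>\<And>a. a \<in> carrier A \<Longrightarrow> a \<odot>\<^bsub>T\<^esub> \<zero>\<^bsub>T\<^esub> = \<zero>\<^bsub>T\<^esub>\<close> by simp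
    next
      case (gen x v)
      then show ?case using ab Z_closed(1,4) by (simp add: smult_\<tau> A.m_assoc)
    next
      case (diff s t)
      then show ?case using ab by (simp add: neg closed)
    qed
  next
    fix t assume "t \<in> carrier T"
    then show "\<one>\<^bsub>A\<^esub> \<odot>\<^bsub>T\<^esub> t = t"
    proof (induction t rule: tensor_induct)
      case zero
      then show ?case using \<open>\<And>a. a \<in> carrier A \<Longrightarrow> a \<odot>\<^bsub>T\<^esub> \<zero>\<^bsub>T\<^esub> = \<zero>\<^bsub>T\<^esub>\<close> by simp
    next
      case (gen x v)
      then show ?case using Z_closed(1) by (simp add: smult_\<tau>)
    qed (simp add: neg)
  qed
qed

lemma tensor_universal_linear:
  assumes L: "left_module A L"
    and closed: "\<And>x v. x \<in> carrier Z \<Longrightarrow> v \<in> carrier V \<Longrightarrow> \<beta> x v \<in> carrier L"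
    and left: "\<And>x y v. \<lbrakk>x \<in> carrier Z; y \<in> carrier Z; v \<in> carrier V\<rbrakk> \<Longrightarrow> \<beta> (x \<oplus>\<^bsub>A\<^esub> y) v = \<beta> x v \<oplus>\<^bsub>L\<^esub> \<beta> y v"
    and right: "\<And>x v w. \<lbrakk>x \<in> carrier Z; v \<in> carrier V; w \<in> carrier V\<rbrakk> \<Longrightarrow> \<beta> x (v \<oplus>\<^bsub>V\<^esub> w) = \<beta> x v \<oplus>\<^bsub>L\<^esub> \<beta> x w"
    and bal: "\<And>x r v. \<lbrakk>x \<in> carrier Z; r \<in> carrier R; v \<in> carrier V\<rbrakk> \<Longrightarrow> \<beta> (x \<otimes>\<^bsub>A\<^esub> c r) v = \<beta> x (r \<odot>\<^bsub>V\<^esub> v)"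
    and lin: "\<And>a x v. \<lbrakk>a \<in> carrier A; x \<in> carrier Z; v \<in> carrier V\<rbrakk> \<Longrightarrow> \<beta> (a \<otimes>\<^bsub>A\<^esub> x) v = a \<odot>\<^bsub>L\<^esub> \<beta> x v"
  shows "\<exists>h \<in> linear_maps A T L. \<forall>x\<in>carrier Z. \<forall>v\<in>carrier V. h (\<tau> x v) = \<beta> x v"
proof -
  interpret L: left_module A L by (rule L)
  interpret T: left_module A T by (rule T_module)
  obtain h where h: "h \<in> hom (add_monoid T) (add_monoid L)"
    "\<And>x v. x \<in> carrier Z \<Longrightarrow> v \<in> carrier V \<Longrightarrow> h (\<tau> x v) = \<beta> x v"
    using tensor_universal[OF L.M.abelian_group_axioms closed left right bal] by blast
  have hc: "h t \<in> carrier L" if "t \<in> carrier T" for t using h(1) that by (auto simp: hom_def)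
  have ha: "h (s \<oplus>\<^bsub>T\<^esub> t) = h s \<oplus>\<^bsub>L\<^esub> h t" if "s \<in> carrier T" "t \<in> carrier T" for s t
    using h(1) that by (auto simp: hom_def)
  have hd: "h (s \<ominus>\<^bsub>T\<^esub> t) = h s \<ominus>\<^bsub>L\<^esub> h t" if "s \<in> carrier T" "t \<in> carrier T" for s t
  proof -
    have "h s = h (s \<ominus>\<^bsub>T\<^esub> t) \<oplus>\<^bsub>L\<^esub> h t"
      using ha[OF T.M.minus_closed[OF that] that(2)] that by (simp add: a_minus_def T.M.a_assoc T.M.l_neg)
    then show ?thesis using hc that by (simp add: a_minus_def L.M.a_assoc L.M.r_neg)
  qed
  have hz: "h \<zero>\<^bsub>T\<^esub> = \<zero>\<^bsub>L\<^esub>" using hd[OF T.M.zero_closed T.M.zero_closed] hc[OF T.M.zero_closed]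
    by (simp add: a_minus_def L.M.r_neg T.M.r_neg)
  have Ldiff: "a \<odot>\<^bsub>L\<^esub> (x \<ominus>\<^bsub>L\<^esub> y) = a \<odot>\<^bsub>L\<^esub> x \<ominus>\<^bsub>L\<^esub> a \<odot>\<^bsub>L\<^esub> y"
    if "a \<in> carrier A" "x \<in> carrier L" "y \<in> carrier L" for a x y
  proof -
    have "a \<odot>\<^bsub>L\<^esub> x = a \<odot>\<^bsub>L\<^esub> (x \<ominus>\<^bsub>L\<^esub> y) \<oplus>\<^bsub>L\<^esub> a \<odot>\<^bsub>L\<^esub> y"
      using L.smult_r_distr[OF that(1) L.M.minus_closed[OF that(2,3)] that(3)] that
      by (simp add: a_minus_def L.M.a_assoc L.M.l_neg)
    then show ?thesis using L.smult_closed that by (simp add: a_minus_def L.M.a_assoc L.M.r_neg)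
  qed
  have Tdiff: "a \<odot>\<^bsub>T\<^esub> (x \<ominus>\<^bsub>T\<^esub> y) = a \<odot>\<^bsub>T\<^esub> x \<ominus>\<^bsub>T\<^esub> a \<odot>\<^bsub>T\<^esub> y"
    if "a \<in> carrier A" "x \<in> carrier T" "y \<in> carrier T" for a x y
  proof -
    have "a \<odot>\<^bsub>T\<^esub> x = a \<odot>\<^bsub>T\<^esub> (x \<ominus>\<^bsub>T\<^esub> y) \<oplus>\<^bsub>T\<^esub> a \<odot>\<^bsub>T\<^esub> y"
      using T.smult_r_distr[OF that(1) T.M.minus_closed[OF that(2,3)] that(3)] that
      by (simp add: a_minus_def T.M.a_assoc T.M.l_neg)
    then show ?thesis using T.smult_closed that by (simp add: a_minus_def T.M.a_assoc T.M.r_neg)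
  qed
  have "h (a \<odot>\<^bsub>T\<^esub> t) = a \<odot>\<^bsub>L\<^esub> h t" if a: "a \<in> carrier A" and "t \<in> carrier T" for a t
    using that(2)
  proof (induction t rule: tensor_induct)
    case zero
    then show ?case using a by (simp add: T.smult_r_null L.smult_r_null hz)
  next
    case (gen x v)
    then show ?case using a lin Z_closed(4) by (simp add: smult_\<tau> h(2))
  next
    case (diff s t)
    then show ?case using a by (simp add: Tdiff Ldiff hd T.smult_closed hc)
  qed
  then have "h \<in> linear_maps A T L" using hc ha by (intro linear_mapsI) auto
  then show ?thesis using h(2) by blast
qed

text \<open>
  The corner module \<open>e T\<close> is a copy of \<open>V\<close>: the map \<open>x \<otimes> v \<mapsto> c\<^sup>-\<^sup>1(e x) v\<close> is a left inverse of
  \<open>v \<mapsto> e \<otimes> v\<close>.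
\<close>

lemma tensor_retraction:
  shows "\<exists>h \<in> hom (add_monoid T) (add_monoid V). \<forall>v\<in>carrier V. h (\<tau> e v) = v"
proof -
  let ?d = "inv_into (carrier R) c"
  have ex: "\<exists>r\<in>carrier R. c r = e \<otimes>\<^bsub>A\<^esub> x" if x: "x \<in> carrier Z" for x
  proof -
    have "e \<otimes>\<^bsub>A\<^esub> x \<in> carrier A" "e \<otimes>\<^bsub>A\<^esub> (e \<otimes>\<^bsub>A\<^esub> x) = e \<otimes>\<^bsub>A\<^esub> x" "e \<otimes>\<^bsub>A\<^esub> x \<otimes>\<^bsub>A\<^esub> e = e \<otimes>\<^bsub>A\<^esub> x"
      using x e by (simp_all add: Z_iff A.m_assoc) (simp add: A.m_assoc[symmetric])
    then show ?thesis by (rule c_surj) blast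
  qed
  define d where "d x = ?d (e \<otimes>\<^bsub>A\<^esub> x)" for x
  have d: "d x \<in> carrier R" "c (d x) = e \<otimes>\<^bsub>A\<^esub> x" if "x \<in> carrier Z" for x
    using ex[OF that] inv_into_into[of "e \<otimes>\<^bsub>A\<^esub> x" c "carrier R"] f_inv_into_f[of "e \<otimes>\<^bsub>A\<^esub> x" c "carrier R"]
    unfolding d_def by (metis imageI)+
  have inj: "r = s" if "r \<in> carrier R" "s \<in> carrier R" "c r = c s" for r s
    using c_bij that by (auto simp: bij_betw_def inj_on_def)
  have dadd: "d (x \<oplus>\<^bsub>A\<^esub> y) = d x \<oplus>\<^bsub>R\<^esub> d y" if "x \<in> carrier Z" "y \<in> carrier Z" for x y
    using that d Z_closed(1,3) e(1) by (intro inj) (auto simp: c_add A.r_distr)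
  have dmult: "d (x \<otimes>\<^bsub>A\<^esub> c r) = d x \<otimes>\<^bsub>R\<^esub> r" if "x \<in> carrier Z" "r \<in> carrier R" for x r
    using that d Z_closed(1,5) e(1) c_corner(1) by (intro inj) (auto simp: c_mult A.m_assoc)
  have de: "d e = \<one>\<^bsub>R\<^esub>" using d[OF Z_closed(2)] e by (intro inj) (auto simp: c_one)
  have "\<exists>h \<in> hom (add_monoid T) (add_monoid V).
    \<forall>x\<in>carrier Z. \<forall>v\<in>carrier V. h (\<tau> x v) = d x \<odot>\<^bsub>V\<^esub> v"
    by (rule tensor_universal[OF V.M.abelian_group_axioms])
       (auto simp: d(1) V.smult_closed dadd dmult V.smult_l_distr V.smult_r_distr V.smult_assoc)
  then obtain h where h: "h \<in> hom (add_monoid T) (add_monoid V)"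
    "\<forall>x\<in>carrier Z. \<forall>v\<in>carrier V. h (\<tau> x v) = d x \<odot>\<^bsub>V\<^esub> v" by blast
  have "h (\<tau> e v) = v" if "v \<in> carrier V" for v
    using h(2) Z_closed(2) that by (simp add: de V.smult_one)
  then show ?thesis using h(1) by blast
qed

text \<open>
  For \<open>x \<in> A e\<close> the element \<open>e x\<close> is in the corner, so \<open>e (x
  \<otimes> v) = e \<otimes> c\<^sup>-\<^sup>1(e x) v\<close>.
\<close>

lemma smult_e_\<tau>:
  assumes "t \<in> carrier T" shows "\<exists>v\<in>carrier V. e \<odot>\<^bsub>T\<^esub> t = \<tau> e v"
proof -
  interpret T: left_module A T by (rule T_module)
  have z: "\<tau> e \<zero>\<^bsub>V\<^esub> = \<zero>\<^bsub>T\<^esub>"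
    using \<tau>_add_right[OF Z_closed(2) V.M.zero_closed V.M.zero_closed] \<tau>_closed[OF Z_closed(2) V.M.zero_closed]
    by (simp add: T.M.add.l_cancel_one)
  have neg: "\<tau> e (\<ominus>\<^bsub>V\<^esub> v) = \<ominus>\<^bsub>T\<^esub> \<tau> e v" if "v \<in> carrier V" for v
    using \<tau>_add_right[OF Z_closed(2), of "\<ominus>\<^bsub>V\<^esub> v" v] that \<tau>_closed[OF Z_closed(2)] z
    by (metis V.M.a_inv_closed V.M.l_neg T.M.minus_equality)
  show ?thesis using assms
  proof (induction t rule: tensor_induct)
    case zero
    then show ?case using z V.M.zero_closed e(1) by (metis T.smult_r_null)
  next
    case (gen x v)
    have "e \<otimes>\<^bsub>A\<^esub> x \<in> carrier A" "e \<otimes>\<^bsub>A\<^esub> (e \<otimes>\<^bsub>A\<^esub> x) = e \<otimes>\<^bsub>A\<^esub> x" "e \<otimes>\<^bsub>A\<^esub> x \<otimes>\<^bsub>A\<^esub> e = e \<otimes>\<^bsub>A\<^esub> x"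
      using gen e by (simp_all add: Z_iff A.m_assoc) (simp add: A.m_assoc[symmetric])
    then obtain r where r: "r \<in> carrier R" "c r = e \<otimes>\<^bsub>A\<^esub> x" by (rule c_surj)
    have "e \<odot>\<^bsub>T\<^esub> \<tau> x v = \<tau> (e \<otimes>\<^bsub>A\<^esub> c r) v" using gen e(1) r c_corner(2)[OF r(1)] by (simp add: smult_\<tau>)
    then show ?case using \<tau>_balanced[OF Z_closed(2) r(1)] gen V.smult_closed[OF r(1)] by auto
  next
    case (diff s t)
    then obtain v w where vw: "v \<in> carrier V" "w \<in> carrier V" "e \<odot>\<^bsub>T\<^esub> s = \<tau> e v" "e \<odot>\<^bsub>T\<^esub> t = \<tau> e w" by blast
    have "\<ominus>\<^bsub>T\<^esub> t = (\<ominus>\<^bsub>A\<^esub> \<one>\<^bsub>A\<^esub>) \<odot>\<^bsub>T\<^esub> t" using diff by (simp add: T.smult_l_minus)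
    then have "e \<odot>\<^bsub>T\<^esub> (\<ominus>\<^bsub>T\<^esub> t) = (e \<otimes>\<^bsub>A\<^esub> (\<ominus>\<^bsub>A\<^esub> \<one>\<^bsub>A\<^esub>)) \<odot>\<^bsub>T\<^esub> t"
      using diff e(1) by (simp add: T.smult_assoc)
    also have "\<dots> = ((\<ominus>\<^bsub>A\<^esub> \<one>\<^bsub>A\<^esub>) \<otimes>\<^bsub>A\<^esub> e) \<odot>\<^bsub>T\<^esub> t"
      using e(1) by (simp add: A.r_minus A.l_minus)
    also have "\<dots> = \<ominus>\<^bsub>T\<^esub> (e \<odot>\<^bsub>T\<^esub> t)"
      using diff e(1) by (simp add: T.smult_assoc T.smult_l_minus T.smult_closed)
    finally have "e \<odot>\<^bsub>T\<^esub> (s \<ominus>\<^bsub>T\<^esub> t) = \<tau> e v \<oplus>\<^bsub>T\<^esub> \<ominus>\<^bsub>T\<^esub> \<tau> e w"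
      using diff e(1) vw by (simp add: a_minus_def T.smult_r_distr)
    also have "\<dots> = \<tau> e (v \<oplus>\<^bsub>V\<^esub> \<ominus>\<^bsub>V\<^esub> w)"
      using vw by (simp add: \<tau>_add_right Z_closed(2) neg)
    finally show ?case using vw by blast
  qed
qed

lemma T_induced:
  "tensor_module R (principal_left_module A e) (\<lambda>x r. x \<otimes>\<^bsub>A\<^esub> c r) V = T"
  by (simp add: T_def Z_def)

end

section \<open>Simple modules over a ring with orthogonal idempotents\<close>

text \<open>
  Idempotents \<open>f p\<close> with sum \<open>1\<close>, such that two of them are either isomorphic or have no nonzero maps
  between their left ideals.  Each corner is presented as an isomorphic copy \<open>R p\<close>.
\<close>

locale idempotent_system = A: ring A
  for A :: "('a, 's) ring_scheme" +
  fixes P :: "'p set" and f :: "'p \<Rightarrow> 'a" and link :: "'p \<Rightarrow> 'p \<Rightarrow> bool"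
    and R :: "'p \<Rightarrow> ('r, 't) ring_scheme" and c :: "'p \<Rightarrow> 'r \<Rightarrow> 'a"
  assumes f_closed: "p \<in> P \<Longrightarrow> f p \<in> carrier A"
    and f_idem: "p \<in> P \<Longrightarrow> f p \<otimes>\<^bsub>A\<^esub> f p = f p"
    and finite_P: "finite P"
    and f_sum: "finsum A f P = \<one>\<^bsub>A\<^esub>"
    and linked: "\<lbrakk>p \<in> P; q \<in> P; link p q\<rbrakk> \<Longrightarrow> \<exists>a\<in>carrier A. \<exists>b\<in>carrier A.
      f p \<otimes>\<^bsub>A\<^esub> a = a \<and> b \<otimes>\<^bsub>A\<^esub> a = f q"
    and unlinked: "\<lbrakk>p \<in> P; q \<in> P; \<not> link p q; x \<in> carrier A\<rbrakk> \<Longrightarrow> f p \<otimes>\<^bsub>A\<^esub> (x \<otimes>\<^bsub>A\<^esub> f q) = \<zero>\<^bsub>A\<^esub>"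
    and link_sym: "\<lbrakk>p \<in> P; q \<in> P; link p q\<rbrakk> \<Longrightarrow> link q p"
    and R_ring: "p \<in> P \<Longrightarrow> ring (R p)"
    and c_bij: "p \<in> P \<Longrightarrow> bij_betw (c p) (carrier (R p)) ((\<lambda>x. f p \<otimes>\<^bsub>A\<^esub> x \<otimes>\<^bsub>A\<^esub> f p) ` carrier A)"
    and c_mult: "\<lbrakk>p \<in> P; r \<in> carrier (R p); s \<in> carrier (R p)\<rbrakk> \<Longrightarrow> c p (r \<otimes>\<^bsub>R p\<^esub> s) = c p r \<otimes>\<^bsub>A\<^esub> c p s"
    and c_add: "\<lbrakk>p \<in> P; r \<in> carrier (R p); s \<in> carrier (R p)\<rbrakk> \<Longrightarrow> c p (r \<oplus>\<^bsub>R p\<^esub> s) = c p r \<oplus>\<^bsub>A\<^esub> c p s"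
    and c_one: "p \<in> P \<Longrightarrow> c p \<one>\<^bsub>R p\<^esub> = f p"
begin

definition induced :: "'p \<Rightarrow> ('r, 'v) module \<Rightarrow> ('a, ('a \<times> 'v \<Rightarrow>\<^sub>0 int) set) module" where
  "induced p V = tensor_module (R p) (principal_left_module A (f p)) (\<lambda>x r. x \<otimes>\<^bsub>A\<^esub> c p r) V"

lemma corner_tensor: "p \<in> P \<Longrightarrow> left_module (R p) V \<Longrightarrow> corner_tensor A (R p) V (f p) (c p)"
  by (intro corner_tensor.intro corner_tensor_axioms.intro A.ring_axioms R_ring f_closed f_idem c_bij
      c_mult c_add c_one)

text \<open>
  The \<open>f p\<close> add up to \<open>1\<close>.
\<close>

lemma zero_if_annihilated:
  assumes M: "left_module A M" and x: "x \<in> carrier M"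
    and z: "\<And>p. p \<in> P \<Longrightarrow> f p \<odot>\<^bsub>M\<^esub> x = \<zero>\<^bsub>M\<^esub>"
  shows "x = \<zero>\<^bsub>M\<^esub>"
proof -
  interpret M: left_module A M by (rule M)
  have "finsum A f Q \<odot>\<^bsub>M\<^esub> x = \<zero>\<^bsub>M\<^esub>" if "finite Q" "Q \<subseteq> P" for Q
    using that
  proof (induction Q)
    case empty
    then show ?case using x by (simp add: M.smult_l_null)
  next
    case (insert q Q)
    have "finsum A f Q \<in> carrier A" using insert f_closed by (intro A.finsum_closed) auto
    moreover have "finsum A f (insert q Q) = f q \<oplus>\<^bsub>A\<^esub> finsum A f Q"
      using insert f_closed by (intro A.finsum_insert) auto
    ultimately show ?case using insert f_closed x z by (simp add: M.smult_l_distr)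
  qed
  then show ?thesis using finite_P f_sum x M.smult_one by force
qed

text \<open>
  For a submodule \<open>N\<close>, the vectors \<open>v\<close> with \<open>f p \<otimes> v \<in>
  N\<close> form a submodule of \<open>V\<close>. If it is all of \<open>V\<close>, then
  \<open>N\<close> contains all tensors. If it is zero, then \<open>f p\<close> annihilates
  \<open>N\<close>, and therefore so does every \<open>f q\<close>: for linked \<open>q\<close> since
  \<open>f q\<close> factors through \<open>f p\<close>, otherwise since \<open>f q A f p = 0\<close>.
\<close>

lemma induced_simple:
  assumes p: "p \<in> P" and V: "simple_module (R p) V"
  shows "simple_module A (induced p V)"
proof -
  interpret corner_tensor A "R p" V "f p" "c p" by (rule corner_tensor[OF p simple_moduleD(1)[OF V]])
  interpret T: left_module A T by (rule T_module)
  have T: "induced p V = T" unfolding induced_def by (rule T_induced)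
  obtain h where h: "h \<in> hom (add_monoid T) (add_monoid V)" "\<And>v. v \<in> carrier V \<Longrightarrow> h (\<tau> (f p) v) = v"
    using tensor_retraction by blast
  interpret hh: group_hom "add_monoid T" "add_monoid V" h
    using h(1) T.M.add.group_axioms V.M.add.group_axioms by (simp add: group_hom_def group_hom_axioms_def)
  have h0: "h \<zero>\<^bsub>T\<^esub> = \<zero>\<^bsub>V\<^esub>" using hh.hom_one by simp
  obtain v where v: "v \<in> carrier V" "v \<noteq> \<zero>\<^bsub>V\<^esub>" using simple_moduleD(2)[OF V] by blast
  have "\<tau> (f p) v \<noteq> \<zero>\<^bsub>T\<^esub>" using h(2)[OF v(1)] h0 v(2) by metis
  then have nz: "carrier T \<noteq> {\<zero>\<^bsub>T\<^esub>}" using \<tau>_closed[OF Z_closed(2) v(1)] by blast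
  have z0: "\<tau> \<zero>\<^bsub>A\<^esub> w = \<zero>\<^bsub>T\<^esub>" if "w \<in> carrier V" for w
    using smult_\<tau>[OF A.zero_closed Z_closed(2) that] T.smult_l_null[OF \<tau>_closed[OF Z_closed(2) that]] e(1)
    by simp
  have "N = {\<zero>\<^bsub>T\<^esub>} \<or> N = carrier T" if N: "submodule N A T" for N
  proof -
    note N' = submoduleD[OF N]
    let ?U = "{v \<in> carrier V. \<tau> (f p) v \<in> N}"
    have "submodule ?U (R p) V"
    proof (rule V.submoduleI')
      have "\<tau> (f p) \<zero>\<^bsub>V\<^esub> = \<tau> (f p) (\<zero>\<^bsub>R p\<^esub> \<odot>\<^bsub>V\<^esub> \<zero>\<^bsub>V\<^esub>)" by (simp add: V.smult_l_null)
      also have "\<dots> = \<tau> (c p \<zero>\<^bsub>R p\<^esub>) \<zero>\<^bsub>V\<^esub>"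
        using \<tau>_balanced[OF Z_closed(2) R.zero_closed V.M.zero_closed] c_corner(2)[OF R.zero_closed] by simp
      also have "c p \<zero>\<^bsub>R p\<^esub> = \<zero>\<^bsub>A\<^esub>"
        using c_add[OF R.zero_closed R.zero_closed] c_corner(1)[OF R.zero_closed] by (simp add: A.add.l_cancel_one)
      finally show "\<zero>\<^bsub>V\<^esub> \<in> ?U" using z0 N'(2) by simp
    next
      fix r w assume r: "r \<in> carrier (R p)" and w: "w \<in> ?U"
      have "\<tau> (f p) (r \<odot>\<^bsub>V\<^esub> w) = \<tau> (f p \<otimes>\<^bsub>A\<^esub> c p r) w"
        using w r by (intro \<tau>_balanced[symmetric] Z_closed) auto
      also have "\<dots> = c p r \<odot>\<^bsub>T\<^esub> \<tau> (f p) w"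
        using w r c_corner[OF r] Z_closed(2) by (simp add: smult_\<tau>)
      finally show "r \<odot>\<^bsub>V\<^esub> w \<in> ?U" using w r N'(4)[OF c_corner(1)[OF r]] V.smult_closed by simp
    qed (use N'(3) \<tau>_add_right[OF Z_closed(2)] in auto)
    then consider "?U = carrier V" | "?U = {\<zero>\<^bsub>V\<^esub>}" using simple_moduleD(3)[OF V] by blast
    then show ?thesis
    proof cases
      case 1
      have "t \<in> N" if "t \<in> carrier T" for t
        using that
      proof (induction t rule: tensor_induct)
        case zero
        show ?case by (rule N'(2))
      next
        case (gen x w)
        have "x \<odot>\<^bsub>T\<^esub> \<tau> (f p) w \<in> N" using 1 gen Z_closed(1) by (intro N'(4)) auto
        then show ?case using gen Z_closed by (simp add: smult_\<tau> Z_iff)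
      next
        case (diff s t)
        have "\<ominus>\<^bsub>T\<^esub> t \<in> N" using diff N'(4)[of "\<ominus>\<^bsub>A\<^esub> \<one>\<^bsub>A\<^esub>" t] by (simp add: T.smult_l_minus)
        then show ?case using diff N'(3) by (simp add: a_minus_def)
      qed
      then show ?thesis using N'(1) by blast
    next
      case 2
      have "n = \<zero>\<^bsub>T\<^esub>" if n: "n \<in> N" for n
      proof (rule zero_if_annihilated[OF T.left_module_axioms])
        show nT: "n \<in> carrier T" using n N'(1) by blast
        fix q assume q: "q \<in> P"
        show "f q \<odot>\<^bsub>T\<^esub> n = \<zero>\<^bsub>T\<^esub>"
        proof (cases "link p q")
          case True
          then obtain a b where ab: "a \<in> carrier A" "b \<in> carrier A" "f p \<otimes>\<^bsub>A\<^esub> a = a" "b \<otimes>\<^bsub>A\<^esub> a = f q"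
            using linked[OF p q] by blast
          have aN: "a \<odot>\<^bsub>T\<^esub> n \<in> N" by (rule N'(4)[OF ab(1) n])
          have fa: "f p \<odot>\<^bsub>T\<^esub> (a \<odot>\<^bsub>T\<^esub> n) = a \<odot>\<^bsub>T\<^esub> n"
            using T.smult_assoc[OF e(1) ab(1) nT] ab(3) by simp
          obtain w where w: "w \<in> carrier V" "a \<odot>\<^bsub>T\<^esub> n = \<tau> (f p) w"
            using smult_e_\<tau>[of "a \<odot>\<^bsub>T\<^esub> n"] aN N'(1) fa by auto
          then have "w \<in> ?U" using aN by simp
          then have "w = \<zero>\<^bsub>V\<^esub>" using 2 by blast
          moreover have "\<tau> (f p) \<zero>\<^bsub>V\<^esub> = \<zero>\<^bsub>T\<^esub>"
            using \<tau>_add_right[OF Z_closed(2) V.M.zero_closed V.M.zero_closed]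
              \<tau>_closed[OF Z_closed(2) V.M.zero_closed] by (simp add: T.M.add.l_cancel_one)
          ultimately have "a \<odot>\<^bsub>T\<^esub> n = \<zero>\<^bsub>T\<^esub>" using w by simp
          then show ?thesis using T.smult_assoc[OF ab(2,1) nT] ab by (simp add: T.smult_r_null)
        next
          case False
          then have nl: "\<not> link q p" using link_sym[OF q p] by blast
          show ?thesis using nT
          proof (induction n rule: tensor_induct)
            case zero
            then show ?case using f_closed[OF q] by (simp add: T.smult_r_null)
          next
            case (gen x w)
            have "f q \<otimes>\<^bsub>A\<^esub> x = \<zero>\<^bsub>A\<^esub>" using unlinked[OF q p nl, of x] gen(1) by (simp add: Z_iff)
            then show ?case using gen f_closed[OF q] z0 by (simp add: smult_\<tau>)
          next
            case (diff s t)
            have "\<ominus>\<^bsub>T\<^esub> t = (\<ominus>\<^bsub>A\<^esub> \<one>\<^bsub>A\<^esub>) \<odot>\<^bsub>T\<^esub> t" using diff by (simp add: T.smult_l_minus)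
            then have "f q \<odot>\<^bsub>T\<^esub> (\<ominus>\<^bsub>T\<^esub> t) = (f q \<otimes>\<^bsub>A\<^esub> (\<ominus>\<^bsub>A\<^esub> \<one>\<^bsub>A\<^esub>)) \<odot>\<^bsub>T\<^esub> t"
              using diff f_closed[OF q] by (simp add: T.smult_assoc)
            also have "\<dots> = ((\<ominus>\<^bsub>A\<^esub> \<one>\<^bsub>A\<^esub>) \<otimes>\<^bsub>A\<^esub> f q) \<odot>\<^bsub>T\<^esub> t"
              using f_closed[OF q] by (simp add: A.r_minus A.l_minus)
            also have "\<dots> = \<zero>\<^bsub>T\<^esub>" using diff f_closed[OF q] by (simp add: T.smult_assoc T.smult_r_null)
            finally show ?case using diff f_closed[OF q] by (simp add: a_minus_def T.smult_r_distr)
          qed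
        qed
      qed
      then show ?thesis using N'(2) by blast
    qed
  qed
  then show ?thesis unfolding T simple_module_def using T.left_module_axioms nz by blast
qed

text \<open>
  An isomorphism carries \<open>f p \<otimes> v\<close> to a nonzero vector fixed by \<open>f p\<close>,
  which is impossible in the second module unless \<open>p\<close> and \<open>q\<close> are linked. For
  \<open>p = q\<close> it restricts to the images of \<open>f p\<close>, which are copies of
  \<open>V\<close> and \<open>W\<close>.
\<close>

lemma induced_isomorphic_imp:
  assumes p: "p \<in> P" and q: "q \<in> P" and V: "simple_module (R p) V" and W: "simple_module (R q) W"
    and iso: "module_isomorphic A (induced p V) (induced q W)"
  shows "link p q" "p = q \<Longrightarrow> module_isomorphic (R p) V W"
proof -
  interpret V: corner_tensor A "R p" V "f p" "c p" by (rule corner_tensor[OF p simple_moduleD(1)[OF V]])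
  interpret W: corner_tensor A "R q" W "f q" "c q" by (rule corner_tensor[OF q simple_moduleD(1)[OF W]])
  interpret TV: left_module A V.T by (rule V.T_module)
  interpret TW: left_module A W.T by (rule W.T_module)
  have T: "induced p V = V.T" "induced q W = W.T"
    unfolding induced_def by (rule V.T_induced W.T_induced)+
  obtain \<phi> where \<phi>: "\<phi> \<in> linear_maps A V.T W.T" "bij_betw \<phi> (carrier V.T) (carrier W.T)"
    using iso unfolding module_isomorphic_iff T by blast
  note \<phi>' = linear_mapsD[OF \<phi>(1)]
  have \<phi>0: "\<phi> \<zero>\<^bsub>V.T\<^esub> = \<zero>\<^bsub>W.T\<^esub>"
    by (rule linear_maps_zero[OF TV.left_module_axioms TW.left_module_axioms \<phi>(1)])
  obtain h where h: "h \<in> hom (add_monoid V.T) (add_monoid V)" "\<And>v. v \<in> carrier V \<Longrightarrow> h (V.\<tau> (f p) v) = v"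
    using V.tensor_retraction by blast
  interpret hh: group_hom "add_monoid V.T" "add_monoid V" h
    using h(1) TV.M.add.group_axioms V.V.M.add.group_axioms by (simp add: group_hom_def group_hom_axioms_def)
  have h0: "h \<zero>\<^bsub>V.T\<^esub> = \<zero>\<^bsub>V\<^esub>" using hh.hom_one by simp
  have e\<tau>: "f p \<odot>\<^bsub>V.T\<^esub> V.\<tau> (f p) v = V.\<tau> (f p) v" if "v \<in> carrier V" for v
    using that V.smult_\<tau>[OF V.e(1) V.Z_closed(2) that] V.e by simp
  obtain v where v: "v \<in> carrier V" "v \<noteq> \<zero>\<^bsub>V\<^esub>" using simple_moduleD(2)[OF V] by blast
  have "\<phi> (V.\<tau> (f p) v) \<noteq> \<zero>\<^bsub>W.T\<^esub>"
  proof
    assume "\<phi> (V.\<tau> (f p) v) = \<zero>\<^bsub>W.T\<^esub>"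
    then have "V.\<tau> (f p) v = \<zero>\<^bsub>V.T\<^esub>"
      using \<phi>0 \<phi>(2) V.\<tau>_closed[OF V.Z_closed(2) v(1)] TV.M.zero_closed
      by (metis bij_betw_imp_inj_on inj_onD)
    then show False using h(2)[OF v(1)] h0 v(2) by metis
  qed
  moreover have "f p \<odot>\<^bsub>W.T\<^esub> \<phi> (V.\<tau> (f p) v) = \<phi> (V.\<tau> (f p) v)"
    using \<phi>'(3)[OF V.e(1) V.\<tau>_closed[OF V.Z_closed(2) v(1)]] e\<tau>[OF v(1)] by simp
  moreover have "f p \<odot>\<^bsub>W.T\<^esub> t = \<zero>\<^bsub>W.T\<^esub>" if nl: "\<not> link p q" and "t \<in> carrier W.T" for t
    using that(2)
  proof (induction t rule: W.tensor_induct)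
    case zero
    then show ?case using V.e(1) by (simp add: TW.smult_r_null)
  next
    case (gen x w)
    have "f p \<otimes>\<^bsub>A\<^esub> x = \<zero>\<^bsub>A\<^esub>" using unlinked[OF p q nl, of x] gen(1) by (simp add: W.Z_iff)
    moreover have "W.\<tau> \<zero>\<^bsub>A\<^esub> w = \<zero>\<^bsub>W.T\<^esub>"
      using W.smult_\<tau>[OF A.zero_closed W.Z_closed(2) gen(2)]
        TW.smult_l_null[OF W.\<tau>_closed[OF W.Z_closed(2) gen(2)]] W.e(1) by simp
    ultimately show ?case using gen V.e(1) by (simp add: W.smult_\<tau>)
  next
    case (diff s t)
    have "\<ominus>\<^bsub>W.T\<^esub> t = (\<ominus>\<^bsub>A\<^esub> \<one>\<^bsub>A\<^esub>) \<odot>\<^bsub>W.T\<^esub> t" using diff by (simp add: TW.smult_l_minus)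
    then have "f p \<odot>\<^bsub>W.T\<^esub> (\<ominus>\<^bsub>W.T\<^esub> t) = (f p \<otimes>\<^bsub>A\<^esub> (\<ominus>\<^bsub>A\<^esub> \<one>\<^bsub>A\<^esub>)) \<odot>\<^bsub>W.T\<^esub> t"
      using diff V.e(1) by (simp add: TW.smult_assoc)
    also have "\<dots> = ((\<ominus>\<^bsub>A\<^esub> \<one>\<^bsub>A\<^esub>) \<otimes>\<^bsub>A\<^esub> f p) \<odot>\<^bsub>W.T\<^esub> t"
      using V.e(1) by (simp add: A.r_minus A.l_minus)
    also have "\<dots> = \<zero>\<^bsub>W.T\<^esub>" using diff V.e(1) by (simp add: TW.smult_assoc TW.smult_r_null)
    finally show ?case using diff V.e(1) by (simp add: a_minus_def TW.smult_r_distr)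
  qed
  ultimately show "link p q" using \<phi>'(1)[OF V.\<tau>_closed[OF V.Z_closed(2) v(1)]] by metis
  assume pq: "p = q"
  obtain k where k: "k \<in> hom (add_monoid W.T) (add_monoid W)" "\<And>w. w \<in> carrier W \<Longrightarrow> k (W.\<tau> (f q) w) = w"
    using W.tensor_retraction by blast
  define \<psi> where "\<psi> v = k (\<phi> (V.\<tau> (f p) v))" for v
  have \<psi>: "\<psi> v \<in> carrier W" "\<phi> (V.\<tau> (f p) v) = W.\<tau> (f q) (\<psi> v)" if v: "v \<in> carrier V" for v
  proof -
    have t: "V.\<tau> (f p) v \<in> carrier V.T" by (rule V.\<tau>_closed[OF V.Z_closed(2) v])
    have "f q \<odot>\<^bsub>W.T\<^esub> \<phi> (V.\<tau> (f p) v) = \<phi> (V.\<tau> (f p) v)"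
      using \<phi>'(3)[OF V.e(1) t] e\<tau>[OF v] pq by simp
    then obtain w where w: "w \<in> carrier W" "\<phi> (V.\<tau> (f p) v) = W.\<tau> (f q) w"
      using W.smult_e_\<tau>[OF \<phi>'(1)[OF t]] by auto
    then show "\<psi> v \<in> carrier W" "\<phi> (V.\<tau> (f p) v) = W.\<tau> (f q) (\<psi> v)"
      using k(2)[OF w(1)] by (simp_all add: \<psi>_def)
  qed
  have \<psi>_eq: "\<psi> v = w" if "w \<in> carrier W" "\<phi> (V.\<tau> (f p) v) = W.\<tau> (f q) w" for v w
    using k(2)[OF that(1)] that(2) by (simp add: \<psi>_def)
  have "\<psi> \<in> linear_maps (R p) V W"
  proof (rule linear_mapsI)
    fix v w assume vw: "v \<in> carrier V" "w \<in> carrier V"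
    show "\<psi> (v \<oplus>\<^bsub>V\<^esub> w) = \<psi> v \<oplus>\<^bsub>W\<^esub> \<psi> w"
      using vw \<psi> \<phi>'(2)[OF V.\<tau>_closed[OF V.Z_closed(2) vw(1)] V.\<tau>_closed[OF V.Z_closed(2) vw(2)]]
      by (intro \<psi>_eq) (auto simp: V.\<tau>_add_right[OF V.Z_closed(2)] W.\<tau>_add_right[OF W.Z_closed(2)])
  next
    fix r v assume r: "r \<in> carrier (R p)" and v: "v \<in> carrier V"
    have t: "V.\<tau> (f p) v \<in> carrier V.T" by (rule V.\<tau>_closed[OF V.Z_closed(2) v])
    have 1: "V.\<tau> (f p) (r \<odot>\<^bsub>V\<^esub> v) = c p r \<odot>\<^bsub>V.T\<^esub> V.\<tau> (f p) v"
      using V.\<tau>_balanced[OF V.Z_closed(2) r v] V.smult_\<tau>[OF V.c_corner(1)[OF r] V.Z_closed(2) v] V.c_corner[OF r] by simp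
    have rq: "r \<in> carrier (R q)" using r pq by simp
    have 2: "W.\<tau> (f q) (r \<odot>\<^bsub>W\<^esub> \<psi> v) = c q r \<odot>\<^bsub>W.T\<^esub> W.\<tau> (f q) (\<psi> v)"
      using W.\<tau>_balanced[OF W.Z_closed(2) rq \<psi>(1)[OF v]]
        W.smult_\<tau>[OF W.c_corner(1)[OF rq] W.Z_closed(2) \<psi>(1)[OF v]] W.c_corner[OF rq] by simp
    show "\<psi> (r \<odot>\<^bsub>V\<^esub> v) = r \<odot>\<^bsub>W\<^esub> \<psi> v"
      using 1 2 \<psi>[OF v] \<phi>'(3)[OF V.c_corner(1)[OF r] t] pq W.V.smult_closed[OF rq]
      by (intro \<psi>_eq) auto
  qed (rule \<psi>(1))
  moreover obtain w where w: "w \<in> carrier V" "\<psi> w \<noteq> \<zero>\<^bsub>W\<^esub>"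
  proof (rule that[OF v(1)])
    show "\<psi> v \<noteq> \<zero>\<^bsub>W\<^esub>"
    proof
      assume "\<psi> v = \<zero>\<^bsub>W\<^esub>"
      moreover have "W.\<tau> (f q) \<zero>\<^bsub>W\<^esub> = \<zero>\<^bsub>W.T\<^esub>"
        using W.\<tau>_add_right[OF W.Z_closed(2) W.V.M.zero_closed W.V.M.zero_closed]
          W.\<tau>_closed[OF W.Z_closed(2) W.V.M.zero_closed] by (simp add: TW.M.add.l_cancel_one)
      ultimately show False using \<psi>(2)[OF v(1)] \<open>\<phi> (V.\<tau> (f p) v) \<noteq> \<zero>\<^bsub>W.T\<^esub>\<close> by simp
    qed
  qed
  ultimately show "module_isomorphic (R p) V W"
    using schur[OF V W[folded pq]] by blast
qed

text \<open>
  An isomorphism \<open>\<psi>\<close> of corner modules induces \<open>x \<otimes> v \<mapsto> x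
  \<otimes> \<psi> v\<close>, which is nonzero; both sides are simple, so Schur's lemma replaces the
  construction of an inverse.
\<close>

lemma induced_isomorphicI:
  assumes p: "p \<in> P" and V: "simple_module (R p) V" and W: "simple_module (R p) W"
    and iso: "module_isomorphic (R p) V W"
  shows "module_isomorphic A (induced p V) (induced p W)"
proof -
  interpret V: corner_tensor A "R p" V "f p" "c p" by (rule corner_tensor[OF p simple_moduleD(1)[OF V]])
  interpret W: corner_tensor A "R p" W "f p" "c p" by (rule corner_tensor[OF p simple_moduleD(1)[OF W]])
  interpret TW: left_module A W.T by (rule W.T_module)
  have T: "induced p V = V.T" "induced p W = W.T"
    unfolding induced_def by (rule V.T_induced W.T_induced)+
  obtain \<psi> where \<psi>: "\<psi> \<in> linear_maps (R p) V W" "bij_betw \<psi> (carrier V) (carrier W)"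
    using iso unfolding module_isomorphic_iff by blast
  note \<psi>' = linear_mapsD[OF \<psi>(1)]
  have "\<exists>h \<in> linear_maps A V.T W.T. \<forall>x\<in>carrier V.Z. \<forall>v\<in>carrier V. h (V.\<tau> x v) = W.\<tau> x (\<psi> v)"
  proof (rule V.tensor_universal_linear[OF W.T_module])
    fix x v assume xv: "x \<in> carrier W.Z" "v \<in> carrier V"
    note \<psi>v = \<psi>'(1)[OF xv(2)]
    show "W.\<tau> x (\<psi> v) \<in> carrier W.T" by (rule W.\<tau>_closed[OF xv(1) \<psi>v])
    show "W.\<tau> (x \<oplus>\<^bsub>A\<^esub> y) (\<psi> v) = W.\<tau> x (\<psi> v) \<oplus>\<^bsub>W.T\<^esub> W.\<tau> y (\<psi> v)" if "y \<in> carrier W.Z" for y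
      by (rule W.\<tau>_add_left[OF xv(1) that \<psi>v])
    show "W.\<tau> x (\<psi> (v \<oplus>\<^bsub>V\<^esub> w)) = W.\<tau> x (\<psi> v) \<oplus>\<^bsub>W.T\<^esub> W.\<tau> x (\<psi> w)" if "w \<in> carrier V" for w
      unfolding \<psi>'(2)[OF xv(2) that] by (rule W.\<tau>_add_right[OF xv(1) \<psi>v \<psi>'(1)[OF that]])
    show "W.\<tau> (x \<otimes>\<^bsub>A\<^esub> c p r) (\<psi> v) = W.\<tau> x (\<psi> (r \<odot>\<^bsub>V\<^esub> v))" if "r \<in> carrier (R p)" for r
      unfolding \<psi>'(3)[OF that xv(2)] by (rule W.\<tau>_balanced[OF xv(1) that \<psi>v])
    show "W.\<tau> (a \<otimes>\<^bsub>A\<^esub> x) (\<psi> v) = a \<odot>\<^bsub>W.T\<^esub> W.\<tau> x (\<psi> v)" if "a \<in> carrier A" for a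
      by (rule W.smult_\<tau>[OF that xv(1) \<psi>v, symmetric])
  qed
  then obtain h where h: "h \<in> linear_maps A V.T W.T" "\<And>x v. x \<in> carrier V.Z \<Longrightarrow> v \<in> carrier V \<Longrightarrow> h (V.\<tau> x v) = W.\<tau> x (\<psi> v)"
    by blast
  obtain w where w: "w \<in> carrier W" "w \<noteq> \<zero>\<^bsub>W\<^esub>" using simple_moduleD(2)[OF W] by blast
  then have "w \<in> \<psi> ` carrier V" using bij_betw_imp_surj_on[OF \<psi>(2)] by simp
  then obtain v where v: "v \<in> carrier V" "\<psi> v = w" by blast
  obtain k where k: "k \<in> hom (add_monoid W.T) (add_monoid W)" "\<And>w. w \<in> carrier W \<Longrightarrow> k (W.\<tau> (f p) w) = w"
    using W.tensor_retraction by blast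
  interpret kk: group_hom "add_monoid W.T" "add_monoid W" k
    using k(1) TW.M.add.group_axioms W.V.M.add.group_axioms by (simp add: group_hom_def group_hom_axioms_def)
  have "W.\<tau> (f p) w \<noteq> \<zero>\<^bsub>W.T\<^esub>" using k(2)[OF w(1)] kk.hom_one w(2) by auto
  then have "h (V.\<tau> (f p) v) \<noteq> \<zero>\<^bsub>W.T\<^esub>" using h(2)[OF V.Z_closed(2) v(1)] v(2) by simp
  then show ?thesis
    using schur[OF induced_simple[OF p V] induced_simple[OF p W], unfolded T, OF h(1) V.\<tau>_closed[OF V.Z_closed(2) v(1)]]
    unfolding T by blast
qed

text \<open>
  If \<open>f p\<close> does not annihilate the simple module \<open>M\<close>, then \<open>f p M\<close> is simple over the corner and
  induces \<open>M\<close>.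
\<close>

lemma simple_induced:
  fixes M :: "('a, 'x) module"
  assumes M: "simple_module A M" and p: "p \<in> P" and x: "x \<in> carrier M" "f p \<odot>\<^bsub>M\<^esub> x \<noteq> \<zero>\<^bsub>M\<^esub>"
  shows "\<exists>V :: ('r, 'x) module. simple_module (R p) V \<and> module_isomorphic A M (induced p V)"
proof -
  interpret M: left_module A M by (rule simple_moduleD(1)[OF M])
  interpret Rp: ring "R p" by (rule R_ring[OF p])
  note fp = f_closed[OF p]
  \<comment> \<open>\<open>V\<close> is \<open>f p M\<close>, on which \<open>R p\<close> acts through \<open>c p\<close>.\<close>
  define V :: "('r, 'x) module" where "V = \<lparr>carrier = (\<lambda>x. f p \<odot>\<^bsub>M\<^esub> x) ` carrier M, monoid.mult = undefined,
    one = undefined, ring.zero = \<zero>\<^bsub>M\<^esub>, ring.add = ring.add M, module.smult = (\<lambda>r x. c p r \<odot>\<^bsub>M\<^esub> x)\<rparr>"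
  have Vs: "\<zero>\<^bsub>V\<^esub> = \<zero>\<^bsub>M\<^esub>" "x \<oplus>\<^bsub>V\<^esub> y = x \<oplus>\<^bsub>M\<^esub> y" "r \<odot>\<^bsub>V\<^esub> x = c p r \<odot>\<^bsub>M\<^esub> x" for x y r
    by (simp_all add: V_def)
  have V_iff: "y \<in> carrier V \<longleftrightarrow> y \<in> carrier M \<and> f p \<odot>\<^bsub>M\<^esub> y = y" for y
  proof
    assume "y \<in> carrier V"
    then obtain z where "z \<in> carrier M" "y = f p \<odot>\<^bsub>M\<^esub> z" by (auto simp: V_def)
    then show "y \<in> carrier M \<and> f p \<odot>\<^bsub>M\<^esub> y = y"
      using M.smult_assoc[OF fp fp] f_idem[OF p] fp M.smult_closed by simp
  next
    assume "y \<in> carrier M \<and> f p \<odot>\<^bsub>M\<^esub> y = y"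
    then have "y \<in> (\<lambda>x. f p \<odot>\<^bsub>M\<^esub> x) ` carrier M" by (metis imageI)
    then show "y \<in> carrier V" by (simp add: V_def)
  qed
  have cc: "c p r \<in> carrier A" "f p \<otimes>\<^bsub>A\<^esub> c p r = c p r" if "r \<in> carrier (R p)" for r
  proof -
    have "c p r \<in> (\<lambda>x. f p \<otimes>\<^bsub>A\<^esub> x \<otimes>\<^bsub>A\<^esub> f p) ` carrier A"
      using bij_betw_imp_surj_on[OF c_bij[OF p]] that by blast
    then obtain a where "a \<in> carrier A" "c p r = f p \<otimes>\<^bsub>A\<^esub> a \<otimes>\<^bsub>A\<^esub> f p" by blast
    then show "c p r \<in> carrier A" "f p \<otimes>\<^bsub>A\<^esub> c p r = c p r"
      using fp f_idem[OF p] by (simp_all add: A.m_assoc[symmetric])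
  qed
  have V_module: "left_module (R p) V"
  proof (intro left_module.intro left_module_axioms.intro Rp.ring_axioms)
    show "abelian_group V"
    proof (rule abelian_groupI)
      fix y assume "y \<in> carrier V"
      then have y: "y \<in> carrier M" "f p \<odot>\<^bsub>M\<^esub> y = y" by (auto simp: V_iff)
      have "f p \<odot>\<^bsub>M\<^esub> (\<ominus>\<^bsub>M\<^esub> y) \<oplus>\<^bsub>M\<^esub> y = f p \<odot>\<^bsub>M\<^esub> (\<ominus>\<^bsub>M\<^esub> y \<oplus>\<^bsub>M\<^esub> y)"
        using y fp M.smult_r_distr[OF fp, of "\<ominus>\<^bsub>M\<^esub> y" y] by simp
      also have "\<dots> = \<zero>\<^bsub>M\<^esub>" using y fp by (simp add: M.M.l_neg M.smult_r_null)
      finally show "\<exists>z\<in>carrier V. z \<oplus>\<^bsub>V\<^esub> y = \<zero>\<^bsub>V\<^esub>"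
        using y(1) unfolding Vs by (intro bexI[of _ "f p \<odot>\<^bsub>M\<^esub> (\<ominus>\<^bsub>M\<^esub> y)"]) (auto simp: V_def)
    qed (auto simp: V_iff Vs M.smult_r_distr[OF fp] M.smult_r_null[OF fp] M.M.a_ac)
  next
    fix r y assume r: "r \<in> carrier (R p)" and y: "y \<in> carrier V"
    show "r \<odot>\<^bsub>V\<^esub> y \<in> carrier V"
      using y cc[OF r] fp M.smult_closed M.smult_assoc[OF fp cc(1)[OF r]] by (simp add: V_iff Vs)
  qed (auto simp: V_iff Vs cc c_add[OF p] c_mult[OF p] c_one[OF p] M.smult_l_distr M.smult_r_distr M.smult_assoc)
  have V_simple: "simple_module (R p) V"
    unfolding simple_module_def
  proof (intro conjI allI impI V_module)
    show "carrier V \<noteq> {\<zero>\<^bsub>V\<^esub>}" using x by (auto simp: V_def)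
    fix U assume U: "submodule U (R p) V"
    note U' = submoduleD[OF U]
    show "U = {\<zero>\<^bsub>V\<^esub>} \<or> U = carrier V"
    proof (rule disjCI)
      assume "U \<noteq> carrier V"
      have "u = \<zero>\<^bsub>M\<^esub>" if u: "u \<in> U" for u
      proof (rule ccontr)
        assume nz: "u \<noteq> \<zero>\<^bsub>M\<^esub>"
        have uM: "u \<in> carrier M" "f p \<odot>\<^bsub>M\<^esub> u = u" using u U'(1) V_iff by blast+
        let ?N = "(\<lambda>a. a \<odot>\<^bsub>M\<^esub> u) ` carrier A"
        have "submodule ?N A M"
        proof (rule M.submoduleI')
          show "\<zero>\<^bsub>M\<^esub> \<in> ?N" using M.smult_l_null[OF uM(1)] A.zero_closed by (metis imageI)
          fix s t assume "s \<in> ?N" "t \<in> ?N"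
          then obtain a b where "a \<in> carrier A" "b \<in> carrier A" "s = a \<odot>\<^bsub>M\<^esub> u" "t = b \<odot>\<^bsub>M\<^esub> u" by blast
          then show "s \<oplus>\<^bsub>M\<^esub> t \<in> ?N"
            using uM by (intro image_eqI[where x = "a \<oplus>\<^bsub>A\<^esub> b"]) (auto simp: M.smult_l_distr)
        next
          fix b s assume b: "b \<in> carrier A" "s \<in> ?N"
          then obtain a where "a \<in> carrier A" "s = a \<odot>\<^bsub>M\<^esub> u" by blast
          then show "b \<odot>\<^bsub>M\<^esub> s \<in> ?N"
            using uM b(1) by (intro image_eqI[where x = "b \<otimes>\<^bsub>A\<^esub> a"]) (auto simp: M.smult_assoc)
        qed (use uM M.smult_closed in auto)
        moreover have "u \<in> ?N" using M.smult_one[OF uM(1)] A.one_closed by (metis imageI)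
        ultimately have N: "?N = carrier M" using simple_moduleD(3)[OF M] nz by blast
        have "y \<in> U" if y: "y \<in> carrier V" for y
        proof -
          have yM: "y \<in> carrier M" "f p \<odot>\<^bsub>M\<^esub> y = y" using y V_iff by blast+
          then obtain a where a: "a \<in> carrier A" "y = a \<odot>\<^bsub>M\<^esub> u" using N by blast
          have "f p \<otimes>\<^bsub>A\<^esub> a \<otimes>\<^bsub>A\<^esub> f p \<in> (\<lambda>x. f p \<otimes>\<^bsub>A\<^esub> x \<otimes>\<^bsub>A\<^esub> f p) ` carrier A" using a(1) by blast
          then obtain r where r: "r \<in> carrier (R p)" "c p r = f p \<otimes>\<^bsub>A\<^esub> a \<otimes>\<^bsub>A\<^esub> f p"
            using c_bij[OF p] unfolding bij_betw_def by (metis imageE)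
          have "r \<odot>\<^bsub>V\<^esub> u = f p \<odot>\<^bsub>M\<^esub> (a \<odot>\<^bsub>M\<^esub> (f p \<odot>\<^bsub>M\<^esub> u))"
            using uM(1) a(1) fp unfolding Vs r(2) by (simp add: M.smult_assoc M.smult_closed)
          then have "r \<odot>\<^bsub>V\<^esub> u = y" using uM(2) a(2) yM(2) by simp
          then show ?thesis using U'(4)[OF r(1) u] by simp
        qed
        then show False using U'(1) \<open>U \<noteq> carrier V\<close> by blast
      qed
      then show "U = {\<zero>\<^bsub>V\<^esub>}" using U'(2) unfolding Vs(1) by blast
    qed
  qed
  interpret V: corner_tensor A "R p" V "f p" "c p" by (rule corner_tensor[OF p V_module])
  have T: "induced p V = V.T" unfolding induced_def by (rule V.T_induced)
  have vM: "v \<in> carrier M" if "v \<in> carrier V" for v using that V_iff by blast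
  have "\<exists>h \<in> linear_maps A V.T M. \<forall>x\<in>carrier V.Z. \<forall>v\<in>carrier V. h (V.\<tau> x v) = x \<odot>\<^bsub>M\<^esub> v"
  proof (rule V.tensor_universal_linear[OF M.left_module_axioms], unfold Vs)
    fix x v assume xv: "x \<in> carrier V.Z" "v \<in> carrier V"
    note x = V.Z_closed(1)[OF xv(1)] and v = vM[OF xv(2)]
    show "x \<odot>\<^bsub>M\<^esub> v \<in> carrier M" by (rule M.smult_closed[OF x v])
    show "(x \<oplus>\<^bsub>A\<^esub> y) \<odot>\<^bsub>M\<^esub> v = x \<odot>\<^bsub>M\<^esub> v \<oplus>\<^bsub>M\<^esub> y \<odot>\<^bsub>M\<^esub> v" if "y \<in> carrier V.Z" for y
      by (rule M.smult_l_distr[OF x V.Z_closed(1)[OF that] v])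
    show "x \<odot>\<^bsub>M\<^esub> (v \<oplus>\<^bsub>M\<^esub> w) = x \<odot>\<^bsub>M\<^esub> v \<oplus>\<^bsub>M\<^esub> x \<odot>\<^bsub>M\<^esub> w" if "w \<in> carrier V" for w
      by (rule M.smult_r_distr[OF x v vM[OF that]])
    show "(x \<otimes>\<^bsub>A\<^esub> c p r) \<odot>\<^bsub>M\<^esub> v = x \<odot>\<^bsub>M\<^esub> (c p r \<odot>\<^bsub>M\<^esub> v)" if "r \<in> carrier (R p)" for r
      by (rule M.smult_assoc[OF x cc(1)[OF that] v])
    show "(a \<otimes>\<^bsub>A\<^esub> x) \<odot>\<^bsub>M\<^esub> v = a \<odot>\<^bsub>M\<^esub> (x \<odot>\<^bsub>M\<^esub> v)" if "a \<in> carrier A" for a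
      by (rule M.smult_assoc[OF that x v])
  qed
  then obtain h where h: "h \<in> linear_maps A V.T M" "\<And>x v. x \<in> carrier V.Z \<Longrightarrow> v \<in> carrier V \<Longrightarrow> h (V.\<tau> x v) = x \<odot>\<^bsub>M\<^esub> v"
    by blast
  have y: "f p \<odot>\<^bsub>M\<^esub> x \<in> carrier V" using x by (simp add: V_def)
  have "h (V.\<tau> (f p) (f p \<odot>\<^bsub>M\<^esub> x)) \<noteq> \<zero>\<^bsub>M\<^esub>"
    using h(2)[OF V.Z_closed(2) y] x(2) y V_iff by simp
  from schur[OF induced_simple[OF p V_simple, unfolded T] M h(1) V.\<tau>_closed[OF V.Z_closed(2) y] this]
  have "module_isomorphic A M (induced p V)"
    unfolding T by (rule module_isomorphic_sym[OF V.T_module M.left_module_axioms])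
  then show ?thesis using V_simple by blast
qed

end

section \<open>The linkage groups and the corners of the essential algebra\<close>

lemma linear_inclusion_linear: "Vector_Spaces.linear scale scale linear_inclusion"
proof -
  have sup: "linear_inclusion a = (\<Sum>\<gamma>\<in>A. scale (Poly_Mapping.lookup a \<gamma>) \<gamma>)"
    if "finite A" "Poly_Mapping.keys a \<subseteq> A" for A and a :: "('b \<Rightarrow>\<^sub>0 'k::field) \<Rightarrow>\<^sub>0 'k"
    unfolding linear_inclusion_def using that
    by (intro sum.mono_neutral_left) (auto simp: in_keys_iff)
  have "linear_inclusion (a + b) = linear_inclusion a + linear_inclusion b"
    for a b :: "('b \<Rightarrow>\<^sub>0 'k::field) \<Rightarrow>\<^sub>0 'k"
  proof -
    define A where "A = Poly_Mapping.keys a \<union> Poly_Mapping.keys b \<union> Poly_Mapping.keys (a + b)"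
    show ?thesis
      by (subst (1 2 3) sup[of A])
         (auto simp: A_def lookup_add scale.scale_left_distrib sum.distrib)
  qed
  moreover have "linear_inclusion (scale c a) = scale c (linear_inclusion a)"
    for c and a :: "('b \<Rightarrow>\<^sub>0 'k::field) \<Rightarrow>\<^sub>0 'k"
    by (subst (1 2) sup[of "Poly_Mapping.keys a"])
       (auto simp: in_keys_iff scale.scale_sum_right)
  ultimately show ?thesis by unfold_locales auto
qed

lemmas linear_inclusion_simps =
  module_hom.add[OF linear_inclusion_linear[THEN Vector_Spaces.linear.axioms(3)]]
  module_hom.diff[OF linear_inclusion_linear[THEN Vector_Spaces.linear.axioms(3)]]
  module_hom.scale[OF linear_inclusion_linear[THEN Vector_Spaces.linear.axioms(3)]]
  module_hom.zero[OF linear_inclusion_linear[THEN Vector_Spaces.linear.axioms(3)]]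

lemmas linear_inclusion_sum =
  module_hom.sum[OF linear_inclusion_linear[THEN Vector_Spaces.linear.axioms(3)]]

lemma linear_inclusion_single: "linear_inclusion (Poly_Mapping.single \<gamma> 1) = (\<gamma> :: 'b \<Rightarrow>\<^sub>0 'k::field)"
  by (simp add: linear_inclusion_def)

text \<open>
  The product of the group algebra extends the product of the linkage group bilinearly, as does the
  composition; the inclusion is therefore multiplicative.
\<close>

lemma linear_inclusion_mult:
  fixes a b :: "('a, 'a, 'k::field_char_0) section_elts \<Rightarrow>\<^sub>0 'k"
  shows "linear_inclusion (bilinear_extension (\<lambda>g h. Poly_Mapping.single (section_comp G G G g h) 1) a b) =
    section_comp G G G (linear_inclusion a) (linear_inclusion b)"
  unfolding bilinear_extension_def linear_inclusion_sum linear_inclusion_simps linear_inclusion_single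
  unfolding linear_inclusion_def section_comp_sum_left section_comp_scale_left
  unfolding section_comp_sum_right section_comp_scale_right scale.scale_sum_right scale.scale_scale ..

context fin_group_over
begin

abbreviation GA :: "'a set \<times> 'a set \<Rightarrow> ('k, ('a, 'a, 'k) section_elts \<Rightarrow>\<^sub>0 'k) module" where
  "GA p \<equiv> group_algebra (linkage_group G p)"

definition linkage_sections :: "'a set \<times> 'a set \<Rightarrow> (('a \<times> 'a) set \<times> ('a \<times> 'a) set) set" where
  "linkage_sections p = {s \<in> covering_sections G. left_pair G s = p \<and> right_pair G s = p}"

lemma linkage_sectionsD:
  assumes "s \<in> linkage_sections p"
  shows "s \<in> covering_sections G" "left_pair G s = p" "right_pair G s = p"
  using assms by (auto simp: linkage_sections_def)

lemma card_linkage_section: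
  assumes s: "s \<in> linkage_sections p"
  shows "card (snd s) = card (snd p)"
proof -
  note s' = linkage_sectionsD[OF s]
  have "inj_on fst (snd s)" using cov_inj(2)[OF s'(1)] by (auto simp: inj_on_def)
  then have "card (fst ` snd s) = card (snd s)" by (rule card_image)
  moreover have "fst ` snd s = snd p" using s'(2) by (auto simp: left_pair_def fst_eq_Domain)
  ultimately show ?thesis by simp
qed

lemma basis_elt_linkage_section:
  assumes "s \<in> linkage_sections p"
  shows "basis_elt s = (Poly_Mapping.single (section_class (G \<times>\<times> G) s)
    (of_nat (card (snd p)) / of_nat (card (carrier G))) :: ('a, 'a, 'k) section_elts)"
  using card_linkage_section[OF assms]
  by (simp add: normalized_elt_def section_elt_def case_prod_beta)

text \<open>
  The factor \<open>1 / |G : P|\<close> is \<open>|S| / |G|\<close>, since \<open>S\<close> is a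
  bijection between \<open>P\<close> and itself; so the linkage group consists of normalised elements
  and multiplies by composition of sections.
\<close>

lemma linkage_group_simps:
  assumes p: "p \<in> pairs"
  shows "carrier (linkage_group G p) = (basis_elt ` linkage_sections p :: ('a, 'a, 'k) section_elts set)"
    "g \<otimes>\<^bsub>linkage_group G p\<^esub> h = (g \<star> h :: ('a, 'a, 'k) section_elts)"
    "\<one>\<^bsub>linkage_group G p\<^esub> = e p"
proof -
  obtain K P where KP: "p = (K, P)" by fastforce
  have mem: "(T, S) \<in> sections (G \<times>\<times> G) \<and> left_invariants G (T, S) = (carrier G, K, P, {\<one>}) \<and>
      right_invariants G (T, S) = (carrier G, K, P, {\<one>}) \<longleftrightarrow> (T, S) \<in> linkage_sections p" for T S
    by (auto simp: linkage_sections_def covering_sections_def left_pair_def right_pair_def KP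
        left_invariants_def right_invariants_def)
  have elt: "scale (1 / of_nat (group_index G P)) (section_elt (G \<times>\<times> G) T S) =
      (basis_elt (T, S) :: ('a, 'a, 'k) section_elts)" if "(T, S) \<in> linkage_sections p" for T S
    using inverse_group_index[of P, where 'k = 'k] normal_pairs_subgroup(2)[OF p] card_linkage_section[OF that]
    by (simp add: KP normalized_elt_def)
  show "carrier (linkage_group G p) = (basis_elt ` linkage_sections p :: ('a, 'a, 'k) section_elts set)"
    (is "?l = ?r")
  proof (intro equalityI subsetI)
    fix x assume "x \<in> ?l"
    then obtain T S where "x = scale (1 / of_nat (group_index G P)) (section_elt (G \<times>\<times> G) T S)"
      "(T, S) \<in> linkage_sections p"
      unfolding linkage_group_def KP prod.case partial_object.simps mem_Collect_eq mem[unfolded KP] by blast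
    then show "x \<in> ?r" using elt by simp
  next
    fix x assume "x \<in> ?r"
    then obtain T S where "x = basis_elt (T, S)" "(T, S) \<in> linkage_sections p" by force
    then show "x \<in> ?l"
      unfolding linkage_group_def KP prod.case partial_object.simps mem_Collect_eq mem[unfolded KP]
      using elt by (intro exI[of _ T] exI[of _ S]) (simp add: KP)
  qed
qed (cases p, simp add: linkage_group_def)+

lemma linkage_sections_compose:
  assumes "s \<in> linkage_sections p" "v \<in> linkage_sections p"
  shows "section_compose s v \<in> linkage_sections p"
    "basis_elt s \<star> basis_elt v = (basis_elt (section_compose s v) :: ('a, 'a, 'k) section_elts)"
proof -
  note s = linkage_sectionsD[OF assms(1)] and v = linkage_sectionsD[OF assms(2)]
  have "right_pair G s = left_pair G v" using s v by simp
  from compose_pairs[OF s(1) v(1) this] section_compose_covering[OF s(1) v(1)]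
  show "section_compose s v \<in> linkage_sections p"
    using s v by (simp only: linkage_sections_def mem_Collect_eq)
  show "basis_elt s \<star> basis_elt v = (basis_elt (section_compose s v) :: ('a, 'a, 'k) section_elts)"
    by (rule basis_elt_mult[OF s(1) subsetD[OF covering_sections_subset v(1)]])
qed

lemma diag_linkage_section: "p \<in> pairs \<Longrightarrow> diag_section G p \<in> linkage_sections p"
  by (simp add: linkage_sections_def diag_section_covering)

lemma GA_simps:
  assumes "p \<in> pairs"
  shows "carrier (GA p) = {a. Poly_Mapping.keys a \<subseteq> basis_elt ` linkage_sections p}"
    "monoid.mult (GA p) = bilinear_extension (\<lambda>g h. Poly_Mapping.single (g \<star> h) 1)"
    "\<one>\<^bsub>GA p\<^esub> = Poly_Mapping.single (e p) 1" "\<zero>\<^bsub>GA p\<^esub> = 0" "ring.add (GA p) = (+)"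
    "module.smult (GA p) = scale"
  by (simp_all add: group_algebra_def linkage_group_simps[OF assms])

lemma GA_k_algebra:
  assumes p: "p \<in> pairs"
  shows "k_algebra (GA p)"
proof (rule k_algebra_spanI[where \<beta> = "\<lambda>g h. Poly_Mapping.single (g \<star> h) 1"
      and U = "(\<lambda>\<gamma>. Poly_Mapping.single \<gamma> 1) ` (basis_elt ` linkage_sections p)"])
  note b = cov_burnside[OF linkage_sectionsD(1)]
  let ?U = "(\<lambda>\<gamma>. Poly_Mapping.single \<gamma> (1::'k)) ` (basis_elt ` linkage_sections p :: ('a, 'a, 'k) section_elts set)"
  let ?m = "bilinear_extension (\<lambda>g h :: ('a, 'a, 'k) section_elts. Poly_Mapping.single (g \<star> h) (1::'k))"
  show "carrier (GA p) = scale.span ?U" unfolding span_singles by (simp add: GA_simps[OF p])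
  have "e p \<in> basis_elt ` linkage_sections p"
    using e_elt_eq[OF p, where 'k = 'k] diag_linkage_section[OF p] by blast
  then show "\<one>\<^bsub>GA p\<^esub> \<in> scale.span ?U" by (simp add: GA_simps[OF p] scale.span_base)
  show "?m x y \<in> scale.span ?U" if "x \<in> ?U" "y \<in> ?U" for x y
  proof -
    obtain s v where s: "s \<in> linkage_sections p" "v \<in> linkage_sections p"
      "x = Poly_Mapping.single (basis_elt s) 1" "y = Poly_Mapping.single (basis_elt v) 1"
      using \<open>x \<in> ?U\<close> \<open>y \<in> ?U\<close> by blast
    show ?thesis
      unfolding s(3,4) bilinear_extension_single linkage_sections_compose(2)[OF s(1,2)]
      by (intro scale.span_base imageI linkage_sections_compose(1) s(1,2))
  qed
  show "?m (?m x y) z = ?m x (?m y z)" if "x \<in> ?U" "y \<in> ?U" "z \<in> ?U" for x y z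
    using that by (auto simp: bilinear_extension_single star_assoc b)
  show "?m \<one>\<^bsub>GA p\<^esub> x = x" "?m x \<one>\<^bsub>GA p\<^esub> = x" if "x \<in> ?U" for x
  proof -
    obtain s where s: "s \<in> linkage_sections p" "x = Poly_Mapping.single (basis_elt s) 1"
      using \<open>x \<in> ?U\<close> by blast
    note s' = linkage_sectionsD[OF s(1)]
    have "e p \<star> basis_elt s = (basis_elt s :: ('a, 'a, 'k) section_elts)"
      "basis_elt s \<star> e p = (basis_elt s :: ('a, 'a, 'k) section_elts)"
      using e_left_pair[OF s'(1)] e_right_pair[OF s'(1)] unfolding s'(2,3) by this+
    then show "?m \<one>\<^bsub>GA p\<^esub> x = x" "?m x \<one>\<^bsub>GA p\<^esub> = x"
      unfolding s(2) GA_simps(3)[OF p] bilinear_extension_single by simp_all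
  qed
qed (simp_all add: GA_simps[OF p])

lemma linear_inclusion_covering:
  assumes p: "p \<in> pairs" and a: "a \<in> carrier (GA p)"
  shows "linear_inclusion a \<in> Ec" "f p \<star> linear_inclusion a = linear_inclusion a \<star> f p"
proof -
  have keys: "\<exists>s\<in>linkage_sections p. \<gamma> = basis_elt s" if "\<gamma> \<in> Poly_Mapping.keys a" for \<gamma>
    using a that by (auto simp: GA_simps[OF p])
  show "linear_inclusion a \<in> Ec"
    unfolding linear_inclusion_def
    using keys basis_elt_covering linkage_sectionsD(1)
    by (intro scale.subspace_sum scale.subspace_scale subspace_covering) blast
  show "f p \<star> linear_inclusion a = linear_inclusion a \<star> f p"
    unfolding linear_inclusion_def section_comp_sum_left section_comp_sum_right
      section_comp_scale_left section_comp_scale_right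
  proof (intro sum.cong refl arg_cong[where f = "scale _"])
    fix \<gamma> assume "\<gamma> \<in> Poly_Mapping.keys a"
    then obtain s where "s \<in> linkage_sections p" "\<gamma> = basis_elt s" using keys by blast
    then show "f p \<star> \<gamma> = \<gamma> \<star> f p"
      using f_basis_elt_commute[of s] linkage_sectionsD[of s p] by simp
  qed
qed

lemma Ec_burnside: "x \<in> Ec \<Longrightarrow> x \<in> section_burnside G G"
  using covering_subset_burnside by blast

lemma f_f: "p \<in> pairs \<Longrightarrow> f p \<star> f p = f p"
  by (simp add: f_orthogonal)

lemma corner_map_eq:
  assumes p: "p \<in> pairs" and a: "a \<in> carrier (GA p)"
  shows "corner_map G p a = bar (f p \<star> linear_inclusion a)"
proof -
  note l = linear_inclusion_covering[OF p a] and f = f_burnside[of p]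
  note lb = Ec_burnside[OF l(1)]
  have "f p \<star> linear_inclusion a \<star> f p = f p \<star> (f p \<star> linear_inclusion a)"
    unfolding star_assoc[OF f lb f] by (simp only: l(2))
  also have "\<dots> = f p \<star> linear_inclusion a"
    using star_assoc[OF f f lb] f_f[OF p] by simp
  finally show ?thesis
    unfolding corner_map_def by (simp add: Eb_simps f lb star_burnside)
qed

text \<open>
  For \<open>\<gamma>\<close> in the linkage group, \<open>f\<^bsub>p\<^esub> \<gamma>\<close> is \<open>\<gamma>\<close> plus a combination of basis elements whose left pair is
  strictly larger than \<open>p\<close>; the coefficients of an element of the group algebra can therefore be read
  off from its product with \<open>f\<^bsub>p\<^esub>\<close>.
\<close>

lemma f_linear_inclusion_inj:
  assumes p: "p \<in> pairs" and a: "a \<in> carrier (GA p)" and z: "f p \<star> linear_inclusion a = 0"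
  shows "a = 0"
proof (rule poly_mapping_eqI)
  let ?w = "of_nat (card (snd p)) / of_nat (card (carrier G)) :: 'k"
  let ?lin = "linear_inclusion a"
  fix \<gamma>0
  show "Poly_Mapping.lookup a \<gamma>0 = Poly_Mapping.lookup 0 \<gamma>0"
  proof (cases "\<gamma>0 \<in> Poly_Mapping.keys a")
    case True
    have keys: "\<exists>s\<in>linkage_sections p. \<gamma> = basis_elt s" if "\<gamma> \<in> Poly_Mapping.keys a" for \<gamma>
      using a that by (auto simp: GA_simps[OF p])
    obtain s0 where s0: "s0 \<in> linkage_sections p" "\<gamma>0 = basis_elt s0" using keys[OF True] by blast
    let ?c = "section_class (G \<times>\<times> G) s0"
    note s0' = linkage_sectionsD[OF s0(1)]
    have w: "?w \<noteq> 0"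
    proof -
      have P: "subgroup (snd p) G" by (rule normal_pairs_subgroup(2)[OF p])
      then have "card (snd p) \<noteq> 0"
        using finite_subset[OF subgroup.subset[OF P]] subgroup.one_closed[OF P] by auto
      then show ?thesis using card_carrier_neq_0 by simp
    qed
    \<comment> \<open>The coefficient of \<open>f\<^bsub>p\<^esub> a\<close> at the class of \<open>s0\<close> comes from \<open>e\<^bsub>p\<^esub> a\<close> alone; invariants separate the other classes.\<close>
    have larger: "Poly_Mapping.lookup (e q \<star> ?lin) ?c = 0" if q: "q \<in> pairs" "pair_le p q" "p \<noteq> q" for q
    proof -
      have "Poly_Mapping.lookup (e q \<star> \<gamma>) ?c = 0" if "\<gamma> \<in> Poly_Mapping.keys a" for \<gamma>
      proof -
        obtain s where s: "s \<in> linkage_sections p" "\<gamma> = basis_elt s" using keys[OF \<open>\<gamma> \<in> _\<close>] by blast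
        note s' = linkage_sectionsD[OF s(1)]
        let ?s = "section_compose (diag_section G q) s"
        have c: "?s \<in> covering_sections G"
          by (rule section_compose_covering[OF diag_section_covering[OF q(1)] s'(1)])
        have "left_pair G ?s = q" using left_pair_compose_diag(1)[OF s'(1) q(1)] s'(2) q(2) by simp
        then have "section_class (G \<times>\<times> G) ?s \<noteq> ?c"
          using same_class_invariants(2)[OF s0'(1) subsetD[OF covering_sections_subset c]] s0'(2) q(3) by auto
        then show ?thesis
          unfolding s(2) e_basis_elt(1)[OF q(1) s'(1)]
          by (simp add: normalized_elt_def section_elt_def lookup_single when_def)
      qed
      then show ?thesis
        unfolding linear_inclusion_def section_comp_sum_right section_comp_scale_right
        by (simp add: lookup_sum)
    qed
    have ep: "e p \<star> \<gamma> = \<gamma>" if "\<gamma> \<in> Poly_Mapping.keys a" for \<gamma>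
      using keys[OF that] e_left_pair linkage_sectionsD by metis
    \<comment> \<open>Elements of the linkage group have equal coefficients, so distinct ones have distinct classes.\<close>
    have own: "Poly_Mapping.lookup \<gamma> ?c = (if \<gamma> = \<gamma>0 then ?w else 0)" if "\<gamma> \<in> Poly_Mapping.keys a" for \<gamma>
      using keys[OF that] s0 by (auto simp: basis_elt_linkage_section lookup_single when_def)
    have "Poly_Mapping.lookup (e p \<star> ?lin) ?c = (\<Sum>\<gamma>\<in>Poly_Mapping.keys a.
        if \<gamma> = \<gamma>0 then Poly_Mapping.lookup a \<gamma> * ?w else 0)"
      unfolding linear_inclusion_def section_comp_sum_right section_comp_scale_right lookup_sum
      by (intro sum.cong refl) (simp add: ep own)
    also have "\<dots> = Poly_Mapping.lookup a \<gamma>0 * ?w" using True by (simp add: sum.delta)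
    finally have "Poly_Mapping.lookup (f p \<star> ?lin) ?c = Poly_Mapping.lookup a \<gamma>0 * ?w"
      unfolding f_elt_eq_e_plus[OF p] section_comp_add_left section_comp_sum_left section_comp_scale_left
        lookup_add lookup_sum using larger by simp
    then show ?thesis using z w by simp
  qed (simp add: in_keys_iff)
qed

text \<open>
  On a covering section \<open>s\<close> with left pair below \<open>p\<close>,
  \<open>f\<^bsub>p\<^esub> s f\<^bsub>p\<^esub>\<close> is \<open>s' f\<^bsub>q\<^esub>
  f\<^bsub>p\<^esub>\<close> with \<open>s'\<close> linking \<open>p\<close> and \<open>q\<close>. It is
  zero unless \<open>q = p\<close>, and then \<open>s'\<close> belongs to the linkage group.
\<close>

lemma f_corner:
  assumes p: "p \<in> pairs" and z: "z \<in> Ec"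
  shows "\<exists>a\<in>carrier (GA p). f p \<star> z \<star> f p = f p \<star> linear_inclusion a"
  using z
proof (induction z rule: covering_induct)
  case (basis s)
  let ?s = "section_compose (diag_section G p) s"
  have c: "?s \<in> covering_sections G"
    by (rule section_compose_covering[OF diag_section_covering[OF p] basis])
  show ?case
  proof (cases "pair_le (left_pair G s) p \<and> right_pair G ?s = p")
    case True
    then have "left_pair G ?s = p" by (intro left_pair_compose_diag(1)[OF basis p]) simp
    then have s: "?s \<in> linkage_sections p" using c True by (simp add: linkage_sections_def)
    have "f p \<star> basis_elt s = basis_elt ?s \<star> f p" using f_basis_elt(2)[OF basis p] True by simp
    moreover have "basis_elt ?s \<star> f p = f p \<star> basis_elt ?s"
      using f_basis_elt_commute[OF c] linkage_sectionsD[OF s] by simp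
    moreover have "basis_elt ?s \<star> f p \<star> f p = basis_elt ?s \<star> f p"
      using f_f[OF p] star_assoc[OF cov_burnside[OF c] f_burnside f_burnside] by simp
    ultimately have "f p \<star> basis_elt s \<star> f p = f p \<star> basis_elt ?s" by simp
    then show ?thesis
      using s by (intro bexI[of _ "Poly_Mapping.single (basis_elt ?s) 1"])
        (simp_all add: linear_inclusion_single GA_simps[OF p])
  next
    case False
    have "f p \<star> basis_elt s \<star> f p = 0"
    proof (cases "pair_le (left_pair G s) p")
      case True
      with False have "right_pair G ?s \<noteq> p" by simp
      then show ?thesis
        using f_basis_elt(2)[OF basis p True] f_orthogonal[OF right_pair_normal[OF c] p]
          star_assoc[OF cov_burnside[OF c] f_burnside f_burnside, of "right_pair G ?s" p] by simp
    qed (simp add: f_basis_elt(1)[OF basis p])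
    then show ?thesis
      by (intro bexI[of _ 0]) (simp_all add: linear_inclusion_simps GA_simps[OF p])
  qed
next
  case (add x y)
  then obtain a b where "a \<in> carrier (GA p)" "b \<in> carrier (GA p)"
    "f p \<star> x \<star> f p = f p \<star> linear_inclusion a" "f p \<star> y \<star> f p = f p \<star> linear_inclusion b" by blast
  then show ?case
    using Poly_Mapping.keys_add[of a b]
    by (intro bexI[of _ "a + b"]) (auto simp: section_comp_linear linear_inclusion_simps GA_simps[OF p])
next
  case (scale c x)
  then obtain a where "a \<in> carrier (GA p)" "f p \<star> x \<star> f p = f p \<star> linear_inclusion a" by blast
  then show ?case
    by (intro bexI[of _ "scale c a"])
       (auto simp: section_comp_linear linear_inclusion_simps GA_simps[OF p] in_keys_iff subset_iff)
next
  case zero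
  show ?case by (intro bexI[of _ 0]) (simp_all add: linear_inclusion_simps GA_simps[OF p])
qed

lemma Eb_covering_repr:
  assumes "x \<in> carrier Eb" obtains z where "z \<in> Ec" "x = bar z"
  using assms carrier_Eb_covering by auto

text \<open>
  Multiplicativity holds because \<open>f\<^bsub>p\<^esub>\<close> commutes with the linkage group. For
  injectivity, \<open>f\<^bsub>p\<^esub> a\<close> lies in \<open>E\<^sup>c\<close>; if it is in
  \<open>I\<close> as well, it is annihilated by the idempotent \<open>f\<^bsub>p\<^esub>\<close> and so
  is zero.
\<close>

lemma corner_iso:
  assumes p: "p \<in> Red"
  shows "corner_map G p \<in> k_algebra_iso (GA p) (corner_algebra Eb (bar (f p)))"
proof -
  have pp: "p \<in> pairs" using p by (simp add: reduced_pairs_def)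
  note f = f_burnside[of p] and GA = GA_simps[OF pp] and eq = corner_map_eq[OF pp]
    and l = linear_inclusion_covering[OF pp]
  note lb = Ec_burnside[OF l(1)]
  interpret GA: k_algebra "GA p" by (rule GA_k_algebra[OF pp])
  interpret GAr: ring "GA p" by (rule GA.is_ring)
  have corner: "carrier (corner_algebra Eb (bar (f p))) = (\<lambda>z. bar (f p \<star> z \<star> f p)) ` Ec" (is "?C = _")
  proof -
    have "?C = (\<lambda>x. bar (f p) \<otimes>\<^bsub>Eb\<^esub> x \<otimes>\<^bsub>Eb\<^esub> bar (f p)) ` carrier Eb"
      by (simp add: corner_algebra_def)
    also have "\<dots> = (\<lambda>x. bar (f p) \<otimes>\<^bsub>Eb\<^esub> x \<otimes>\<^bsub>Eb\<^esub> bar (f p)) ` bar ` Ec"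
    proof -
      have "carrier Eb = bar ` Ec"
      proof (intro equalityI subsetI)
        fix x assume "x \<in> carrier Eb"
        then obtain z where "z \<in> Ec" "x = bar z" by (rule Eb_covering_repr)
        then show "x \<in> bar ` Ec" by simp
      qed (auto simp: Eb_simps(1) intro!: imageI Ec_burnside)
      then show ?thesis by simp
    qed
    also have "\<dots> = (\<lambda>z. bar (f p \<star> z \<star> f p)) ` Ec"
      unfolding image_image
      by (intro image_cong refl) (simp add: Eb_simps(4) f star_burnside Ec_burnside)
    finally show ?thesis .
  qed
  have ring_hom: "corner_map G p \<in> ring_hom (GA p) (corner_algebra Eb (bar (f p)))"
  proof (rule ring_hom_memI)
    fix a assume a: "a \<in> carrier (GA p)"
    have fl: "f p \<star> linear_inclusion a \<star> f p = f p \<star> linear_inclusion a"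
      unfolding l(2)[OF a] star_assoc[OF lb[OF a] f f] f_f[OF pp] ..
    then show "corner_map G p a \<in> carrier (corner_algebra Eb (bar (f p)))"
      unfolding corner eq[OF a] by (intro image_eqI[OF _ l(1)[OF a]]) (simp only: fl)
    fix b assume b: "b \<in> carrier (GA p)"
    have "f p \<star> linear_inclusion a \<star> (f p \<star> linear_inclusion b) =
        f p \<star> (linear_inclusion a \<star> f p \<star> linear_inclusion b)"
      by (simp add: star_assoc f lb[OF a] lb[OF b] star_burnside)
    also have "\<dots> = f p \<star> f p \<star> (linear_inclusion a \<star> linear_inclusion b)"
      unfolding l(2)[OF a, symmetric] by (simp add: star_assoc f lb[OF a] lb[OF b] star_burnside)
    also have "\<dots> = f p \<star> linear_inclusion (a \<otimes>\<^bsub>GA p\<^esub> b)"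
      by (simp add: f_f[OF pp] GA(2) linear_inclusion_mult)
    finally show "corner_map G p (a \<otimes>\<^bsub>GA p\<^esub> b) =
        corner_map G p a \<otimes>\<^bsub>corner_algebra Eb (bar (f p))\<^esub> corner_map G p b"
      using a b GAr.m_closed[OF a b] by (simp add: corner_algebra_def eq Eb_simps f lb star_burnside)
    show "corner_map G p (a \<oplus>\<^bsub>GA p\<^esub> b) =
        corner_map G p a \<oplus>\<^bsub>corner_algebra Eb (bar (f p))\<^esub> corner_map G p b"
      using a b GAr.a_closed[OF a b]
      by (simp add: corner_algebra_def eq Eb_simps f lb star_burnside GA(5) linear_inclusion_simps
          section_comp_add_right)
  next
    show "corner_map G p \<one>\<^bsub>GA p\<^esub> = \<one>\<^bsub>corner_algebra Eb (bar (f p))\<^esub>"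
      unfolding eq[OF GAr.one_closed]
      by (simp add: corner_algebra_def GA(3) linear_inclusion_single f_e[OF pp pp])
  qed
  have "inj_on (corner_map G p) (carrier (GA p))"
  proof (rule inj_onI)
    fix a b assume a: "a \<in> carrier (GA p)" and b: "b \<in> carrier (GA p)"
      and ab: "corner_map G p a = corner_map G p b"
    have c: "a - b \<in> carrier (GA p)"
      using a b by (simp add: GA(1) in_keys_iff subset_iff lookup_minus) metis
    have "f p \<star> linear_inclusion (a - b) \<in> I"
      using ab unfolding eq[OF a] eq[OF b] bar_eq_iff
      by (simp add: linear_inclusion_simps section_comp_diff_right)
    from covering_ideal_annihilated[OF star_covering[OF f_elt_covering l(1)[OF c]] this p]
    have "f p \<star> linear_inclusion (a - b) = 0"
      using star_assoc[OF f f lb[OF c]] f_f[OF pp] by simp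
    from f_linear_inclusion_inj[OF pp c this] show "a = b" by simp
  qed
  moreover have "corner_map G p ` carrier (GA p) = carrier (corner_algebra Eb (bar (f p)))"
  proof
    show "corner_map G p ` carrier (GA p) \<subseteq> carrier (corner_algebra Eb (bar (f p)))"
      using ring_hom_closed[OF ring_hom] by blast
    show "carrier (corner_algebra Eb (bar (f p))) \<subseteq> corner_map G p ` carrier (GA p)"
      unfolding corner
    proof (rule image_subsetI)
      fix z assume "z \<in> Ec"
      then obtain a where a: "a \<in> carrier (GA p)" "f p \<star> z \<star> f p = f p \<star> linear_inclusion a"
        using f_corner[OF pp] by blast
      then show "bar (f p \<star> z \<star> f p) \<in> corner_map G p ` carrier (GA p)"
        by (intro image_eqI[OF _ a(1)]) (simp only: eq a(2))
    qed
  qed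
  moreover have "corner_map G p (c \<odot>\<^bsub>GA p\<^esub> a) = c \<odot>\<^bsub>corner_algebra Eb (bar (f p))\<^esub> corner_map G p a"
    if a: "a \<in> carrier (GA p)" for a c
  proof -
    have "scale c a \<in> carrier (GA p)" using a by (auto simp: GA(1) in_keys_iff subset_iff)
    then show ?thesis
      using a by (simp add: GA(6) eq corner_algebra_def Eb_simps linear_inclusion_simps section_comp_scale_right)
  qed
  ultimately show ?thesis
    using ring_hom unfolding k_algebra_iso_def ring_iso_def bij_betw_def by simp
qed

section \<open>Simple modules of the essential algebra\<close>

lemma bar_sum:
  assumes "finite A" "\<And>a. a \<in> A \<Longrightarrow> x a \<in> section_burnside G G"
  shows "finsum Eb (\<lambda>a. bar (x a)) A = bar (\<Sum>a\<in>A. x a)"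
  using assms
proof (induction A)
  case empty
  interpret Eb: ring Eb by (rule Eb_ring)
  show ?case by (simp add: Eb_simps)
next
  case (insert a A)
  interpret Eb: ring Eb by (rule Eb_ring)
  have "(\<Sum>a\<in>A. x a) \<in> section_burnside G G"
    using insert by (intro scale.subspace_sum[OF subspace_burnside]) auto
  moreover have "bar (x b) \<in> carrier Eb" if "b \<in> insert a A" for b
    using insert(4)[OF that] by (simp add: Eb_simps)
  ultimately show ?case
    using insert by (subst Eb.finsum_insert) (auto simp: Eb_simps(5))
qed

text \<open>
  A section \<open>s\<close> linking \<open>p\<close> and \<open>q\<close> gives the isomorphism of
  idempotents: with \<open>a = f\<^bsub>p\<^esub> s\<close> and \<open>b\<close> the converse of
  \<open>s\<close>, \<open>b a = b s f\<^bsub>q\<^esub> = e\<^bsub>q\<^esub> f\<^bsub>q\<^esub> =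
  f\<^bsub>q\<^esub>\<close>.
\<close>

lemma essential_idempotent_system:
  "idempotent_system Eb Red (\<lambda>p. bar (f p)) (linked G) GA (corner_map G)"
proof (intro idempotent_system.intro idempotent_system_axioms.intro Eb_ring)
  have sub: "Red \<subseteq> pairs" by (auto simp: reduced_pairs_def)
  show fin: "finite Red" using sub finite_normal_pairs finite_subset by blast
  have "e top_pair - u = u'" using u_plus_u' by (metis add_diff_cancel_left')
  then have "bar (e top_pair) = bar u" using u'_in_I by (simp add: bar_eq_iff)
  then show "finsum Eb (\<lambda>p. bar (f p)) Red = \<one>\<^bsub>Eb\<^esub>"
    unfolding bar_sum[OF fin f_burnside] by (simp add: Eb_simps f_sum_def)
  fix p assume p: "p \<in> Red"
  then have pp: "p \<in> pairs" using sub by blast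
  show "bar (f p) \<in> carrier Eb" by (simp add: Eb_simps f_burnside)
  show "bar (f p) \<otimes>\<^bsub>Eb\<^esub> bar (f p) = bar (f p)" by (simp add: Eb_simps f_burnside f_f[OF pp])
  show "ring (GA p)" by (rule k_algebra.is_ring[OF GA_k_algebra[OF pp]])
  have iso: "corner_map G p \<in> ring_iso (GA p) (corner_algebra Eb (bar (f p)))"
    using corner_iso[OF p] by (simp add: k_algebra_iso_def)
  then have hom: "corner_map G p \<in> ring_hom (GA p) (corner_algebra Eb (bar (f p)))"
    by (simp add: ring_iso_def)
  show "bij_betw (corner_map G p) (carrier (GA p))
      ((\<lambda>x. bar (f p) \<otimes>\<^bsub>Eb\<^esub> x \<otimes>\<^bsub>Eb\<^esub> bar (f p)) ` carrier Eb)"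
    using iso by (simp add: ring_iso_def corner_algebra_def)
  show "corner_map G p \<one>\<^bsub>GA p\<^esub> = bar (f p)"
    using ring_hom_one[OF hom] by (simp add: corner_algebra_def)
  show "corner_map G p (r \<otimes>\<^bsub>GA p\<^esub> s) = corner_map G p r \<otimes>\<^bsub>Eb\<^esub> corner_map G p s"
    and "corner_map G p (r \<oplus>\<^bsub>GA p\<^esub> s) = corner_map G p r \<oplus>\<^bsub>Eb\<^esub> corner_map G p s"
    if "r \<in> carrier (GA p)" "s \<in> carrier (GA p)" for r s
    using ring_hom_mult[OF hom that] ring_hom_add[OF hom that] by (simp_all add: corner_algebra_def)
  fix q assume q: "q \<in> Red"
  then have qp: "q \<in> pairs" using sub by blast
  show "linked G p q \<Longrightarrow> linked G q p" by (rule linked_sym)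
  show "bar (f p) \<otimes>\<^bsub>Eb\<^esub> (x \<otimes>\<^bsub>Eb\<^esub> bar (f q)) = \<zero>\<^bsub>Eb\<^esub>" if nl: "\<not> linked G p q" and x: "x \<in> carrier Eb" for x
  proof -
    obtain z where z: "z \<in> Ec" "x = bar z" by (rule Eb_covering_repr[OF x])
    have "f p \<star> (z \<star> f q) = 0"
      using f_unlinked[OF pp qp nl z(1)] star_assoc[OF f_burnside Ec_burnside[OF z(1)] f_burnside] by simp
    then show ?thesis
      unfolding z(2) by (simp add: Eb_simps f_burnside Ec_burnside[OF z(1)] star_burnside)
  qed
  assume "linked G p q"
  then obtain s where s: "s \<in> covering_sections G" "left_pair G s = p" "right_pair G s = q"
    unfolding linked_iff by blast
  let ?s = "section_converse s"
  have c: "?s \<in> covering_sections G" by (rule section_converse_covering[OF s(1)])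
  note b = cov_burnside[OF s(1)] cov_burnside[OF c]
  have "f p \<star> (f p \<star> basis_elt s) = f p \<star> basis_elt s"
    using star_assoc[OF f_burnside f_burnside b(1), of p p] f_f[OF pp] by simp
  then have 1: "bar (f p) \<otimes>\<^bsub>Eb\<^esub> bar (f p \<star> basis_elt s) = bar (f p \<star> basis_elt s)"
    by (simp add: Eb_simps f_burnside b star_burnside)
  \<comment> \<open>Moving \<open>f\<^bsub>p\<^esub>\<close> across \<open>s\<close> brings the converse next to \<open>s\<close>, where the product is \<open>e\<^bsub>q\<^esub>\<close>.\<close>
  have "basis_elt ?s \<star> (f p \<star> basis_elt s) = basis_elt ?s \<star> basis_elt s \<star> f q"
    using f_basis_elt_commute[OF s(1)] s(2,3) star_assoc[OF b(2,1) f_burnside] by simp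
  also have "basis_elt ?s \<star> basis_elt s = e q"
    unfolding basis_elt_mult[OF c subsetD[OF covering_sections_subset s(1)]] converse_compose[OF s(1)]
      s(3) e_elt_eq[OF qp] ..
  also have "e q \<star> f q = f q" by (simp add: e_f[OF qp qp])
  finally have 2: "bar (basis_elt ?s) \<otimes>\<^bsub>Eb\<^esub> bar (f p \<star> basis_elt s) = bar (f q)"
    by (simp add: Eb_simps f_burnside b star_burnside)
  show "\<exists>a\<in>carrier Eb. \<exists>b\<in>carrier Eb. bar (f p) \<otimes>\<^bsub>Eb\<^esub> a = a \<and> b \<otimes>\<^bsub>Eb\<^esub> a = bar (f q)"
    using 1 2 b by (intro bexI[of _ "bar (f p \<star> basis_elt s)"] bexI[of _ "bar (basis_elt ?s)"] conjI)
      (simp_all add: Eb_simps(1) f_burnside star_burnside)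
qed

lemma induced_module_eq:
  "induced_module G p V = idempotent_system.induced Eb (\<lambda>p. bar (f p)) GA (corner_map G) p V"
  by (simp add: induced_module_def idempotent_system.induced_def[OF essential_idempotent_system])

lemma induced_module_simple:
  assumes "p \<in> Red" "simple_module (GA p) V"
  shows "simple_module Eb (induced_module G p V)"
  unfolding induced_module_eq by (rule idempotent_system.induced_simple[OF essential_idempotent_system assms])

lemma induced_module_isomorphic:
  assumes Rep: "Rep \<subseteq> Red" "\<And>p q. p \<in> Rep \<Longrightarrow> q \<in> Rep \<Longrightarrow> linked G p q \<Longrightarrow> p = q"
    and p: "p \<in> Rep" and q: "q \<in> Rep"
    and V: "simple_module (GA p) V" and W: "simple_module (GA q) W"
  shows "module_isomorphic Eb (induced_module G p V) (induced_module G q W) \<longleftrightarrow>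
    p = q \<and> module_isomorphic (GA p) V W"
proof
  note sys = essential_idempotent_system
  note pq = subsetD[OF Rep(1) p] subsetD[OF Rep(1) q]
  assume *: "module_isomorphic Eb (induced_module G p V) (induced_module G q W)"
  note imp = idempotent_system.induced_isomorphic_imp[OF sys pq V W *[unfolded induced_module_eq]]
  have "p = q" using Rep(2)[OF p q] imp(1) by blast
  then show "p = q \<and> module_isomorphic (GA p) V W" using imp(2) by blast
next
  assume *: "p = q \<and> module_isomorphic (GA p) V W"
  then show "module_isomorphic Eb (induced_module G p V) (induced_module G q W)"
  proof -
    have pq: "q = p" by (rule conjunct1[OF *, symmetric])
    have iso: "module_isomorphic (GA p) V W" by (rule conjunct2[OF *])
    have W': "simple_module (GA p) W" using W pq by simp
    show ?thesis
      unfolding induced_module_eq pq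
      by (rule idempotent_system.induced_isomorphicI
          [OF essential_idempotent_system subsetD[OF Rep(1) p] V W' iso])
  qed
qed

text \<open>
  Some \<open>f\<^bsub>q\<^esub>\<close> with \<open>q\<close> reduced acts nontrivially; the link
  between \<open>q\<close> and its representative \<open>p\<close> transports this to
  \<open>f\<^bsub>p\<^esub>\<close>.
\<close>

lemma simple_module_is_induced:
  assumes Rep: "Rep \<subseteq> Red" "\<And>q. q \<in> Red \<Longrightarrow> \<exists>p\<in>Rep. linked G p q"
    and M: "simple_module Eb (M :: (('a, 'a, 'k) section_elts set, 'x) module)"
  shows "\<exists>p\<in>Rep. \<exists>V :: (('a, 'a, 'k) section_elts \<Rightarrow>\<^sub>0 'k, 'x) module.
    simple_module (GA p) V \<and> module_isomorphic Eb M (induced_module G p V)"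
proof -
  interpret sys: idempotent_system Eb Red "\<lambda>p. bar (f p)" "linked G" GA "corner_map G"
    by (rule essential_idempotent_system)
  interpret M: left_module Eb M by (rule simple_moduleD(1)[OF M])
  obtain x where x: "x \<in> carrier M" "x \<noteq> \<zero>\<^bsub>M\<^esub>" using simple_moduleD(2)[OF M] by blast
  then obtain q where q: "q \<in> Red" "bar (f q) \<odot>\<^bsub>M\<^esub> x \<noteq> \<zero>\<^bsub>M\<^esub>"
    using sys.zero_if_annihilated[OF M.left_module_axioms x(1)] by blast
  obtain p where p: "p \<in> Rep" "linked G p q" using Rep(2)[OF q(1)] by blast
  have pR: "p \<in> Red" using p(1) Rep(1) by blast
  obtain a b where ab: "a \<in> carrier Eb" "b \<in> carrier Eb" "bar (f p) \<otimes>\<^bsub>Eb\<^esub> a = a" "b \<otimes>\<^bsub>Eb\<^esub> a = bar (f q)"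
    using sys.linked[OF pR q(1) p(2)] by blast
  note ax = M.smult_closed[OF ab(1) x(1)]
  have "a \<odot>\<^bsub>M\<^esub> x \<noteq> \<zero>\<^bsub>M\<^esub>"
    using M.smult_assoc[OF ab(2,1) x(1)] ab(4) q(2) M.smult_r_null[OF ab(2)] by auto
  then have "bar (f p) \<odot>\<^bsub>M\<^esub> (a \<odot>\<^bsub>M\<^esub> x) \<noteq> \<zero>\<^bsub>M\<^esub>"
    using M.smult_assoc[OF sys.f_closed[OF pR] ab(1) x(1)] ab(3) by simp
  from sys.simple_induced[OF M pR ax this] show ?thesis
    unfolding induced_module_eq using p(1) by blast
qed

end

theorem proposition6p3:
  fixes G :: "('a, 'g) monoid_scheme"
  assumes "group G" and "finite (carrier G)"
  shows
    "let E = (section_algebra G :: ('k::field_char_0, ('a, 'a, 'k) section_elts) module);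
         Ec = covering_algebra G;
         I = essential_ideal G;
         Ebar = essential_algebra G;
         Red = reduced_pairs TYPE('k) G;
         RedClasses = linkage_class G ` Red;
         NonRedClasses = linkage_class G ` (normal_pairs G - Red);
         block = (\<lambda>C. f_class G C <#\<^bsub>E\<^esub> Ec)
     in
      \<comment> \<open>(a)\<close>
      (k_subalgebra E Ec \<one>\<^bsub>E\<^esub> \<and> carrier E = Ec <+>\<^bsub>E\<^esub> I) \<and>
      \<comment> \<open>(b)\<close>
      (sum_is_direct NonRedClasses block \<and> Ec \<inter> I = internal_sum NonRedClasses block) \<and>
      \<comment> \<open>(c)\<close>
      (let B = internal_sum RedClasses block; u = (\<Sum>C\<in>RedClasses. f_class G C)
       in sum_is_direct RedClasses block \<and>
          k_subalgebra (E\<lparr>carrier := Ec\<rparr>) B u \<and>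
          to_essential G \<in> k_algebra_iso (E\<lparr>carrier := B, one := u\<rparr>) Ebar) \<and>
      \<comment> \<open>(d)\<close>
      (\<forall>p\<in>Red. corner_map G p \<in>
         k_algebra_iso (group_algebra (linkage_group G p))
           (corner_algebra Ebar (to_essential G (f_elt G p)))) \<and>
      \<comment> \<open>(e)\<close>
      (\<forall>Rep. Rep \<subseteq> Red \<and> (\<forall>C\<in>RedClasses. \<exists>!p. p \<in> Rep \<and> p \<in> C) \<longrightarrow>
         (\<forall>p\<in>Rep. \<forall>V :: (('a, 'a, 'k) section_elts \<Rightarrow>\<^sub>0 'k, 'v) module.
            simple_module (group_algebra (linkage_group G p)) V \<longrightarrow>
            simple_module Ebar (induced_module G p V)) \<and>
         (\<forall>p\<in>Rep. \<forall>q\<in>Rep.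
            \<forall>V :: (('a, 'a, 'k) section_elts \<Rightarrow>\<^sub>0 'k, 'v) module.
            \<forall>W :: (('a, 'a, 'k) section_elts \<Rightarrow>\<^sub>0 'k, 'w) module.
            simple_module (group_algebra (linkage_group G p)) V \<and>
            simple_module (group_algebra (linkage_group G q)) W \<longrightarrow>
            (module_isomorphic Ebar (induced_module G p V) (induced_module G q W) \<longleftrightarrow>
             p = q \<and> module_isomorphic (group_algebra (linkage_group G p)) V W)) \<and>
         (\<forall>M :: (('a, 'a, 'k) section_elts set, 'x) module.
            simple_module Ebar M \<longrightarrow>
            (\<exists>p\<in>Rep. \<exists>V :: (('a, 'a, 'k) section_elts \<Rightarrow>\<^sub>0 'k, 'x) module.
               simple_module (group_algebra (linkage_group G p)) V \<and>
               module_isomorphic Ebar M (induced_module G p V))))"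
proof -
  interpret fin_group_over G "TYPE('k)"
    using assms by (simp add: fin_group_over_def fin_group_def fin_group_axioms_def)
  have sub: "Red \<subseteq> pairs" by (auto simp: reduced_pairs_def)
  show ?thesis
    unfolding Let_def
  proof (intro conjI ballI allI impI)
    show "k_subalgebra EE Ec \<one>\<^bsub>EE\<^esub>" by (rule covering_subalgebra)
    show "carrier EE = Ec <+>\<^bsub>EE\<^esub> I" by (rule covering_plus_ideal)
    show "sum_is_direct (linkage_class G ` (pairs - Red)) block"
      and "sum_is_direct (linkage_class G ` Red) block"
      using sub by (intro blocks_direct image_mono; blast)+
    show "Ec \<inter> I = internal_sum (linkage_class G ` (pairs - Red)) block" by (rule covering_inter_ideal)
    show "k_subalgebra (EE\<lparr>carrier := Ec\<rparr>) (internal_sum (linkage_class G ` Red) block)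
        (\<Sum>C\<in>linkage_class G ` Red. f_class G C)"
      unfolding internal_sum_blocks[OF reduced_closed(1)] sum_f_class[OF reduced_closed(1)]
      by (rule reduced_subalgebra)
    show "bar \<in> k_algebra_iso (EE\<lparr>carrier := internal_sum (linkage_class G ` Red) block,
        one := \<Sum>C\<in>linkage_class G ` Red. f_class G C\<rparr>) Eb"
      unfolding internal_sum_blocks[OF reduced_closed(1)] sum_f_class[OF reduced_closed(1)]
      by (rule reduced_iso)
    show "corner_map G p \<in> k_algebra_iso (GA p) (corner_algebra Eb (bar (f p)))" if "p \<in> Red" for p
      by (rule corner_iso[OF that])
    fix Rep assume Rep: "Rep \<subseteq> Red \<and> (\<forall>C\<in>linkage_class G ` Red. \<exists>!p. p \<in> Rep \<and> p \<in> C)"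
    have RepR: "Rep \<subseteq> Red" using Rep by (rule conjunct1)
    have RepC: "\<exists>!p. p \<in> Rep \<and> p \<in> linkage_class G q" if "q \<in> Red" for q
      using conjunct2[OF Rep] imageI[OF that] by (rule bspec)
    have unique: "p = q" if "p \<in> Rep" "q \<in> Rep" "linked G p q" for p q
    proof -
      have "p \<in> Red" "p \<in> pairs" "q \<in> pairs" using that(1,2) RepR sub by blast+
      moreover from this have "p \<in> linkage_class G p" "q \<in> linkage_class G p"
        using that(3) linkage_class_self by (simp_all add: linkage_class_def)
      ultimately have "p \<in> Red" "p \<in> linkage_class G p" "q \<in> linkage_class G p" by blast+
      then show ?thesis using RepC[of p] that(1,2) by blast
    qed
    have total: "\<exists>p\<in>Rep. linked G p q" if "q \<in> Red" for q
    proof -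
      obtain p where p: "p \<in> Rep" "p \<in> linkage_class G q" using RepC[OF \<open>q \<in> Red\<close>] by blast
      then have "linked G q p" by (simp add: linkage_class_def)
      then show ?thesis using p(1) linked_sym by blast
    qed
    show "simple_module Eb (induced_module G p V)"
      if "p \<in> Rep" "simple_module (GA p) V"
      for p and V :: "(('a, 'a, 'k) section_elts \<Rightarrow>\<^sub>0 'k, 'v) module"
      by (rule induced_module_simple[OF subsetD[OF RepR that(1)] that(2)])
    show "module_isomorphic Eb (induced_module G p V) (induced_module G q W) \<longleftrightarrow>
        p = q \<and> module_isomorphic (GA p) V W"
      if "p \<in> Rep" "q \<in> Rep" "simple_module (GA p) V \<and> simple_module (GA q) W"
      for p q and V :: "(('a, 'a, 'k) section_elts \<Rightarrow>\<^sub>0 'k, 'v) module"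
        and W :: "(('a, 'a, 'k) section_elts \<Rightarrow>\<^sub>0 'k, 'w) module"
      by (rule induced_module_isomorphic[OF RepR unique that(1,2) conjunct1[OF that(3)] conjunct2[OF that(3)]])
    show "\<exists>p\<in>Rep. \<exists>V :: (('a, 'a, 'k) section_elts \<Rightarrow>\<^sub>0 'k, 'x) module.
        simple_module (GA p) V \<and> module_isomorphic Eb M (induced_module G p V)"
      if "simple_module Eb M" for M :: "(('a, 'a, 'k) section_elts set, 'x) module"
      by (rule simple_module_is_induced[OF RepR total that])
  qed
qed

end
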